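(* Let $R$ be a one dimensional Gorenstein (commutative Noetherian) local ring with reduced completion. Then $$\mathrm{ca}(R)=\mathcal C(R).$$
   Context: The cohomology annihilator of a commutative Noetherian ring $R$ is $\mathrm{ca}(R)=\bigcup_{n\ge 0}\mathrm{ca}^n(R)$, where $\mathrm{ca}^n(R)=\bigcap_{M,N}\mathrm{ann}_R\mathrm{Ext}_R^n(M,N)$, the intersection running over all finitely generated $R$-modules $M,N$. The normalization $\overline{R}$ is the integral closure of $R$ in its total quotient ring, and the conductor is $\mathcal C(R)=\{r\in R : rq\in R \text{ for all } q\in\overline R\}=\mathrm{ann}_R(\overline R/R)$. The completion is taken at the maximal ideal of $R$. Gorenstein means of finite injective dimension as a module over itself. *)

theory Defs
  imports "HOL-Algebra.Polynomials" "HOL-Algebra.Ideal_Product" "HOL-Algebra.Module"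
    "HOL-Library.Extended_Nat"
begin

section \<open>Commutative rings\<close>

definition local_ring :: "('a, 'k) ring_scheme \<Rightarrow> bool" where
  "local_ring R \<longleftrightarrow> cring R \<and> (\<exists>!\<mm>. maximalideal \<mm> R)"

definition max_ideal :: "('a, 'k) ring_scheme \<Rightarrow> 'a set" where
  "max_ideal R = (THE \<mm>. maximalideal \<mm> R)"

definition krull_dim :: "('a, 'k) ring_scheme \<Rightarrow> enat" where
  "krull_dim R =
     Sup {enat n | n. \<exists>P. (\<forall>i\<le>n. primeideal (P i) R) \<and> (\<forall>i<n. P i \<subset> P (Suc i))}"

definition reduced_ring :: "('a, 'k) ring_scheme \<Rightarrow> bool" where
  "reduced_ring R \<longleftrightarrow>
     (\<forall>x\<in>carrier R. \<forall>n::nat. x [^]\<^bsub>R\<^esub> n = \<zero>\<^bsub>R\<^esub> \<longrightarrow> x = \<zero>\<^bsub>R\<^esub>)"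

definition quot_pow :: "('a, 'k) ring_scheme \<Rightarrow> 'a set \<Rightarrow> nat \<Rightarrow> 'a set ring" where
  "quot_pow R I n = R Quot (I [^]\<^bsub>ideals_set R\<^esub> n)"

text \<open>The inverse limit of the rings \<open>R/I\<^sup>n\<close>. The transition map \<open>R/I\<^sup>n\<^sup>+\<^sup>1 \<rightarrow> R/I\<^sup>n\<close> sends a
  coset to the unique coset containing it, so compatibility is the inclusion
  \<open>x (Suc n) \<subseteq> x n\<close>.\<close>

definition adic_completion :: "('a, 'k) ring_scheme \<Rightarrow> 'a set \<Rightarrow> (nat \<Rightarrow> 'a set) ring" where
  "adic_completion R I =
     \<lparr>carrier = {x. \<forall>n. x n \<in> carrier (quot_pow R I n) \<and> x (Suc n) \<subseteq> x n},
      monoid.mult = (\<lambda>x y n. x n \<otimes>\<^bsub>quot_pow R I n\<^esub> y n),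
      one = (\<lambda>n. \<one>\<^bsub>quot_pow R I n\<^esub>),
      zero = (\<lambda>n. \<zero>\<^bsub>quot_pow R I n\<^esub>),
      add = (\<lambda>x y n. x n \<oplus>\<^bsub>quot_pow R I n\<^esub> y n)\<rparr>"


section \<open>Normalization and conductor\<close>

definition nonzerodivisors :: "('a, 'k) ring_scheme \<Rightarrow> 'a set" where
  "nonzerodivisors R =
     {s \<in> carrier R. \<forall>r\<in>carrier R. s \<otimes>\<^bsub>R\<^esub> r = \<zero>\<^bsub>R\<^esub> \<longrightarrow> r = \<zero>\<^bsub>R\<^esub>}"

definition frac_rel :: "('a, 'k) ring_scheme \<Rightarrow> (('a \<times> 'a) \<times> ('a \<times> 'a)) set" where
  "frac_rel R =
     {((a, s), (b, t)). a \<in> carrier R \<and> s \<in> nonzerodivisors R \<and>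
        b \<in> carrier R \<and> t \<in> nonzerodivisors R \<and> a \<otimes>\<^bsub>R\<^esub> t = b \<otimes>\<^bsub>R\<^esub> s}"

definition fraction :: "('a, 'k) ring_scheme \<Rightarrow> 'a \<Rightarrow> 'a \<Rightarrow> ('a \<times> 'a) set" where
  "fraction R a s = frac_rel R `` {(a, s)}"

definition total_quotient_ring :: "('a, 'k) ring_scheme \<Rightarrow> ('a \<times> 'a) set ring" where
  "total_quotient_ring R =
     \<lparr>carrier = (carrier R \<times> nonzerodivisors R) // frac_rel R,
      monoid.mult = (\<lambda>U V. \<Union>p\<in>U. \<Union>q\<in>V.
               fraction R (fst p \<otimes>\<^bsub>R\<^esub> fst q) (snd p \<otimes>\<^bsub>R\<^esub> snd q)),
      one = fraction R \<one>\<^bsub>R\<^esub> \<one>\<^bsub>R\<^esub>,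
      zero = fraction R \<zero>\<^bsub>R\<^esub> \<one>\<^bsub>R\<^esub>,
      add = (\<lambda>U V. \<Union>p\<in>U. \<Union>q\<in>V.
               fraction R (fst p \<otimes>\<^bsub>R\<^esub> snd q \<oplus>\<^bsub>R\<^esub> fst q \<otimes>\<^bsub>R\<^esub> snd p)
                 (snd p \<otimes>\<^bsub>R\<^esub> snd q))\<rparr>"

definition to_frac :: "('a, 'k) ring_scheme \<Rightarrow> 'a \<Rightarrow> ('a \<times> 'a) set" where
  "to_frac R r = fraction R r \<one>\<^bsub>R\<^esub>"

definition integral_closure :: "'q set \<Rightarrow> ('q, 'k) ring_scheme \<Rightarrow> 'q set" where
  "integral_closure A Q =
     {q \<in> carrier Q. \<exists>p. polynomial\<^bsub>Q\<^esub> A p \<and> p \<noteq> [] \<and> lead_coeff p = \<one>\<^bsub>Q\<^esub> \<and>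
        ring.eval Q p q = \<zero>\<^bsub>Q\<^esub>}"

definition normalization :: "('a, 'k) ring_scheme \<Rightarrow> ('a \<times> 'a) set set" where
  "normalization R = integral_closure (to_frac R ` carrier R) (total_quotient_ring R)"

definition conductor :: "('a, 'k) ring_scheme \<Rightarrow> 'a set" where
  "conductor R =
     {r \<in> carrier R. \<forall>q\<in>normalization R.
        to_frac R r \<otimes>\<^bsub>total_quotient_ring R\<^esub> q \<in> to_frac R ` carrier R}"


section \<open>Modules\<close>

text \<open>The record type of modules has ring multiplication and unit fields, which the locale
  \<^locale>\<open>module\<close> ignores; they are left \<^const>\<open>undefined\<close> below.\<close>

definition regular_module :: "('a, 'k) ring_scheme \<Rightarrow> ('a, 'a) module" where
  "regular_module R =
     \<lparr>carrier = carrier R, monoid.mult = undefined, one = undefined, zero = \<zero>\<^bsub>R\<^esub>,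
      add = (\<lambda>x y. x \<oplus>\<^bsub>R\<^esub> y), smult = (\<lambda>r x. r \<otimes>\<^bsub>R\<^esub> x)\<rparr>"

definition free_module :: "('a, 'k) ring_scheme \<Rightarrow> nat \<Rightarrow> ('a, nat \<Rightarrow> 'a) module" where
  "free_module R k =
     \<lparr>carrier = {..<k} \<rightarrow>\<^sub>E carrier R, monoid.mult = undefined, one = undefined,
      zero = (\<lambda>i\<in>{..<k}. \<zero>\<^bsub>R\<^esub>),
      add = (\<lambda>x y. \<lambda>i\<in>{..<k}. x i \<oplus>\<^bsub>R\<^esub> y i),
      smult = (\<lambda>r x. \<lambda>i\<in>{..<k}. r \<otimes>\<^bsub>R\<^esub> x i)\<rparr>"

definition quotient_module ::
    "('a, 'm, 'l) module_scheme \<Rightarrow> 'm set \<Rightarrow> ('a, 'm set) module" where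
  "quotient_module M K =
     \<lparr>carrier = a_rcosets\<^bsub>M\<^esub> K, monoid.mult = undefined, one = undefined, zero = K,
      add = (\<lambda>U V. U <+>\<^bsub>M\<^esub> V),
      smult = (\<lambda>r U. \<Union>x\<in>U. K +>\<^bsub>M\<^esub> (r \<odot>\<^bsub>M\<^esub> x))\<rparr>"

definition mod_hom ::
    "('a, 'k) ring_scheme \<Rightarrow> ('a, 'm, 'l) module_scheme \<Rightarrow> ('a, 'n, 'j) module_scheme
       \<Rightarrow> ('m \<Rightarrow> 'n) set" where
  "mod_hom R M N =
     {f \<in> carrier M \<rightarrow>\<^sub>E carrier N.
        (\<forall>x\<in>carrier M. \<forall>y\<in>carrier M. f (x \<oplus>\<^bsub>M\<^esub> y) = f x \<oplus>\<^bsub>N\<^esub> f y) \<and>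
        (\<forall>r\<in>carrier R. \<forall>x\<in>carrier M. f (r \<odot>\<^bsub>M\<^esub> x) = r \<odot>\<^bsub>N\<^esub> f x)}"

definition hom_module ::
    "('a, 'k) ring_scheme \<Rightarrow> ('a, 'm, 'l) module_scheme \<Rightarrow> ('a, 'n, 'j) module_scheme
       \<Rightarrow> ('a, 'm \<Rightarrow> 'n) module" where
  "hom_module R M N =
     \<lparr>carrier = mod_hom R M N, monoid.mult = undefined, one = undefined,
      zero = (\<lambda>x\<in>carrier M. \<zero>\<^bsub>N\<^esub>),
      add = (\<lambda>f g. \<lambda>x\<in>carrier M. f x \<oplus>\<^bsub>N\<^esub> g x),
      smult = (\<lambda>r f. \<lambda>x\<in>carrier M. r \<odot>\<^bsub>N\<^esub> f x)\<rparr>"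

definition fin_gen_module ::
    "('a, 'k) ring_scheme \<Rightarrow> ('a, 'm, 'l) module_scheme \<Rightarrow> bool" where
  "fin_gen_module R M \<longleftrightarrow> module R M \<and>
     (\<exists>A\<subseteq>carrier M. finite A \<and> carrier M = \<Inter>{H. submodule H R M \<and> A \<subseteq> H})"

definition mod_annihilator ::
    "('a, 'k) ring_scheme \<Rightarrow> ('a, 'm, 'l) module_scheme \<Rightarrow> 'a set" where
  "mod_annihilator R M = {r \<in> carrier R. \<forall>x\<in>carrier M. r \<odot>\<^bsub>M\<^esub> x = \<zero>\<^bsub>M\<^esub>}"


section \<open>Ext and the cohomology annihilator\<close>

text \<open>A resolution \<open>\<dots> \<rightarrow> R\<^bsup>b 1\<^esup> \<rightarrow> R\<^bsup>b 0\<^esup> \<rightarrow> M \<rightarrow> 0\<close> by finitely generated free modules, with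
  augmentation \<open>e\<close> and differentials \<open>d i : R\<^bsup>b (i+1)\<^esup> \<rightarrow> R\<^bsup>b i\<^esup>\<close>.\<close>

definition free_resolution ::
    "('a, 'k) ring_scheme \<Rightarrow> ('a, 'm, 'l) module_scheme \<Rightarrow>
       (nat \<Rightarrow> nat) \<Rightarrow> ((nat \<Rightarrow> 'a) \<Rightarrow> 'm) \<Rightarrow> (nat \<Rightarrow> (nat \<Rightarrow> 'a) \<Rightarrow> (nat \<Rightarrow> 'a)) \<Rightarrow> bool" where
  "free_resolution R M b e d \<longleftrightarrow>
     e \<in> mod_hom R (free_module R (b 0)) M \<and>
     (\<forall>i. d i \<in> mod_hom R (free_module R (b (Suc i))) (free_module R (b i))) \<and>
     e ` carrier (free_module R (b 0)) = carrier M \<and>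
     d 0 ` carrier (free_module R (b 1)) = a_kernel (free_module R (b 0)) M e \<and>
     (\<forall>i. d (Suc i) ` carrier (free_module R (b (Suc (Suc i)))) =
        a_kernel (free_module R (b (Suc i))) (free_module R (b i)) (d i))"

definition hom_diff ::
    "('a, 'k) ring_scheme \<Rightarrow> (nat \<Rightarrow> nat) \<Rightarrow> (nat \<Rightarrow> (nat \<Rightarrow> 'a) \<Rightarrow> (nat \<Rightarrow> 'a)) \<Rightarrow> nat \<Rightarrow>
       ((nat \<Rightarrow> 'a) \<Rightarrow> 'n) \<Rightarrow> ((nat \<Rightarrow> 'a) \<Rightarrow> 'n)" where
  "hom_diff R b d i f = compose (carrier (free_module R (b (Suc i)))) f (d i)"

definition hom_cocycles ::
    "('a, 'k) ring_scheme \<Rightarrow> (nat \<Rightarrow> nat) \<Rightarrow> (nat \<Rightarrow> (nat \<Rightarrow> 'a) \<Rightarrow> (nat \<Rightarrow> 'a)) \<Rightarrow>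
       ('a, 'n, 'j) module_scheme \<Rightarrow> nat \<Rightarrow> ((nat \<Rightarrow> 'a) \<Rightarrow> 'n) set" where
  "hom_cocycles R b d N i =
     a_kernel (hom_module R (free_module R (b i)) N)
       (hom_module R (free_module R (b (Suc i))) N) (hom_diff R b d i)"

fun hom_coboundaries ::
    "('a, 'k) ring_scheme \<Rightarrow> (nat \<Rightarrow> nat) \<Rightarrow> (nat \<Rightarrow> (nat \<Rightarrow> 'a) \<Rightarrow> (nat \<Rightarrow> 'a)) \<Rightarrow>
       ('a, 'n, 'j) module_scheme \<Rightarrow> nat \<Rightarrow> ((nat \<Rightarrow> 'a) \<Rightarrow> 'n) set" where
  "hom_coboundaries R b d N 0 = {\<zero>\<^bsub>hom_module R (free_module R (b 0)) N\<^esub>}"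
| "hom_coboundaries R b d N (Suc i) =
     hom_diff R b d i ` carrier (hom_module R (free_module R (b i)) N)"

definition hom_cohomology ::
    "('a, 'k) ring_scheme \<Rightarrow> (nat \<Rightarrow> nat) \<Rightarrow> (nat \<Rightarrow> (nat \<Rightarrow> 'a) \<Rightarrow> (nat \<Rightarrow> 'a)) \<Rightarrow>
       ('a, 'n, 'j) module_scheme \<Rightarrow> nat \<Rightarrow> ('a, ((nat \<Rightarrow> 'a) \<Rightarrow> 'n) set) module" where
  "hom_cohomology R b d N i =
     quotient_module
       ((hom_module R (free_module R (b i)) N)\<lparr>carrier := hom_cocycles R b d N i\<rparr>)
       (hom_coboundaries R b d N i)"

text \<open>\<open>Ext\<^sup>n(M, N)\<close> is computed from one chosen resolution of \<open>M\<close>. Over a Noetherian ring every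
  finitely generated \<open>M\<close> has a resolution by finitely generated free modules, and any two choices
  yield isomorphic modules. For other \<open>M\<close> the definition may be meaningless.\<close>

definition Ext ::
    "('a, 'k) ring_scheme \<Rightarrow> nat \<Rightarrow> ('a, 'm, 'l) module_scheme \<Rightarrow> ('a, 'n, 'j) module_scheme
       \<Rightarrow> ('a, ((nat \<Rightarrow> 'a) \<Rightarrow> 'n) set) module" where
  "Ext R n M N =
     (let (b, d) = (SOME (b, d). \<exists>e. free_resolution R M b e d) in hom_cohomology R b d N n)"

text \<open>HOL cannot quantify over modules of all types in a definition. Every finitely generated
  \<open>R\<close>-module is isomorphic to a quotient \<open>R\<^sup>k/K\<close>, whose elements are cosets of type
  \<^typ>\<open>(nat \<Rightarrow> 'a) set\<close>, so modules with carrier in this type represent all of them up to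
  isomorphism.\<close>

definition cohomology_annihilator_at :: "('a, 'k) ring_scheme \<Rightarrow> nat \<Rightarrow> 'a set" where
  "cohomology_annihilator_at R n =
     {r \<in> carrier R. \<forall>(M :: ('a, (nat \<Rightarrow> 'a) set) module) (N :: ('a, (nat \<Rightarrow> 'a) set) module).
        fin_gen_module R M \<longrightarrow> fin_gen_module R N \<longrightarrow> r \<in> mod_annihilator R (Ext R n M N)}"

definition cohomology_annihilator :: "('a, 'k) ring_scheme \<Rightarrow> 'a set" where
  "cohomology_annihilator R = (\<Union>n. cohomology_annihilator_at R n)"


section \<open>Injective dimension and Gorenstein rings\<close>

text \<open>The test modules \<open>A\<close>, \<open>B\<close> range over one type for the reason given above. That type accommodates
  \<open>R\<close> and its ideals up to isomorphism, so by Baer's criterion this is injectivity with respect to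
  all modules.\<close>

definition injective_module ::
    "('a, 'k) ring_scheme \<Rightarrow> ('a, 'i, 'l) module_scheme \<Rightarrow> bool" where
  "injective_module R E \<longleftrightarrow> module R E \<and>
     (\<forall>(A :: ('a, (nat \<Rightarrow> 'a) set) module) (B :: ('a, (nat \<Rightarrow> 'a) set) module).
        module R A \<longrightarrow> module R B \<longrightarrow>
        (\<forall>h\<in>mod_hom R A B. \<forall>f\<in>mod_hom R A E. inj_on h (carrier A) \<longrightarrow>
           (\<exists>g\<in>mod_hom R B E. \<forall>x\<in>carrier A. g (h x) = f x)))"

text \<open>A resolution \<open>0 \<rightarrow> N \<rightarrow> E 0 \<rightarrow> E 1 \<rightarrow> \<dots>\<close> by injective modules.\<close>

definition injective_resolution ::
    "('a, 'k) ring_scheme \<Rightarrow> ('a, 'n, 'j) module_scheme \<Rightarrow> (nat \<Rightarrow> ('a, 'i) module) \<Rightarrow>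
       ('n \<Rightarrow> 'i) \<Rightarrow> (nat \<Rightarrow> 'i \<Rightarrow> 'i) \<Rightarrow> bool" where
  "injective_resolution R N E e d \<longleftrightarrow>
     (\<forall>i. injective_module R (E i)) \<and>
     e \<in> mod_hom R N (E 0) \<and>
     (\<forall>i. d i \<in> mod_hom R (E i) (E (Suc i))) \<and>
     inj_on e (carrier N) \<and>
     e ` carrier N = a_kernel (E 0) (E 1) (d 0) \<and>
     (\<forall>i. d i ` carrier (E i) = a_kernel (E (Suc i)) (E (Suc (Suc i))) (d (Suc i)))"

text \<open>The type argument \<open>'i\<close> is the type in which the injective modules are sought. Used as a
  hypothesis with \<open>'i\<close> free, the definition covers injective resolutions in any type.\<close>

definition finite_injective_dim ::
    "'i itself \<Rightarrow> ('a, 'k) ring_scheme \<Rightarrow> ('a, 'n, 'j) module_scheme \<Rightarrow> bool" where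
  "finite_injective_dim T R N \<longleftrightarrow>
     (\<exists>(E :: nat \<Rightarrow> ('a, 'i) module) e d n. injective_resolution R N E e d \<and>
        (\<forall>i>n. carrier (E i) = {\<zero>\<^bsub>E i\<^esub>}))"

definition gorenstein_ring :: "'i itself \<Rightarrow> ('a, 'k) ring_scheme \<Rightarrow> bool" where
  "gorenstein_ring T R \<longleftrightarrow> finite_injective_dim T R (regular_module R)"

end

theory Submission
  imports Defs
begin

text \<open>Let \<open>Q\<close> be the total quotient ring of \<open>R\<close> and \<open>S\<close> the normalization.

  Finitely generated ideals of \<open>S\<close> are projective, so the kernel of a matrix over \<open>R\<close> acting on
  \<open>Q\<^sup>p\<close> is the image of a projection that maps \<open>S\<^sup>p\<close> to itself. For \<open>r\<close> in the conductor, \<open>r\<close>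
  times this projection is defined over \<open>R\<close>. Applied to the first differential of a free resolution,
  this gives an endomorphism of \<open>F\<^sub>1\<close> with values in the second syzygy on which it is multiplication
  by \<open>r\<close>, and so \<open>r\<close> annihilates every \<open>Ext\<^sup>2(M, N)\<close>.

  Conversely let \<open>r\<close> annihilate all \<open>Ext\<^sup>n\<close> with \<open>n > 0\<close>, and let \<open>q \<in> S\<close>. Some ideal \<open>I\<close> containing a
  nonzerodivisor satisfies \<open>q I \<subseteq> I\<close>. Over a Gorenstein ring of dimension one lattices are reflexive;
  hence up to free modules \<open>I\<close> is the \<open>n\<close>-th syzygy \<open>K\<close> of some \<open>M\<close>. As \<open>r\<close> annihilates \<open>Ext\<^sup>n(M, K)\<close>,
  multiplication by \<open>r\<close> on \<open>K\<close>, and therefore on \<open>I\<close>, factors through a free module. But a map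
  \<open>I \<rightarrow> R\<^sup>g \<rightarrow> I\<close> is multiplication by some \<open>w\<close> with \<open>q w \<in> R\<close>, so \<open>r q \<in> R\<close>.\<close>

section \<open>Linear maps and free modules\<close>

text \<open>The completion enters through Krull's intersection theorem: R embeds in it and is
  therefore reduced. Projectivity over S rests on a uniform bound. For a regular t in the maximal
  ideal a chain of e simple steps from R to tR shows that e + 1 elements, the first one regular,
  satisfy a relation with a unit coefficient. For the powers of u = y/x this makes u a root of a
  polynomial with a unit coefficient, and the truncations of that polynomial are integral. The
  degree is 2 because the projection belongs to the kernel of the first differential, which is the
  second syzygy. In the converse the degree n is given, so I has to be realized as a syzygy of every
  order; this calls for cosyzygies that are again lattices and can be iterated. As
  \<open>Ext\<close> works with an arbitrary chosen resolution, its syzygies match the constructed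
  ones up to maps through free modules. Such a map can be evaluated because a functional p on I
  satisfies x p(y) = y p(x), so that q can be moved across it.\<close>

definition lin ::
    "('a, 'k) ring_scheme \<Rightarrow> ('a, 'm, 'l) module_scheme \<Rightarrow> ('a, 'n, 'j) module_scheme
       \<Rightarrow> ('m \<Rightarrow> 'n) \<Rightarrow> bool" where
  "lin R M N f \<longleftrightarrow> (\<forall>x\<in>carrier M. f x \<in> carrier N) \<and>
     (\<forall>x\<in>carrier M. \<forall>y\<in>carrier M. f (x \<oplus>\<^bsub>M\<^esub> y) = f x \<oplus>\<^bsub>N\<^esub> f y) \<and>
     (\<forall>r\<in>carrier R. \<forall>x\<in>carrier M. f (r \<odot>\<^bsub>M\<^esub> x) = r \<odot>\<^bsub>N\<^esub> f x)"

lemma linI: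
  assumes "\<And>x. x \<in> carrier M \<Longrightarrow> f x \<in> carrier N"
    and "\<And>x y. x \<in> carrier M \<Longrightarrow> y \<in> carrier M \<Longrightarrow> f (x \<oplus>\<^bsub>M\<^esub> y) = f x \<oplus>\<^bsub>N\<^esub> f y"
    and "\<And>r x. r \<in> carrier R \<Longrightarrow> x \<in> carrier M \<Longrightarrow> f (r \<odot>\<^bsub>M\<^esub> x) = r \<odot>\<^bsub>N\<^esub> f x"
  shows "lin R M N f"
  using assms by (auto simp: lin_def)

lemma linD:
  assumes "lin R M N f"
  shows lin_closed: "x \<in> carrier M \<Longrightarrow> f x \<in> carrier N"
    and lin_add: "x \<in> carrier M \<Longrightarrow> y \<in> carrier M \<Longrightarrow> f (x \<oplus>\<^bsub>M\<^esub> y) = f x \<oplus>\<^bsub>N\<^esub> f y"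
    and lin_smult: "r \<in> carrier R \<Longrightarrow> x \<in> carrier M \<Longrightarrow> f (r \<odot>\<^bsub>M\<^esub> x) = r \<odot>\<^bsub>N\<^esub> f x"
  using assms by (auto simp: lin_def)

lemma mod_hom_iff: "f \<in> mod_hom R M N \<longleftrightarrow> lin R M N f \<and> f \<in> extensional (carrier M)"
  by (auto simp: mod_hom_def lin_def PiE_def)

lemma mod_hom_lin: "f \<in> mod_hom R M N \<Longrightarrow> lin R M N f"
  by (simp add: mod_hom_iff)

lemma lin_cong:
  assumes "module R M" "\<And>x. x \<in> carrier M \<Longrightarrow> f x = g x"
  shows "lin R M N f \<longleftrightarrow> lin R M N g"
proof -
  interpret module R M by fact
  show ?thesis using assms(2) by (auto simp: lin_def)
qed

text \<open>\<open>lin\<close> says nothing about values outside the carrier, so composites and sums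
  stay linear as they stand; \<open>mod_hom\<close> asks for extensional functions. This is the
  passage from the first notion to the second.\<close>

lemma restrict_mod_hom:
  assumes "module R M" "lin R M N f"
  shows "restrict f (carrier M) \<in> mod_hom R M N"
  using assms lin_cong[OF assms(1), of f "restrict f (carrier M)" N]
  by (auto simp: mod_hom_iff)

lemma lin_zero:
  assumes "module R M" "module R N" "lin R M N f"
  shows "f \<zero>\<^bsub>M\<^esub> = \<zero>\<^bsub>N\<^esub>"
proof -
  interpret M: module R M by fact
  interpret N: module R N by fact
  have "f (\<zero>\<^bsub>R\<^esub> \<odot>\<^bsub>M\<^esub> \<zero>\<^bsub>M\<^esub>) = \<zero>\<^bsub>R\<^esub> \<odot>\<^bsub>N\<^esub> f \<zero>\<^bsub>M\<^esub>"
    by (rule lin_smult[OF assms(3) M.R.zero_closed M.M.zero_closed])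
  then show ?thesis using lin_closed[OF assms(3) M.M.zero_closed] by simp
qed

lemma (in module) neg_eq_smult: "x \<in> carrier M \<Longrightarrow> \<ominus>\<^bsub>M\<^esub> x = (\<ominus> \<one>) \<odot>\<^bsub>M\<^esub> x"
  by (simp add: smult_l_minus)

lemma lin_neg:
  assumes "module R M" "module R N" "lin R M N f" "x \<in> carrier M"
  shows "f (\<ominus>\<^bsub>M\<^esub> x) = \<ominus>\<^bsub>N\<^esub> f x"
proof -
  interpret M: module R M by fact
  interpret N: module R N by fact
  show ?thesis using assms(4) lin_closed[OF assms(3)] lin_smult[OF assms(3)]
    by (simp add: M.neg_eq_smult N.neg_eq_smult)
qed

lemma lin_diff:
  assumes "module R M" "module R N" "lin R M N f" "x \<in> carrier M" "y \<in> carrier M"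
  shows "f (x \<ominus>\<^bsub>M\<^esub> y) = f x \<ominus>\<^bsub>N\<^esub> f y"
proof -
  interpret M: module R M by fact
  interpret N: module R N by fact
  show ?thesis using assms(4,5) lin_add[OF assms(3)] lin_neg[OF assms(1-3)]
    by (simp add: a_minus_def)
qed

lemma lin_comp:
  assumes "lin R M N f" "lin R N P g"
  shows "lin R M P (\<lambda>x. g (f x))"
  using assms by (auto simp: lin_def)

lemma lin_id: "lin R M M (\<lambda>x. x)"
  by (simp add: lin_def)

lemma lin_plus:
  assumes "module R N" "lin R M N f" "lin R M N g"
  shows "lin R M N (\<lambda>x. f x \<oplus>\<^bsub>N\<^esub> g x)"
proof -
  interpret N: module R N by fact
  show ?thesis using assms(2,3)
    by (intro linI) (auto simp: lin_def N.smult_r_distr N.M.add.m_ac)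
qed

lemma lin_scale:
  assumes "module R N" "lin R M N f" "r \<in> carrier R"
  shows "lin R M N (\<lambda>x. r \<odot>\<^bsub>N\<^esub> f x)"
proof -
  interpret N: module R N by fact
  show ?thesis using assms(2,3)
    by (intro linI) (auto simp: lin_def N.smult_r_distr N.smult_assoc1[symmetric] N.R.m_comm)
qed

lemma lin_minus:
  assumes "module R N" "lin R M N f" "lin R M N g"
  shows "lin R M N (\<lambda>x. f x \<ominus>\<^bsub>N\<^esub> g x)"
proof -
  interpret N: module R N by fact
  have "lin R M N (\<lambda>x. f x \<oplus>\<^bsub>N\<^esub> (\<ominus>\<^bsub>R\<^esub> \<one>\<^bsub>R\<^esub>) \<odot>\<^bsub>N\<^esub> g x)"
    using assms by (intro lin_plus lin_scale) auto
  then show ?thesis using lin_closed[OF assms(3)] assms(3)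
    by (auto simp: lin_def a_minus_def N.neg_eq_smult)
qed

lemma submodule_iff:
  assumes "module R M"
  shows "submodule H R M \<longleftrightarrow> H \<subseteq> carrier M \<and> \<zero>\<^bsub>M\<^esub> \<in> H \<and> (\<forall>x\<in>H. \<forall>y\<in>H. x \<oplus>\<^bsub>M\<^esub> y \<in> H) \<and>
     (\<forall>r\<in>carrier R. \<forall>x\<in>H. r \<odot>\<^bsub>M\<^esub> x \<in> H)"
proof -
  interpret module R M by fact
  show ?thesis
  proof
    assume H: "submodule H R M"
    then have "\<zero>\<^bsub>M\<^esub> \<in> H"
      using subgroup.one_closed[OF submodule.axioms(1)[OF H]] by simp
    then show "H \<subseteq> carrier M \<and> \<zero>\<^bsub>M\<^esub> \<in> H \<and> (\<forall>x\<in>H. \<forall>y\<in>H. x \<oplus>\<^bsub>M\<^esub> y \<in> H) \<and>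
     (\<forall>r\<in>carrier R. \<forall>x\<in>H. r \<odot>\<^bsub>M\<^esub> x \<in> H)"
      using submoduleE[OF H] by auto
  next
    assume H: "H \<subseteq> carrier M \<and> \<zero>\<^bsub>M\<^esub> \<in> H \<and> (\<forall>x\<in>H. \<forall>y\<in>H. x \<oplus>\<^bsub>M\<^esub> y \<in> H) \<and>
     (\<forall>r\<in>carrier R. \<forall>x\<in>H. r \<odot>\<^bsub>M\<^esub> x \<in> H)"
    then have "\<And>a. a \<in> H \<Longrightarrow> \<ominus>\<^bsub>M\<^esub> a \<in> H"
      using neg_eq_smult R.add.inv_closed[OF R.one_closed] by (simp add: subset_iff)
    with H show "submodule H R M"
      by (intro submoduleI) auto
  qed
qed

lemma submodule_minus:
  assumes "module R M" "submodule H R M" "x \<in> H" "y \<in> H"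
  shows "x \<ominus>\<^bsub>M\<^esub> y \<in> H"
  using module.submoduleE[OF assms(1,2)] assms(3,4) by (simp add: a_minus_def)

text \<open>The recursion does not look at the carrier, so the value is the same in a submodule
  given by \<open>carrier := W\<close>, and identities follow by induction on the length. Over the
  regular module it becomes the scalar product \<open>dot\<close>.\<close>

primrec lc :: "('a, 'm, 'l) module_scheme \<Rightarrow> (nat \<Rightarrow> 'a) \<Rightarrow> (nat \<Rightarrow> 'm) \<Rightarrow> nat \<Rightarrow> 'm" where
  "lc M x y 0 = \<zero>\<^bsub>M\<^esub>"
| "lc M x y (Suc k) = lc M x y k \<oplus>\<^bsub>M\<^esub> x k \<odot>\<^bsub>M\<^esub> y k"

lemma lc_cong:
  "(\<And>i. i < k \<Longrightarrow> x i = x' i) \<Longrightarrow> (\<And>i. i < k \<Longrightarrow> y i = y' i) \<Longrightarrow> lc M x y k = lc M x' y' k"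
  by (induct k) auto

context module begin

lemma lc_closed [simp]:
  "(\<And>i. i < k \<Longrightarrow> x i \<in> carrier R) \<Longrightarrow> (\<And>i. i < k \<Longrightarrow> y i \<in> carrier M) \<Longrightarrow> lc M x y k \<in> carrier M"
  by (induct k) auto

lemma lc_add_left:
  "(\<And>i. i < k \<Longrightarrow> x i \<in> carrier R) \<Longrightarrow> (\<And>i. i < k \<Longrightarrow> x' i \<in> carrier R) \<Longrightarrow>
   (\<And>i. i < k \<Longrightarrow> y i \<in> carrier M) \<Longrightarrow>
   lc M (\<lambda>i. x i \<oplus> x' i) y k = lc M x y k \<oplus>\<^bsub>M\<^esub> lc M x' y k"
  by (induct k) (auto simp: smult_l_distr M.add.m_ac)

lemma lc_scale_left:
  "r \<in> carrier R \<Longrightarrow> (\<And>i. i < k \<Longrightarrow> x i \<in> carrier R) \<Longrightarrow> (\<And>i. i < k \<Longrightarrow> y i \<in> carrier M) \<Longrightarrow>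
   lc M (\<lambda>i. r \<otimes> x i) y k = r \<odot>\<^bsub>M\<^esub> lc M x y k"
  by (induct k) (auto simp: smult_r_distr smult_assoc1)

lemma lc_add_right:
  "(\<And>i. i < k \<Longrightarrow> x i \<in> carrier R) \<Longrightarrow> (\<And>i. i < k \<Longrightarrow> y' i \<in> carrier M) \<Longrightarrow>
   (\<And>i. i < k \<Longrightarrow> y i \<in> carrier M) \<Longrightarrow>
   lc M x (\<lambda>i. y i \<oplus>\<^bsub>M\<^esub> y' i) k = lc M x y k \<oplus>\<^bsub>M\<^esub> lc M x y' k"
  by (induct k) (auto simp: smult_r_distr M.add.m_ac)

lemma lc_scale_right:
  "r \<in> carrier R \<Longrightarrow> (\<And>i. i < k \<Longrightarrow> x i \<in> carrier R) \<Longrightarrow> (\<And>i. i < k \<Longrightarrow> y i \<in> carrier M) \<Longrightarrow>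
   lc M x (\<lambda>i. r \<odot>\<^bsub>M\<^esub> y i) k = r \<odot>\<^bsub>M\<^esub> lc M x y k"
  by (induct k) (auto simp: smult_r_distr smult_assoc1[symmetric] R.m_comm)

lemma lc_zero_left:
  "(\<And>i. i < k \<Longrightarrow> x i = \<zero>) \<Longrightarrow> (\<And>i. i < k \<Longrightarrow> y i \<in> carrier M) \<Longrightarrow> lc M x y k = \<zero>\<^bsub>M\<^esub>"
  by (induct k) auto

lemma lc_unit:
  "j < k \<Longrightarrow> (\<And>i. i < k \<Longrightarrow> y i \<in> carrier M) \<Longrightarrow> lc M (\<lambda>i. if i = j then \<one> else \<zero>) y k = y j"
proof (induct k)
  case (Suc k)
  show ?case
  proof (cases "j = k")
    case True
    then have "lc M (\<lambda>i. if i = j then \<one> else \<zero>) y k = \<zero>\<^bsub>M\<^esub>"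
      using Suc by (intro lc_zero_left) auto
    then show ?thesis using True Suc by simp
  next
    case False
    then have "j < k" using Suc by simp
    then show ?thesis using Suc False by auto
  qed
qed simp

lemma lc_mem:
  assumes "submodule H R M" "\<And>i. i < k \<Longrightarrow> x i \<in> carrier R" "\<And>i. i < k \<Longrightarrow> y i \<in> H"
  shows "lc M x y k \<in> H"
  using assms(2,3) assms(1)[unfolded submodule_iff[OF module_axioms]]
  by (induct k) auto

end

lemma lin_lc:
  assumes "module R M" "module R N" "lin R M N f"
    and "\<And>i. i < k \<Longrightarrow> x i \<in> carrier R" "\<And>i. i < k \<Longrightarrow> y i \<in> carrier M"
  shows "f (lc M x y k) = lc N x (\<lambda>i. f (y i)) k"
proof -
  interpret M: module R M by fact
  interpret N: module R N by fact
  show ?thesis using assms(4,5)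
    by (induct k) (simp_all add: lin_zero[OF assms(1-3)] lin_add[OF assms(3)] lin_smult[OF assms(3)])
qed

section \<open>The free modules R^k and the regular module\<close>

lemma free_module_simps [simp]:
  "carrier (free_module R k) = {..<k} \<rightarrow>\<^sub>E carrier R"
  "\<zero>\<^bsub>free_module R k\<^esub> = (\<lambda>i\<in>{..<k}. \<zero>\<^bsub>R\<^esub>)"
  "x \<oplus>\<^bsub>free_module R k\<^esub> y = (\<lambda>i\<in>{..<k}. x i \<oplus>\<^bsub>R\<^esub> y i)"
  "r \<odot>\<^bsub>free_module R k\<^esub> x = (\<lambda>i\<in>{..<k}. r \<otimes>\<^bsub>R\<^esub> x i)"
  by (simp_all add: free_module_def)

lemma regular_module_simps [simp]:
  "carrier (regular_module R) = carrier R"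
  "\<zero>\<^bsub>regular_module R\<^esub> = \<zero>\<^bsub>R\<^esub>"
  "x \<oplus>\<^bsub>regular_module R\<^esub> y = x \<oplus>\<^bsub>R\<^esub> y"
  "r \<odot>\<^bsub>regular_module R\<^esub> x = r \<otimes>\<^bsub>R\<^esub> x"
  by (simp_all add: regular_module_def)

lemma PiE_lessThan_eqI:
  "x \<in> {..<k::nat} \<rightarrow>\<^sub>E A \<Longrightarrow> y \<in> {..<k} \<rightarrow>\<^sub>E B \<Longrightarrow> (\<And>i. i < k \<Longrightarrow> x i = y i) \<Longrightarrow> x = y"
  by (rule extensionalityI[of _ "{..<k}"]) (simp_all add: PiE_def)

lemma PiE_lessThan_mem: "x \<in> {..<k::nat} \<rightarrow>\<^sub>E A \<Longrightarrow> i < k \<Longrightarrow> x i \<in> A"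
  by (erule PiE_mem) simp

context cring begin

lemma module_free: "module R (free_module R k)"
proof -
  have mem: "x i \<in> carrier R" if "x \<in> {..<k} \<rightarrow>\<^sub>E carrier R" "i \<in> {..<k}" for x i
    using that by (rule PiE_mem)
  have "abelian_group (free_module R k)"
  proof (rule abelian_groupI, unfold free_module_simps)
    fix x y z :: "nat \<Rightarrow> 'a"
    assume x: "x \<in> {..<k} \<rightarrow>\<^sub>E carrier R" and y: "y \<in> {..<k} \<rightarrow>\<^sub>E carrier R"
    show "(\<lambda>i\<in>{..<k}. x i \<oplus> y i) \<in> {..<k} \<rightarrow>\<^sub>E carrier R"
      using mem[OF x] mem[OF y] by auto
    show "(\<lambda>i\<in>{..<k}. x i \<oplus> y i) = (\<lambda>i\<in>{..<k}. y i \<oplus> x i)"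
      using mem[OF x] mem[OF y] by (intro restrict_ext a_comm) auto
    assume z: "z \<in> {..<k} \<rightarrow>\<^sub>E carrier R"
    show "(\<lambda>i\<in>{..<k}. (\<lambda>i\<in>{..<k}. x i \<oplus> y i) i \<oplus> z i) = (\<lambda>i\<in>{..<k}. x i \<oplus> (\<lambda>i\<in>{..<k}. y i \<oplus> z i) i)"
      using mem[OF x] mem[OF y] mem[OF z] by (intro restrict_ext) (simp add: a_assoc)
  next
    fix x assume x: "x \<in> {..<k} \<rightarrow>\<^sub>E carrier R"
    show "(\<lambda>i\<in>{..<k}. (\<lambda>i\<in>{..<k}. \<zero>) i \<oplus> x i) = x"
      using mem[OF x] x by (intro PiE_lessThan_eqI[OF _ x, of _ "carrier R"]) auto
    show "\<exists>y\<in>{..<k} \<rightarrow>\<^sub>E carrier R. (\<lambda>i\<in>{..<k}. y i \<oplus> x i) = (\<lambda>i\<in>{..<k}. \<zero>)"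
      using mem[OF x]
      by (intro bexI[of _ "\<lambda>i\<in>{..<k}. \<ominus> x i"] restrict_ext) (auto simp: l_neg)
  qed auto
  then show ?thesis
  proof (rule moduleI[OF is_cring], unfold free_module_simps)
    fix a b x y
    assume a: "a \<in> carrier R" and x: "x \<in> {..<k} \<rightarrow>\<^sub>E carrier R"
    show "(\<lambda>i\<in>{..<k}. a \<otimes> x i) \<in> {..<k} \<rightarrow>\<^sub>E carrier R"
      using a mem[OF x] by auto
    { assume y: "y \<in> {..<k} \<rightarrow>\<^sub>E carrier R"
      show "(\<lambda>i\<in>{..<k}. a \<otimes> (\<lambda>i\<in>{..<k}. x i \<oplus> y i) i) = (\<lambda>i\<in>{..<k}. (\<lambda>i\<in>{..<k}. a \<otimes> x i) i \<oplus> (\<lambda>i\<in>{..<k}. a \<otimes> y i) i)"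
        using a mem[OF x] mem[OF y] by (intro restrict_ext) (simp add: r_distr) }
    assume b: "b \<in> carrier R"
    show "(\<lambda>i\<in>{..<k}. (a \<oplus> b) \<otimes> x i) = (\<lambda>i\<in>{..<k}. (\<lambda>i\<in>{..<k}. a \<otimes> x i) i \<oplus> (\<lambda>i\<in>{..<k}. b \<otimes> x i) i)"
      using a b mem[OF x] by (intro restrict_ext) (simp add: l_distr)
    show "(\<lambda>i\<in>{..<k}. a \<otimes> b \<otimes> x i) = (\<lambda>i\<in>{..<k}. a \<otimes> (\<lambda>i\<in>{..<k}. b \<otimes> x i) i)"
      using a b mem[OF x] by (intro restrict_ext) (simp add: m_assoc)
  next
    fix x assume x: "x \<in> {..<k} \<rightarrow>\<^sub>E carrier R"
    show "(\<lambda>i\<in>{..<k}. \<one> \<otimes> x i) = x"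
      using mem[OF x] x by (intro PiE_lessThan_eqI[OF _ x, of _ "carrier R"]) auto
  qed
qed

lemma module_regular: "module R (regular_module R)"
proof (rule moduleI)
  show "abelian_group (regular_module R)"
  proof (rule abelian_groupI)
    fix x assume "x \<in> carrier (regular_module R)"
    then show "\<exists>y\<in>carrier (regular_module R). y \<oplus>\<^bsub>regular_module R\<^esub> x = \<zero>\<^bsub>regular_module R\<^esub>"
      by (intro bexI[of _ "\<ominus> x"]) (auto simp: l_neg)
  qed (auto simp: a_ac)
qed (auto simp: l_distr r_distr m_assoc is_cring)

lemma lin_proj: "i < k \<Longrightarrow> lin R (free_module R k) (regular_module R) (\<lambda>x. x i)"
  by (auto intro!: linI)

definition unit_vec :: "nat \<Rightarrow> nat \<Rightarrow> nat \<Rightarrow> 'a" where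
  "unit_vec k j = (\<lambda>i\<in>{..<k}. if i = j then \<one> else \<zero>)"

lemma unit_vec_closed [simp]: "unit_vec k j \<in> {..<k} \<rightarrow>\<^sub>E carrier R"
  by (auto simp: unit_vec_def)

lemma lc_component:
  assumes "i < n" "\<And>j. j < k \<Longrightarrow> x j \<in> carrier R" "\<And>j. j < k \<Longrightarrow> y j \<in> {..<n} \<rightarrow>\<^sub>E carrier R"
  shows "lc (free_module R n) x y k i = lc (regular_module R) x (\<lambda>j. y j i) k"
  using lin_lc[OF module_free module_regular lin_proj[OF assms(1)], of k x y] assms(2,3) by simp

lemma lc_regular_commute:
  "(\<And>i. i < k \<Longrightarrow> x i \<in> carrier R) \<Longrightarrow> (\<And>i. i < k \<Longrightarrow> y i \<in> carrier R) \<Longrightarrow>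
    lc (regular_module R) x y k = lc (regular_module R) y x k"
  by (induct k) (auto simp: m_comm)

lemma lc_unit_vec:
  assumes "x \<in> {..<k} \<rightarrow>\<^sub>E carrier R"
  shows "lc (free_module R k) x (unit_vec k) k = x"
proof (rule PiE_lessThan_eqI)
  interpret F: module R "free_module R k" by (rule module_free)
  interpret A: module R "regular_module R" by (rule module_regular)
  show "lc (free_module R k) x (unit_vec k) k \<in> {..<k} \<rightarrow>\<^sub>E carrier R"
    using F.lc_closed[of k x "unit_vec k"] assms by auto
  fix i assume i: "i < k"
  have "lc (free_module R k) x (unit_vec k) k i = lc (regular_module R) x (\<lambda>j. unit_vec k j i) k"
    using assms i by (intro lc_component) auto
  also have "\<dots> = lc (regular_module R) (\<lambda>j. unit_vec k j i) x k"
    using assms i by (intro lc_regular_commute) (auto simp: unit_vec_def)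
  also have "\<dots> = lc (regular_module R) (\<lambda>j. if j = i then \<one> else \<zero>) x k"
    using i by (intro lc_cong) (auto simp: unit_vec_def)
  also have "\<dots> = x i"
    using assms i by (intro A.lc_unit) auto
  finally show "lc (free_module R k) x (unit_vec k) k i = x i" .
qed fact

lemma lin_free_expand:
  assumes "module R N" "lin R (free_module R k) N f" "x \<in> {..<k} \<rightarrow>\<^sub>E carrier R"
  shows "f x = lc N x (\<lambda>i. f (unit_vec k i)) k"
  using lin_lc[OF module_free assms(1,2), of k x "unit_vec k"] lc_unit_vec[OF assms(3)] assms(3)
  by auto

end

lemma lin_lc_free:
  assumes "module R N" "\<And>i. i < k \<Longrightarrow> y i \<in> carrier N"
  shows "lin R (free_module R k) N (\<lambda>x. lc N x y k)"
proof -
  interpret module R N by fact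
  have *: "lc N (restrict z {..<k}) y k = lc N z y k" for z :: "nat \<Rightarrow> 'a"
    by (rule lc_cong) auto
  show ?thesis
    using assms(2) by (intro linI) (auto simp: * lc_add_left lc_scale_left PiE_iff)
qed

text \<open>Projectivity of R^k: preimages under g are chosen for the images of the unit vectors,
  and the choice is extended by linear combinations.\<close>

lemma lin_free_lift:
  assumes "module R M" "module R N" "lin R M N g" "lin R (free_module R k) N f"
    and "\<And>x. x \<in> {..<k} \<rightarrow>\<^sub>E carrier R \<Longrightarrow> f x \<in> g ` carrier M"
  obtains h where "lin R (free_module R k) M h"
    "\<And>x. x \<in> {..<k} \<rightarrow>\<^sub>E carrier R \<Longrightarrow> g (h x) = f x"
proof -
  interpret M: module R M by fact
  have "\<forall>i. \<exists>y\<in>carrier M. g y = f (M.unit_vec k i)"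
    using assms(5) by (metis (no_types, lifting) M.unit_vec_closed imageE)
  then obtain y where y: "\<And>i. y i \<in> carrier M" "\<And>i. g (y i) = f (M.unit_vec k i)"
    by metis
  show ?thesis
  proof
    show "lin R (free_module R k) M (\<lambda>x. lc M x y k)"
      using y assms(1) by (intro lin_lc_free) auto
    fix x assume x: "x \<in> {..<k} \<rightarrow>\<^sub>E carrier R"
    then have "g (lc M x y k) = lc N x (\<lambda>i. g (y i)) k"
      using lin_lc[OF assms(1-3), of k x y] y(1) by (simp add: PiE_iff)
    also have "\<dots> = f x"
      using M.lin_free_expand[OF assms(2,4) x] y(2) by (simp only:)
    finally show "g (lc M x y k) = f x" .
  qed
qed

section \<open>Noetherian local rings\<close>

context cring begin

lemma ideal_iff:
  "ideal I R \<longleftrightarrow> I \<subseteq> carrier R \<and> \<zero> \<in> I \<and> (\<forall>x\<in>I. \<forall>y\<in>I. x \<oplus> y \<in> I) \<and>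
     (\<forall>r\<in>carrier R. \<forall>x\<in>I. r \<otimes> x \<in> I)"
proof
  assume I: "ideal I R"
  interpret ideal I R by fact
  show "I \<subseteq> carrier R \<and> \<zero> \<in> I \<and> (\<forall>x\<in>I. \<forall>y\<in>I. x \<oplus> y \<in> I) \<and>
   (\<forall>r\<in>carrier R. \<forall>x\<in>I. r \<otimes> x \<in> I)"
    using a_subset I_l_closed by auto
next
  assume I: "I \<subseteq> carrier R \<and> \<zero> \<in> I \<and> (\<forall>x\<in>I. \<forall>y\<in>I. x \<oplus> y \<in> I) \<and>
   (\<forall>r\<in>carrier R. \<forall>x\<in>I. r \<otimes> x \<in> I)"
  have "\<ominus> a = (\<ominus> \<one>) \<otimes> a" if "a \<in> I" for a
    using I that by (simp add: l_minus subset_iff)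
  then have neg: "\<ominus> a \<in> I" if "a \<in> I" for a
    using I that by simp
  have "subgroup I (add_monoid R)"
    using I neg by (intro add.subgroupI) (auto simp: a_inv_def)
  moreover have "a \<otimes> x \<in> I" if "a \<in> I" "x \<in> carrier R" for a x
    using I that m_comm[of a x] by (auto simp: subset_iff)
  ultimately show "ideal I R"
    using I by (intro idealI) (auto simp: ring_axioms subset_iff)
qed

lemma idealI_closure:
  "I \<subseteq> carrier R \<Longrightarrow> \<zero> \<in> I \<Longrightarrow> (\<And>x y. x \<in> I \<Longrightarrow> y \<in> I \<Longrightarrow> x \<oplus> y \<in> I) \<Longrightarrow>
   (\<And>r x. r \<in> carrier R \<Longrightarrow> x \<in> I \<Longrightarrow> r \<otimes> x \<in> I) \<Longrightarrow> ideal I R"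
  by (simp add: ideal_iff)

lemma idealD:
  assumes "ideal I R"
  shows "x \<in> I \<Longrightarrow> x \<in> carrier R"
    and "\<zero> \<in> I"
    and "x \<in> I \<Longrightarrow> y \<in> I \<Longrightarrow> x \<oplus> y \<in> I"
    and "r \<in> carrier R \<Longrightarrow> x \<in> I \<Longrightarrow> r \<otimes> x \<in> I"
    and "r \<in> carrier R \<Longrightarrow> x \<in> I \<Longrightarrow> x \<otimes> r \<in> I"
    and "x \<in> I \<Longrightarrow> \<ominus> x \<in> I"
    and "x \<in> I \<Longrightarrow> y \<in> I \<Longrightarrow> x \<ominus> y \<in> I"
proof -
  have I: "I \<subseteq> carrier R \<and> \<zero> \<in> I \<and> (\<forall>x\<in>I. \<forall>y\<in>I. x \<oplus> y \<in> I) \<and>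
     (\<forall>r\<in>carrier R. \<forall>x\<in>I. r \<otimes> x \<in> I)"
    using assms by (simp add: ideal_iff)
  show "x \<in> I \<Longrightarrow> x \<in> carrier R" "\<zero> \<in> I" "x \<in> I \<Longrightarrow> y \<in> I \<Longrightarrow> x \<oplus> y \<in> I"
    "r \<in> carrier R \<Longrightarrow> x \<in> I \<Longrightarrow> r \<otimes> x \<in> I"
    using I by auto
  show "r \<in> carrier R \<Longrightarrow> x \<in> I \<Longrightarrow> x \<otimes> r \<in> I"
    using I m_comm[of x r] by (auto simp: subset_iff)
  have *: "\<ominus> x \<in> I" if "x \<in> I" for x
  proof -
    have "\<ominus> x = (\<ominus> \<one>) \<otimes> x" using I that by (simp add: l_minus subset_iff)
    then show ?thesis using I that by simp
  qed
  show "x \<in> I \<Longrightarrow> \<ominus> x \<in> I" "x \<in> I \<Longrightarrow> y \<in> I \<Longrightarrow> x \<ominus> y \<in> I"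
    using * I by (auto simp: a_minus_def)
qed

definition adjoin :: "'a set \<Rightarrow> 'a \<Rightarrow> 'a set" where
  "adjoin I a = {x. \<exists>i\<in>I. \<exists>r\<in>carrier R. x = i \<oplus> r \<otimes> a}"

lemma adjoin_ideal:
  assumes "ideal I R" "a \<in> carrier R"
  shows "ideal (adjoin I a) R"
proof (rule idealI_closure)
  note I = idealD[OF assms(1)]
  show "adjoin I a \<subseteq> carrier R"
    using assms(2) I(1) by (auto simp: adjoin_def)
  show "\<zero> \<in> adjoin I a"
    using assms(2) I(2) by (auto simp: adjoin_def intro!: bexI[of _ \<zero>])
  fix x assume "x \<in> adjoin I a"
  then obtain i r where x: "i \<in> I" "r \<in> carrier R" "x = i \<oplus> r \<otimes> a"
    by (auto simp: adjoin_def)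
  have i: "i \<in> carrier R" using x I(1) by simp
  { fix y assume "y \<in> adjoin I a"
    then obtain j s where y: "j \<in> I" "s \<in> carrier R" "y = j \<oplus> s \<otimes> a"
      by (auto simp: adjoin_def)
    have j: "j \<in> carrier R" using y I(1) by simp
    have "x \<oplus> y = (i \<oplus> j) \<oplus> (r \<oplus> s) \<otimes> a"
      using x(2) y(2) i j assms(2) unfolding x(3) y(3) by algebra
    then show "x \<oplus> y \<in> adjoin I a"
      using x(1,2) y(1,2) I(3) by (auto simp: adjoin_def) }
  fix s assume s: "s \<in> carrier R"
  have "s \<otimes> x = s \<otimes> i \<oplus> (s \<otimes> r) \<otimes> a"
    using x(2) i s assms(2) unfolding x(3) by algebra
  then show "s \<otimes> x \<in> adjoin I a"
    using x(1,2) s I(4) by (auto simp: adjoin_def)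
qed

lemma adjoin_incl: "ideal I R \<Longrightarrow> a \<in> carrier R \<Longrightarrow> I \<subseteq> adjoin I a"
  using idealD(1)[of I] by (force simp: adjoin_def intro: bexI[of _ \<zero>])

lemma adjoin_self: "ideal I R \<Longrightarrow> a \<in> carrier R \<Longrightarrow> a \<in> adjoin I a"
  using idealD(2)[of I] by (force simp: adjoin_def intro: bexI[of _ \<one>])

lemma PIdl_mem: "x \<in> PIdl a \<longleftrightarrow> (\<exists>r\<in>carrier R. x = r \<otimes> a)"
  by (auto simp: cgenideal_def)

end

text \<open>By \<open>ideal_chain_is_trivial\<close> a nonempty chain of ideals contains its union,
  so Zorn's lemma applies to an arbitrary nonempty set of ideals. Noetherian induction is used in
  this form throughout.\<close>

lemma (in noetherian_ring) ideal_maximal_element: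
  assumes "S \<noteq> {}" "\<And>I. I \<in> S \<Longrightarrow> ideal I R"
  obtains M where "M \<in> S" "\<And>I. I \<in> S \<Longrightarrow> M \<subseteq> I \<Longrightarrow> I = M"
proof -
  have "\<exists>M\<in>S. \<forall>J\<in>S. M \<subseteq> J \<longrightarrow> J = M"
  proof (rule subset_Zorn)
    fix C assume C: "subset.chain S C"
    show "\<exists>U\<in>S. \<forall>J\<in>C. J \<subseteq> U"
    proof (cases "C = {}")
      case True
      then show ?thesis using assms(1) by auto
    next
      case False
      have "subset.chain {I. ideal I R} C"
        using C assms(2) by (auto simp: pred_on.chain_def)
      then have "\<Union>C \<in> C" using ideal_chain_is_trivial False by blast
      then show ?thesis using C by (auto simp: pred_on.chain_def)
    qed
  qed
  then show ?thesis using that by auto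
qed

lemma (in noetherian_ring) ideal_sequence_stationary:
  fixes A :: "nat \<Rightarrow> 'a set"
  assumes "\<And>n. ideal (A n) R" "\<And>n. A n \<subseteq> A (Suc n)"
  obtains n where "\<And>k. n \<le> k \<Longrightarrow> A k = A n"
proof -
  obtain M where M: "M \<in> range A" "\<And>I. I \<in> range A \<Longrightarrow> M \<subseteq> I \<Longrightarrow> I = M"
    using ideal_maximal_element[of "range A"] assms(1) by blast
  then obtain n where "M = A n" by auto
  moreover have "A n \<subseteq> A k" if "n \<le> k" for n k
    using that by (rule lift_Suc_mono_le[of A, OF assms(2)])
  ultimately have "\<And>k. n \<le> k \<Longrightarrow> A k = A n" using M(2)[OF rangeI] by simp
  then show ?thesis by (rule that)
qed

locale noetherian_cring = cring R + noetherian_ring R for R (structure)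

context noetherian_cring begin

text \<open>An ideal P maximal among those containing I and missing S is prime: if a and b lie
  outside P, both P + Ra and P + Rb meet S. The product of the two elements found lies in S, but
  also in P + Rab, which is P as soon as ab is in P.\<close>

lemma prime_disjoint:
  assumes "ideal I R" "S \<subseteq> carrier R" "\<one> \<in> S" "\<And>x y. x \<in> S \<Longrightarrow> y \<in> S \<Longrightarrow> x \<otimes> y \<in> S" "I \<inter> S = {}"
  obtains P where "primeideal P R" "I \<subseteq> P" "P \<inter> S = {}"
proof -
  define F where "F = {J. ideal J R \<and> I \<subseteq> J \<and> J \<inter> S = {}}"
  obtain P where P: "P \<in> F" "\<And>J. J \<in> F \<Longrightarrow> P \<subseteq> J \<Longrightarrow> J = P"
    using ideal_maximal_element[of F] assms(1,5) unfolding F_def by blast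
  then have iP: "ideal P R" "I \<subseteq> P" "P \<inter> S = {}" by (auto simp: F_def)
  note Pc = idealD[OF iP(1)]
  have meet: "\<exists>i\<in>P. \<exists>r\<in>carrier R. i \<oplus> r \<otimes> a \<in> S" if "a \<in> carrier R" "a \<notin> P" for a
  proof -
    have "adjoin P a \<notin> F"
      using P(2)[of "adjoin P a"] adjoin_incl[OF iP(1) that(1)] adjoin_self[OF iP(1) that(1)] that(2)
      by auto
    then have "adjoin P a \<inter> S \<noteq> {}"
      using adjoin_ideal[OF iP(1) that(1)] adjoin_incl[OF iP(1) that(1)] iP(2) by (auto simp: F_def)
    then show ?thesis by (auto simp: adjoin_def)
  qed
  have "primeideal P R"
  proof (rule primeidealI[OF iP(1) is_cring])
    show "carrier R \<noteq> P" using iP(3) assms(3) by auto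
    fix a b assume ab: "a \<in> carrier R" "b \<in> carrier R" "a \<otimes> b \<in> P"
    show "a \<in> P \<or> b \<in> P"
    proof (rule ccontr)
      assume "\<not> (a \<in> P \<or> b \<in> P)"
      then obtain i r j s where *: "i \<in> P" "r \<in> carrier R" "i \<oplus> r \<otimes> a \<in> S"
          "j \<in> P" "s \<in> carrier R" "j \<oplus> s \<otimes> b \<in> S"
        using meet ab by metis
      have ij: "i \<in> carrier R" "j \<in> carrier R" using * Pc(1) by auto
      have "(i \<oplus> r \<otimes> a) \<otimes> (j \<oplus> s \<otimes> b) = (j \<oplus> s \<otimes> b) \<otimes> i \<oplus> (r \<otimes> a) \<otimes> j \<oplus> (r \<otimes> s) \<otimes> (a \<otimes> b)"
        using * ij ab by algebra
      also have "\<dots> \<in> P"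
        using * ij ab by (simp add: Pc(3,4))
      finally show False using assms(4)[OF *(3,6)] iP(3) by auto
    qed
  qed
  then show ?thesis using iP that by blast
qed

end

locale local_noetherian = noetherian_cring R for R (structure) +
  fixes \<mm>
  assumes maximal: "maximalideal \<mm> R" and unique_maximal: "maximalideal I R \<Longrightarrow> I = \<mm>"

context local_noetherian begin

lemma ideal_max: "ideal \<mm> R"
  using maximal by (rule maximalideal.axioms)

lemma prime_max: "primeideal \<mm> R"
  using maximalideal_prime[OF maximal] .

lemmas max_closed = idealD[OF ideal_max]

lemma one_notin_max: "\<one> \<notin> \<mm>"
  using ideal.one_imp_carrier[OF ideal_max] maximalideal.I_notcarr[OF maximal] by auto

lemma proper_ideal_le_max:
  assumes "ideal I R" "\<one> \<notin> I"
  shows "I \<subseteq> \<mm>"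
proof -
  obtain M where M: "M \<in> {J. ideal J R \<and> I \<subseteq> J \<and> \<one> \<notin> J}"
    "\<And>J. J \<in> {J. ideal J R \<and> I \<subseteq> J \<and> \<one> \<notin> J} \<Longrightarrow> M \<subseteq> J \<Longrightarrow> J = M"
    using ideal_maximal_element[of "{J. ideal J R \<and> I \<subseteq> J \<and> \<one> \<notin> J}"] assms by blast
  have "maximalideal M R"
  proof (rule maximalidealI)
    show "ideal M R" "carrier R \<noteq> M" using M(1) by auto
    fix J assume J: "ideal J R" "M \<subseteq> J" "J \<subseteq> carrier R"
    show "J = M \<or> J = carrier R"
    proof (cases "\<one> \<in> J")
      case True
      then show ?thesis using ideal.one_imp_carrier[OF J(1)] by simp
    next
      case False
      then show ?thesis using M J by blast
    qed
  qed
  then show ?thesis using unique_maximal M(1) by auto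
qed

lemma not_max_Unit:
  assumes "a \<in> carrier R" "a \<notin> \<mm>"
  shows "a \<in> Units R"
proof -
  have "\<one> \<in> PIdl a"
    using proper_ideal_le_max[OF cgenideal_ideal[OF assms(1)]] cgenideal_self[OF assms(1)] assms(2)
    by blast
  then obtain r where "r \<in> carrier R" "\<one> = r \<otimes> a" by (auto simp: PIdl_mem)
  then show ?thesis using assms(1) m_comm[of r a] by (auto simp: Units_def)
qed

lemma one_minus_max_Unit: "a \<in> \<mm> \<Longrightarrow> \<one> \<ominus> a \<in> Units R"
proof (rule not_max_Unit)
  assume a: "a \<in> \<mm>"
  then have ac: "a \<in> carrier R" by (rule max_closed)
  then show "\<one> \<ominus> a \<in> carrier R" by simp
  show "\<one> \<ominus> a \<notin> \<mm>"
  proof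
    assume "\<one> \<ominus> a \<in> \<mm>"
    then have "(\<one> \<ominus> a) \<oplus> a \<in> \<mm>" using a by (rule max_closed)
    moreover have "(\<one> \<ominus> a) \<oplus> a = \<one>" using ac by algebra
    ultimately show False using one_notin_max by simp
  qed
qed

end

subsection \<open>Krull's intersection theorem\<close>

context noetherian_cring begin

lemma ideal_pow_closed: "ideal I R \<Longrightarrow> ideal (I [^]\<^bsub>ideals_set R\<^esub> (n::nat)) R"
proof -
  interpret S: comm_monoid "ideals_set R" by (rule ideals_set_is_comm_monoid)
  assume "ideal I R"
  then have "I [^]\<^bsub>ideals_set R\<^esub> n \<in> carrier (ideals_set R)"
    by (intro S.nat_pow_closed) (simp add: ideals_set_def)
  then show ?thesis by (simp add: ideals_set_def)
qed

lemma ideal_pow_add: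
  assumes "ideal I R"
  shows "I [^]\<^bsub>ideals_set R\<^esub> (n + k :: nat) = (I [^]\<^bsub>ideals_set R\<^esub> n) \<cdot> (I [^]\<^bsub>ideals_set R\<^esub> k)"
proof -
  interpret S: comm_monoid "ideals_set R" by (rule ideals_set_is_comm_monoid)
  show ?thesis
    using assms S.nat_pow_mult[of I n k] by (simp add: ideals_set_def)
qed

lemma ideal_prod_subset:
  assumes "ideal K R" "\<And>i j. i \<in> I \<Longrightarrow> j \<in> J \<Longrightarrow> i \<otimes> j \<in> K"
  shows "I \<cdot> J \<subseteq> K"
proof
  fix s assume "s \<in> I \<cdot> J"
  then show "s \<in> K"
    by induct (use assms idealD[OF assms(1)] in auto)
qed

text \<open>Take P maximal among the ideals above K that contain no power of I. For a in I outside
  P, both P + Ra and the colon ideal (P : a) are strictly larger than P, so each contains a power of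
  I; the product of these two powers falls into P.\<close>

lemma ideal_pow_le:
  assumes I: "ideal I R" and K: "ideal K R" and "\<And>a. a \<in> I \<Longrightarrow> \<exists>n::nat. a [^] n \<in> K"
  shows "\<exists>N::nat. I [^]\<^bsub>ideals_set R\<^esub> N \<subseteq> K"
proof (rule ccontr)
  assume no: "\<not> ?thesis"
  define F where "F = {J. ideal J R \<and> K \<subseteq> J \<and> (\<forall>N::nat. \<not> I [^]\<^bsub>ideals_set R\<^esub> N \<subseteq> J)}"
  obtain P where P: "P \<in> F" "\<And>J. J \<in> F \<Longrightarrow> P \<subseteq> J \<Longrightarrow> J = P"
    using ideal_maximal_element[of F] no K unfolding F_def by blast
  then have iP: "ideal P R" "K \<subseteq> P" and nP: "\<And>N::nat. \<not> I [^]\<^bsub>ideals_set R\<^esub> N \<subseteq> P" by (auto simp: F_def)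
  note Pc = idealD[OF iP(1)]
  have big: "\<exists>N::nat. I [^]\<^bsub>ideals_set R\<^esub> N \<subseteq> J" if "ideal J R" "P \<subset> J" for J
    using P(2)[of J] that iP by (auto simp: F_def)
  have "I [^]\<^bsub>ideals_set R\<^esub> (1::nat) = I"
  proof -
    interpret S: comm_monoid "ideals_set R" by (rule ideals_set_is_comm_monoid)
    show ?thesis using I by (intro S.nat_pow_eone) (simp add: ideals_set_def)
  qed
  then obtain a where a: "a \<in> I" "a \<notin> P" using nP[of 1] by auto
  have ac: "a \<in> carrier R" using a idealD[OF I] by auto
  \<comment> \<open>The last power of a outside P. It lies in (P : a) and shows that this colon
    ideal is strictly larger than P.\<close>
  obtain n where n: "a [^] (Suc n :: nat) \<in> P" "a [^] n \<notin> P"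
  proof -
    obtain n0 :: nat where "a [^] n0 \<in> P" using assms(3)[OF a(1)] iP by auto
    moreover have "\<one> \<notin> P" using Pc(4)[of a \<one>] a(2) ac by auto
    then have "a [^] (0::nat) \<notin> P" by simp
    ultimately have "\<exists>n<n0. a [^] n \<notin> P \<and> a [^] (Suc n) \<in> P"
      using ex_least_nat_less[of "\<lambda>n. a [^] n \<in> P" n0] by (auto simp: less_Suc_eq_le)
    then show ?thesis using that by auto
  qed
  define C where "C = {x \<in> carrier R. a \<otimes> x \<in> P}"
  have C: "ideal C R"
    using ac Pc by (intro idealI_closure) (auto simp: C_def r_distr m_lcomm)
  have "P \<subset> C"
  proof -
    have "a [^] n \<in> C" using n ac by (simp add: C_def m_comm)
    moreover have "P \<subseteq> C" using Pc(1,4) ac by (auto simp: C_def)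
    ultimately show ?thesis using n by auto
  qed
  then obtain M :: nat where M: "I [^]\<^bsub>ideals_set R\<^esub> M \<subseteq> C" using big C by blast
  have "P \<subset> adjoin P a" using adjoin_incl[OF iP(1) ac] adjoin_self[OF iP(1) ac] a by auto
  then obtain N :: nat where N: "I [^]\<^bsub>ideals_set R\<^esub> N \<subseteq> adjoin P a"
    using big adjoin_ideal[OF iP(1) ac] by blast
  have "(I [^]\<^bsub>ideals_set R\<^esub> N) \<cdot> (I [^]\<^bsub>ideals_set R\<^esub> M) \<subseteq> P"
  proof (rule ideal_prod_subset[OF iP(1)])
    fix i j assume "i \<in> I [^]\<^bsub>ideals_set R\<^esub> N" "j \<in> I [^]\<^bsub>ideals_set R\<^esub> M"
    then have "i \<in> adjoin P a" and j: "j \<in> carrier R" "a \<otimes> j \<in> P"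
      using M N by (auto simp: C_def)
    then obtain p r where p: "p \<in> P" "r \<in> carrier R" "i = p \<oplus> r \<otimes> a" by (auto simp: adjoin_def)
    have "p \<in> carrier R" using p Pc(1) by auto
    then have "i \<otimes> j = j \<otimes> p \<oplus> r \<otimes> (a \<otimes> j)"
      using p(2) j ac unfolding p(3) by algebra
    then show "i \<otimes> j \<in> P" using p j Pc by auto
  qed
  then show False using nP[of "N + M"] ideal_pow_add[OF I] by simp
qed

end

text \<open>If x is nonzero, then x is not in \<mm> x, because 1 - a is a unit for a in \<mm>.
  Choose K maximal among the ideals that contain \<mm> x but not x. Every a in \<mm> turns out to be
  nilpotent modulo K, so some power of \<mm> lies in K, and that power contains x.\<close>

lemma (in local_noetherian) krull_intersection:
  assumes "x \<in> carrier R" "\<And>n::nat. x \<in> \<mm> [^]\<^bsub>ideals_set R\<^esub> n"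
  shows "x = \<zero>"
proof (rule ccontr)
  assume nz: "x \<noteq> \<zero>"
  define mx where "mx = {a \<otimes> x | a. a \<in> \<mm>}"
  have mx: "ideal mx R"
  proof (rule idealI_closure)
    show "mx \<subseteq> carrier R" using assms(1) max_closed(1) by (auto simp: mx_def)
    show "\<zero> \<in> mx" using assms(1) max_closed(2) by (force simp: mx_def)
    fix u assume "u \<in> mx"
    then obtain a where a: "a \<in> \<mm>" "u = a \<otimes> x" by (auto simp: mx_def)
    have ac: "a \<in> carrier R" using a max_closed(1) by simp
    { fix v assume "v \<in> mx"
      then obtain b where b: "b \<in> \<mm>" "v = b \<otimes> x" by (auto simp: mx_def)
      then have "b \<in> carrier R" using max_closed(1) by simp
      then have "u \<oplus> v = (a \<oplus> b) \<otimes> x" using a b ac assms(1) by (simp add: l_distr)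
      then show "u \<oplus> v \<in> mx" using a b max_closed(3) by (auto simp: mx_def) }
    fix r assume r: "r \<in> carrier R"
    then have "r \<otimes> u = (r \<otimes> a) \<otimes> x" using a ac assms(1) by (simp add: m_assoc)
    then show "r \<otimes> u \<in> mx" using a r max_closed(4) by (auto simp: mx_def)
  qed
  have "x \<notin> mx"
  proof
    assume "x \<in> mx"
    then obtain a where a: "a \<in> \<mm>" "x = a \<otimes> x" by (auto simp: mx_def)
    have ac: "a \<in> carrier R" using a max_closed(1) by simp
    have "(\<one> \<ominus> a) \<otimes> x = x \<ominus> a \<otimes> x" using ac assms(1) by algebra
    also have "\<dots> = \<zero>" using a(2) assms(1) by (simp add: r_neg a_minus_def)
    finally have *: "(\<one> \<ominus> a) \<otimes> x = \<zero>" .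
    have "inv (\<one> \<ominus> a) \<otimes> ((\<one> \<ominus> a) \<otimes> x) = x"
      using one_minus_max_Unit[OF a(1)] assms(1)
        m_assoc[of "inv (\<one> \<ominus> a)" "\<one> \<ominus> a" x] Units_closed[OF one_minus_max_Unit[OF a(1)]]
      by simp
    then show False using * nz one_minus_max_Unit[OF a(1)] by simp
  qed
  then obtain K where K: "K \<in> {K. ideal K R \<and> mx \<subseteq> K \<and> x \<notin> K}"
      "\<And>J. J \<in> {K. ideal K R \<and> mx \<subseteq> K \<and> x \<notin> K} \<Longrightarrow> K \<subseteq> J \<Longrightarrow> J = K"
    using ideal_maximal_element[of "{K. ideal K R \<and> mx \<subseteq> K \<and> x \<notin> K}"] mx by blast
  then have iK: "ideal K R" "mx \<subseteq> K" "x \<notin> K" by auto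
  note Kc = idealD[OF iK(1)]
  have "\<exists>n::nat. a [^] n \<in> K" if a: "a \<in> \<mm>" for a
  proof -
    have ac: "a \<in> carrier R" using a max_closed(1) by simp
    define A where "A n = {r \<in> carrier R. a [^] n \<otimes> r \<in> K}" for n :: nat
    have A: "ideal (A n) R" for n
      using ac Kc by (intro idealI_closure) (auto simp: A_def r_distr m_lcomm)
    have "A n \<subseteq> A (Suc n)" for n
    proof
      fix r assume "r \<in> A n"
      then have "r \<in> carrier R" "a \<otimes> (a [^] n \<otimes> r) \<in> K" using ac Kc(4) by (auto simp: A_def)
      then show "r \<in> A (Suc n)" using ac by (simp add: A_def m_assoc m_lcomm m_comm)
    qed
    then obtain n where n: "\<And>k. n \<le> k \<Longrightarrow> A k = A n" using ideal_sequence_stationary[of A] A by blast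
    have an: "a [^] n \<in> carrier R" using ac by simp
    show ?thesis
    proof (rule ccontr)
      assume "\<not> ?thesis"
      then have "a [^] n \<notin> K" by auto
      then have "adjoin K (a [^] n) \<notin> {K. ideal K R \<and> mx \<subseteq> K \<and> x \<notin> K}"
        using K(2)[of "adjoin K (a [^] n)"] adjoin_incl[OF iK(1) an] adjoin_self[OF iK(1) an] by auto
      then have "x \<in> adjoin K (a [^] n)"
        using adjoin_ideal[OF iK(1) an] adjoin_incl[OF iK(1) an] iK by auto
      then obtain k r where k: "k \<in> K" "r \<in> carrier R" "x = k \<oplus> r \<otimes> a [^] n" by (auto simp: adjoin_def)
      have kc: "k \<in> carrier R" using k Kc(1) by simp
      \<comment> \<open>Multiplying x = k + r a^n by a puts r into (K : a^(n+1)). This ideal equals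
        (K : a^n) by the choice of n, so r a^n and with it x would lie in K.\<close>
      have "a \<otimes> x \<in> K" using a iK(2) by (auto simp: mx_def)
      then have "a \<otimes> x \<ominus> a \<otimes> k \<in> K" using Kc k(1) ac by auto
      moreover have "a \<otimes> x \<ominus> a \<otimes> k = a [^] (Suc n) \<otimes> r"
        unfolding k(3) nat_pow_Suc using kc k(2) ac an by algebra
      ultimately have "r \<in> A (Suc n)" using k(2) by (simp add: A_def)
      then have "r \<in> A n" using n[of "Suc n"] by simp
      then have "k \<oplus> r \<otimes> a [^] n \<in> K" using k(1,2) Kc an by (auto simp: A_def m_comm)
      then show False using k(3) iK(3) by simp
    qed
  qed
  then obtain N :: nat where "\<mm> [^]\<^bsub>ideals_set R\<^esub> N \<subseteq> K"
    using ideal_pow_le[OF ideal_max iK(1)] by blast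
  then show False using assms(2) iK(3) by blast
qed

section \<open>One-dimensional reduced local rings\<close>

context cring begin

lemma nonzerodivisorsI:
  "s \<in> carrier R \<Longrightarrow> (\<And>r. r \<in> carrier R \<Longrightarrow> s \<otimes> r = \<zero> \<Longrightarrow> r = \<zero>) \<Longrightarrow> s \<in> nonzerodivisors R"
  by (simp add: nonzerodivisors_def)

lemma nonzerodivisorsD:
  assumes "s \<in> nonzerodivisors R"
  shows "s \<in> carrier R" and "r \<in> carrier R \<Longrightarrow> s \<otimes> r = \<zero> \<Longrightarrow> r = \<zero>"
    and "r \<in> carrier R \<Longrightarrow> r \<otimes> s = \<zero> \<Longrightarrow> r = \<zero>"
  using assms by (auto simp: nonzerodivisors_def m_comm[of r s])

lemma nonzerodivisor_cancel:
  assumes "s \<in> nonzerodivisors R" "a \<in> carrier R" "b \<in> carrier R" "s \<otimes> a = s \<otimes> b"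
  shows "a = b"
proof -
  have s: "s \<in> carrier R" using assms(1) by (rule nonzerodivisorsD)
  have "s \<otimes> (a \<ominus> b) = s \<otimes> a \<ominus> s \<otimes> b" using s assms(2,3) by algebra
  also have "\<dots> = \<zero>" using assms(4) s assms(2,3) by (simp add: a_minus_def r_neg)
  finally have "a \<ominus> b = \<zero>" using nonzerodivisorsD(2)[OF assms(1)] assms(2,3) by simp
  then show ?thesis using assms(2,3) by simp
qed

lemma one_nonzerodivisor: "\<one> \<in> nonzerodivisors R"
  by (simp add: nonzerodivisors_def)

lemma mult_nonzerodivisor:
  assumes "s \<in> nonzerodivisors R" "t \<in> nonzerodivisors R"
  shows "s \<otimes> t \<in> nonzerodivisors R"
proof (rule nonzerodivisorsI)
  note s = nonzerodivisorsD[OF assms(1)] and t = nonzerodivisorsD[OF assms(2)]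
  show "s \<otimes> t \<in> carrier R" using s(1) t(1) by simp
  fix r assume r: "r \<in> carrier R" "s \<otimes> t \<otimes> r = \<zero>"
  then have "s \<otimes> (t \<otimes> r) = \<zero>" using s(1) t(1) by (simp add: m_assoc)
  then show "r = \<zero>" using s(2) t(1,2) r(1) by simp
qed

lemma pow_nonzerodivisor: "s \<in> nonzerodivisors R \<Longrightarrow> s [^] (n::nat) \<in> nonzerodivisors R"
  by (induct n) (auto simp: one_nonzerodivisor mult_nonzerodivisor)

end

context local_noetherian begin

text \<open>The map from R to its completion is multiplicative, so a nilpotent x has zero image.
  This means that x lies in every power of \<mm>, and Krull's theorem applies.\<close>

lemma reduced_of_completion:
  assumes "reduced_ring (adic_completion R \<mm>)"
  shows "reduced_ring R"
  unfolding reduced_ring_def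
proof (intro ballI allI impI)
  fix x and k :: nat assume x: "x \<in> carrier R" "x [^] k = \<zero>"
  define I where "I n = \<mm> [^]\<^bsub>ideals_set R\<^esub> n" for n :: nat
  have I: "ideal (I n) R" for n unfolding I_def by (rule ideal_pow_closed[OF ideal_max])
  have sub: "I (Suc n) \<subseteq> I n" for n
  proof -
    have "I (Suc n) = I n \<cdot> \<mm>" by (simp add: I_def ideals_set_def)
    also have "\<dots> \<subseteq> I n"
      using idealD[OF I[of n]] max_closed(1) by (intro ideal_prod_subset[OF I]) auto
    finally show ?thesis .
  qed
  have add: "abelian_subgroup (I n) R" for n
    by (rule abelian_subgroupI3[OF ideal.axioms(1)[OF I] is_abelian_group])
  let ?C = "adic_completion R \<mm>"
  \<comment> \<open>The image of y in the completion, the sequence of its cosets. Compatibility of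
    the cosets is the inclusion \<open>sub\<close>.\<close>
  define c where "c y = (\<lambda>n. I n +> y)" for y
  have c_carrier: "c y \<in> carrier ?C" if "y \<in> carrier R" for y
    using that sub by (auto simp: adic_completion_def c_def quot_pow_def FactRing_def I_def[symmetric]
        a_r_coset_def' A_RCOSETS_def')
  have c_one: "\<one>\<^bsub>?C\<^esub> = c \<one>"
    by (simp add: adic_completion_def c_def quot_pow_def FactRing_def I_def[symmetric])
  have c_mult: "c y \<otimes>\<^bsub>?C\<^esub> c z = c (y \<otimes> z)" if "y \<in> carrier R" "z \<in> carrier R" for y z
    using ideal.rcoset_mult_add[OF I that]
    by (simp add: adic_completion_def c_def quot_pow_def FactRing_def I_def[symmetric])
  have zero_C: "\<zero>\<^bsub>?C\<^esub> = I"
    by (simp add: adic_completion_def quot_pow_def FactRing_def I_def[symmetric])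
  have c_zero: "c \<zero> = I"
    using idealD[OF I] by (intro ext) (auto simp: c_def a_r_coset_def')
  have c_pow: "c x [^]\<^bsub>?C\<^esub> n = c (x [^] n)" for n :: nat
    using x(1) by (induct n) (auto simp: c_one c_mult)
  have "c x = \<zero>\<^bsub>?C\<^esub>"
    using assms[unfolded reduced_ring_def, rule_format, OF c_carrier[OF x(1)], of k]
      c_pow[of k] x(2) c_zero zero_C by simp
  then have "I n +> x = I n" for n using zero_C by (simp add: c_def fun_eq_iff)
  moreover have "\<zero> \<oplus> x \<in> I n +> x" for n
    using idealD(2)[OF I[of n]] unfolding a_r_coset_def' by blast
  ultimately have "x \<in> I n" for n
    using x(1) by simp
  then show "x = \<zero>" using krull_intersection[OF x(1)] by (simp add: I_def)
qed

lemma krull_dim_le_oneD: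
  assumes "krull_dim R = 1" "primeideal P R" "primeideal P' R" "primeideal P'' R"
  shows "\<not> (P \<subset> P' \<and> P' \<subset> P'')"
proof
  assume *: "P \<subset> P' \<and> P' \<subset> P''"
  let ?P = "\<lambda>i::nat. if i = 0 then P else if i = 1 then P' else P''"
  have "(\<forall>i\<le>2. primeideal (?P i) R) \<and> (\<forall>i<2. ?P i \<subset> ?P (Suc i))"
    using assms * by (auto simp: less_2_cases_iff)
  then have "enat 2 \<le> krull_dim R"
    unfolding krull_dim_def by (intro Sup_upper CollectI exI[of _ 2] exI[of _ ?P] conjI refl) auto
  then show False using assms(1) by (simp add: one_enat_def)
qed

text \<open>If \<mm> were zero, the second prime of a chain would be zero too and could not properly
  contain the first, so all chains would have length 0.\<close>

lemma krull_dim_one_max_nonzero: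
  assumes "krull_dim R = 1"
  shows "\<exists>x\<in>\<mm>. x \<noteq> \<zero>"
proof (rule ccontr)
  assume no: "\<not> ?thesis"
  have "n = 0" if "\<forall>i\<le>n. primeideal (P i) R" "\<forall>i<n. P i \<subset> P (Suc i)" for P and n :: nat
  proof (rule ccontr)
    assume "n \<noteq> 0"
    then have P: "primeideal (P 0) R" "primeideal (P 1) R" "P 0 \<subset> P 1" using that by auto
    have i: "ideal (P 0) R" "ideal (P 1) R" using P(1,2) by (auto intro: primeideal.axioms)
    have "\<one> \<notin> P 1"
      using primeideal.I_notcarr[OF P(2)] ideal.one_imp_carrier[OF i(2)] by auto
    then have "P 1 \<subseteq> {\<zero>}" using proper_ideal_le_max[OF i(2)] no by auto
    then show False using P(3) idealD(2)[OF i(1)] by auto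
  qed
  then have "krull_dim R \<le> 0"
    unfolding krull_dim_def by (intro Sup_least) (auto simp: zero_enat_def)
  then show False using assms by simp
qed

end

locale reduced_local_dim1 = local_noetherian +
  assumes dim: "krull_dim R = 1" and reduced: "reduced_ring R"
begin

section \<open>Nilpotence modulo a regular element, annihilators and socles\<close>

lemma square_zero: "x \<in> carrier R \<Longrightarrow> x \<otimes> x = \<zero> \<Longrightarrow> x = \<zero>"
  using reduced[unfolded reduced_ring_def, rule_format, of x 2] by (simp add: numeral_2_eq_2)

text \<open>Otherwise some prime P above xR omits a and so lies strictly inside \<mm>. A regular x
  cannot lie in a minimal prime, so there is a prime P' strictly inside P, and P', P, \<mm> form a
  chain that is too long.\<close>

lemma max_nilpotent_mod:
  assumes "x \<in> nonzerodivisors R" "a \<in> \<mm>"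
  shows "\<exists>n::nat. a [^] n \<in> PIdl x"
proof (rule ccontr)
  assume no: "\<not> ?thesis"
  note x = nonzerodivisorsD[OF assms(1)]
  have ac: "a \<in> carrier R" using assms(2) max_closed by auto
  obtain P where P: "primeideal P R" "PIdl x \<subseteq> P" "P \<inter> {a [^] n |n::nat. True} = {}"
  proof (rule prime_disjoint[of "PIdl x" "{a [^] n |n::nat. True}"])
    show "ideal (PIdl x) R" by (rule cgenideal_ideal[OF x(1)])
    show "\<one> \<in> {a [^] n |n::nat. True}" using nat_pow_0[of a] by (metis (mono_tags) mem_Collect_eq)
    show "u \<otimes> v \<in> {a [^] n |n::nat. True}" if "u \<in> {a [^] n |n::nat. True}" "v \<in> {a [^] n |n::nat. True}" for u v
      using that ac by (auto simp: nat_pow_mult)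
  qed (use ac no in auto)
  have iP: "ideal P R" using P(1) by (rule primeideal.axioms)
  have "P \<subset> \<mm>"
  proof -
    have "\<one> \<notin> P"
      using primeideal.I_notcarr[OF P(1)] ideal.one_imp_carrier[OF iP] by auto
    moreover have "a [^] (1::nat) \<notin> P" using P(3) by blast
    then have "a \<notin> P" using ac by simp
    ultimately show ?thesis using proper_ideal_le_max[OF iP] assms(2) by auto
  qed
  \<comment> \<open>A prime that misses this set is contained in P and omits x. The set misses 0
    because y x^n = 0 implies y = 0 for regular x.\<close>
  let ?S = "{y \<otimes> x [^] n |y n::nat. y \<in> carrier R - P}"
  have one: "\<one> \<in> carrier R - P"
    using primeideal.I_notcarr[OF P(1)] ideal.one_imp_carrier[OF iP] by auto
  have inS: "y \<in> ?S" if "y \<in> carrier R - P" for y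
    using that by (auto intro!: exI[of _ y] exI[of _ 0])
  obtain P' where P': "primeideal P' R" "{\<zero>} \<subseteq> P'" "P' \<inter> ?S = {}"
  proof (rule prime_disjoint[OF zeroideal])
    show "?S \<subseteq> carrier R" using x(1) by auto
    show "\<one> \<in> ?S" using inS one .
    fix u v assume "u \<in> ?S" "v \<in> ?S"
    then obtain y z and n k :: nat where *: "y \<in> carrier R - P" "u = y \<otimes> x [^] n"
      "z \<in> carrier R - P" "v = z \<otimes> x [^] k"
      by blast
    then have "u \<otimes> v = (y \<otimes> z) \<otimes> x [^] (n + k)"
      using x(1) by (simp add: m_ac nat_pow_mult[symmetric])
    moreover have "y \<otimes> z \<in> carrier R - P"
      using * primeideal.I_prime[OF P(1)] by auto
    ultimately show "u \<otimes> v \<in> ?S" by blast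
  next
    show "{\<zero>} \<inter> ?S = {}"
    proof (rule ccontr)
      assume "{\<zero>} \<inter> ?S \<noteq> {}"
      then obtain y and n :: nat where y: "y \<in> carrier R - P" "y \<otimes> x [^] n = \<zero>" by auto
      then have "y = \<zero>" using nonzerodivisorsD(3)[OF pow_nonzerodivisor[OF assms(1)]] by auto
      then show False using y idealD(2)[OF iP] by auto
    qed
  qed
  have iP': "ideal P' R" using P'(1) by (rule primeideal.axioms)
  have "P' \<subseteq> P"
    using P'(3) inS idealD(1)[OF iP'] by blast
  moreover have "x \<in> ?S"
    using one x(1) by (auto intro!: exI[of _ \<one>] exI[of _ 1])
  then have "x \<notin> P'" "x \<in> P" using P'(3) P(2) cgenideal_self[OF x(1)] by auto
  ultimately have "P' \<subset> P" by auto
  then show False using krull_dim_le_oneD[OF dim P'(1) P(1) prime_max] \<open>P \<subset> \<mm>\<close> by simp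
qed

text \<open>The square of r x is (r x)(r (x + y)) - r^2 x y, which vanishes. In a reduced ring the
  annihilator of a sum of two elements with product 0 is thus the intersection of their
  annihilators.\<close>

lemma add_annihilates:
  assumes "x \<in> carrier R" "y \<in> carrier R" "x \<otimes> y = \<zero>" "r \<in> carrier R" "r \<otimes> (x \<oplus> y) = \<zero>"
  shows "r \<otimes> x = \<zero>" "r \<otimes> y = \<zero>"
proof -
  have "(r \<otimes> x) \<otimes> (r \<otimes> x) = (r \<otimes> x) \<otimes> (r \<otimes> (x \<oplus> y)) \<ominus> (r \<otimes> r) \<otimes> (x \<otimes> y)"
    using assms(1,2,4) by algebra
  also have "\<dots> = \<zero>" using assms by (simp add: a_minus_def)
  finally have "(r \<otimes> x) \<otimes> (r \<otimes> x) = \<zero>" .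
  then show rx: "r \<otimes> x = \<zero>" by (rule square_zero[OF m_closed[OF assms(4,1)]])
  have "r \<otimes> y = r \<otimes> (x \<oplus> y) \<ominus> r \<otimes> x" using assms(1,2,4) by algebra
  then show "r \<otimes> y = \<zero>" using assms rx by simp
qed

text \<open>Choose x in I whose double annihilator \<open>A x\<close> is maximal. If i is in I and r
  x = 0, then r i is an element of I with x (r i) = 0, so it suffices that such elements
  vanish.\<close>

lemma ideal_annihilator_element:
  assumes "ideal I R"
  obtains x where "x \<in> I" "\<And>r i. r \<in> carrier R \<Longrightarrow> r \<otimes> x = \<zero> \<Longrightarrow> i \<in> I \<Longrightarrow> r \<otimes> i = \<zero>"
proof -
  note Ic = idealD[OF assms]
  define A where "A x = {y \<in> carrier R. \<forall>r\<in>carrier R. r \<otimes> x = \<zero> \<longrightarrow> r \<otimes> y = \<zero>}" for x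
  have A: "ideal (A x) R" for x
    by (intro idealI_closure) (auto simp: A_def r_distr m_lcomm)
  obtain M where M: "M \<in> A ` I" "\<And>J. J \<in> A ` I \<Longrightarrow> M \<subseteq> J \<Longrightarrow> J = M"
    using ideal_maximal_element[of "A ` I"] A Ic(2) by blast
  then obtain x where x: "x \<in> I" "M = A x" by auto
  have xc: "x \<in> carrier R" using x Ic by auto
  \<comment> \<open>If x y = 0, passing from x to x + y enlarges the double annihilator, so it does
    not change by maximality. It now contains y, and since y kills x it also kills itself.\<close>
  have key: "y = \<zero>" if "y \<in> I" "x \<otimes> y = \<zero>" for y
  proof -
    have yc: "y \<in> carrier R" using that Ic by auto
    have "A x \<subseteq> A (x \<oplus> y)"
      using add_annihilates[OF xc yc that(2)] by (auto simp: A_def)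
    moreover have "x \<oplus> y \<in> I" using x that Ic by auto
    ultimately have "A (x \<oplus> y) = A x" using M(2) x by auto
    moreover have "y \<in> A (x \<oplus> y)"
      using add_annihilates[OF xc yc that(2)] yc by (auto simp: A_def)
    moreover have "y \<otimes> x = \<zero>" by (simp add: that(2) m_comm[OF yc xc])
    ultimately have "y \<otimes> y = \<zero>" using yc unfolding A_def by blast
    then show ?thesis by (rule square_zero[OF yc])
  qed
  show ?thesis
  proof (rule that[OF x(1)])
    fix r i assume r: "r \<in> carrier R" "r \<otimes> x = \<zero>" "i \<in> I"
    have ic: "i \<in> carrier R" using r Ic by auto
    show "r \<otimes> i = \<zero>"
    proof (rule key)
      show "r \<otimes> i \<in> I" using r Ic by auto
      have "x \<otimes> (r \<otimes> i) = i \<otimes> (r \<otimes> x)" using r(1) ic xc by algebra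
      then show "x \<otimes> (r \<otimes> i) = \<zero>" using r ic by simp
    qed
  qed
qed

text \<open>Take t in \<mm> with the same annihilator as \<mm>. If r t = 0 then r kills \<mm>; as
  \<mm> is nonzero, r is no unit, hence lies in \<mm> and kills itself.\<close>

lemma exists_nonzerodivisor_in_max: "\<exists>t\<in>\<mm>. t \<in> nonzerodivisors R"
proof -
  obtain t where t: "t \<in> \<mm>" "\<And>r i. r \<in> carrier R \<Longrightarrow> r \<otimes> t = \<zero> \<Longrightarrow> i \<in> \<mm> \<Longrightarrow> r \<otimes> i = \<zero>"
    using ideal_annihilator_element[OF ideal_max] by blast
  obtain y where y: "y \<in> \<mm>" "y \<noteq> \<zero>" using krull_dim_one_max_nonzero[OF dim] by auto
  have tc: "t \<in> carrier R" "y \<in> carrier R" using t y max_closed by auto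
  have "t \<in> nonzerodivisors R"
  proof (rule nonzerodivisorsI[OF tc(1)])
    fix r assume r: "r \<in> carrier R" "t \<otimes> r = \<zero>"
    then have rt: "r \<otimes> t = \<zero>" using tc by (simp add: m_comm)
    have "r \<in> \<mm>"
    proof (rule ccontr)
      assume "r \<notin> \<mm>"
      then have u: "r \<in> Units R" using not_max_Unit r by simp
      have "inv r \<otimes> (r \<otimes> y) = y" using u r(1) tc(2) by (metis Units_inv_closed Units_l_inv l_one m_assoc)
      then show False using t(2)[OF r(1) rt y(1)] y(2) u by simp
    qed
    then show "r = \<zero>" by (intro square_zero[OF r(1)] t(2)[OF r(1) rt])
  qed
  then show ?thesis using t by auto
qed

text \<open>Choose z outside I with (I : z) maximal. If a z were outside I for some a in \<mm>,
  maximality would give (I : a^k z) = (I : z) for all k, and no a^k z would lie in I. But some power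
  of a is a multiple of t and lies in I.\<close>

lemma exists_socle_element:
  assumes I: "ideal I R" and "t \<in> I" "t \<in> nonzerodivisors R" "I \<noteq> carrier R"
  obtains z where "z \<in> carrier R" "z \<notin> I" "\<And>a. a \<in> \<mm> \<Longrightarrow> a \<otimes> z \<in> I"
proof -
  note Ic = idealD[OF I]
  define A where "A z = {r \<in> carrier R. r \<otimes> z \<in> I}" for z
  have A: "ideal (A z) R" if "z \<in> carrier R" for z
    using that Ic by (intro idealI_closure) (auto simp: A_def l_distr m_assoc)
  let ?S = "carrier R - I"
  obtain M where M: "M \<in> A ` ?S" "\<And>J. J \<in> A ` ?S \<Longrightarrow> M \<subseteq> J \<Longrightarrow> J = M"
    using ideal_maximal_element[of "A ` ?S"] A assms(4) Ic(1) by blast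
  then obtain z where z: "z \<in> carrier R" "z \<notin> I" "M = A z" by auto
  show ?thesis
  proof (rule that[OF z(1,2)])
    fix a assume a: "a \<in> \<mm>"
    then have ac: "a \<in> carrier R" using max_closed by auto
    obtain n :: nat where "a [^] n \<in> PIdl t" using max_nilpotent_mod[OF assms(3) a] by auto
    then have n: "a [^] n \<in> I" using cgenideal_minimal[OF I assms(2)] by auto
    show "a \<otimes> z \<in> I"
    proof (rule ccontr)
      assume no: "a \<otimes> z \<notin> I"
      have "a [^] k \<otimes> z \<notin> I" for k :: nat
      proof (induct k)
        case 0
        then show ?case using z by simp
      next
        case (Suc k)
        have kc: "a [^] k \<in> carrier R" using ac by simp
        have "A z \<subseteq> A (a [^] k \<otimes> z)"
          using z(1) kc Ic(1,4) by (auto simp: A_def m_lcomm[of _ "a [^] k" z])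
        then have "A (a [^] k \<otimes> z) = A z" using M(2)[of "A (a [^] k \<otimes> z)"] z Suc kc by auto
        moreover have "a \<notin> A z" using no by (simp add: A_def)
        ultimately have "a \<otimes> (a [^] k \<otimes> z) \<notin> I" using ac by (auto simp: A_def)
        then show ?case using ac kc z(1) by (simp add: m_ac)
      qed
      then show False using n Ic(5)[OF z(1)] by blast
    qed
  qed
qed

text \<open>The scalars tried are the powers of t: t^n - t^k is t^n times a unit for n < k, hence
  regular. If w + t^n x and w + t^k x kill a n and a k, their difference kills a n * a k, which is
  therefore 0.\<close>

lemma exists_regular_translate:
  assumes "x \<in> nonzerodivisors R" "w \<in> carrier R"
  obtains c where "c \<in> carrier R" "w \<oplus> c \<otimes> x \<in> nonzerodivisors R"
proof -
  obtain t where t: "t \<in> \<mm>" "t \<in> nonzerodivisors R" using exists_nonzerodivisor_in_max by auto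
  note tc = nonzerodivisorsD[OF t(2)] and xc = nonzerodivisorsD[OF assms(1)]
  have "\<exists>n::nat. w \<oplus> t [^] n \<otimes> x \<in> nonzerodivisors R"
  proof (rule ccontr)
    assume no: "\<not> ?thesis"
    have "\<forall>n::nat. \<exists>a\<in>carrier R. (w \<oplus> t [^] n \<otimes> x) \<otimes> a = \<zero> \<and> a \<noteq> \<zero>"
      using no assms(2) xc(1) tc(1) unfolding nonzerodivisors_def by auto
    then obtain a where a: "\<And>n::nat. a n \<in> carrier R" "\<And>n::nat. (w \<oplus> t [^] n \<otimes> x) \<otimes> a n = \<zero>"
      "\<And>n::nat. a n \<noteq> \<zero>"
      by metis
    have orth: "a n \<otimes> a k = \<zero>" if "n < k" for n k
    proof -
      define j where "j = k - n"
      have j: "k = n + j" "0 < j" using that by (auto simp: j_def)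
      have tn: "t [^] n \<in> carrier R" "t [^] j \<in> carrier R" using tc by auto
      have u: "\<one> \<ominus> t [^] j \<in> Units R"
      proof (rule one_minus_max_Unit)
        obtain i where "j = Suc i" using j(2) gr0_implies_Suc by auto
        then show "t [^] j \<in> \<mm>" using max_closed(4)[OF _ t(1)] tc(1) by auto
      qed
      let ?p = "a n \<otimes> a k"
      have p: "?p \<in> carrier R" using a by simp
      have "((\<one> \<ominus> t [^] j) \<otimes> (t [^] n \<otimes> x)) \<otimes> ?p =
         ((w \<oplus> t [^] n \<otimes> x) \<otimes> a n) \<otimes> a k \<ominus> ((w \<oplus> (t [^] n \<otimes> t [^] j) \<otimes> x) \<otimes> a k) \<otimes> a n"
        using a(1)[of n] a(1)[of k] tn xc(1) assms(2) by algebra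
      also have "\<dots> = \<zero>"
        using a(2)[of n] a(2)[of k] a(1)[of k] a(1)[of n] tc(1) by (simp add: j(1) nat_pow_mult)
      finally have *: "((\<one> \<ominus> t [^] j) \<otimes> (t [^] n \<otimes> x)) \<otimes> ?p = \<zero>" .
      have "(\<one> \<ominus> t [^] j) \<in> nonzerodivisors R"
      proof (rule nonzerodivisorsI)
        show "\<one> \<ominus> t [^] j \<in> carrier R" using u by auto
        fix r assume r: "r \<in> carrier R" "(\<one> \<ominus> t [^] j) \<otimes> r = \<zero>"
        have "inv (\<one> \<ominus> t [^] j) \<otimes> ((\<one> \<ominus> t [^] j) \<otimes> r) = r"
          using u r(1) m_assoc[of "inv (\<one> \<ominus> t [^] j)" "\<one> \<ominus> t [^] j" r] Units_closed[OF u] by simp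
        then show "r = \<zero>" using r(2) u by simp
      qed
      then have "(\<one> \<ominus> t [^] j) \<otimes> (t [^] n \<otimes> x) \<in> nonzerodivisors R"
        using assms(1) t(2) by (intro mult_nonzerodivisor pow_nonzerodivisor)
      then show ?thesis using * p nonzerodivisorsD(2) by blast
    qed
    \<comment> \<open>These annihilators of tails increase and become stationary. By orthogonality a
      n kills the tail from n + 1 on, hence also itself, so it is 0 in a reduced ring.\<close>
    define J where "J n = {y \<in> carrier R. \<forall>k\<ge>n. y \<otimes> a k = \<zero>}" for n :: nat
    have Ji: "ideal (J n) R" for n
      using a(1) by (intro idealI_closure) (auto simp: J_def l_distr m_assoc)
    have Js: "J n \<subseteq> J (Suc n)" for n by (auto simp: J_def)
    obtain n where "\<And>k. n \<le> k \<Longrightarrow> J k = J n"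
      using ideal_sequence_stationary[of J, OF Ji Js] by metis
    then have "J (Suc n) = J n" using le_SucI[OF le_refl] by blast
    moreover have "a n \<in> J (Suc n)" unfolding J_def using a(1) orth Suc_le_lessD by blast
    ultimately have "a n \<in> J n" by simp
    then have "a n \<otimes> a n = \<zero>" unfolding J_def by blast
    then show False using square_zero[OF a(1)] a(3) by simp
  qed
  then show ?thesis using that tc(1) by auto
qed

end

section \<open>Primitive relations\<close>

context cring begin

abbreviation dot :: "(nat \<Rightarrow> 'a) \<Rightarrow> (nat \<Rightarrow> 'a) \<Rightarrow> nat \<Rightarrow> 'a" where
  "dot \<equiv> lc (regular_module R)"

lemma dot_closed [simp]:
  "(\<And>i. i < k \<Longrightarrow> x i \<in> carrier R) \<Longrightarrow> (\<And>i. i < k \<Longrightarrow> y i \<in> carrier R) \<Longrightarrow> dot x y k \<in> carrier R"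
  using module.lc_closed[OF module_regular, of k x y] by simp

lemma dot_update_right:
  assumes "j < k" "\<And>i. i < k \<Longrightarrow> x i \<in> carrier R" "\<And>i. i < k \<Longrightarrow> y i \<in> carrier R" "u \<in> carrier R"
  shows "dot x (y(j := y j \<oplus> u)) k = dot x y k \<oplus> x j \<otimes> u"
  using assms
proof (induct k)
  case (Suc k)
  have c: "dot x y k \<in> carrier R" "x k \<in> carrier R" "y k \<in> carrier R" "x j \<in> carrier R"
    using Suc by auto
  show ?case
  proof (cases "j = k")
    case True
    then have "dot x (y(j := y j \<oplus> u)) k = dot x y k" by (intro lc_cong) auto
    then show ?thesis using True c Suc(5) by (simp add: r_distr a_assoc del: fun_upd_apply add: fun_upd_same)
  next
    case False
    then have "dot x (y(j := y j \<oplus> u)) k = dot x y k \<oplus> x j \<otimes> u"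
      using Suc(2-5) by (intro Suc(1)) simp_all
    then show ?thesis using False c Suc(5) by (simp add: a_ac del: fun_upd_apply add: fun_upd_other)
  qed
qed simp

lemma dot_update_left:
  assumes "j < k" "\<And>i. i < k \<Longrightarrow> x i \<in> carrier R" "\<And>i. i < k \<Longrightarrow> y i \<in> carrier R" "u \<in> carrier R"
  shows "dot (x(j := x j \<oplus> u)) y k = dot x y k \<oplus> u \<otimes> y j"
proof -
  have "dot (x(j := x j \<oplus> u)) y k = dot y (x(j := x j \<oplus> u)) k"
    using assms by (intro lc_regular_commute) auto
  also have "\<dots> = dot y x k \<oplus> y j \<otimes> u" using assms by (intro dot_update_right) auto
  also have "\<dots> = dot x y k \<oplus> u \<otimes> y j"
    using assms lc_regular_commute[of k x y] m_comm[of u "y j"] by simp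
  finally show ?thesis .
qed

text \<open>An elementary operation on the vector is absorbed by the transposed operation on the
  coefficients, so relations for the modified vector yield relations for the original one.\<close>

lemma dot_transvection:
  assumes "i < k" "j < k" "\<And>i. i < k \<Longrightarrow> x i \<in> carrier R" "\<And>i. i < k \<Longrightarrow> y i \<in> carrier R" "c \<in> carrier R"
  shows "dot x (y(j := y j \<oplus> c \<otimes> y i)) k = dot (x(i := x i \<oplus> x j \<otimes> c)) y k"
  using dot_update_right[of j k x y "c \<otimes> y i"] dot_update_left[of i k x y "x j \<otimes> c"] assms
  by (simp add: m_assoc del: fun_upd_apply)

text \<open>J/I is zero or a simple module: every element of J outside I generates J modulo
  I.\<close>

definition simple_step :: "'a set \<Rightarrow> 'a set \<Rightarrow> bool" where
  "simple_step J I \<longleftrightarrow> I \<subseteq> J \<and> (\<forall>x\<in>J - I. \<forall>y\<in>J. \<exists>c\<in>carrier R. y \<ominus> c \<otimes> x \<in> I)"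

end

context reduced_local_dim1 begin

text \<open>R/I has finite length. A maximal counterexample I is proper; adjoining a socle element z
  of R/I gives a larger ideal with a series, which extends by the step from I + Rz to I.\<close>

lemma exists_composition_series:
  assumes "ideal I R" "t \<in> I" "t \<in> nonzerodivisors R"
  shows "\<exists>n Y. Y 0 = carrier R \<and> Y n = I \<and> (\<forall>i\<le>n. ideal (Y i) R) \<and> (\<forall>i<n. simple_step (Y i) (Y (Suc i)))"
    (is "?P I")
proof (rule ccontr)
  assume "\<not> ?P I"
  define S where "S = {J. ideal J R \<and> t \<in> J \<and> \<not> ?P J}"
  have ne: "S \<noteq> {}" using assms \<open>\<not> ?P I\<close> unfolding S_def by blast
  have Si: "ideal J R" if "J \<in> S" for J using that by (simp add: S_def)
  obtain I where IS: "I \<in> S" and max: "\<And>J. J \<in> S \<Longrightarrow> I \<subseteq> J \<Longrightarrow> J = I"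
    using ideal_maximal_element[OF ne Si] by blast
  have I: "ideal I R" "t \<in> I" "\<not> ?P I" using IS by (simp_all add: S_def)
  note Ic = idealD[OF I(1)]
  have P: "?P (carrier R)"
    by (intro exI[of _ 0] exI[of _ "\<lambda>_. carrier R"]) (auto intro: oneideal)
  have "I \<noteq> carrier R"
  proof
    assume eq: "I = carrier R"
    show False using I(3) P unfolding eq by contradiction
  qed
  then obtain z where z: "z \<in> carrier R" "z \<notin> I" "\<And>a. a \<in> \<mm> \<Longrightarrow> a \<otimes> z \<in> I"
    using exists_socle_element[OF I(1,2) assms(3)] by blast
  define J where "J = adjoin I z"
  have J: "ideal J R" "I \<subseteq> J" "z \<in> J"
    using adjoin_ideal adjoin_incl adjoin_self I(1) z(1) by (auto simp: J_def)
  have "simple_step J I"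
    unfolding simple_step_def
  proof (intro conjI ballI J(2))
    fix x y assume x: "x \<in> J - I" and y: "y \<in> J"
    obtain i r where x': "i \<in> I" "r \<in> carrier R" "x = i \<oplus> r \<otimes> z"
      using x by (auto simp: J_def adjoin_def)
    obtain j s where y': "j \<in> I" "s \<in> carrier R" "y = j \<oplus> s \<otimes> z"
      using y by (auto simp: J_def adjoin_def)
    \<comment> \<open>Otherwise r z, and with it x, would lie in I. So r is a unit, and s / r is the
      multiple of x that cancels the z-part of y.\<close>
    have "r \<notin> \<mm>" using x x' z(3) Ic(3) by auto
    then have u: "r \<in> Units R" using not_max_Unit x' by simp
    let ?c = "s \<otimes> inv r"
    have c: "inv r \<in> carrier R" "i \<in> carrier R" "j \<in> carrier R" "inv r \<otimes> r = \<one>"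
      using u x'(1) y'(1) Ic(1) by auto
    have "?c \<otimes> (r \<otimes> z) = s \<otimes> (inv r \<otimes> r) \<otimes> z"
      using c(1) x'(2) y'(2) z(1) by algebra
    also have "\<dots> = s \<otimes> z" using c y'(2) by simp
    finally have *: "?c \<otimes> (r \<otimes> z) = s \<otimes> z" .
    have "y \<ominus> ?c \<otimes> x = (j \<oplus> s \<otimes> z) \<ominus> (?c \<otimes> i \<oplus> ?c \<otimes> (r \<otimes> z))"
      unfolding x'(3) y'(3) using c x'(2) y'(2) z(1) by algebra
    also have "\<dots> = j \<ominus> ?c \<otimes> i" unfolding * using c y'(2) z(1) by algebra
    also have "\<dots> \<in> I" using Ic x' y' c by auto
    finally show "\<exists>c\<in>carrier R. y \<ominus> c \<otimes> x \<in> I" using c y'(2) by blast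
  qed
  moreover have "?P J"
  proof (rule ccontr)
    assume "\<not> ?P J"
    then have "J \<in> S" using J I(2) by (auto simp: S_def)
    then show False using max[of J] J z(2) by auto
  qed
  then obtain n Y where Y: "Y 0 = carrier R" "Y n = J" "\<And>i. i \<le> n \<Longrightarrow> ideal (Y i) R"
      "\<And>i. i < n \<Longrightarrow> simple_step (Y i) (Y (Suc i))" by auto
  ultimately have "?P I"
    using I(1) by (intro exI[of _ "Suc n"] exI[of _ "\<lambda>i. if i \<le> n then Y i else I"])
      (auto simp: less_Suc_eq le_Suc_eq)
  then show False using I(3) by simp
qed

text \<open>Gaussian elimination: among more elements than the length of \<open>R/tR\<close> two have leading terms in
  the same class, and one of them can be pushed deeper into the filtration \<open>Z\<close>.\<close>

lemma primitive_relation_aux: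
  fixes Z :: "nat \<Rightarrow> 'a set"
  assumes Z: "\<And>n. ideal (Z n) R"
    and step: "\<And>n k x y. x \<in> Z n \<Longrightarrow> x \<notin> Z (Suc n) \<Longrightarrow> y \<in> Z (n + k * e) \<Longrightarrow>
         \<exists>c\<in>carrier R. y \<oplus> c \<otimes> x \<in> Z (Suc (n + k * e))"
    and e: "0 < e"
  shows "(\<And>i. i \<le> e \<Longrightarrow> v i \<in> Z (d i)) \<Longrightarrow>
     (\<And>x n. N \<le> n \<Longrightarrow> x \<in> Z n \<Longrightarrow> \<exists>c. (\<forall>i\<le>e. c i \<in> \<mm>) \<and> x = dot c v (Suc e)) \<Longrightarrow>
     \<exists>r. (\<forall>i\<le>e. r i \<in> carrier R) \<and> dot r v (Suc e) = \<zero> \<and> (\<exists>i\<le>e. r i \<notin> \<mm>)"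
proof (induct "\<Sum>i\<le>e. N - d i" arbitrary: v d rule: less_induct)
  case less
  have vc: "v i \<in> carrier R" if "i < Suc e" for i
    using less(2)[of i] that idealD(1)[OF Z] by auto
  \<comment> \<open>The induction runs on the total distance of the levels d i from N. It applies
    once an entry has moved a level deeper, provided that the elements of depth N are still
    combinations of the new entries with coefficients in \<mm>.\<close>
  have bump: "\<exists>r. (\<forall>i\<le>e. r i \<in> carrier R) \<and> dot r w (Suc e) = \<zero> \<and> (\<exists>i\<le>e. r i \<notin> \<mm>)"
    if "j \<le> e" "d j < N" "\<And>i. i \<le> e \<Longrightarrow> i \<noteq> j \<Longrightarrow> w i \<in> Z (d i)" "w j \<in> Z (Suc (d j))"
      "\<And>x n. N \<le> n \<Longrightarrow> x \<in> Z n \<Longrightarrow> \<exists>c. (\<forall>i\<le>e. c i \<in> \<mm>) \<and> x = dot c w (Suc e)" for j w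
  proof (rule less(1)[of "d(j := Suc (d j))" w])
    show "(\<Sum>i\<le>e. N - (d(j := Suc (d j))) i) < (\<Sum>i\<le>e. N - d i)"
      using that(1,2) by (intro sum_strict_mono_ex1) auto
  qed (use that in auto)
  show ?case
  proof (cases "\<exists>j\<le>e. N \<le> d j")
    case True
    then obtain j where j: "j \<le> e" "N \<le> d j" by auto
    then obtain c where c: "\<And>i. i \<le> e \<Longrightarrow> c i \<in> \<mm>" "v j = dot c v (Suc e)"
      using less(3)[OF j(2) less(2)[OF j(1)]] by auto
    have cc: "c i \<in> carrier R" if "i < Suc e" for i using c(1)[of i] that max_closed(1) by auto
    \<comment> \<open>The entry v j has depth N, so it is a combination of all entries with
      coefficients in \<mm>. Brought to one side, its coefficient becomes 1 - c j, which is not in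
      \<mm>.\<close>
    let ?r = "(\<lambda>i. \<ominus> c i)(j := \<ominus> c j \<oplus> \<one>)"
    have "dot (\<lambda>i. \<ominus> c i) v (Suc e) = dot (\<lambda>i. \<ominus> \<one> \<otimes> c i) v (Suc e)"
      using cc by (intro lc_cong) (auto simp: l_minus)
    also have "\<dots> = \<ominus> \<one> \<otimes> dot c v (Suc e)"
      using module.lc_scale_left[OF module_regular, of "\<ominus> \<one>" "Suc e" c v] cc vc by simp
    also have "\<dots> = \<ominus> v j" using c(2) vc[of j] j by (simp add: l_minus)
    finally have "dot ?r v (Suc e) = \<ominus> v j \<oplus> \<one> \<otimes> v j"
      using dot_update_left[of j "Suc e" "\<lambda>i. \<ominus> c i" v \<one>] cc vc j by simp
    also have "\<dots> = \<zero>" using vc[of j] j by (simp add: l_neg)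
    finally have "dot ?r v (Suc e) = \<zero>" .
    moreover have "\<ominus> c j \<oplus> \<one> \<notin> \<mm>"
    proof
      assume "\<ominus> c j \<oplus> \<one> \<in> \<mm>"
      then have "c j \<oplus> (\<ominus> c j \<oplus> \<one>) \<in> \<mm>" using c(1)[OF j(1)] max_closed by blast
      moreover have "c j \<oplus> (\<ominus> c j \<oplus> \<one>) = \<one>" using cc[of j] j by (simp add: a_assoc[symmetric] r_neg)
      ultimately show False using one_notin_max by simp
    qed
    moreover have "\<forall>i\<le>e. ?r i \<in> carrier R" using cc by auto
    ultimately show ?thesis using j(1) by (intro exI[of _ ?r] conjI exI[of _ j]) auto
  next
    case False
    then have dN: "d j < N" if "j \<le> e" for j using that by auto
    show ?thesis
    proof (cases "\<exists>j\<le>e. v j \<in> Z (Suc (d j))")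
      case True
      then obtain j where j: "j \<le> e" "v j \<in> Z (Suc (d j))" by auto
      show ?thesis by (rule bump[where w = v and j = j]) (use less(2,3) j dN in auto)
    next
      case no: False
      \<comment> \<open>There are e + 1 indices and e residues modulo e.\<close>
      have "\<not> inj_on (\<lambda>j. d j mod e) {..e}"
      proof
        assume "inj_on (\<lambda>j. d j mod e) {..e}"
        then have "card {..e} \<le> card {..<e}"
          using e by (intro card_inj_on_le[of "\<lambda>j. d j mod e"]) auto
        then show False by simp
      qed
      then obtain i j where ij: "i \<le> e" "j \<le> e" "i \<noteq> j" "d i mod e = d j mod e" "d i \<le> d j"
        unfolding inj_on_def by (metis atMost_iff nat_le_linear)
      then obtain k where k: "d j = d i + k * e"
        by (metis mod_eq_nat2E mult.commute)
      obtain c where c: "c \<in> carrier R" "v j \<oplus> c \<otimes> v i \<in> Z (Suc (d j))"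
        using step[of "v i" "d i" "v j" k] less(2)[OF ij(1)] less(2)[OF ij(2)] no ij(1) unfolding k by auto
      let ?w = "v(j := v j \<oplus> c \<otimes> v i)"
      have "\<exists>r. (\<forall>i\<le>e. r i \<in> carrier R) \<and> dot r ?w (Suc e) = \<zero> \<and> (\<exists>i\<le>e. r i \<notin> \<mm>)"
      proof (rule bump[OF ij(2) dN[OF ij(2)]])
        fix x n assume xn: "N \<le> n" "x \<in> Z n"
        then obtain b where b: "\<And>i. i \<le> e \<Longrightarrow> b i \<in> \<mm>" "x = dot b v (Suc e)"
          using less(3) by blast
        have bc: "b i \<in> carrier R" if "i < Suc e" for i using b(1)[of i] that max_closed(1) by auto
        \<comment> \<open>These coefficients compensate for the change of v j, so that they express
          the same x by the new entries. The correction stays in \<mm> because b j does.\<close>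
        let ?b = "b(i := b i \<oplus> b j \<otimes> (\<ominus> c))"
        have "dot ?b ?w (Suc e) = dot (?b(i := ?b i \<oplus> ?b j \<otimes> c)) v (Suc e)"
          using ij bc vc c by (intro dot_transvection) (auto simp: less_Suc_eq_le)
        also have "?b(i := ?b i \<oplus> ?b j \<otimes> c) = b"
          using ij bc[of i] bc[of j] c(1) by (auto simp: a_assoc r_distr[symmetric] l_neg)
        finally have "x = dot ?b ?w (Suc e)" using b(2) by (simp only:)
        moreover have "b j \<otimes> (\<ominus> c) \<in> \<mm>" using b(1)[OF ij(2)] c(1) max_closed by auto
        then have "\<forall>i\<le>e. ?b i \<in> \<mm>" using b(1) ij max_closed(3) by auto
        ultimately show "\<exists>c. (\<forall>i\<le>e. c i \<in> \<mm>) \<and> x = dot c ?w (Suc e)" by blast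
      qed (use less(2) c in auto)
      then obtain r where r: "\<forall>i\<le>e. r i \<in> carrier R" "dot r ?w (Suc e) = \<zero>" "\<exists>i\<le>e. r i \<notin> \<mm>"
        by blast
      let ?r = "r(i := r i \<oplus> r j \<otimes> c)"
      have "dot ?r v (Suc e) = \<zero>"
        using r(1,2) ij vc c dot_transvection[of i "Suc e" j r v c] by (auto simp: less_Suc_eq_le)
      moreover have "\<forall>i\<le>e. ?r i \<in> carrier R" using r(1) ij c(1) by auto
      \<comment> \<open>Pulling the relation back changes the coefficient at i by a multiple of r j.
        If all new coefficients were in \<mm>, then r j would be, hence also r i, and the relation
        for the modified entries would not be primitive.\<close>
      moreover have "\<exists>i\<le>e. ?r i \<notin> \<mm>"
      proof (rule ccontr)
        assume no: "\<not> ?thesis"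
        then have "r j \<in> \<mm>" using ij by auto
        then have "r j \<otimes> c \<in> \<mm>" using c(1) max_closed by auto
        moreover have "r i \<oplus> r j \<otimes> c \<in> \<mm>" using no ij by auto
        ultimately have "(r i \<oplus> r j \<otimes> c) \<ominus> r j \<otimes> c \<in> \<mm>" by (rule max_closed(7)[rotated])
        moreover have "(r i \<oplus> r j \<otimes> c) \<ominus> r j \<otimes> c = r i"
        proof -
          have "r i \<in> carrier R" "r j \<in> carrier R" using r(1) ij by auto
          then show ?thesis using c(1) by algebra
        qed
        ultimately have "r i \<in> \<mm>" by simp
        then show False using r(3) no by (auto split: if_splits)
      qed
      ultimately show ?thesis by blast
    qed
  qed
qed

text \<open>The number e of simple steps from R to tR depends on t alone and not on v. A coefficient
  outside \<mm> is a unit, so one of the e + 1 elements is a combination of the others.\<close>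

lemma primitive_relation:
  assumes "t \<in> \<mm>" "t \<in> nonzerodivisors R"
  obtains e where "0 < e" "\<And>v x. (\<And>i. i \<le> e \<Longrightarrow> v i \<in> carrier R) \<Longrightarrow> v 0 \<in> nonzerodivisors R \<Longrightarrow>
     \<exists>r. (\<forall>i\<le>e. r i \<in> carrier R) \<and> dot r v (Suc e) = \<zero> \<and> (\<exists>i\<le>e. r i \<notin> \<mm>)"
proof -
  note tc = nonzerodivisorsD[OF assms(2)]
  have iT: "ideal (PIdl t) R" "t \<in> PIdl t"
    using cgenideal_ideal[OF tc(1)] cgenideal_self[OF tc(1)] by auto
  obtain e Y where Y: "Y 0 = carrier R" "Y e = PIdl t" "\<And>i. i \<le> e \<Longrightarrow> ideal (Y i) R"
      "\<And>i. i < e \<Longrightarrow> simple_step (Y i) (Y (Suc i))"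
    using exists_composition_series[OF iT assms(2)] by auto
  have e: "0 < e"
  proof (rule ccontr)
    assume "\<not> 0 < e"
    then have "\<one> \<in> PIdl t" using Y(1,2) by auto
    then show False using cgenideal_minimal[OF ideal_max assms(1)] one_notin_max by auto
  qed
  define G where "G q J = {t [^] q \<otimes> w | w. w \<in> J}" for q :: nat and J
  have tq: "t [^] q \<in> nonzerodivisors R" "t [^] q \<in> carrier R" for q :: nat
    using pow_nonzerodivisor[OF assms(2)] tc(1) by auto
  have G: "ideal (G q J) R" if "ideal J R" for q J
  proof (rule idealI_closure)
    note Jc = idealD[OF that]
    show "G q J \<subseteq> carrier R" using Jc tq by (auto simp: G_def)
    show "\<zero> \<in> G q J" unfolding G_def using Jc(2) tq by (intro CollectI exI[of _ \<zero>]) simp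
    fix x assume "x \<in> G q J"
    then obtain w where w: "w \<in> J" "x = t [^] q \<otimes> w" by (auto simp: G_def)
    { fix y assume "y \<in> G q J"
      then obtain u where "u \<in> J" "y = t [^] q \<otimes> u" by (auto simp: G_def)
      then have "x \<oplus> y = t [^] q \<otimes> (w \<oplus> u)" using w tq Jc(1) by (simp add: r_distr)
      then show "x \<oplus> y \<in> G q J" using Jc(3) w \<open>u \<in> J\<close> by (auto simp: G_def) }
    fix r assume r: "r \<in> carrier R"
    then have "r \<otimes> x = t [^] q \<otimes> (r \<otimes> w)" using w tq Jc(1) by (simp add: m_lcomm)
    then show "r \<otimes> x \<in> G q J" using Jc(4) w r by (auto simp: G_def)
  qed
  \<comment> \<open>The t-adic filtration refined by the series Y: below t^q Y i comes t^q Y (i+1),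
    and t^q Y e = t^q (tR) is the top of the next block. Levels congruent modulo e have quotients
    that correspond under a power of t.\<close>
  define Z where "Z n = G (n div e) (Y (n mod e))" for n
  have Ymod: "ideal (Y (n mod e)) R" for n
    using Y(3)[of "n mod e"] mod_less_divisor[OF e, of n] by simp
  have Z: "ideal (Z n) R" for n unfolding Z_def using Ymod by (rule G)
  have Z_Suc: "Z (Suc n) = G (n div e) (Y (Suc (n mod e)))" for n
  proof (cases "Suc (n mod e) = e")
    case True
    then have "Z (Suc n) = G (Suc (n div e)) (carrier R)"
      by (simp add: Z_def mod_Suc div_Suc Y(1))
    also have "\<dots> = G (n div e) (PIdl t)"
      using tc(1) by (force simp: G_def PIdl_mem m_ac)
    finally show ?thesis using True Y(2) by simp
  next
    case False
    then show ?thesis by (simp add: Z_def mod_Suc div_Suc)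
  qed
  have Z0: "x \<in> Z 0" if "x \<in> carrier R" for x
    using that by (auto simp: Z_def G_def Y(1) intro!: exI[of _ x])
  have step: "\<exists>c\<in>carrier R. y \<oplus> c \<otimes> x \<in> Z (Suc (n + k * e))"
    if x: "x \<in> Z n" "x \<notin> Z (Suc n)" and y: "y \<in> Z (n + k * e)" for n k x y
  proof -
    obtain w where w: "w \<in> Y (n mod e)" "x = t [^] (n div e) \<otimes> w" using x(1) by (auto simp: Z_def G_def)
    obtain u where u: "u \<in> Y (n mod e)" "y = t [^] (n div e + k) \<otimes> u"
      using y e by (auto simp: Z_def G_def add.commute)
    have wu: "w \<in> carrier R" "u \<in> carrier R" using w u idealD(1)[OF Ymod] by auto
    have "w \<notin> Y (Suc (n mod e))" using x(2) w by (auto simp: Z_Suc G_def)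
    then obtain c where c: "c \<in> carrier R" "u \<ominus> c \<otimes> w \<in> Y (Suc (n mod e))"
      using Y(4)[of "n mod e"] mod_less_divisor[OF e, of n] w u unfolding simple_step_def by blast
    \<comment> \<open>Multiplication by t^k moves x from level n to level n + k e; there y and t^k x
      belong to the same quotient of the series, and c is the scalar that comparison
      provides.\<close>
    have "y \<oplus> (\<ominus> (t [^] k \<otimes> c)) \<otimes> x = (t [^] (n div e) \<otimes> t [^] k) \<otimes> (u \<ominus> c \<otimes> w)"
      using w(2) u(2) wu c(1) tq(2)[of "n div e"] tq(2)[of k] unfolding nat_pow_mult[OF tc(1), symmetric] by algebra
    then have "y \<oplus> (\<ominus> (t [^] k \<otimes> c)) \<otimes> x = t [^] (n div e + k) \<otimes> (u \<ominus> c \<otimes> w)"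
      using tc(1) by (simp add: nat_pow_mult)
    moreover have "(n + k * e) div e = n div e + k" using e by simp
    ultimately have "y \<oplus> (\<ominus> (t [^] k \<otimes> c)) \<otimes> x \<in> Z (Suc (n + k * e))"
      using c(2) unfolding Z_Suc G_def by auto
    then show ?thesis using c(1) tq by (intro bexI[of _ "\<ominus> (t [^] k \<otimes> c)"]) auto
  qed
  show ?thesis
  proof (rule that[OF e])
    fix v assume v: "\<And>i. i \<le> e \<Longrightarrow> v i \<in> carrier R" "v 0 \<in> nonzerodivisors R"
    obtain q :: nat and s where s: "s \<in> carrier R" "t [^] q = s \<otimes> v 0"
      using max_nilpotent_mod[OF v(2) assms(1)] by (auto simp: PIdl_mem)
    show "\<exists>r. (\<forall>i\<le>e. r i \<in> carrier R) \<and> dot r v (Suc e) = \<zero> \<and> (\<exists>i\<le>e. r i \<notin> \<mm>)"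
    \<comment> \<open>All entries start at level 0. From level (q + 1) e on, elements are multiples
      of t^(q+1), hence of t * v 0, because t^q is a multiple of v 0. The factor t puts the
      coefficient at index 0 into \<mm>; the other coefficients are 0.\<close>
    proof (rule primitive_relation_aux[where Z = Z, OF Z step e, where d = "\<lambda>_. 0" and N = "Suc q * e"])
      fix x n assume n: "Suc q * e \<le> n" and x: "x \<in> Z n"
      obtain w where w: "w \<in> carrier R" "x = t [^] (n div e) \<otimes> w"
        using x idealD(1)[OF Ymod] by (auto simp: Z_def G_def)
      have "Suc q \<le> n div e" using n e by (metis div_le_mono nonzero_mult_div_cancel_right not_gr_zero)
      then obtain k where k: "n div e = q + Suc k" using add_Suc_right le_Suc_ex less_eq_Suc_le less_imp_Suc_add by metis
      let ?c = "\<lambda>i::nat. if i = 0 then t \<otimes> (t [^] k \<otimes> w \<otimes> s) else \<zero>"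
      have tk: "t [^] k \<in> carrier R" using tc by simp
      have v0: "v 0 \<in> carrier R" using v by simp
      have "t [^] (n div e) = s \<otimes> v 0 \<otimes> (t [^] k \<otimes> t)"
        using tc(1) s(2) nat_pow_mult[OF tc(1), of q "Suc k"] by (simp add: k)
      then have "x = (t \<otimes> (t [^] k \<otimes> w \<otimes> s)) \<otimes> v 0"
        unfolding w(2) using tc(1) tk w(1) s(1) v0 by algebra
      also have "\<dots> = dot ?c v 1" using tc(1) tk w(1) s(1) v0 by simp
      also have "\<dots> = dot ?c v (Suc j)" if "j \<le> e" for j
        using that
      proof (induct j)
        case (Suc j)
        have "dot ?c v (Suc j) \<in> carrier R" using Suc v tc(1) tk w(1) s(1) by (intro dot_closed) auto
        then show ?case using Suc v by simp
      qed simp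
      finally have "x = dot ?c v (Suc e)" by simp
      moreover have "t \<otimes> (t [^] k \<otimes> w \<otimes> s) \<in> \<mm>"
        using tk w(1) s(1) by (intro max_closed(5) assms(1)) simp
      then have "\<forall>i\<le>e. ?c i \<in> \<mm>" using max_closed(2) by simp
      ultimately show "\<exists>c. (\<forall>i\<le>e. c i \<in> \<mm>) \<and> x = dot c v (Suc e)"
        by (intro exI[of _ ?c] conjI)
    qed (use v Z0 in auto)
  qed
qed

end

section \<open>The total quotient ring\<close>

context cring begin

text \<open>For transitivity both sides are multiplied by the middle denominator t, which can be
  cancelled because it is a nonzerodivisor.\<close>

lemma equiv_frac_rel: "equiv (carrier R \<times> nonzerodivisors R) (frac_rel R)"
proof (rule equivI)
  show "frac_rel R \<subseteq> (carrier R \<times> nonzerodivisors R) \<times> (carrier R \<times> nonzerodivisors R)"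
    by (auto simp: frac_rel_def)
  show "refl_on (carrier R \<times> nonzerodivisors R) (frac_rel R)"
    by (auto simp: refl_on_def frac_rel_def)
  show "sym (frac_rel R)" by (auto simp: sym_def frac_rel_def)
  show "trans (frac_rel R)"
  proof (rule transI)
    fix p q u assume pq: "(p, q) \<in> frac_rel R" and qu: "(q, u) \<in> frac_rel R"
    obtain a s where p: "p = (a, s)" by (cases p)
    obtain b t where q: "q = (b, t)" by (cases q)
    obtain c v where u: "u = (c, v)" by (cases u)
    have *: "a \<in> carrier R" "s \<in> nonzerodivisors R" "b \<in> carrier R" "t \<in> nonzerodivisors R"
      "c \<in> carrier R" "v \<in> nonzerodivisors R" "a \<otimes> t = b \<otimes> s" "b \<otimes> v = c \<otimes> t"
      using pq qu unfolding p q u by (auto simp: frac_rel_def)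
    have c: "s \<in> carrier R" "t \<in> carrier R" "v \<in> carrier R"
      using *(2,4,6) by (auto dest: nonzerodivisorsD(1))
    have "t \<otimes> (a \<otimes> v) = (a \<otimes> t) \<otimes> v" using c *(1) by algebra
    also have "\<dots> = s \<otimes> (b \<otimes> v)" unfolding *(7) using c *(3) by algebra
    also have "\<dots> = t \<otimes> (c \<otimes> s)" unfolding *(8) using c *(5) by algebra
    finally have "a \<otimes> v = c \<otimes> s" using nonzerodivisor_cancel[OF *(4)] c * by simp
    then show "(p, u) \<in> frac_rel R" using * unfolding p u by (simp add: frac_rel_def)
  qed
qed

lemma fraction_eq_iff:
  assumes "a \<in> carrier R" "s \<in> nonzerodivisors R" "b \<in> carrier R" "t \<in> nonzerodivisors R"
  shows "fraction R a s = fraction R b t \<longleftrightarrow> a \<otimes> t = b \<otimes> s"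
  using assms eq_equiv_class_iff[OF equiv_frac_rel, of "(a, s)" "(b, t)"]
  by (simp add: fraction_def) (simp add: frac_rel_def)

lemma total_quotient_carrier:
  "carrier (total_quotient_ring R) = {fraction R a s | a s. a \<in> carrier R \<and> s \<in> nonzerodivisors R}"
  by (auto simp: total_quotient_ring_def quotient_def fraction_def)

lemma fraction_mult:
  assumes "a \<in> carrier R" "s \<in> nonzerodivisors R" "b \<in> carrier R" "t \<in> nonzerodivisors R"
  shows "fraction R a s \<otimes>\<^bsub>total_quotient_ring R\<^esub> fraction R b t = fraction R (a \<otimes> b) (s \<otimes> t)"
proof -
  have "congruent2 (frac_rel R) (frac_rel R) (\<lambda>p q. fraction R (fst p \<otimes> fst q) (snd p \<otimes> snd q))"
  proof (rule congruent2I[OF equiv_frac_rel equiv_frac_rel])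
    fix p q u assume pq: "(p, q) \<in> frac_rel R" and u: "u \<in> carrier R \<times> nonzerodivisors R"
    then have c: "fst p \<in> carrier R" "snd p \<in> nonzerodivisors R" "snd p \<in> carrier R"
      "fst q \<in> carrier R" "snd q \<in> nonzerodivisors R" "snd q \<in> carrier R"
      "fst u \<in> carrier R" "snd u \<in> nonzerodivisors R" "snd u \<in> carrier R"
      and e: "fst p \<otimes> snd q = fst q \<otimes> snd p"
      by (auto simp: frac_rel_def dest: nonzerodivisorsD(1))
    have "fst p \<otimes> fst u \<otimes> (snd q \<otimes> snd u) = (fst p \<otimes> snd q) \<otimes> (fst u \<otimes> snd u)"
      using c by algebra
    also have "\<dots> = fst q \<otimes> fst u \<otimes> (snd p \<otimes> snd u)" unfolding e using c by algebra
    finally show "fraction R (fst p \<otimes> fst u) (snd p \<otimes> snd u) = fraction R (fst q \<otimes> fst u) (snd q \<otimes> snd u)"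
      using c by (subst fraction_eq_iff) (auto simp: mult_nonzerodivisor)
    then show "fraction R (fst u \<otimes> fst p) (snd u \<otimes> snd p) = fraction R (fst u \<otimes> fst q) (snd u \<otimes> snd q)"
      using c by (simp add: m_comm)
  qed
  from UN_equiv_class2[OF equiv_frac_rel equiv_frac_rel this, of "(a, s)" "(b, t)"]
  show ?thesis using assms by (simp add: total_quotient_ring_def) (simp add: fraction_def)
qed

lemma fraction_add:
  assumes "a \<in> carrier R" "s \<in> nonzerodivisors R" "b \<in> carrier R" "t \<in> nonzerodivisors R"
  shows "fraction R a s \<oplus>\<^bsub>total_quotient_ring R\<^esub> fraction R b t =
    fraction R (a \<otimes> t \<oplus> b \<otimes> s) (s \<otimes> t)"
proof -
  have "congruent2 (frac_rel R) (frac_rel R)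
    (\<lambda>p q. fraction R (fst p \<otimes> snd q \<oplus> fst q \<otimes> snd p) (snd p \<otimes> snd q))"
  proof (rule congruent2I[OF equiv_frac_rel equiv_frac_rel])
    fix p q u assume pq: "(p, q) \<in> frac_rel R" and u: "u \<in> carrier R \<times> nonzerodivisors R"
    then have c: "fst p \<in> carrier R" "snd p \<in> nonzerodivisors R" "snd p \<in> carrier R"
      "fst q \<in> carrier R" "snd q \<in> nonzerodivisors R" "snd q \<in> carrier R"
      "fst u \<in> carrier R" "snd u \<in> nonzerodivisors R" "snd u \<in> carrier R"
      and e: "fst p \<otimes> snd q = fst q \<otimes> snd p"
      by (auto simp: frac_rel_def dest: nonzerodivisorsD(1))
    have "(fst p \<otimes> snd u \<oplus> fst u \<otimes> snd p) \<otimes> (snd q \<otimes> snd u) =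
        (fst p \<otimes> snd q) \<otimes> (snd u \<otimes> snd u) \<oplus> fst u \<otimes> snd p \<otimes> (snd q \<otimes> snd u)"
      using c by algebra
    also have "\<dots> = (fst q \<otimes> snd u \<oplus> fst u \<otimes> snd q) \<otimes> (snd p \<otimes> snd u)" unfolding e using c by algebra
    finally show *: "fraction R (fst p \<otimes> snd u \<oplus> fst u \<otimes> snd p) (snd p \<otimes> snd u) =
        fraction R (fst q \<otimes> snd u \<oplus> fst u \<otimes> snd q) (snd q \<otimes> snd u)"
      using c by (subst fraction_eq_iff) (auto simp: mult_nonzerodivisor)
    then show "fraction R (fst u \<otimes> snd p \<oplus> fst p \<otimes> snd u) (snd u \<otimes> snd p) =
        fraction R (fst u \<otimes> snd q \<oplus> fst q \<otimes> snd u) (snd u \<otimes> snd q)"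
      using c by (simp add: m_comm[of "snd u"] a_comm[of "fst u \<otimes> _"])
  qed
  from UN_equiv_class2[OF equiv_frac_rel equiv_frac_rel this, of "(a, s)" "(b, t)"]
  show ?thesis using assms by (simp add: total_quotient_ring_def) (simp add: fraction_def)
qed

lemma total_quotient_cring: "cring (total_quotient_ring R)" (is "cring ?Q")
proof (rule cringI)
  note nzc = nonzerodivisorsD(1)
  note nz = mult_nonzerodivisor one_nonzerodivisor
  have zero: "\<zero>\<^bsub>?Q\<^esub> = fraction R \<zero> \<one>" and one: "\<one>\<^bsub>?Q\<^esub> = fraction R \<one> \<one>"
    by (simp_all add: total_quotient_ring_def)
  have carr: "fraction R a s \<in> carrier ?Q" if "a \<in> carrier R" "s \<in> nonzerodivisors R" for a s
    using that by (auto simp: total_quotient_carrier)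
  have E: thesis if "x \<in> carrier ?Q" "\<And>a s. a \<in> carrier R \<Longrightarrow> s \<in> nonzerodivisors R \<Longrightarrow> s \<in> carrier R \<Longrightarrow> x = fraction R a s \<Longrightarrow> thesis"
    for x thesis
    using that by (auto simp: total_quotient_carrier dest: nzc)
  show "abelian_group ?Q"
  proof (rule abelian_groupI)
    fix x y z assume x: "x \<in> carrier ?Q" and y: "y \<in> carrier ?Q"
    show "x \<oplus>\<^bsub>?Q\<^esub> y \<in> carrier ?Q"
      by (rule E[OF x], rule E[OF y]) (simp add: fraction_add carr nz)
    show "x \<oplus>\<^bsub>?Q\<^esub> y = y \<oplus>\<^bsub>?Q\<^esub> x"
    proof (rule E[OF x], rule E[OF y])
      fix a s b t assume c: "a \<in> carrier R" "s \<in> nonzerodivisors R" "s \<in> carrier R" "x = fraction R a s"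
        "b \<in> carrier R" "t \<in> nonzerodivisors R" "t \<in> carrier R" "y = fraction R b t"
      have "(a \<otimes> t \<oplus> b \<otimes> s) \<otimes> (t \<otimes> s) = (b \<otimes> s \<oplus> a \<otimes> t) \<otimes> (s \<otimes> t)"
        using c(1,3,5,7) by algebra
      then show ?thesis using c by (simp add: fraction_add fraction_eq_iff nz)
    qed
    assume z: "z \<in> carrier ?Q"
    show "x \<oplus>\<^bsub>?Q\<^esub> y \<oplus>\<^bsub>?Q\<^esub> z = x \<oplus>\<^bsub>?Q\<^esub> (y \<oplus>\<^bsub>?Q\<^esub> z)"
    proof (rule E[OF x], rule E[OF y], rule E[OF z])
      fix a s b t d u assume c: "a \<in> carrier R" "s \<in> nonzerodivisors R" "s \<in> carrier R" "x = fraction R a s"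
        "b \<in> carrier R" "t \<in> nonzerodivisors R" "t \<in> carrier R" "y = fraction R b t"
        "d \<in> carrier R" "u \<in> nonzerodivisors R" "u \<in> carrier R" "z = fraction R d u"
      have "((a \<otimes> t \<oplus> b \<otimes> s) \<otimes> u \<oplus> d \<otimes> (s \<otimes> t)) \<otimes> (s \<otimes> (t \<otimes> u)) =
         (a \<otimes> (t \<otimes> u) \<oplus> (b \<otimes> u \<oplus> d \<otimes> t) \<otimes> s) \<otimes> (s \<otimes> t \<otimes> u)"
        using c(1,3,5,7,9,11) by algebra
      then show ?thesis using c by (simp add: fraction_add fraction_eq_iff nz)
    qed
  next
    fix x assume x: "x \<in> carrier ?Q"
    show "\<zero>\<^bsub>?Q\<^esub> \<oplus>\<^bsub>?Q\<^esub> x = x"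
      by (rule E[OF x]) (simp add: fraction_add zero nz)
    show "\<exists>y\<in>carrier ?Q. y \<oplus>\<^bsub>?Q\<^esub> x = \<zero>\<^bsub>?Q\<^esub>"
    proof (rule E[OF x])
      fix a s assume c: "a \<in> carrier R" "s \<in> nonzerodivisors R" "s \<in> carrier R" "x = fraction R a s"
      have "(\<ominus> a \<otimes> s \<oplus> a \<otimes> s) \<otimes> \<one> = \<zero> \<otimes> (s \<otimes> s)" using c(1,3) by algebra
      then have "fraction R (\<ominus> a) s \<oplus>\<^bsub>?Q\<^esub> x = \<zero>\<^bsub>?Q\<^esub>"
        using c by (simp add: fraction_add zero fraction_eq_iff nz)
      then show ?thesis using c carr[of "\<ominus> a" s] by blast
    qed
  qed (simp add: zero carr nz)
  show "comm_monoid ?Q"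
  proof (rule comm_monoidI)
    fix x y z assume x: "x \<in> carrier ?Q" and y: "y \<in> carrier ?Q"
    show "x \<otimes>\<^bsub>?Q\<^esub> y \<in> carrier ?Q"
      by (rule E[OF x], rule E[OF y]) (simp add: fraction_mult carr nz)
    show "x \<otimes>\<^bsub>?Q\<^esub> y = y \<otimes>\<^bsub>?Q\<^esub> x"
      by (rule E[OF x], rule E[OF y]) (simp add: fraction_mult nz m_comm)
    assume z: "z \<in> carrier ?Q"
    show "x \<otimes>\<^bsub>?Q\<^esub> y \<otimes>\<^bsub>?Q\<^esub> z = x \<otimes>\<^bsub>?Q\<^esub> (y \<otimes>\<^bsub>?Q\<^esub> z)"
      by (rule E[OF x], rule E[OF y], rule E[OF z]) (simp add: fraction_mult nz m_assoc)
  next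
    fix x assume x: "x \<in> carrier ?Q"
    show "\<one>\<^bsub>?Q\<^esub> \<otimes>\<^bsub>?Q\<^esub> x = x"
      by (rule E[OF x]) (simp add: fraction_mult one nz)
  qed (simp add: one carr nz)
  fix x y z assume x: "x \<in> carrier ?Q" and y: "y \<in> carrier ?Q" and z: "z \<in> carrier ?Q"
  show "(x \<oplus>\<^bsub>?Q\<^esub> y) \<otimes>\<^bsub>?Q\<^esub> z = x \<otimes>\<^bsub>?Q\<^esub> z \<oplus>\<^bsub>?Q\<^esub> y \<otimes>\<^bsub>?Q\<^esub> z"
  proof (rule E[OF x], rule E[OF y], rule E[OF z])
    fix a s b t d u assume c: "a \<in> carrier R" "s \<in> nonzerodivisors R" "s \<in> carrier R" "x = fraction R a s"
      "b \<in> carrier R" "t \<in> nonzerodivisors R" "t \<in> carrier R" "y = fraction R b t"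
      "d \<in> carrier R" "u \<in> nonzerodivisors R" "u \<in> carrier R" "z = fraction R d u"
    have "(a \<otimes> t \<oplus> b \<otimes> s) \<otimes> d \<otimes> (s \<otimes> u \<otimes> (t \<otimes> u)) =
       (a \<otimes> d \<otimes> (t \<otimes> u) \<oplus> b \<otimes> d \<otimes> (s \<otimes> u)) \<otimes> (s \<otimes> t \<otimes> u)"
      using c(1,3,5,7,9,11) by algebra
    then show ?thesis using c by (simp add: fraction_add fraction_mult fraction_eq_iff nz)
  qed
qed

end

text \<open>The properties that characterize the total quotient ring. What follows argues from them
  and does not return to classes of pairs.\<close>

locale fraction_ring = R: cring R + Q: cring Q for R (structure) and Q (structure) +
  fixes \<iota>
  assumes hom: "\<iota> \<in> ring_hom R Q" and inj: "inj_on \<iota> (carrier R)"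
    and units: "s \<in> nonzerodivisors R \<Longrightarrow> \<iota> s \<in> Units Q"
    and fractions: "q \<in> carrier Q \<Longrightarrow> \<exists>a\<in>carrier R. \<exists>s\<in>nonzerodivisors R. q \<otimes>\<^bsub>Q\<^esub> \<iota> s = \<iota> a"

lemma (in cring) fraction_ring_total_quotient:
  "fraction_ring R (total_quotient_ring R) (to_frac R)"
proof -
  interpret Q: cring "total_quotient_ring R" by (rule total_quotient_cring)
  have one: "\<one>\<^bsub>total_quotient_ring R\<^esub> = fraction R \<one> \<one>"
    by (simp add: total_quotient_ring_def)
  have carr: "fraction R a s \<in> carrier (total_quotient_ring R)" if "a \<in> carrier R" "s \<in> nonzerodivisors R" for a s
    using that by (auto simp: total_quotient_carrier)
  show ?thesis
  proof (unfold_locales)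
    show "to_frac R \<in> ring_hom R (total_quotient_ring R)"
      by (rule ring_hom_memI)
        (auto simp: to_frac_def carr one_nonzerodivisor fraction_add fraction_mult one)
    show "inj_on (to_frac R) (carrier R)"
      by (rule inj_onI) (simp add: to_frac_def fraction_eq_iff one_nonzerodivisor)
    fix s assume s: "s \<in> nonzerodivisors R"
    then have sc: "s \<in> carrier R" by (rule nonzerodivisorsD)
    have "fraction R \<one> s \<otimes>\<^bsub>total_quotient_ring R\<^esub> to_frac R s = \<one>\<^bsub>total_quotient_ring R\<^esub>"
      using s sc by (simp add: to_frac_def fraction_mult one_nonzerodivisor one fraction_eq_iff)
    then show "to_frac R s \<in> Units (total_quotient_ring R)"
      using s sc carr[of s \<one>] carr[of \<one> s] Q.m_comm[of "fraction R \<one> s" "to_frac R s"]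
      by (auto simp: Units_def to_frac_def one_nonzerodivisor)
  next
    fix q assume "q \<in> carrier (total_quotient_ring R)"
    then obtain a s where as: "a \<in> carrier R" "s \<in> nonzerodivisors R" "q = fraction R a s"
      by (auto simp: total_quotient_carrier)
    have sc: "s \<in> carrier R" using as by (auto dest: nonzerodivisorsD(1))
    have "q \<otimes>\<^bsub>total_quotient_ring R\<^esub> to_frac R s = to_frac R a"
      using as sc by (simp add: to_frac_def fraction_mult one_nonzerodivisor fraction_eq_iff)
    then show "\<exists>a\<in>carrier R. \<exists>s\<in>nonzerodivisors R. q \<otimes>\<^bsub>total_quotient_ring R\<^esub> to_frac R s = to_frac R a"
      using as by blast
  qed
qed

section \<open>Almost integral elements\<close>

context fraction_ring begin

sublocale ring_hom_cring R Q \<iota>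
  by (unfold_locales) (rule hom)

lemma inj_eq: "a \<in> carrier R \<Longrightarrow> b \<in> carrier R \<Longrightarrow> \<iota> a = \<iota> b \<longleftrightarrow> a = b"
  using inj by (auto simp: inj_on_def)

abbreviation A where "A \<equiv> \<iota> ` carrier R"

lemma A_closed:
  shows A_carrier: "x \<in> A \<Longrightarrow> x \<in> carrier Q"
    and A_zero: "\<zero>\<^bsub>Q\<^esub> \<in> A"
    and A_one: "\<one>\<^bsub>Q\<^esub> \<in> A"
    and A_add: "x \<in> A \<Longrightarrow> y \<in> A \<Longrightarrow> x \<oplus>\<^bsub>Q\<^esub> y \<in> A"
    and A_mult: "x \<in> A \<Longrightarrow> y \<in> A \<Longrightarrow> x \<otimes>\<^bsub>Q\<^esub> y \<in> A"
    and A_uminus: "x \<in> A \<Longrightarrow> \<ominus>\<^bsub>Q\<^esub> x \<in> A"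
    and A_pow: "x \<in> A \<Longrightarrow> x [^]\<^bsub>Q\<^esub> (n::nat) \<in> A"
proof -
  show "x \<in> A \<Longrightarrow> x \<in> carrier Q" by auto
  show "\<zero>\<^bsub>Q\<^esub> \<in> A" by (rule image_eqI[of _ _ \<zero>]) auto
  show one: "\<one>\<^bsub>Q\<^esub> \<in> A" by (rule image_eqI[of _ _ \<one>]) auto
  show "x \<in> A \<Longrightarrow> y \<in> A \<Longrightarrow> x \<oplus>\<^bsub>Q\<^esub> y \<in> A" by (auto simp flip: hom_add)
  show mult: "x \<in> A \<Longrightarrow> y \<in> A \<Longrightarrow> x \<otimes>\<^bsub>Q\<^esub> y \<in> A" for x y by (auto simp flip: hom_mult)
  show "x \<in> A \<Longrightarrow> \<ominus>\<^bsub>Q\<^esub> x \<in> A" by (auto simp flip: hom_a_inv)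
  show "x \<in> A \<Longrightarrow> x [^]\<^bsub>Q\<^esub> (n::nat) \<in> A" by (induct n) (simp_all add: one mult)
qed

text \<open>Over a Noetherian ring these are the integral elements; this description makes it evident that
  they form a ring.\<close>

definition almost_integral :: "'c set" where
  "almost_integral = {q \<in> carrier Q. \<exists>d\<in>nonzerodivisors R. \<forall>n::nat. \<iota> d \<otimes>\<^bsub>Q\<^esub> q [^]\<^bsub>Q\<^esub> n \<in> A}"

lemma almost_integral_carrier: "q \<in> almost_integral \<Longrightarrow> q \<in> carrier Q"
  by (simp add: almost_integral_def)

lemma nzd_closed: "d \<in> nonzerodivisors R \<Longrightarrow> \<iota> d \<in> carrier Q"
  by (rule hom_closed[OF R.nonzerodivisorsD(1)])

lemma unit_cancel:
  assumes "d \<in> nonzerodivisors R" "x \<in> carrier Q" "y \<in> carrier Q" "\<iota> d \<otimes>\<^bsub>Q\<^esub> x = \<iota> d \<otimes>\<^bsub>Q\<^esub> y"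
  shows "x = y"
  using Q.Units_l_cancel[OF units[OF assms(1)] assms(2,3)] assms(4) by simp

lemma almost_integral_pair:
  assumes "u \<in> almost_integral" "v \<in> almost_integral"
  obtains d where "d \<in> nonzerodivisors R"
    "\<And>(i::nat) (j::nat). \<iota> d \<otimes>\<^bsub>Q\<^esub> (u [^]\<^bsub>Q\<^esub> i \<otimes>\<^bsub>Q\<^esub> v [^]\<^bsub>Q\<^esub> j) \<in> A"
proof -
  obtain a b where ab: "a \<in> nonzerodivisors R" "\<And>i::nat. \<iota> a \<otimes>\<^bsub>Q\<^esub> u [^]\<^bsub>Q\<^esub> i \<in> A"
    "b \<in> nonzerodivisors R" "\<And>i::nat. \<iota> b \<otimes>\<^bsub>Q\<^esub> v [^]\<^bsub>Q\<^esub> i \<in> A"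
    using assms by (auto simp: almost_integral_def)
  have c: "a \<in> carrier R" "b \<in> carrier R" "u \<in> carrier Q" "v \<in> carrier Q"
    using ab assms by (auto simp: almost_integral_def dest: R.nonzerodivisorsD(1))
  show ?thesis
  proof (rule that[OF R.mult_nonzerodivisor[OF ab(1,3)]])
    fix i j :: nat
    have p: "u [^]\<^bsub>Q\<^esub> i \<in> carrier Q" "v [^]\<^bsub>Q\<^esub> j \<in> carrier Q" "\<iota> a \<in> carrier Q" "\<iota> b \<in> carrier Q"
      using c by auto
    have "\<iota> (a \<otimes> b) \<otimes>\<^bsub>Q\<^esub> (u [^]\<^bsub>Q\<^esub> i \<otimes>\<^bsub>Q\<^esub> v [^]\<^bsub>Q\<^esub> j) =
      (\<iota> a \<otimes>\<^bsub>Q\<^esub> u [^]\<^bsub>Q\<^esub> i) \<otimes>\<^bsub>Q\<^esub> (\<iota> b \<otimes>\<^bsub>Q\<^esub> v [^]\<^bsub>Q\<^esub> j)"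
      unfolding hom_mult[OF c(1,2)] using p by algebra
    then show "\<iota> (a \<otimes> b) \<otimes>\<^bsub>Q\<^esub> (u [^]\<^bsub>Q\<^esub> i \<otimes>\<^bsub>Q\<^esub> v [^]\<^bsub>Q\<^esub> j) \<in> A"
      using A_mult[OF ab(2)[of i] ab(4)[of j]] by simp
  qed
qed

lemma almost_integral_A: "a \<in> A \<Longrightarrow> a \<in> almost_integral"
  unfolding almost_integral_def
  by (intro CollectI conjI bexI[of _ \<one>] allI)
    (simp_all add: A_pow A_mult A_one A_carrier R.one_nonzerodivisor)

lemma almost_integral_mult:
  assumes "u \<in> almost_integral" "v \<in> almost_integral"
  shows "u \<otimes>\<^bsub>Q\<^esub> v \<in> almost_integral"
proof -
  obtain d where d: "d \<in> nonzerodivisors R"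
    "\<And>(i::nat) (j::nat). \<iota> d \<otimes>\<^bsub>Q\<^esub> (u [^]\<^bsub>Q\<^esub> i \<otimes>\<^bsub>Q\<^esub> v [^]\<^bsub>Q\<^esub> j) \<in> A"
    using almost_integral_pair[OF assms] by blast
  have c: "u \<in> carrier Q" "v \<in> carrier Q" using assms by (auto dest: almost_integral_carrier)
  then have "\<iota> d \<otimes>\<^bsub>Q\<^esub> (u \<otimes>\<^bsub>Q\<^esub> v) [^]\<^bsub>Q\<^esub> n \<in> A" for n :: nat
    using d(2)[of n n] by (simp add: Q.nat_pow_distrib)
  then show ?thesis using d(1) c unfolding almost_integral_def by blast
qed

lemma almost_integral_add:
  assumes "u \<in> almost_integral" "v \<in> almost_integral"
  shows "u \<oplus>\<^bsub>Q\<^esub> v \<in> almost_integral"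
proof -
  obtain d where d: "d \<in> nonzerodivisors R"
    "\<And>(i::nat) (j::nat). \<iota> d \<otimes>\<^bsub>Q\<^esub> (u [^]\<^bsub>Q\<^esub> i \<otimes>\<^bsub>Q\<^esub> v [^]\<^bsub>Q\<^esub> j) \<in> A"
    using almost_integral_pair[OF assms] by blast
  have c: "u \<in> carrier Q" "v \<in> carrier Q" "\<iota> d \<in> carrier Q"
    using assms nzd_closed[OF d(1)] by (auto dest: almost_integral_carrier)
  \<comment> \<open>Generalizing over the monomial in front turns the expansion of the n-th power
    into a plain induction: one factor u + v raises either i or j by one.\<close>
  have "\<iota> d \<otimes>\<^bsub>Q\<^esub> (u [^]\<^bsub>Q\<^esub> i \<otimes>\<^bsub>Q\<^esub> v [^]\<^bsub>Q\<^esub> j) \<otimes>\<^bsub>Q\<^esub> (u \<oplus>\<^bsub>Q\<^esub> v) [^]\<^bsub>Q\<^esub> n \<in> A" for i j n :: nat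
  proof (induct n arbitrary: i j)
    case 0
    then show ?case using d(2)[of i j] by (simp add: A_carrier)
  next
    case (Suc n)
    have p: "u [^]\<^bsub>Q\<^esub> i \<in> carrier Q" "v [^]\<^bsub>Q\<^esub> j \<in> carrier Q" "(u \<oplus>\<^bsub>Q\<^esub> v) [^]\<^bsub>Q\<^esub> n \<in> carrier Q"
      using c by auto
    have "\<iota> d \<otimes>\<^bsub>Q\<^esub> (u [^]\<^bsub>Q\<^esub> i \<otimes>\<^bsub>Q\<^esub> v [^]\<^bsub>Q\<^esub> j) \<otimes>\<^bsub>Q\<^esub> (u \<oplus>\<^bsub>Q\<^esub> v) [^]\<^bsub>Q\<^esub> Suc n =
       \<iota> d \<otimes>\<^bsub>Q\<^esub> (u [^]\<^bsub>Q\<^esub> Suc i \<otimes>\<^bsub>Q\<^esub> v [^]\<^bsub>Q\<^esub> j) \<otimes>\<^bsub>Q\<^esub> (u \<oplus>\<^bsub>Q\<^esub> v) [^]\<^bsub>Q\<^esub> n \<oplus>\<^bsub>Q\<^esub>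
       \<iota> d \<otimes>\<^bsub>Q\<^esub> (u [^]\<^bsub>Q\<^esub> i \<otimes>\<^bsub>Q\<^esub> v [^]\<^bsub>Q\<^esub> Suc j) \<otimes>\<^bsub>Q\<^esub> (u \<oplus>\<^bsub>Q\<^esub> v) [^]\<^bsub>Q\<^esub> n"
      unfolding Q.nat_pow_Suc using p c by algebra
    then show ?case using Suc[of "Suc i" j] Suc[of i "Suc j"] A_add by simp
  qed
  from this[of 0 0] have "\<iota> d \<otimes>\<^bsub>Q\<^esub> (u \<oplus>\<^bsub>Q\<^esub> v) [^]\<^bsub>Q\<^esub> n \<in> A" for n :: nat
    using c by simp
  then show ?thesis using d(1) c by (auto simp: almost_integral_def)
qed

lemma almost_integral_uminus:
  assumes "u \<in> almost_integral"
  shows "\<ominus>\<^bsub>Q\<^esub> u \<in> almost_integral"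
proof -
  have "\<ominus>\<^bsub>Q\<^esub> u = (\<ominus>\<^bsub>Q\<^esub> \<one>\<^bsub>Q\<^esub>) \<otimes>\<^bsub>Q\<^esub> u"
    using almost_integral_carrier[OF assms] by (simp add: Q.l_minus)
  then show ?thesis
    using almost_integral_mult[OF almost_integral_A[OF A_uminus[OF A_one]] assms] by simp
qed

lemma almost_integral_minus:
  "u \<in> almost_integral \<Longrightarrow> v \<in> almost_integral \<Longrightarrow> u \<ominus>\<^bsub>Q\<^esub> v \<in> almost_integral"
  by (simp add: a_minus_def almost_integral_add almost_integral_uminus)

lemma almost_integral_dot:
  "(\<And>i. i < k \<Longrightarrow> x i \<otimes>\<^bsub>Q\<^esub> y i \<in> almost_integral) \<Longrightarrow> Q.dot x y k \<in> almost_integral"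
  by (induct k) (auto intro: almost_integral_add almost_integral_A[OF A_zero])

text \<open>The A-module spanned by 1, u, ..., u^(n-1). Coefficient lists have length exactly n,
  highest power first; leading zeros are allowed, unlike in \<open>polynomial\<close>, so that lists
  can be added entrywise.\<close>

definition poly_span :: "nat \<Rightarrow> 'c \<Rightarrow> 'c set" where
  "poly_span n u = {Q.eval l u | l. set l \<subseteq> A \<and> length l = n}"

lemma eval_Cons: "Q.eval (c # l) u = c \<otimes>\<^bsub>Q\<^esub> u [^]\<^bsub>Q\<^esub> length l \<oplus>\<^bsub>Q\<^esub> Q.eval l u"
  by simp

lemma set_A_carrier: "set l \<subseteq> A \<Longrightarrow> set l \<subseteq> carrier Q"
  using A_carrier by blast

lemma eval_carrier: "set l \<subseteq> A \<Longrightarrow> u \<in> carrier Q \<Longrightarrow> Q.eval l u \<in> carrier Q"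
  using Q.eval_in_carrier set_A_carrier by simp

lemma eval_map2_add:
  assumes "length l = length l'" "set l \<subseteq> A" "set l' \<subseteq> A" "u \<in> carrier Q"
  shows "Q.eval (map2 (\<oplus>\<^bsub>Q\<^esub>) l l') u = Q.eval l u \<oplus>\<^bsub>Q\<^esub> Q.eval l' u"
  using assms
proof (induct l l' rule: list_induct2)
  case (Cons c l d l')
  have m: "c \<in> carrier Q" "d \<in> carrier Q" "Q.eval l u \<in> carrier Q" "Q.eval l' u \<in> carrier Q"
    "u [^]\<^bsub>Q\<^esub> length l' \<in> carrier Q"
    using Cons A_carrier eval_carrier[of l u] eval_carrier[of l' u] by auto
  have "map2 (\<oplus>\<^bsub>Q\<^esub>) (c # l) (d # l') = (c \<oplus>\<^bsub>Q\<^esub> d) # map2 (\<oplus>\<^bsub>Q\<^esub>) l l'" by simp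
  then have "Q.eval (map2 (\<oplus>\<^bsub>Q\<^esub>) (c # l) (d # l')) u =
     (c \<oplus>\<^bsub>Q\<^esub> d) \<otimes>\<^bsub>Q\<^esub> u [^]\<^bsub>Q\<^esub> length l' \<oplus>\<^bsub>Q\<^esub> (Q.eval l u \<oplus>\<^bsub>Q\<^esub> Q.eval l' u)"
    using Cons by (simp only: eval_Cons) simp
  also have "\<dots> = (c \<otimes>\<^bsub>Q\<^esub> u [^]\<^bsub>Q\<^esub> length l' \<oplus>\<^bsub>Q\<^esub> Q.eval l u) \<oplus>\<^bsub>Q\<^esub> (d \<otimes>\<^bsub>Q\<^esub> u [^]\<^bsub>Q\<^esub> length l' \<oplus>\<^bsub>Q\<^esub> Q.eval l' u)"
    using m by algebra
  finally show ?case using Cons(1) by simp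
qed simp

lemma eval_map_mult:
  assumes "set l \<subseteq> A" "u \<in> carrier Q" "a \<in> carrier Q"
  shows "Q.eval (map ((\<otimes>\<^bsub>Q\<^esub>) a) l) u = a \<otimes>\<^bsub>Q\<^esub> Q.eval l u"
  using assms
proof (induct l)
  case (Cons c l)
  have m: "c \<in> carrier Q" "Q.eval l u \<in> carrier Q" "u [^]\<^bsub>Q\<^esub> length l \<in> carrier Q"
    using Cons A_carrier eval_carrier[of l u] by auto
  have "Q.eval (map ((\<otimes>\<^bsub>Q\<^esub>) a) (c # l)) u =
     (a \<otimes>\<^bsub>Q\<^esub> c) \<otimes>\<^bsub>Q\<^esub> u [^]\<^bsub>Q\<^esub> length l \<oplus>\<^bsub>Q\<^esub> a \<otimes>\<^bsub>Q\<^esub> Q.eval l u"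
    using Cons by simp
  also have "\<dots> = a \<otimes>\<^bsub>Q\<^esub> (c \<otimes>\<^bsub>Q\<^esub> u [^]\<^bsub>Q\<^esub> length l \<oplus>\<^bsub>Q\<^esub> Q.eval l u)"
    using m assms(3) by algebra
  finally show ?case by simp
qed simp

lemma eval_append_zeros:
  assumes "set l \<subseteq> A" "u \<in> carrier Q"
  shows "Q.eval (l @ replicate k \<zero>\<^bsub>Q\<^esub>) u = Q.eval l u \<otimes>\<^bsub>Q\<^esub> u [^]\<^bsub>Q\<^esub> k"
proof -
  have z: "Q.eval (replicate k \<zero>\<^bsub>Q\<^esub>) u = \<zero>\<^bsub>Q\<^esub>" using assms(2) by (induct k) auto
  show ?thesis
    using Q.eval_append[OF set_A_carrier[OF assms(1)], of "replicate k \<zero>\<^bsub>Q\<^esub>" u] z assms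
      eval_carrier[OF assms]
    by (auto simp: set_replicate_conv_if)
qed

lemma poly_spanI:
  assumes "set l \<subseteq> A" "u \<in> carrier Q" "length l \<le> n"
  shows "Q.eval l u \<in> poly_span n u"
proof -
  have "Q.eval (replicate k \<zero>\<^bsub>Q\<^esub> @ l) u = Q.eval l u" for k
    using eval_carrier[OF assms(1,2)] assms(2) by (induct k) auto
  then have "Q.eval l u = Q.eval (replicate (n - length l) \<zero>\<^bsub>Q\<^esub> @ l) u" by simp
  moreover have "set (replicate (n - length l) \<zero>\<^bsub>Q\<^esub> @ l) \<subseteq> A"
    using assms(1) A_zero by (auto simp: set_replicate_conv_if)
  moreover have "length (replicate (n - length l) \<zero>\<^bsub>Q\<^esub> @ l) = n"
    using assms(3) by simp
  ultimately show ?thesis unfolding poly_span_def by blast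
qed

lemma poly_span_carrier: "h \<in> poly_span n u \<Longrightarrow> u \<in> carrier Q \<Longrightarrow> h \<in> carrier Q"
  using eval_carrier by (auto simp: poly_span_def)

lemma poly_span_add:
  assumes "h \<in> poly_span n u" "h' \<in> poly_span n u" "u \<in> carrier Q"
  shows "h \<oplus>\<^bsub>Q\<^esub> h' \<in> poly_span n u"
proof -
  obtain l l' where l: "set l \<subseteq> A" "length l = n" "h = Q.eval l u"
      "set l' \<subseteq> A" "length l' = n" "h' = Q.eval l' u"
    using assms by (auto simp: poly_span_def)
  have "set (map2 (\<oplus>\<^bsub>Q\<^esub>) l l') \<subseteq> A"
    using l(1,4) A_add by (auto dest!: set_zip_leftD set_zip_rightD elim!: in_set_zipE) blast
  then show ?thesis
    using poly_spanI[of "map2 (\<oplus>\<^bsub>Q\<^esub>) l l'" u n] eval_map2_add[of l l' u] l assms(3) by simp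
qed

lemma poly_span_mult:
  assumes "a \<in> A" "h \<in> poly_span n u" "u \<in> carrier Q"
  shows "a \<otimes>\<^bsub>Q\<^esub> h \<in> poly_span n u"
proof -
  obtain l where l: "set l \<subseteq> A" "length l = n" "h = Q.eval l u"
    using assms by (auto simp: poly_span_def)
  have "set (map ((\<otimes>\<^bsub>Q\<^esub>) a) l) \<subseteq> A"
    using l(1) A_mult[OF assms(1)] by auto
  then show ?thesis
    using poly_spanI[of "map ((\<otimes>\<^bsub>Q\<^esub>) a) l" u n] eval_map_mult[of l u a] l assms(3) A_carrier[OF assms(1)] by simp
qed

text \<open>With u = y/x, the product x^k u^k = y^k lies in A, so x^n clears the denominators of all
  polynomial expressions of degree below n in u.\<close>

lemma poly_span_denominator:
  assumes "x \<in> carrier R" "y \<in> carrier R" "u \<in> carrier Q" "\<iota> x \<otimes>\<^bsub>Q\<^esub> u = \<iota> y" "h \<in> poly_span n u"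
  shows "\<iota> (x [^] n) \<otimes>\<^bsub>Q\<^esub> h \<in> A"
proof -
  have pw: "\<iota> x [^]\<^bsub>Q\<^esub> k \<otimes>\<^bsub>Q\<^esub> u [^]\<^bsub>Q\<^esub> k \<in> A" for k :: nat
  proof -
    have "(\<iota> x \<otimes>\<^bsub>Q\<^esub> u) [^]\<^bsub>Q\<^esub> k \<in> A" using assms(2,4) by (intro A_pow) simp
    then show ?thesis using assms(1,3) by (simp add: Q.nat_pow_distrib)
  qed
  have xk: "\<iota> x [^]\<^bsub>Q\<^esub> k \<in> A" for k :: nat using assms(1) A_pow by simp
  have "\<iota> x [^]\<^bsub>Q\<^esub> length l \<otimes>\<^bsub>Q\<^esub> Q.eval l u \<in> A" if "set l \<subseteq> A" for l
    using that
  proof (induct l)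
    case Nil
    then show ?case using A_zero by simp
  next
    case (Cons c l)
    have m: "c \<in> carrier Q" "Q.eval l u \<in> carrier Q" "u [^]\<^bsub>Q\<^esub> length l \<in> carrier Q" "\<iota> x \<in> carrier Q"
       "\<iota> x [^]\<^bsub>Q\<^esub> length l \<in> carrier Q"
      using Cons A_carrier eval_carrier[of l u] assms by auto
    have "\<iota> x [^]\<^bsub>Q\<^esub> length (c # l) \<otimes>\<^bsub>Q\<^esub> Q.eval (c # l) u =
      (\<iota> x \<otimes>\<^bsub>Q\<^esub> c) \<otimes>\<^bsub>Q\<^esub> (\<iota> x [^]\<^bsub>Q\<^esub> length l \<otimes>\<^bsub>Q\<^esub> u [^]\<^bsub>Q\<^esub> length l) \<oplus>\<^bsub>Q\<^esub>
      \<iota> x \<otimes>\<^bsub>Q\<^esub> (\<iota> x [^]\<^bsub>Q\<^esub> length l \<otimes>\<^bsub>Q\<^esub> Q.eval l u)"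
      unfolding eval_Cons list.size add_0_right add_Suc_right Q.nat_pow_Suc using m by algebra
    also have "\<dots> \<in> A"
      using Cons assms(1) pw[of "length l"] by (intro A_add A_mult[OF A_mult pw] A_mult[of "\<iota> x"]) auto
    finally show ?case .
  qed
  then show ?thesis using assms(1,5) by (auto simp: poly_span_def)
qed

text \<open>An element c that maps the span of 1, ..., u^(n-1) into itself has all its powers there,
  since the span contains 1. The denominator x^n of the span then serves for every power of
  c.\<close>

lemma almost_integral_stable:
  assumes x: "x \<in> nonzerodivisors R" "y \<in> carrier R" "u \<in> carrier Q" "\<iota> x \<otimes>\<^bsub>Q\<^esub> u = \<iota> y"
    and c: "c \<in> carrier Q" "0 < n" "\<And>j. j < n \<Longrightarrow> c \<otimes>\<^bsub>Q\<^esub> u [^]\<^bsub>Q\<^esub> j \<in> poly_span n u"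
  shows "c \<in> almost_integral"
proof -
  have xc: "x \<in> carrier R" using x(1) by (rule R.nonzerodivisorsD)
  have ev: "c \<otimes>\<^bsub>Q\<^esub> Q.eval l u \<in> poly_span n u" if "set l \<subseteq> A" "length l \<le> n" for l
    using that
  proof (induct l)
    case Nil
    have "Q.eval [] u \<in> poly_span n u" by (rule poly_spanI) (use x in auto)
    then show ?case using c(1) by simp
  next
    case (Cons a l)
    have m: "a \<in> carrier Q" "Q.eval l u \<in> carrier Q" "u [^]\<^bsub>Q\<^esub> length l \<in> carrier Q"
      using Cons A_carrier eval_carrier[of l u] x(3) by auto
    have "c \<otimes>\<^bsub>Q\<^esub> Q.eval (a # l) u = a \<otimes>\<^bsub>Q\<^esub> (c \<otimes>\<^bsub>Q\<^esub> u [^]\<^bsub>Q\<^esub> length l) \<oplus>\<^bsub>Q\<^esub> c \<otimes>\<^bsub>Q\<^esub> Q.eval l u"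
      unfolding eval_Cons using m c(1) by algebra
    also have "\<dots> \<in> poly_span n u"
      using Cons c(3)[of "length l"] x(3) by (intro poly_span_add[OF poly_span_mult]) auto
    finally show ?case .
  qed
  have "c [^]\<^bsub>Q\<^esub> k \<in> poly_span n u" for k :: nat
  proof (induct k)
    case 0
    have "Q.eval [\<one>\<^bsub>Q\<^esub>] u \<in> poly_span n u" by (rule poly_spanI) (use x(3) c(2) A_one in auto)
    then show ?case using x(3) by simp
  next
    case (Suc k)
    then obtain l where "set l \<subseteq> A" "length l = n" "c [^]\<^bsub>Q\<^esub> k = Q.eval l u" by (auto simp: poly_span_def)
    then show ?case using ev[of l] c(1) eval_carrier[of l u] x(3) by (simp add: Q.m_comm)
  qed
  then have "\<iota> (x [^] n) \<otimes>\<^bsub>Q\<^esub> c [^]\<^bsub>Q\<^esub> k \<in> A" for k :: nat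
    using poly_span_denominator[OF xc x(2-4)] by blast
  then show ?thesis using c(1) R.pow_nonzerodivisor[OF x(1)] unfolding almost_integral_def by blast
qed

text \<open>If \<open>u\<close> is a root of a polynomial, the values at \<open>u\<close> of its truncations multiply the module
  spanned by \<open>1, u, \<dots>, u\<^bsup>n-1\<^esup>\<close> into itself.\<close>

lemma prefix_almost_integral:
  assumes x: "x \<in> nonzerodivisors R" "y \<in> carrier R" "u \<in> carrier Q" "\<iota> x \<otimes>\<^bsub>Q\<^esub> u = \<iota> y"
    and l: "set (l1 @ l2) \<subseteq> A" "Q.eval (l1 @ l2) u = \<zero>\<^bsub>Q\<^esub>" "1 < length (l1 @ l2)"
  shows "Q.eval l1 u \<in> almost_integral"
proof (rule almost_integral_stable[OF x, of _ "length (l1 @ l2) - 1"])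
  have l12: "set l1 \<subseteq> A" "set l2 \<subseteq> A" using l by auto
  note ec = eval_carrier[OF l12(1) x(3)] eval_carrier[OF l12(2) x(3)]
  show "Q.eval l1 u \<in> carrier Q" "0 < length (l1 @ l2) - 1" using ec l by auto
  fix j assume j: "j < length (l1 @ l2) - 1"
  show "Q.eval l1 u \<otimes>\<^bsub>Q\<^esub> u [^]\<^bsub>Q\<^esub> j \<in> poly_span (length (l1 @ l2) - 1) u"
  proof (cases "j < length l2")
    case True
    have "Q.eval (l1 @ replicate j \<zero>\<^bsub>Q\<^esub>) u \<in> poly_span (length (l1 @ l2) - 1) u"
      using True j l12 A_zero x(3) by (intro poly_spanI) (auto simp: set_replicate_conv_if)
    then show ?thesis using eval_append_zeros[OF l12(1) x(3)] by simp
  next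
    case False
    \<comment> \<open>For large j the relation is used to trade the value of l1 times u^(length l2)
      for minus the value of l2. For small j the product was already the value of a list that is
      short enough.\<close>
    define i where "i = j - length l2"
    have ji: "j = length l2 + i" using False by (simp add: i_def)
    have pc: "u [^]\<^bsub>Q\<^esub> length l2 \<in> carrier Q" "u [^]\<^bsub>Q\<^esub> i \<in> carrier Q" using x(3) by auto
    have "Q.eval l1 u \<otimes>\<^bsub>Q\<^esub> u [^]\<^bsub>Q\<^esub> length l2 \<oplus>\<^bsub>Q\<^esub> Q.eval l2 u = \<zero>\<^bsub>Q\<^esub>"
      using Q.eval_append[OF set_A_carrier[OF l12(1)] set_A_carrier[OF l12(2)] x(3)] l(2) by simp
    then have *: "Q.eval l1 u \<otimes>\<^bsub>Q\<^esub> u [^]\<^bsub>Q\<^esub> length l2 = \<ominus>\<^bsub>Q\<^esub> Q.eval l2 u"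
      using ec pc by (metis Q.minus_equality Q.m_closed)
    have "Q.eval l1 u \<otimes>\<^bsub>Q\<^esub> u [^]\<^bsub>Q\<^esub> j = (Q.eval l1 u \<otimes>\<^bsub>Q\<^esub> u [^]\<^bsub>Q\<^esub> length l2) \<otimes>\<^bsub>Q\<^esub> u [^]\<^bsub>Q\<^esub> i"
      using ec pc x(3) by (simp add: ji Q.nat_pow_mult[symmetric] Q.m_assoc)
    also have "\<dots> = (\<ominus>\<^bsub>Q\<^esub> \<one>\<^bsub>Q\<^esub>) \<otimes>\<^bsub>Q\<^esub> (Q.eval l2 u \<otimes>\<^bsub>Q\<^esub> u [^]\<^bsub>Q\<^esub> i)"
      unfolding * using ec pc by (simp add: Q.l_minus)
    also have "\<dots> = (\<ominus>\<^bsub>Q\<^esub> \<one>\<^bsub>Q\<^esub>) \<otimes>\<^bsub>Q\<^esub> Q.eval (l2 @ replicate i \<zero>\<^bsub>Q\<^esub>) u"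
      using eval_append_zeros[OF l12(2) x(3)] by simp
    also have "\<dots> \<in> poly_span (length (l1 @ l2) - 1) u"
      using j ji l12 A_zero x(3) A_uminus[OF A_one]
      by (intro poly_span_mult poly_spanI) (auto simp: set_replicate_conv_if)
    finally show ?thesis .
  qed
qed

section \<open>Integral and almost integral elements\<close>

lemma poly_span_mono: "m \<le> n \<Longrightarrow> u \<in> carrier Q \<Longrightarrow> poly_span m u \<subseteq> poly_span n u"
  using poly_spanI by (force simp: poly_span_def)

lemma power_in_poly_span: "j < n \<Longrightarrow> u \<in> carrier Q \<Longrightarrow> u [^]\<^bsub>Q\<^esub> j \<in> poly_span n u"
proof -
  assume j: "j < n" and u: "u \<in> carrier Q"
  have "Q.eval ([\<one>\<^bsub>Q\<^esub>] @ replicate j \<zero>\<^bsub>Q\<^esub>) u \<in> poly_span n u"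
    using j u A_one A_zero by (intro poly_spanI) (auto simp: set_replicate_conv_if)
  then show ?thesis using eval_append_zeros[of "[\<one>\<^bsub>Q\<^esub>]" u j] A_one u by simp
qed

text \<open>A monic equation of degree n expresses q^n by lower powers, so multiplication by q
  preserves the span of 1, ..., q^(n-1).\<close>

lemma integral_imp_almost_integral:
  assumes "q \<in> integral_closure A Q"
  shows "q \<in> almost_integral"
proof -
  obtain p where p: "q \<in> carrier Q" "polynomial\<^bsub>Q\<^esub> A p" "p \<noteq> []" "lead_coeff p = \<one>\<^bsub>Q\<^esub>" "Q.eval p q = \<zero>\<^bsub>Q\<^esub>"
    using assms by (auto simp: integral_closure_def)
  then obtain l where l: "p = \<one>\<^bsub>Q\<^esub> # l" by (cases p) auto
  have lA: "set l \<subseteq> A" using p(2) l by (auto simp: polynomial_def)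
  have ev: "q [^]\<^bsub>Q\<^esub> length l \<oplus>\<^bsub>Q\<^esub> Q.eval l q = \<zero>\<^bsub>Q\<^esub>"
    using p(1,5) unfolding l eval_Cons by simp
  show ?thesis
  proof (cases "l = []")
    \<comment> \<open>The equation is monic of degree 0 and reads 1 = 0, so Q is the zero
      ring.\<close>
    case True
    then have "\<one>\<^bsub>Q\<^esub> = \<zero>\<^bsub>Q\<^esub>" using ev by simp
    then have "q = \<zero>\<^bsub>Q\<^esub>" using p(1) Q.l_one Q.l_null by metis
    then show ?thesis using almost_integral_A[OF A_zero] by simp
  next
    case False
    obtain a s where as: "a \<in> carrier R" "s \<in> nonzerodivisors R" "q \<otimes>\<^bsub>Q\<^esub> \<iota> s = \<iota> a"
      using fractions[OF p(1)] by blast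
    show ?thesis
    proof (rule almost_integral_stable[OF as(2,1) p(1) _ p(1), of "length l"])
      show "\<iota> s \<otimes>\<^bsub>Q\<^esub> q = \<iota> a" using as(3) p(1) nzd_closed[OF as(2)] by (simp add: Q.m_comm)
      show "0 < length l" using False by simp
      fix j assume j: "j < length l"
      have eq: "q \<otimes>\<^bsub>Q\<^esub> q [^]\<^bsub>Q\<^esub> j = q [^]\<^bsub>Q\<^esub> Suc j" using p(1) by (simp add: Q.m_comm)
      show "q \<otimes>\<^bsub>Q\<^esub> q [^]\<^bsub>Q\<^esub> j \<in> poly_span (length l) q"
      proof (cases "Suc j = length l")
        case True
        have "q [^]\<^bsub>Q\<^esub> length l = \<ominus>\<^bsub>Q\<^esub> Q.eval l q"
          using ev p(1) eval_carrier[OF lA p(1)] by (metis Q.minus_equality Q.nat_pow_closed)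
        also have "\<dots> = (\<ominus>\<^bsub>Q\<^esub> \<one>\<^bsub>Q\<^esub>) \<otimes>\<^bsub>Q\<^esub> Q.eval l q"
          using eval_carrier[OF lA p(1)] by (simp add: Q.l_minus)
        also have "\<dots> \<in> poly_span (length l) q"
          using lA p(1) A_uminus[OF A_one] by (intro poly_span_mult poly_spanI) auto
        finally show ?thesis using eq True by simp
      next
        case False
        then show ?thesis using eq power_in_poly_span[of "Suc j" "length l" q] j p(1) by simp
      qed
    qed
  qed
qed

text \<open>The part of d times \<open>poly_span n q\<close> that lies in R, as an ideal of R. In
  this form the chain condition of R applies to it.\<close>

definition scaled_span :: "'a \<Rightarrow> 'c \<Rightarrow> nat \<Rightarrow> 'a set" where
  "scaled_span d q n = {x \<in> carrier R. \<exists>h\<in>poly_span n q. \<iota> x = \<iota> d \<otimes>\<^bsub>Q\<^esub> h}"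

lemma scaled_span_ideal:
  assumes "d \<in> carrier R" "q \<in> carrier Q"
  shows "ideal (scaled_span d q n) R"
proof (rule R.idealI_closure)
  show "scaled_span d q n \<subseteq> carrier R" by (auto simp: scaled_span_def)
  have "\<zero>\<^bsub>Q\<^esub> \<in> poly_span n q" using poly_spanI[of "[]" q n] assms by simp
  then show "\<zero> \<in> scaled_span d q n"
    using assms by (auto simp: scaled_span_def intro!: bexI[of _ "\<zero>\<^bsub>Q\<^esub>"])
  fix x assume "x \<in> scaled_span d q n"
  then obtain h where h: "x \<in> carrier R" "h \<in> poly_span n q" "\<iota> x = \<iota> d \<otimes>\<^bsub>Q\<^esub> h"
    by (auto simp: scaled_span_def)
  note hc = poly_span_carrier[OF h(2) assms(2)]
  { fix y assume "y \<in> scaled_span d q n"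
    then obtain g where g: "y \<in> carrier R" "g \<in> poly_span n q" "\<iota> y = \<iota> d \<otimes>\<^bsub>Q\<^esub> g"
      by (auto simp: scaled_span_def)
    then have "\<iota> (x \<oplus> y) = \<iota> d \<otimes>\<^bsub>Q\<^esub> (h \<oplus>\<^bsub>Q\<^esub> g)"
      using h hc poly_span_carrier[OF g(2) assms(2)] assms by (simp add: Q.r_distr)
    then show "x \<oplus> y \<in> scaled_span d q n"
      using g h poly_span_add[OF h(2) g(2) assms(2)] by (auto simp: scaled_span_def) }
  fix r assume r: "r \<in> carrier R"
  then have "\<iota> (r \<otimes> x) = \<iota> d \<otimes>\<^bsub>Q\<^esub> (\<iota> r \<otimes>\<^bsub>Q\<^esub> h)"
    using h hc assms by (simp add: Q.m_lcomm)
  then show "r \<otimes> x \<in> scaled_span d q n"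
    using h r poly_span_mult[OF _ h(2) assms(2), of "\<iota> r"] by (auto simp: scaled_span_def)
qed

text \<open>The ideals \<open>scaled_span d q n\<close> become stationary. Since d q^n is in R, it
  lies in the ideal of index n + 1 and hence in the one of index n; cancelling d writes q^n through
  lower powers. The leading coefficient 1 must be nonzero for \<open>polynomial\<close>.\<close>

lemma almost_integral_imp_integral:
  assumes "noetherian_ring R" "q \<in> almost_integral" "\<one> \<noteq> \<zero>"
  shows "q \<in> integral_closure A Q"
proof -
  interpret N: noetherian_ring R by fact
  obtain d where d: "q \<in> carrier Q" "d \<in> nonzerodivisors R" "\<And>n::nat. \<iota> d \<otimes>\<^bsub>Q\<^esub> q [^]\<^bsub>Q\<^esub> n \<in> A"
    using assms(2) by (auto simp: almost_integral_def)
  note dc = R.nonzerodivisorsD(1)[OF d(2)]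
  have "scaled_span d q n \<subseteq> scaled_span d q (Suc n)" for n
    using poly_span_mono[of n "Suc n" q] d(1) by (auto simp: scaled_span_def)
  then obtain n where n: "\<And>k. n \<le> k \<Longrightarrow> scaled_span d q k = scaled_span d q n"
    using N.ideal_sequence_stationary[of "scaled_span d q"] scaled_span_ideal[OF dc d(1)] by metis
  obtain x where x: "x \<in> carrier R" "\<iota> x = \<iota> d \<otimes>\<^bsub>Q\<^esub> q [^]\<^bsub>Q\<^esub> n" using d(3)[of n] by auto
  have "x \<in> scaled_span d q (Suc n)"
    using x power_in_poly_span[of n "Suc n" q] d(1) by (auto simp: scaled_span_def)
  then have "x \<in> scaled_span d q n" using n[of "Suc n"] by simp
  then obtain l where l: "set l \<subseteq> A" "length l = n" "\<iota> x = \<iota> d \<otimes>\<^bsub>Q\<^esub> Q.eval l q"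
    by (auto simp: scaled_span_def poly_span_def)
  have eq: "q [^]\<^bsub>Q\<^esub> n = Q.eval l q"
    using unit_cancel[OF d(2)] x(2) l(3) eval_carrier[OF l(1) d(1)] d(1) by simp
  have m: "\<ominus>\<^bsub>Q\<^esub> \<one>\<^bsub>Q\<^esub> \<in> A" using A_uminus A_one by simp
  let ?p = "\<one>\<^bsub>Q\<^esub> # map ((\<otimes>\<^bsub>Q\<^esub>) (\<ominus>\<^bsub>Q\<^esub> \<one>\<^bsub>Q\<^esub>)) l"
  have "\<one>\<^bsub>Q\<^esub> \<noteq> \<zero>\<^bsub>Q\<^esub>" using inj_eq[of \<one> \<zero>] assms(3) by simp
  moreover have "set ?p \<subseteq> A" using l(1) A_mult[OF m] A_one by auto
  ultimately have "polynomial\<^bsub>Q\<^esub> A ?p" by (simp add: polynomial_def)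
  moreover have "Q.eval ?p q = q [^]\<^bsub>Q\<^esub> n \<oplus>\<^bsub>Q\<^esub> (\<ominus>\<^bsub>Q\<^esub> \<one>\<^bsub>Q\<^esub>) \<otimes>\<^bsub>Q\<^esub> Q.eval l q"
    unfolding eval_Cons using eval_map_mult[OF l(1) d(1), of "\<ominus>\<^bsub>Q\<^esub> \<one>\<^bsub>Q\<^esub>"] l(2) d(1) by simp
  then have "Q.eval ?p q = \<zero>\<^bsub>Q\<^esub>"
    using eq eval_carrier[OF l(1) d(1)] by (simp add: Q.l_minus Q.r_neg)
  ultimately show ?thesis
    unfolding integral_closure_def using d(1) by (intro CollectI conjI exI[of _ ?p]) auto
qed

text \<open>I is the part of d R[q] that lies in R. It contains d, and it is stable under q because
  all d q^n are in R. The stability under q = a/s is phrased inside R.\<close>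

lemma almost_integral_ideal:
  assumes "q \<in> almost_integral" "a \<in> carrier R" "s \<in> carrier R" "\<iota> s \<otimes>\<^bsub>Q\<^esub> q = \<iota> a"
  obtains I d where "ideal I R" "d \<in> I" "d \<in> nonzerodivisors R"
    "\<And>x. x \<in> I \<Longrightarrow> \<exists>x'\<in>I. a \<otimes> x = s \<otimes> x'"
proof -
  obtain d where d: "q \<in> carrier Q" "d \<in> nonzerodivisors R" "\<And>n::nat. \<iota> d \<otimes>\<^bsub>Q\<^esub> q [^]\<^bsub>Q\<^esub> n \<in> A"
    using assms by (auto simp: almost_integral_def)
  note dc = R.nonzerodivisorsD(1)[OF d(2)]
  have span: "\<iota> d \<otimes>\<^bsub>Q\<^esub> Q.eval l q \<in> A" if "set l \<subseteq> A" for l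
    using that
  proof (induct l)
    case Nil
    then show ?case using dc A_zero by simp
  next
    case (Cons c l)
    have m: "c \<in> carrier Q" "Q.eval l q \<in> carrier Q" "q [^]\<^bsub>Q\<^esub> length l \<in> carrier Q" "\<iota> d \<in> carrier Q"
      using Cons A_carrier eval_carrier[of l q] d(1) dc by auto
    have "\<iota> d \<otimes>\<^bsub>Q\<^esub> Q.eval (c # l) q = c \<otimes>\<^bsub>Q\<^esub> (\<iota> d \<otimes>\<^bsub>Q\<^esub> q [^]\<^bsub>Q\<^esub> length l) \<oplus>\<^bsub>Q\<^esub> \<iota> d \<otimes>\<^bsub>Q\<^esub> Q.eval l q"
      unfolding eval_Cons using m by algebra
    also have "\<dots> \<in> A" using Cons d(3) by (intro A_add A_mult[of c]) auto
    finally show ?case .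
  qed
  let ?I = "\<Union>n. scaled_span d q n"
  have mono: "m \<le> n \<Longrightarrow> scaled_span d q m \<subseteq> scaled_span d q n" for m n
    using poly_span_mono[of m n q] d(1) by (auto simp: scaled_span_def)
  show ?thesis
  proof (rule that[OF _ _ d(2)])
    note si = R.idealD[OF scaled_span_ideal[OF dc d(1)]]
    show "ideal ?I R"
    proof (rule R.idealI_closure)
      show "?I \<subseteq> carrier R" "\<zero> \<in> ?I" using si(1,2) by auto
      fix x assume "x \<in> ?I"
      then obtain m where m: "x \<in> scaled_span d q m" by auto
      { fix y assume "y \<in> ?I"
        then obtain n where n: "y \<in> scaled_span d q n" by auto
        have "x \<in> scaled_span d q (max m n)" "y \<in> scaled_span d q (max m n)"
          using m n mono[of m "max m n"] mono[of n "max m n"] by auto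
        then show "x \<oplus> y \<in> ?I" using si(3) by auto }
      show "\<And>r. r \<in> carrier R \<Longrightarrow> r \<otimes> x \<in> ?I" using si(4) m by auto
    qed
    have "\<one>\<^bsub>Q\<^esub> \<in> poly_span 1 q" using power_in_poly_span[of 0 1 q] d(1) by simp
    then have "d \<in> scaled_span d q 1"
      using dc by (auto simp: scaled_span_def intro!: bexI[of _ "\<one>\<^bsub>Q\<^esub>"])
    then show "d \<in> ?I" by blast
    fix x assume "x \<in> ?I"
    then obtain l where l: "x \<in> carrier R" "set l \<subseteq> A" "\<iota> x = \<iota> d \<otimes>\<^bsub>Q\<^esub> Q.eval l q"
      by (auto simp: scaled_span_def poly_span_def)
    have l': "set (l @ [\<zero>\<^bsub>Q\<^esub>]) \<subseteq> A" using l(2) A_zero by auto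
    have ev: "Q.eval (l @ [\<zero>\<^bsub>Q\<^esub>]) q = Q.eval l q \<otimes>\<^bsub>Q\<^esub> q"
      using eval_append_zeros[OF l(2) d(1), of 1] d(1) by simp
    obtain x' where x': "x' \<in> carrier R" "\<iota> x' = \<iota> d \<otimes>\<^bsub>Q\<^esub> Q.eval (l @ [\<zero>\<^bsub>Q\<^esub>]) q"
      using span[OF l'] by auto
    have "x' \<in> scaled_span d q (length (l @ [\<zero>\<^bsub>Q\<^esub>]))"
      unfolding scaled_span_def poly_span_def using x' l' by blast
    moreover have "\<iota> (a \<otimes> x) = \<iota> (s \<otimes> x')"
    proof -
      have c: "\<iota> s \<in> carrier Q" "\<iota> d \<in> carrier Q" "Q.eval l q \<in> carrier Q"
        using assms(3) dc eval_carrier[OF l(2) d(1)] by auto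
      have "\<iota> (a \<otimes> x) = (\<iota> s \<otimes>\<^bsub>Q\<^esub> q) \<otimes>\<^bsub>Q\<^esub> (\<iota> d \<otimes>\<^bsub>Q\<^esub> Q.eval l q)"
        using assms l by simp
      also have "\<dots> = \<iota> s \<otimes>\<^bsub>Q\<^esub> (\<iota> d \<otimes>\<^bsub>Q\<^esub> (Q.eval l q \<otimes>\<^bsub>Q\<^esub> q))"
        using c d(1) by algebra
      also have "\<dots> = \<iota> (s \<otimes> x')" using x' ev assms(3) by simp
      finally show ?thesis .
    qed
    then have "a \<otimes> x = s \<otimes> x'" using inj_eq[of "a \<otimes> x" "s \<otimes> x'"] assms(2,3) l(1) x'(1) by blast
    ultimately show "\<exists>x'\<in>?I. a \<otimes> x = s \<otimes> x'" by blast
  qed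
qed

lemma common_denominator:
  assumes "\<And>i. i < p \<Longrightarrow> q i \<in> carrier Q"
  obtains s a where "s \<in> nonzerodivisors R" "\<And>i. i < p \<Longrightarrow> a i \<in> carrier R"
    "\<And>i. i < (p::nat) \<Longrightarrow> \<iota> s \<otimes>\<^bsub>Q\<^esub> q i = \<iota> (a i)"
proof -
  have "\<exists>s\<in>nonzerodivisors R. \<forall>i<p. \<iota> s \<otimes>\<^bsub>Q\<^esub> q i \<in> A"
    using assms
  proof (induct p)
    case 0
    then show ?case using R.one_nonzerodivisor by auto
  next
    case (Suc p)
    then obtain s where s: "s \<in> nonzerodivisors R" "\<And>i. i < p \<Longrightarrow> \<iota> s \<otimes>\<^bsub>Q\<^esub> q i \<in> A" by auto
    obtain a t where at: "a \<in> carrier R" "t \<in> nonzerodivisors R" "q p \<otimes>\<^bsub>Q\<^esub> \<iota> t = \<iota> a"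
      using fractions Suc by blast
    have c: "s \<in> carrier R" "t \<in> carrier R" using s at by (auto dest: R.nonzerodivisorsD(1))
    have "\<iota> (s \<otimes> t) \<otimes>\<^bsub>Q\<^esub> q i \<in> A" if i: "i < Suc p" for i
    proof (cases "i = p")
      case True
      have "\<iota> (s \<otimes> t) \<otimes>\<^bsub>Q\<^esub> q p = \<iota> s \<otimes>\<^bsub>Q\<^esub> (q p \<otimes>\<^bsub>Q\<^esub> \<iota> t)"
        using c Suc(2)[of p] by (simp add: Q.m_ac)
      then show ?thesis using True at c A_mult[of "\<iota> s" "\<iota> a"] by simp
    next
      case False
      have "\<iota> (s \<otimes> t) \<otimes>\<^bsub>Q\<^esub> q i = \<iota> t \<otimes>\<^bsub>Q\<^esub> (\<iota> s \<otimes>\<^bsub>Q\<^esub> q i)"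
        using c Suc(2)[of i] i by (simp add: Q.m_ac)
      then show ?thesis using False i s(2)[of i] c A_mult[of "\<iota> t" "\<iota> s \<otimes>\<^bsub>Q\<^esub> q i"] by simp
    qed
    then show ?case using R.mult_nonzerodivisor[OF s(1) at(2)] by blast
  qed
  then obtain s where s: "s \<in> nonzerodivisors R" "\<forall>i. \<exists>a. i < p \<longrightarrow> a \<in> carrier R \<and> \<iota> s \<otimes>\<^bsub>Q\<^esub> q i = \<iota> a"
    by blast
  then obtain a where "\<forall>i. i < p \<longrightarrow> a i \<in> carrier R \<and> \<iota> s \<otimes>\<^bsub>Q\<^esub> q i = \<iota> (a i)" by metis
  then show ?thesis using that[OF s(1), of a] by blast
qed

end

section \<open>Finitely generated ideals of the normalization are projective\<close>

locale normalization_dim1 = fraction_ring R Q \<iota> + reduced_local_dim1 R \<mm>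
  for R (structure) and Q (structure) and \<iota> and \<mm>
begin

text \<open>The element \<open>\<alpha>\<close> splits the normalization into a part where \<open>u\<close> is integral and a part where
  \<open>1/u\<close> is integral.\<close>

lemma integral_dichotomy:
  assumes x: "x \<in> nonzerodivisors R" "y \<in> carrier R" "u \<in> carrier Q" "\<iota> x \<otimes>\<^bsub>Q\<^esub> u = \<iota> y"
  shows "\<exists>\<alpha> \<gamma>. \<alpha> \<in> almost_integral \<and> \<gamma> \<in> almost_integral \<and> \<alpha> \<otimes>\<^bsub>Q\<^esub> u \<in> almost_integral \<and>
     \<gamma> \<otimes>\<^bsub>Q\<^esub> u = \<one>\<^bsub>Q\<^esub> \<ominus>\<^bsub>Q\<^esub> \<alpha>"
proof -
  have xc: "x \<in> carrier R" using x(1) by (rule R.nonzerodivisorsD)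
  obtain t where t: "t \<in> \<mm>" "t \<in> nonzerodivisors R" using exists_nonzerodivisor_in_max by auto
  obtain e where e: "0 < e" "\<And>v. (\<And>i. i \<le> e \<Longrightarrow> v i \<in> carrier R) \<Longrightarrow> v 0 \<in> nonzerodivisors R \<Longrightarrow>
     \<exists>r. (\<forall>i\<le>e. r i \<in> carrier R) \<and> R.dot r v (Suc e) = \<zero> \<and> (\<exists>i\<le>e. r i \<notin> \<mm>)"
    using primitive_relation[OF t] by metis
  \<comment> \<open>v i equals x^e u^i, so a relation among the v i says that u is a root of the
    polynomial with coefficients r i, one of which is a unit.\<close>
  define v where "v i = y [^] i \<otimes> x [^] (e - i)" for i :: nat
  have vc: "v i \<in> carrier R" for i using x(2) xc by (simp add: v_def)
  have "v 0 \<in> nonzerodivisors R" using R.pow_nonzerodivisor[OF x(1)] xc by (simp add: v_def)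
  then obtain r where r: "\<And>i. i \<le> e \<Longrightarrow> r i \<in> carrier R" "R.dot r v (Suc e) = \<zero>" "\<exists>i\<le>e. r i \<notin> \<mm>"
    using e(2)[of v] vc by blast
  \<comment> \<open>The list r (k-1), ..., r 0, highest coefficient first as \<open>eval\<close>
    expects it.\<close>
  define L where "L k = rev (map (\<lambda>i. \<iota> (r i)) [0..<k])" for k
  have L_Suc: "L (Suc k) = \<iota> (r k) # L k" for k by (simp add: L_def)
  have len: "length (L k) = k" for k by (simp add: L_def)
  have LA: "set (L k) \<subseteq> A" if "k \<le> Suc e" for k
    using that r(1) by (auto simp: L_def)
  have ux: "\<iota> x [^]\<^bsub>Q\<^esub> k \<in> carrier Q" "u [^]\<^bsub>Q\<^esub> k \<in> carrier Q" for k :: nat using xc x(3) by auto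
  have dotL: "\<iota> (R.dot r v k) = \<iota> x [^]\<^bsub>Q\<^esub> e \<otimes>\<^bsub>Q\<^esub> Q.eval (L k) u" if "k \<le> Suc e" for k
    using that
  proof (induct k)
    case 0
    then show ?case using ux by (simp add: L_def)
  next
    case (Suc k)
    have rk: "r k \<in> carrier R" using Suc r(1) by simp
    have ec: "Q.eval (L k) u \<in> carrier Q" using eval_carrier[OF LA x(3)] Suc by simp
    have "\<iota> (v k) = \<iota> y [^]\<^bsub>Q\<^esub> k \<otimes>\<^bsub>Q\<^esub> \<iota> x [^]\<^bsub>Q\<^esub> (e - k)"
      using x(2) xc by (simp add: v_def)
    also have "\<iota> y [^]\<^bsub>Q\<^esub> k = \<iota> x [^]\<^bsub>Q\<^esub> k \<otimes>\<^bsub>Q\<^esub> u [^]\<^bsub>Q\<^esub> k"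
      using x(3,4) xc by (simp add: Q.nat_pow_distrib flip: x(4))
    also have "(\<iota> x [^]\<^bsub>Q\<^esub> k \<otimes>\<^bsub>Q\<^esub> u [^]\<^bsub>Q\<^esub> k) \<otimes>\<^bsub>Q\<^esub> \<iota> x [^]\<^bsub>Q\<^esub> (e - k) =
       (\<iota> x [^]\<^bsub>Q\<^esub> k \<otimes>\<^bsub>Q\<^esub> \<iota> x [^]\<^bsub>Q\<^esub> (e - k)) \<otimes>\<^bsub>Q\<^esub> u [^]\<^bsub>Q\<^esub> k"
      using ux(1)[of k] ux(1)[of "e - k"] ux(2)[of k] by algebra
    also have "\<iota> x [^]\<^bsub>Q\<^esub> k \<otimes>\<^bsub>Q\<^esub> \<iota> x [^]\<^bsub>Q\<^esub> (e - k) = \<iota> x [^]\<^bsub>Q\<^esub> e"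
      using Suc(2) xc by (simp add: Q.nat_pow_mult)
    finally have iv: "\<iota> (v k) = \<iota> x [^]\<^bsub>Q\<^esub> e \<otimes>\<^bsub>Q\<^esub> u [^]\<^bsub>Q\<^esub> k" .
    have "\<iota> (R.dot r v (Suc k)) = \<iota> (R.dot r v k) \<oplus>\<^bsub>Q\<^esub> \<iota> (r k) \<otimes>\<^bsub>Q\<^esub> \<iota> (v k)"
      using rk vc Suc r(1) by simp
    also have "\<dots> = \<iota> x [^]\<^bsub>Q\<^esub> e \<otimes>\<^bsub>Q\<^esub> Q.eval (L k) u \<oplus>\<^bsub>Q\<^esub> \<iota> (r k) \<otimes>\<^bsub>Q\<^esub> (\<iota> x [^]\<^bsub>Q\<^esub> e \<otimes>\<^bsub>Q\<^esub> u [^]\<^bsub>Q\<^esub> k)"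
      using Suc iv by simp
    also have "\<dots> = \<iota> x [^]\<^bsub>Q\<^esub> e \<otimes>\<^bsub>Q\<^esub> (\<iota> (r k) \<otimes>\<^bsub>Q\<^esub> u [^]\<^bsub>Q\<^esub> k \<oplus>\<^bsub>Q\<^esub> Q.eval (L k) u)"
      using hom_closed[OF rk] ux(1)[of e] ux(2)[of k] ec by algebra
    finally show ?case unfolding L_Suc eval_Cons len .
  qed
  let ?l = "L (Suc e)"
  have lA: "set ?l \<subseteq> A" using LA by simp
  have "\<iota> (x [^] e) \<otimes>\<^bsub>Q\<^esub> Q.eval ?l u = \<iota> (x [^] e) \<otimes>\<^bsub>Q\<^esub> \<zero>\<^bsub>Q\<^esub>"
    using dotL[of "Suc e", unfolded r(2), symmetric] xc ux(1)[of e] by simp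
  then have l0: "Q.eval ?l u = \<zero>\<^bsub>Q\<^esub>"
    using unit_cancel[OF R.pow_nonzerodivisor[OF x(1)]] eval_carrier[OF lA x(3)] by blast
  have prefix: "Q.eval l1 u \<in> almost_integral" if "?l = l1 @ l2" for l1 l2
    by (rule prefix_almost_integral[OF x, of l1 l2]) (use that lA l0 len[of "Suc e"] e(1) in auto)
  obtain i where i: "i \<le> e" "r i \<notin> \<mm>" using r(3) by auto
  have "\<iota> (r i) \<in> set ?l"
    unfolding L_def set_rev set_map set_upt by (rule image_eqI[of _ _ i]) (use i(1) in auto)
  then obtain l1 l2 where l12: "?l = l1 @ \<iota> (r i) # l2" by (auto simp: in_set_conv_decomp)
  have l1A: "set l1 \<subseteq> A" "set l2 \<subseteq> A" using lA l12 by auto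
  have ri: "r i \<in> Units R" using not_max_Unit i r(1) by simp
  let ?w = "\<iota> (inv r i)"
  have w: "?w \<in> A" "?w \<in> carrier Q" "\<iota> (r i) \<in> A" "\<iota> (r i) \<in> carrier Q" "?w \<otimes>\<^bsub>Q\<^esub> \<iota> (r i) = \<one>\<^bsub>Q\<^esub>"
    using ri R.Units_l_inv[OF ri] hom_mult[of "inv r i" "r i"] by auto
  \<comment> \<open>Truncations of the polynomial just above and just below the unit coefficient, so
    ?c' = ?c u + r i. Dividing by r i gives 1 - ?c' / r i = (- ?c / r i) u, and these two quotients
    are the required \<alpha> and \<gamma>.\<close>
  let ?c = "Q.eval l1 u" and ?c' = "Q.eval (l1 @ [\<iota> (r i)]) u"
  have ai: "?c \<in> almost_integral" "?c' \<in> almost_integral"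
    using prefix[of l1 "\<iota> (r i) # l2"] prefix[of "l1 @ [\<iota> (r i)]" l2] l12 by auto
  have cc: "?c \<in> carrier Q" "?c' \<in> carrier Q" using ai almost_integral_carrier by auto
  have app: "Q.eval (l @ [b]) u = Q.eval l u \<otimes>\<^bsub>Q\<^esub> u \<oplus>\<^bsub>Q\<^esub> b" if "set l \<subseteq> A" "b \<in> A" for l b
    using Q.eval_append[OF set_A_carrier[OF that(1)], of "[b]" u] that(2) A_carrier x(3) by simp
  have c': "?c' = ?c \<otimes>\<^bsub>Q\<^esub> u \<oplus>\<^bsub>Q\<^esub> \<iota> (r i)" using app[OF l1A(1) w(3)] .
  \<comment> \<open>Either r i is the last coefficient and ?c' is the value 0 of the whole
    polynomial, or ?c' u differs from the value of the next truncation by an element of A.\<close>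
  have c'u: "?c' \<otimes>\<^bsub>Q\<^esub> u \<in> almost_integral"
  proof (cases l2)
    case Nil
    then have "?c' = \<zero>\<^bsub>Q\<^esub>" using l0 l12 by simp
    then show ?thesis using x(3) almost_integral_A[OF A_zero] by simp
  next
    case (Cons b l3)
    have b: "b \<in> A" using l1A(2) Cons by simp
    have s: "set (l1 @ [\<iota> (r i)]) \<subseteq> A" using l1A w by auto
    have "Q.eval ((l1 @ [\<iota> (r i)]) @ [b]) u \<in> almost_integral"
      using prefix[of "(l1 @ [\<iota> (r i)]) @ [b]" l3] l12 Cons by simp
    then have "(?c' \<otimes>\<^bsub>Q\<^esub> u \<oplus>\<^bsub>Q\<^esub> b) \<ominus>\<^bsub>Q\<^esub> b \<in> almost_integral"
      unfolding app[OF s b] using almost_integral_A[OF b] by (rule almost_integral_minus)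
    moreover have "(?c' \<otimes>\<^bsub>Q\<^esub> u \<oplus>\<^bsub>Q\<^esub> b) \<ominus>\<^bsub>Q\<^esub> b = ?c' \<otimes>\<^bsub>Q\<^esub> u"
      using cc(2) x(3) A_carrier[OF b] by algebra
    ultimately show ?thesis by simp
  qed
  show ?thesis
  proof (intro exI conjI)
    show "?w \<otimes>\<^bsub>Q\<^esub> ?c' \<in> almost_integral" "\<ominus>\<^bsub>Q\<^esub> (?w \<otimes>\<^bsub>Q\<^esub> ?c) \<in> almost_integral"
      using almost_integral_mult[OF almost_integral_A[OF w(1)] ai(1)]
        almost_integral_mult[OF almost_integral_A[OF w(1)] ai(2)] almost_integral_uminus by auto
    have "(?w \<otimes>\<^bsub>Q\<^esub> ?c') \<otimes>\<^bsub>Q\<^esub> u = ?w \<otimes>\<^bsub>Q\<^esub> (?c' \<otimes>\<^bsub>Q\<^esub> u)" using w cc x(3) by algebra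
    then show "(?w \<otimes>\<^bsub>Q\<^esub> ?c') \<otimes>\<^bsub>Q\<^esub> u \<in> almost_integral"
      using almost_integral_mult[OF almost_integral_A[OF w(1)] c'u] by simp
    have "(\<ominus>\<^bsub>Q\<^esub> (?w \<otimes>\<^bsub>Q\<^esub> ?c)) \<otimes>\<^bsub>Q\<^esub> u = ?w \<otimes>\<^bsub>Q\<^esub> \<iota> (r i) \<ominus>\<^bsub>Q\<^esub> ?w \<otimes>\<^bsub>Q\<^esub> ?c'"
      unfolding c' using w(2,4) cc x(3) by algebra
    then show "(\<ominus>\<^bsub>Q\<^esub> (?w \<otimes>\<^bsub>Q\<^esub> ?c)) \<otimes>\<^bsub>Q\<^esub> u = \<one>\<^bsub>Q\<^esub> \<ominus>\<^bsub>Q\<^esub> ?w \<otimes>\<^bsub>Q\<^esub> ?c'" using w(5) by simp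
  qed
qed

end

section \<open>Scalar products and dual bases of finitely generated ideals\<close>

context cring begin

lemma dot_add_left:
  "(\<And>i. i < k \<Longrightarrow> x i \<in> carrier R) \<Longrightarrow> (\<And>i. i < k \<Longrightarrow> x' i \<in> carrier R) \<Longrightarrow>
   (\<And>i. i < k \<Longrightarrow> y i \<in> carrier R) \<Longrightarrow> dot (\<lambda>i. x i \<oplus> x' i) y k = dot x y k \<oplus> dot x' y k"
  using module.lc_add_left[OF module_regular, of k x x' y] by simp

lemma dot_scale_left:
  "r \<in> carrier R \<Longrightarrow> (\<And>i. i < k \<Longrightarrow> x i \<in> carrier R) \<Longrightarrow> (\<And>i. i < k \<Longrightarrow> y i \<in> carrier R) \<Longrightarrow>
   dot (\<lambda>i. r \<otimes> x i) y k = r \<otimes> dot x y k"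
  using module.lc_scale_left[OF module_regular, of r k x y] by simp

lemma dot_add_right:
  "(\<And>i. i < k \<Longrightarrow> x i \<in> carrier R) \<Longrightarrow> (\<And>i. i < k \<Longrightarrow> y' i \<in> carrier R) \<Longrightarrow>
   (\<And>i. i < k \<Longrightarrow> y i \<in> carrier R) \<Longrightarrow> dot x (\<lambda>i. y i \<oplus> y' i) k = dot x y k \<oplus> dot x y' k"
  using module.lc_add_right[OF module_regular, of k x y' y] by simp

lemma dot_scale_right:
  "r \<in> carrier R \<Longrightarrow> (\<And>i. i < k \<Longrightarrow> x i \<in> carrier R) \<Longrightarrow> (\<And>i. i < k \<Longrightarrow> y i \<in> carrier R) \<Longrightarrow>
   dot x (\<lambda>i. r \<otimes> y i) k = r \<otimes> dot x y k"
  using module.lc_scale_right[OF module_regular, of r k x y] by simp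

lemma lin_dot:
  "(\<And>i. i < k \<Longrightarrow> y i \<in> carrier R) \<Longrightarrow> lin R (free_module R k) (regular_module R) (\<lambda>x. dot x y k)"
  using lin_lc_free[OF module_regular, of k y] by simp

lemma dot_image_ideal:
  assumes "\<And>i. i < k \<Longrightarrow> w i \<in> carrier R"
  shows "ideal {dot r w k | r. \<forall>i<k. r i \<in> carrier R} R"
proof (rule idealI_closure)
  show "{dot r w k | r. \<forall>i<k. r i \<in> carrier R} \<subseteq> carrier R" using assms by auto
  show "\<zero> \<in> {dot r w k | r. \<forall>i<k. r i \<in> carrier R}"
    using module.lc_zero_left[OF module_regular, of k "\<lambda>_. \<zero>" w] assms
    by (intro CollectI exI[of _ "\<lambda>_. \<zero>"]) auto
  fix x assume "x \<in> {dot r w k | r. \<forall>i<k. r i \<in> carrier R}"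
  then obtain r where r: "x = dot r w k" "\<forall>i<k. r i \<in> carrier R" by auto
  { fix y assume "y \<in> {dot r w k | r. \<forall>i<k. r i \<in> carrier R}"
    then obtain s where s: "y = dot s w k" "\<forall>i<k. s i \<in> carrier R" by auto
    have "x \<oplus> y = dot (\<lambda>i. r i \<oplus> s i) w k" using r s assms by (simp add: dot_add_left)
    then show "x \<oplus> y \<in> {dot r w k | r. \<forall>i<k. r i \<in> carrier R}"
      using r s by (intro CollectI exI[of _ "\<lambda>i. r i \<oplus> s i"]) auto }
  fix c assume c: "c \<in> carrier R"
  then have "c \<otimes> x = dot (\<lambda>i. c \<otimes> r i) w k" using r assms by (simp add: dot_scale_left)
  then show "c \<otimes> x \<in> {dot r w k | r. \<forall>i<k. r i \<in> carrier R}"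
    using r c by (intro CollectI exI[of _ "\<lambda>i. c \<otimes> r i"]) auto
qed

lemma dot_unit:
  assumes "j < k" "\<And>i. i < k \<Longrightarrow> w i \<in> carrier R"
  shows "dot (\<lambda>i. if i = j then \<one> else \<zero>) w k = w j"
  using module.lc_unit[OF module_regular assms(1), of w] assms(2) by simp

end

lemma (in fraction_ring) hom_dot:
  "(\<And>i. i < k \<Longrightarrow> x i \<in> carrier R) \<Longrightarrow> (\<And>i. i < k \<Longrightarrow> y i \<in> carrier R) \<Longrightarrow>
   \<iota> (R.dot x y k) = Q.dot (\<lambda>i. \<iota> (x i)) (\<lambda>i. \<iota> (y i)) k"
  by (induct k) auto

context normalization_dim1 begin

text \<open>The ideal of S generated by regular elements a i is invertible, with the y i generating
  the inverse. In the induction, \<open>integral_dichotomy\<close> for the quotient of the new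
  generator z by each a j decides which part of the j-th summand of 1 is handed over to z.\<close>

lemma regular_dual_basis:
  assumes "\<And>i. i \<le> p \<Longrightarrow> a i \<in> nonzerodivisors R"
  shows "\<exists>y. (\<forall>i\<le>p. y i \<in> carrier Q) \<and> (\<forall>i\<le>p. \<forall>j\<le>p. y i \<otimes>\<^bsub>Q\<^esub> \<iota> (a j) \<in> almost_integral) \<and>
     Q.dot y (\<lambda>i. \<iota> (a i)) (Suc p) = \<one>\<^bsub>Q\<^esub>"
  using assms
proof (induct p)
  case 0
  have u: "\<iota> (a 0) \<in> Units Q" using units 0 by simp
  show ?case
    using u almost_integral_A[OF A_one] by (intro exI[of _ "\<lambda>_. inv\<^bsub>Q\<^esub> \<iota> (a 0)"]) auto
next
  case (Suc p)
  let ?b = "\<lambda>i. \<iota> (a i)"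
  obtain y where y: "\<And>i. i \<le> p \<Longrightarrow> y i \<in> carrier Q"
    "\<And>i j. i \<le> p \<Longrightarrow> j \<le> p \<Longrightarrow> y i \<otimes>\<^bsub>Q\<^esub> ?b j \<in> almost_integral" "Q.dot y ?b (Suc p) = \<one>\<^bsub>Q\<^esub>"
    using Suc(1)[OF Suc(2)[OF le_SucI]] by blast
  have ac: "a i \<in> carrier R" "?b i \<in> carrier Q" if "i \<le> Suc p" for i
    using Suc(2)[OF that] by (auto dest: R.nonzerodivisorsD(1))
  let ?z = "?b (Suc p)"
  have zc: "?z \<in> carrier Q" using ac by simp
  have "\<exists>u \<alpha> \<gamma>. u \<in> carrier Q \<and> u \<otimes>\<^bsub>Q\<^esub> ?b j = ?z \<and> \<alpha> \<in> almost_integral \<and> \<gamma> \<in> almost_integral \<and>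
      \<alpha> \<otimes>\<^bsub>Q\<^esub> u \<in> almost_integral \<and> \<gamma> \<otimes>\<^bsub>Q\<^esub> u = \<one>\<^bsub>Q\<^esub> \<ominus>\<^bsub>Q\<^esub> \<alpha>" (is "\<exists>u \<alpha> \<gamma>. ?P j u \<alpha> \<gamma>") if j: "j \<le> p" for j
  proof -
    have un: "?b j \<in> Units Q" using units Suc(2) j by simp
    let ?u = "inv\<^bsub>Q\<^esub> (?b j) \<otimes>\<^bsub>Q\<^esub> ?z"
    have uc: "?u \<in> carrier Q" using un zc by simp
    have e: "?b j \<otimes>\<^bsub>Q\<^esub> ?u = ?z" using un zc Q.Units_closed[OF un] by (simp add: Q.m_assoc[symmetric])
    have "?u \<otimes>\<^bsub>Q\<^esub> ?b j = ?z" using e Q.m_comm[OF uc Q.Units_closed[OF un]] by simp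
    then show ?thesis
      using integral_dichotomy[of "a j" "a (Suc p)" ?u] Suc(2)[of j] j ac(1)[of "Suc p"] uc e by auto
  qed
  then have "\<forall>j. \<exists>u \<alpha> \<gamma>. j \<le> p \<longrightarrow> ?P j u \<alpha> \<gamma>" by blast
  then have "\<exists>u \<alpha> \<gamma>. \<forall>j. j \<le> p \<longrightarrow> ?P j (u j) (\<alpha> j) (\<gamma> j)" by (simp only: choice_iff)
  then obtain u \<alpha> \<gamma> where d: "\<And>j. j \<le> p \<Longrightarrow> u j \<in> carrier Q" "\<And>j. j \<le> p \<Longrightarrow> u j \<otimes>\<^bsub>Q\<^esub> ?b j = ?z"
    "\<And>j. j \<le> p \<Longrightarrow> \<alpha> j \<in> almost_integral" "\<And>j. j \<le> p \<Longrightarrow> \<gamma> j \<in> almost_integral"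
    "\<And>j. j \<le> p \<Longrightarrow> \<alpha> j \<otimes>\<^bsub>Q\<^esub> u j \<in> almost_integral"
    "\<And>j. j \<le> p \<Longrightarrow> \<gamma> j \<otimes>\<^bsub>Q\<^esub> u j = \<one>\<^bsub>Q\<^esub> \<ominus>\<^bsub>Q\<^esub> \<alpha> j"
    by blast
  have c: "\<alpha> j \<in> carrier Q" "\<gamma> j \<in> carrier Q" "y j \<in> carrier Q" "?b j \<in> carrier Q" "u j \<in> carrier Q" if "j \<le> p" for j
    using d(1,3,4)[OF that] y(1)[OF that] ac(2)[of j] that by (auto dest: almost_integral_carrier)
  let ?n = "Q.dot y \<gamma> (Suc p)"
  have nc: "?n \<in> carrier Q" using c by (intro Q.dot_closed) auto
  \<comment> \<open>The share \<alpha> i of y i is kept, and the complementary shares are collected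
    at z: since \<gamma> j z = (1 - \<alpha> j) a j, the sum n z of the transferred terms restores
    1.\<close>
  let ?y = "\<lambda>i. if i = Suc p then ?n else \<alpha> i \<otimes>\<^bsub>Q\<^esub> y i"
  have nz: "?n \<otimes>\<^bsub>Q\<^esub> ?z = Q.dot y (\<lambda>j. ?b j \<ominus>\<^bsub>Q\<^esub> \<alpha> j \<otimes>\<^bsub>Q\<^esub> ?b j) (Suc p)"
  proof -
    have "?n \<otimes>\<^bsub>Q\<^esub> ?z = ?z \<otimes>\<^bsub>Q\<^esub> ?n" using nc zc by (simp add: Q.m_comm)
    also have "\<dots> = Q.dot y (\<lambda>j. ?z \<otimes>\<^bsub>Q\<^esub> \<gamma> j) (Suc p)"
      using c zc by (intro Q.dot_scale_right[symmetric]) auto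
    also have "\<dots> = Q.dot y (\<lambda>j. ?b j \<ominus>\<^bsub>Q\<^esub> \<alpha> j \<otimes>\<^bsub>Q\<^esub> ?b j) (Suc p)"
    proof (intro lc_cong refl)
      fix j assume "j < Suc p"
      then have j: "j \<le> p" by simp
      have "?z \<otimes>\<^bsub>Q\<^esub> \<gamma> j = (\<gamma> j \<otimes>\<^bsub>Q\<^esub> u j) \<otimes>\<^bsub>Q\<^esub> ?b j"
        unfolding d(2)[OF j, symmetric] using c[OF j] by algebra
      also have "\<dots> = ?b j \<ominus>\<^bsub>Q\<^esub> \<alpha> j \<otimes>\<^bsub>Q\<^esub> ?b j"
        unfolding d(6)[OF j] using c[OF j] by algebra
      finally show "?z \<otimes>\<^bsub>Q\<^esub> \<gamma> j = ?b j \<ominus>\<^bsub>Q\<^esub> \<alpha> j \<otimes>\<^bsub>Q\<^esub> ?b j" .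
    qed
    finally show ?thesis .
  qed
  have ai: "?y i \<otimes>\<^bsub>Q\<^esub> ?b j \<in> almost_integral" if ij: "i \<le> Suc p" "j \<le> Suc p" for i j
  proof (cases "i = Suc p")
    case i: True
    show ?thesis
    proof (cases "j = Suc p")
      case True
      have "Q.dot y (\<lambda>j. ?b j \<ominus>\<^bsub>Q\<^esub> \<alpha> j \<otimes>\<^bsub>Q\<^esub> ?b j) (Suc p) \<in> almost_integral"
      proof (rule almost_integral_dot)
        fix j assume "j < Suc p"
        then have j: "j \<le> p" by simp
        have "y j \<otimes>\<^bsub>Q\<^esub> (?b j \<ominus>\<^bsub>Q\<^esub> \<alpha> j \<otimes>\<^bsub>Q\<^esub> ?b j) = y j \<otimes>\<^bsub>Q\<^esub> ?b j \<ominus>\<^bsub>Q\<^esub> \<alpha> j \<otimes>\<^bsub>Q\<^esub> (y j \<otimes>\<^bsub>Q\<^esub> ?b j)"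
          using c[OF j] by algebra
        then show "y j \<otimes>\<^bsub>Q\<^esub> (?b j \<ominus>\<^bsub>Q\<^esub> \<alpha> j \<otimes>\<^bsub>Q\<^esub> ?b j) \<in> almost_integral"
          using almost_integral_minus[OF y(2)[OF j j] almost_integral_mult[OF d(3)[OF j] y(2)[OF j j]]] by simp
      qed
      then show ?thesis using i True nz by simp
    next
      case False
      then have j: "j \<le> p" using ij by simp
      have "?n \<otimes>\<^bsub>Q\<^esub> ?b j = ?b j \<otimes>\<^bsub>Q\<^esub> ?n" using nc c[OF j] by (simp add: Q.m_comm)
      also have "\<dots> = Q.dot y (\<lambda>i. ?b j \<otimes>\<^bsub>Q\<^esub> \<gamma> i) (Suc p)"
        using c j by (intro Q.dot_scale_right[symmetric]) auto
      also have "\<dots> \<in> almost_integral"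
      proof (rule almost_integral_dot)
        fix i assume "i < Suc p"
        then have i: "i \<le> p" by simp
        have "y i \<otimes>\<^bsub>Q\<^esub> (?b j \<otimes>\<^bsub>Q\<^esub> \<gamma> i) = \<gamma> i \<otimes>\<^bsub>Q\<^esub> (y i \<otimes>\<^bsub>Q\<^esub> ?b j)"
          using c[OF i] c[OF j] by algebra
        then show "y i \<otimes>\<^bsub>Q\<^esub> (?b j \<otimes>\<^bsub>Q\<^esub> \<gamma> i) \<in> almost_integral"
          using almost_integral_mult[OF d(4)[OF i] y(2)[OF i j]] by simp
      qed
      finally show ?thesis using i by simp
    qed
  next
    case False
    then have i: "i \<le> p" using ij by simp
    show ?thesis
    proof (cases "j = Suc p")
      case True
      have "\<alpha> i \<otimes>\<^bsub>Q\<^esub> y i \<otimes>\<^bsub>Q\<^esub> ?z = (\<alpha> i \<otimes>\<^bsub>Q\<^esub> u i) \<otimes>\<^bsub>Q\<^esub> (y i \<otimes>\<^bsub>Q\<^esub> ?b i)"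
        unfolding d(2)[OF i, symmetric] using c[OF i] by algebra
      then show ?thesis using True False almost_integral_mult[OF d(5)[OF i] y(2)[OF i i]] by simp
    next
      case j: False
      then have "j \<le> p" using ij by simp
      then show ?thesis
        using False almost_integral_mult[OF d(3)[OF i] y(2)[OF i]] c[OF i] c(4)[of j] by (simp add: Q.m_assoc)
    qed
  qed
  have "Q.dot ?y ?b (Suc (Suc p)) = Q.dot ?y ?b (Suc p) \<oplus>\<^bsub>Q\<^esub> ?n \<otimes>\<^bsub>Q\<^esub> ?z"
    by simp
  also have "Q.dot ?y ?b (Suc p) = Q.dot y (\<lambda>j. \<alpha> j \<otimes>\<^bsub>Q\<^esub> ?b j) (Suc p)"
  proof -
    have "Q.dot ?y ?b k = Q.dot y (\<lambda>j. \<alpha> j \<otimes>\<^bsub>Q\<^esub> ?b j) k" if "k \<le> Suc p" for k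
      using that
    proof (induct k)
      case (Suc k)
      then have k: "k \<le> p" by simp
      have "\<alpha> k \<otimes>\<^bsub>Q\<^esub> y k \<otimes>\<^bsub>Q\<^esub> ?b k = y k \<otimes>\<^bsub>Q\<^esub> (\<alpha> k \<otimes>\<^bsub>Q\<^esub> ?b k)" using c[OF k] by algebra
      then show ?case using Suc by simp
    qed simp
    from this[OF le_refl] show ?thesis .
  qed
  also have "\<dots> \<oplus>\<^bsub>Q\<^esub> ?n \<otimes>\<^bsub>Q\<^esub> ?z = Q.dot y (\<lambda>j. \<alpha> j \<otimes>\<^bsub>Q\<^esub> ?b j \<oplus>\<^bsub>Q\<^esub> (?b j \<ominus>\<^bsub>Q\<^esub> \<alpha> j \<otimes>\<^bsub>Q\<^esub> ?b j)) (Suc p)"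
    unfolding nz using c by (intro Q.dot_add_right[symmetric]) auto
  also have "\<dots> = Q.dot y ?b (Suc p)"
  proof (intro lc_cong refl)
    fix j assume "j < Suc p"
    then have j: "j \<le> p" by simp
    show "\<alpha> j \<otimes>\<^bsub>Q\<^esub> ?b j \<oplus>\<^bsub>Q\<^esub> (?b j \<ominus>\<^bsub>Q\<^esub> \<alpha> j \<otimes>\<^bsub>Q\<^esub> ?b j) = ?b j"
      using c[OF j] by algebra
  qed
  finally have "Q.dot ?y ?b (Suc (Suc p)) = \<one>\<^bsub>Q\<^esub>" using y(3) by (simp only:)
  moreover have "\<forall>i\<le>Suc p. ?y i \<in> carrier Q" using nc c by (auto simp: le_Suc_eq)
  ultimately show ?case using ai by (intro exI[of _ ?y] conjI) auto
qed

text \<open>The w i may be zero divisors, so they are translated to regular elements by multiples of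
  a regular a0 = x + b, where x is in the ideal I they generate and b kills I. The contribution of b
  to the resulting expression for 1 disappears on I, so the sum of the y i w i acts there as the
  identity.\<close>

lemma dual_basis:
  assumes "\<forall>i<p. w i \<in> carrier R"
  shows "\<exists>y. (\<forall>i<p. y i \<in> carrier Q) \<and> (\<forall>i<p. \<forall>j<p. y i \<otimes>\<^bsub>Q\<^esub> \<iota> (w j) \<in> almost_integral) \<and>
     (\<forall>k<p. Q.dot y (\<lambda>i. \<iota> (w i)) p \<otimes>\<^bsub>Q\<^esub> \<iota> (w k) = \<iota> (w k))"
proof -
  have w: "w i \<in> carrier R" if "i < p" for i using assms that by blast
  define I where "I = {R.dot r w p | r. \<forall>i<p. r i \<in> carrier R}"
  have I: "ideal I R" unfolding I_def using w by (rule R.dot_image_ideal)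
  note Ic = R.idealD[OF I]
  have wI: "w k \<in> I" if "k < p" for k
    unfolding I_def using R.dot_unit[OF that, of w] w by (intro CollectI exI[of _ "\<lambda>i. if i = k then \<one> else \<zero>"]) auto
  obtain x where x: "x \<in> I" "\<And>r i. r \<in> carrier R \<Longrightarrow> r \<otimes> x = \<zero> \<Longrightarrow> i \<in> I \<Longrightarrow> r \<otimes> i = \<zero>"
    using ideal_annihilator_element[OF I] by blast
  define B where "B = {r \<in> carrier R. \<forall>i\<in>I. r \<otimes> i = \<zero>}"
  have B: "ideal B R"
    using Ic(1) by (intro R.idealI_closure) (auto simp: B_def R.l_distr R.m_assoc)
  obtain b where b: "b \<in> B" "\<And>r i. r \<in> carrier R \<Longrightarrow> r \<otimes> b = \<zero> \<Longrightarrow> i \<in> B \<Longrightarrow> r \<otimes> i = \<zero>"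
    using ideal_annihilator_element[OF B] by blast
  have xb': "x \<in> carrier R" "b \<in> carrier R" "b \<otimes> x = \<zero>"
    using x(1) b(1) Ic(1) by (auto simp: B_def)
  have xb: "x \<in> carrier R" "b \<in> carrier R" "x \<otimes> b = \<zero>" "b \<otimes> x = \<zero>"
    using xb' by (simp_all add: R.m_comm[of x b])
  \<comment> \<open>x has the annihilator of I and b has the annihilator of B, the annihilator of I.
    What kills x + b kills both, hence lies in B and kills B, so its square is 0.\<close>
  define a0 where "a0 = x \<oplus> b"
  have a0: "a0 \<in> nonzerodivisors R"
  proof (rule R.nonzerodivisorsI)
    show "a0 \<in> carrier R" using xb by (simp add: a0_def)
    fix r assume r: "r \<in> carrier R" "a0 \<otimes> r = \<zero>"
    then have "r \<otimes> (x \<oplus> b) = \<zero>" using xb by (simp add: a0_def R.m_comm)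
    then have *: "r \<otimes> x = \<zero>" "r \<otimes> b = \<zero>" using add_annihilates[OF xb(1,2,3) r(1)] by auto
    have "r \<in> B" using x(2)[OF r(1) *(1)] r(1) by (simp add: B_def)
    then have "r \<otimes> r = \<zero>" using b(2)[OF r(1) *(2)] by blast
    then show "r = \<zero>" by (rule square_zero[OF r(1)])
  qed
  have a0c: "a0 \<in> carrier R" using a0 by (rule R.nonzerodivisorsD)
  have "\<forall>i. \<exists>c. i < p \<longrightarrow> c \<in> carrier R \<and> w i \<oplus> c \<otimes> a0 \<in> nonzerodivisors R"
    using exists_regular_translate[OF a0 w] by metis
  then obtain c where c: "\<And>i. i < p \<Longrightarrow> c i \<in> carrier R" "\<And>i. i < p \<Longrightarrow> w i \<oplus> c i \<otimes> a0 \<in> nonzerodivisors R"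
    by metis
  define a where "a i = (if i < p then w i \<oplus> c i \<otimes> a0 else a0)" for i
  have an: "a i \<in> nonzerodivisors R" for i using c(2) a0 by (simp add: a_def)
  obtain y where y: "\<And>i. i \<le> p \<Longrightarrow> y i \<in> carrier Q"
     "\<And>i j. i \<le> p \<Longrightarrow> j \<le> p \<Longrightarrow> y i \<otimes>\<^bsub>Q\<^esub> \<iota> (a j) \<in> almost_integral" "Q.dot y (\<lambda>i. \<iota> (a i)) (Suc p) = \<one>\<^bsub>Q\<^esub>"
    using regular_dual_basis[of p a] an by blast
  obtain r where r: "x = R.dot r w p" "\<And>i. i < p \<Longrightarrow> r i \<in> carrier R" using x(1) by (auto simp: I_def)
  let ?w = "\<lambda>i. \<iota> (w i)" and ?c = "\<lambda>i. \<iota> (c i)" and ?r = "\<lambda>i. \<iota> (r i)" and ?a = "\<iota> a0"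
  have cl: "?w i \<in> carrier Q" "?c i \<in> carrier Q" "?r i \<in> carrier Q" "y i \<in> carrier Q" if "i < p" for i
    using that w c(1) r(2) y(1)[of i] by auto
  have ac: "?a \<in> carrier Q" using a0c by simp
  define yW yC rW where "yW = Q.dot y ?w p" and "yC = Q.dot y ?c p" and "rW = Q.dot ?r ?w p"
  \<comment> \<open>The total coefficient of a0 after w i + c i a0 is expanded; index p belongs to
    a0 itself.\<close>
  define \<eta> where "\<eta> = y p \<oplus>\<^bsub>Q\<^esub> yC"
  have \<eta>c: "\<eta> \<in> carrier Q" using y(1) cl by (auto simp: \<eta>_def yC_def intro!: Q.dot_closed)
  have yc: "yC \<in> carrier Q" "yW \<in> carrier Q" "rW \<in> carrier Q"
    using cl by (auto simp: yW_def yC_def rW_def intro!: Q.dot_closed)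
  have ya: "Q.dot y (\<lambda>i. \<iota> (a i)) p = yW \<oplus>\<^bsub>Q\<^esub> ?a \<otimes>\<^bsub>Q\<^esub> yC"
  proof -
    have "Q.dot y (\<lambda>i. \<iota> (a i)) p = Q.dot y (\<lambda>i. ?w i \<oplus>\<^bsub>Q\<^esub> ?a \<otimes>\<^bsub>Q\<^esub> ?c i) p"
      using w c(1) a0c by (intro lc_cong) (auto simp: a_def Q.m_comm)
    also have "\<dots> = yW \<oplus>\<^bsub>Q\<^esub> Q.dot y (\<lambda>i. ?a \<otimes>\<^bsub>Q\<^esub> ?c i) p"
      using cl ac unfolding yW_def by (intro Q.dot_add_right) auto
    also have "Q.dot y (\<lambda>i. ?a \<otimes>\<^bsub>Q\<^esub> ?c i) p = ?a \<otimes>\<^bsub>Q\<^esub> yC"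
      using cl ac unfolding yC_def by (intro Q.dot_scale_right) auto
    finally show ?thesis .
  qed
  have ia: "?a = rW \<oplus>\<^bsub>Q\<^esub> \<iota> b"
    using xb hom_dot[of p r w] r w by (simp add: a0_def rW_def)
  define Y where "Y i = y i \<oplus>\<^bsub>Q\<^esub> \<eta> \<otimes>\<^bsub>Q\<^esub> ?r i" for i
  define YW where "YW = Q.dot Y ?w p"
  have dY: "YW = yW \<oplus>\<^bsub>Q\<^esub> \<eta> \<otimes>\<^bsub>Q\<^esub> rW"
    unfolding YW_def Y_def yW_def rW_def using cl \<eta>c by (subst Q.dot_add_left) (auto simp: Q.dot_scale_left)
  \<comment> \<open>The x-part of a0 is the combination rW of the w i, so it can be moved into the
    coefficients Y i and only \<eta> b remains.\<close>
  have one: "\<one>\<^bsub>Q\<^esub> = YW \<oplus>\<^bsub>Q\<^esub> \<eta> \<otimes>\<^bsub>Q\<^esub> \<iota> b"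
  proof -
    have "\<one>\<^bsub>Q\<^esub> = (yW \<oplus>\<^bsub>Q\<^esub> ?a \<otimes>\<^bsub>Q\<^esub> yC) \<oplus>\<^bsub>Q\<^esub> y p \<otimes>\<^bsub>Q\<^esub> ?a"
      using y(3) ya by (simp add: a_def)
    also have "\<dots> = yW \<oplus>\<^bsub>Q\<^esub> \<eta> \<otimes>\<^bsub>Q\<^esub> ?a"
      unfolding \<eta>_def using yc ac y(1)[OF le_refl] by algebra
    also have "\<dots> = YW \<oplus>\<^bsub>Q\<^esub> \<eta> \<otimes>\<^bsub>Q\<^esub> \<iota> b"
      unfolding dY ia using yc \<eta>c hom_closed[OF xb(2)] by algebra
    finally show ?thesis .
  qed
  have yw: "y i \<otimes>\<^bsub>Q\<^esub> ?w k \<in> almost_integral" if "i \<le> p" "k < p" for i k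
  proof -
    have eq: "\<iota> (a k) = ?w k \<oplus>\<^bsub>Q\<^esub> ?c k \<otimes>\<^bsub>Q\<^esub> ?a" using that w c(1) a0c by (simp add: a_def)
    have "y i \<otimes>\<^bsub>Q\<^esub> ?w k = y i \<otimes>\<^bsub>Q\<^esub> \<iota> (a k) \<ominus>\<^bsub>Q\<^esub> ?c k \<otimes>\<^bsub>Q\<^esub> (y i \<otimes>\<^bsub>Q\<^esub> ?a)"
      unfolding eq using cl(1,2)[OF that(2)] y(1)[OF that(1)] ac by algebra
    moreover have "?a = \<iota> (a p)" by (simp add: a_def)
    ultimately show ?thesis
      using y(2)[OF that(1), of k] y(2)[OF that(1), of p] that c(1)[OF that(2)]
      by (simp add: almost_integral_minus almost_integral_mult almost_integral_A)
  qed
  have "\<eta> \<otimes>\<^bsub>Q\<^esub> ?w k \<in> almost_integral" if k: "k < p" for k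
  proof -
    have "\<eta> \<otimes>\<^bsub>Q\<^esub> ?w k = y p \<otimes>\<^bsub>Q\<^esub> ?w k \<oplus>\<^bsub>Q\<^esub> ?w k \<otimes>\<^bsub>Q\<^esub> yC"
      unfolding \<eta>_def using cl[OF k] yc y(1)[OF le_refl] by algebra
    also have "?w k \<otimes>\<^bsub>Q\<^esub> yC = Q.dot y (\<lambda>i. ?w k \<otimes>\<^bsub>Q\<^esub> ?c i) p"
      unfolding yC_def using cl k by (intro Q.dot_scale_right[symmetric]) auto
    also have "y p \<otimes>\<^bsub>Q\<^esub> ?w k \<oplus>\<^bsub>Q\<^esub> Q.dot y (\<lambda>i. ?w k \<otimes>\<^bsub>Q\<^esub> ?c i) p \<in> almost_integral"
    proof (intro almost_integral_add almost_integral_dot)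
      show "y p \<otimes>\<^bsub>Q\<^esub> ?w k \<in> almost_integral" using yw k by simp
      fix i assume i: "i < p"
      have "y i \<otimes>\<^bsub>Q\<^esub> (?w k \<otimes>\<^bsub>Q\<^esub> ?c i) = ?c i \<otimes>\<^bsub>Q\<^esub> (y i \<otimes>\<^bsub>Q\<^esub> ?w k)"
        using cl[OF i] cl[OF k] by algebra
      then show "y i \<otimes>\<^bsub>Q\<^esub> (?w k \<otimes>\<^bsub>Q\<^esub> ?c i) \<in> almost_integral"
        using yw[of i k] i k c(1) by (simp add: almost_integral_mult almost_integral_A)
    qed
    finally show ?thesis .
  qed
  then have "Y i \<otimes>\<^bsub>Q\<^esub> ?w k \<in> almost_integral" if "i < p" "k < p" for i k
  proof -
    have "Y i \<otimes>\<^bsub>Q\<^esub> ?w k = y i \<otimes>\<^bsub>Q\<^esub> ?w k \<oplus>\<^bsub>Q\<^esub> ?r i \<otimes>\<^bsub>Q\<^esub> (\<eta> \<otimes>\<^bsub>Q\<^esub> ?w k)"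
      unfolding Y_def using cl[OF that(1)] cl[OF that(2)] \<eta>c by algebra
    then show ?thesis
      using yw[of i k] \<open>k < p \<Longrightarrow> \<eta> \<otimes>\<^bsub>Q\<^esub> ?w k \<in> almost_integral\<close> that r(2)[OF that(1)]
      by (simp add: almost_integral_add almost_integral_mult almost_integral_A)
  qed
  moreover have "YW \<otimes>\<^bsub>Q\<^esub> ?w k = ?w k" if k: "k < p" for k
  proof -
    have dc: "YW \<in> carrier Q" unfolding dY using yc \<eta>c by simp
    have "b \<otimes> w k = \<zero>" using b(1) wI[OF k] by (simp add: B_def)
    then have bw: "\<iota> b \<otimes>\<^bsub>Q\<^esub> ?w k = \<zero>\<^bsub>Q\<^esub>" using hom_mult[OF xb(2) w[OF k]] by simp
    have "?w k = (YW \<oplus>\<^bsub>Q\<^esub> \<eta> \<otimes>\<^bsub>Q\<^esub> \<iota> b) \<otimes>\<^bsub>Q\<^esub> ?w k"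
      using cl[OF k] by (simp flip: one)
    also have "\<dots> = YW \<otimes>\<^bsub>Q\<^esub> ?w k \<oplus>\<^bsub>Q\<^esub> \<eta> \<otimes>\<^bsub>Q\<^esub> (\<iota> b \<otimes>\<^bsub>Q\<^esub> ?w k)"
      using dc \<eta>c hom_closed[OF xb(2)] cl[OF k] by algebra
    also have "\<dots> = YW \<otimes>\<^bsub>Q\<^esub> ?w k" using bw \<eta>c dc cl[OF k] by simp
    finally show ?thesis by simp
  qed
  moreover have "Y i \<in> carrier Q" if "i < p" for i using cl[OF that] \<eta>c by (simp add: Y_def)
  ultimately show ?thesis unfolding YW_def by blast
qed

end

lemma lin_smult_vector:
  assumes "module R N" "lin R M (regular_module R) w" "z \<in> carrier N"
  shows "lin R M N (\<lambda>v. w v \<odot>\<^bsub>N\<^esub> z)"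
proof -
  interpret N: module R N by fact
  show ?thesis
    using assms(2,3) by (intro linI) (auto simp: lin_def N.smult_l_distr N.smult_assoc1)
qed

section \<open>Projections onto kernels of matrices over R\<close>

context normalization_dim1 begin

text \<open>Rows are added one at a time. On the kernel of the earlier rows the new row is the
  functional w; it maps S^p onto a fractional ideal, and a dual basis yields a vector y such that
  w(y) is the identity on the values of w. Subtracting w(v) times the projection of y makes w vanish
  and leaves the kernel of w fixed.\<close>

lemma exists_kernel_projection:
  fixes D :: "nat \<Rightarrow> nat \<Rightarrow> 'a"
  assumes "\<forall>i<q. \<forall>j<p. D i j \<in> carrier R"
  shows "\<exists>\<pi>. lin Q (free_module Q p) (free_module Q p) \<pi> \<and>
     (\<forall>v\<in>carrier (free_module Q p). (\<forall>i<p. v i \<in> almost_integral) \<longrightarrow> (\<forall>i<p. \<pi> v i \<in> almost_integral)) \<and>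
     (\<forall>v\<in>carrier (free_module Q p). \<forall>i<q. Q.dot (\<pi> v) (\<lambda>j. \<iota> (D i j)) p = \<zero>\<^bsub>Q\<^esub>) \<and>
     (\<forall>v\<in>carrier (free_module Q p). (\<forall>i<q. Q.dot v (\<lambda>j. \<iota> (D i j)) p = \<zero>\<^bsub>Q\<^esub>) \<longrightarrow> \<pi> v = v)"
  using assms
proof (induct q)
  case 0
  show ?case by (intro exI[of _ "\<lambda>x. x"]) (auto simp: lin_id)
next
  case (Suc q)
  let ?V = "free_module Q p" and ?A = "regular_module Q"
  have V: "module Q ?V" by (rule Q.module_free)
  interpret V: module Q ?V by (rule V)
  have Am: "module Q ?A" by (rule Q.module_regular)
  let ?\<delta> = "\<lambda>i j. \<iota> (D i j)"
  have dc: "?\<delta> i j \<in> carrier Q" if "i < Suc q" "j < p" for i j using Suc(2) that by simp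
  have Dq: "\<forall>i<q. \<forall>j<p. D i j \<in> carrier R" using Suc(2) by simp
  obtain \<pi> where P: "lin Q ?V ?V \<pi>"
     "\<forall>v\<in>carrier ?V. (\<forall>i<p. v i \<in> almost_integral) \<longrightarrow> (\<forall>i<p. \<pi> v i \<in> almost_integral)"
     "\<forall>v\<in>carrier ?V. \<forall>i<q. Q.dot (\<pi> v) (?\<delta> i) p = \<zero>\<^bsub>Q\<^esub>"
     "\<forall>v\<in>carrier ?V. (\<forall>i<q. Q.dot v (?\<delta> i) p = \<zero>\<^bsub>Q\<^esub>) \<longrightarrow> \<pi> v = v"
    using Suc(1)[OF Dq] by (elim exE conjE) (rule that)
  note \<pi> = P(1) P(2)[rule_format] P(3)[rule_format] P(4)[rule_format]
  have lin\<delta>: "lin Q ?V ?A (\<lambda>v. Q.dot v (?\<delta> i) p)" if "i < Suc q" for i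
    using dc that by (intro Q.lin_dot) auto
  define w where "w v = Q.dot (\<pi> v) (?\<delta> q) p" for v
  have lw: "lin Q ?V ?A w"
    unfolding w_def using lin_comp[OF \<pi>(1) lin\<delta>[of q]] by simp
  define W where "W i = w (Q.unit_vec p i)" for i
  have Wc: "W i \<in> carrier Q" for i
    using lin_closed[OF lw, of "Q.unit_vec p i"] by (simp add: W_def)
  have wW: "w v = Q.dot v W p" if "v \<in> carrier ?V" for v
    unfolding W_def[abs_def] by (rule Q.lin_free_expand[OF Am lw]) (use that in simp)
  \<comment> \<open>The values W i lie in Q, whereas \<open>dual_basis\<close> is about elements of
    R. With Y dual to s W, the vector s Y is dual to W.\<close>
  obtain s a where s: "s \<in> nonzerodivisors R" "\<And>i. i < p \<Longrightarrow> a i \<in> carrier R"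
    "\<And>i. i < p \<Longrightarrow> \<iota> s \<otimes>\<^bsub>Q\<^esub> W i = \<iota> (a i)"
    using common_denominator[of p W, OF Wc] by blast
  have sc: "\<iota> s \<in> carrier Q" by (rule nzd_closed[OF s(1)])
  obtain Y where Y: "\<And>i. i < p \<Longrightarrow> Y i \<in> carrier Q"
    "\<And>i j. i < p \<Longrightarrow> j < p \<Longrightarrow> Y i \<otimes>\<^bsub>Q\<^esub> \<iota> (a j) \<in> almost_integral"
    "\<And>k. k < p \<Longrightarrow> Q.dot Y (\<lambda>i. \<iota> (a i)) p \<otimes>\<^bsub>Q\<^esub> \<iota> (a k) = \<iota> (a k)"
    using dual_basis[of p a] s(2) by blast
  define y where "y = (\<lambda>i\<in>{..<p}. \<iota> s \<otimes>\<^bsub>Q\<^esub> Y i)"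
  have yV: "y \<in> carrier ?V" using Y(1) sc by (auto simp: y_def)
  have yc: "y i \<in> carrier Q" if "i < p" for i using that Y(1) sc by (simp add: y_def)
  have yW: "y i \<otimes>\<^bsub>Q\<^esub> W j \<in> almost_integral" if "i < p" "j < p" for i j
  proof -
    have "y i \<otimes>\<^bsub>Q\<^esub> W j = Y i \<otimes>\<^bsub>Q\<^esub> (\<iota> s \<otimes>\<^bsub>Q\<^esub> W j)"
      using that Y(1) sc Wc by (simp add: y_def Q.m_ac)
    then show ?thesis using Y(2)[OF that] s(3)[OF that(2)] by simp
  qed
  have wy: "w y = Q.dot Y (\<lambda>i. \<iota> (a i)) p"
  proof -
    have "w y = Q.dot (\<lambda>i. \<iota> s \<otimes>\<^bsub>Q\<^esub> Y i) W p"
      unfolding wW[OF yV] by (intro lc_cong) (auto simp: y_def)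
    also have "\<dots> = \<iota> s \<otimes>\<^bsub>Q\<^esub> Q.dot Y W p" using Y(1) sc Wc by (intro Q.dot_scale_left) auto
    also have "\<dots> = Q.dot Y (\<lambda>i. \<iota> s \<otimes>\<^bsub>Q\<^esub> W i) p" using Y(1) sc Wc by (intro Q.dot_scale_right[symmetric]) auto
    also have "\<dots> = Q.dot Y (\<lambda>i. \<iota> (a i)) p" using s(3) by (intro lc_cong) auto
    finally show ?thesis .
  qed
  have wyc: "w y \<in> carrier Q" using lin_closed[OF lw yV] by simp
  have wyW: "w y \<otimes>\<^bsub>Q\<^esub> W k = W k" if k: "k < p" for k
  proof (rule unit_cancel[OF s(1)])
    have "\<iota> s \<otimes>\<^bsub>Q\<^esub> (w y \<otimes>\<^bsub>Q\<^esub> W k) = w y \<otimes>\<^bsub>Q\<^esub> (\<iota> s \<otimes>\<^bsub>Q\<^esub> W k)"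
      using sc wyc Wc by (simp add: Q.m_lcomm)
    then show "\<iota> s \<otimes>\<^bsub>Q\<^esub> (w y \<otimes>\<^bsub>Q\<^esub> W k) = \<iota> s \<otimes>\<^bsub>Q\<^esub> W k"
      using Y(3)[OF k] wy s(3)[OF k] by simp
  qed (use wyc Wc in auto)
  have wyw: "w y \<otimes>\<^bsub>Q\<^esub> w v = w v" if v: "v \<in> carrier ?V" for v
  proof -
    have vc: "v i \<in> carrier Q" if "i < p" for i using v that by auto
    have "w y \<otimes>\<^bsub>Q\<^esub> w v = Q.dot v (\<lambda>k. w y \<otimes>\<^bsub>Q\<^esub> W k) p"
      unfolding wW[OF v] using wyc Wc vc by (intro Q.dot_scale_right[symmetric]) auto
    also have "\<dots> = w v" unfolding wW[OF v] using wyW by (intro lc_cong) auto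
    finally show ?thesis .
  qed
  have \<pi>y: "\<pi> y \<in> carrier ?V" by (rule lin_closed[OF \<pi>(1) yV])
  have lnw: "lin Q ?V ?A (\<lambda>v. \<ominus>\<^bsub>Q\<^esub> w v)"
    using lw by (auto simp: lin_def Q.minus_add Q.r_minus)
  define \<pi>' where "\<pi>' v = \<pi> v \<oplus>\<^bsub>?V\<^esub> (\<ominus>\<^bsub>Q\<^esub> w v) \<odot>\<^bsub>?V\<^esub> \<pi> y" for v
  have l': "lin Q ?V ?V \<pi>'"
    unfolding \<pi>'_def by (intro lin_plus[OF V \<pi>(1)] lin_smult_vector[OF V lnw \<pi>y])
  have c': "w v \<in> carrier Q" "\<pi> v \<in> carrier ?V" if "v \<in> carrier ?V" for v
    using lin_closed[OF lw that] lin_closed[OF \<pi>(1) that] by auto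
  have dot': "Q.dot (\<pi>' v) (?\<delta> i) p = Q.dot (\<pi> v) (?\<delta> i) p \<oplus>\<^bsub>Q\<^esub> (\<ominus>\<^bsub>Q\<^esub> w v) \<otimes>\<^bsub>Q\<^esub> Q.dot (\<pi> y) (?\<delta> i) p"
    if v: "v \<in> carrier ?V" and i: "i < Suc q" for v i
  proof -
    have n: "\<ominus>\<^bsub>Q\<^esub> w v \<in> carrier Q" using c'[OF v] by simp
    show ?thesis
      using lin_add[OF lin\<delta>[OF i] c'(2)[OF v] V.smult_closed[OF n \<pi>y]] lin_smult[OF lin\<delta>[OF i] n \<pi>y]
      unfolding \<pi>'_def by simp
  qed
  show ?case
  proof (intro exI[of _ \<pi>'] conjI ballI allI impI l')
    fix v i assume v: "v \<in> carrier ?V" and va: "\<forall>i<p. v i \<in> almost_integral" and i: "i < p"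
    have vc: "v i \<in> carrier Q" if "i < p" for i using v that by auto
    \<comment> \<open>The scalar w(v) need not be integral, but w(v) y has the coordinates sum of v
      k (y j W k), which are integral when v is. Hence \<pi> is applied to w(v) y as a
      whole.\<close>
    let ?z = "(w v) \<odot>\<^bsub>?V\<^esub> y"
    have z: "?z \<in> carrier ?V" using V.smult_closed[OF c'(1)[OF v] yV] .
    have za: "?z j \<in> almost_integral" if j: "j < p" for j
    proof -
      have "?z j = y j \<otimes>\<^bsub>Q\<^esub> Q.dot v W p"
        using j wW[OF v] c'(1)[OF v] yc[OF j] by (simp add: Q.m_comm)
      also have "\<dots> = Q.dot v (\<lambda>k. y j \<otimes>\<^bsub>Q\<^esub> W k) p"
        using yc[OF j] vc Wc by (intro Q.dot_scale_right[symmetric]) auto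
      also have "\<dots> \<in> almost_integral"
        using va yW[OF j] by (intro almost_integral_dot almost_integral_mult[of "v _"]) auto
      finally show ?thesis .
    qed
    have \<pi>z: "\<pi> ?z i = w v \<otimes>\<^bsub>Q\<^esub> \<pi> y i"
      unfolding lin_smult[OF \<pi>(1) c'(1)[OF v] yV] using i by simp
    have pc: "\<pi> v i \<in> carrier Q" "\<pi> y i \<in> carrier Q"
      using c'(2)[OF v] \<pi>y i by (simp_all add: PiE_iff)
    have "\<pi>' v i = \<pi> v i \<oplus>\<^bsub>Q\<^esub> (\<ominus>\<^bsub>Q\<^esub> w v) \<otimes>\<^bsub>Q\<^esub> \<pi> y i" using i by (simp add: \<pi>'_def)
    also have "\<dots> = \<pi> v i \<ominus>\<^bsub>Q\<^esub> \<pi> ?z i"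
      unfolding \<pi>z using pc c'(1)[OF v] by (simp add: a_minus_def Q.l_minus)
    finally have "\<pi>' v i = \<pi> v i \<ominus>\<^bsub>Q\<^esub> \<pi> ?z i" .
    moreover have "\<pi> v i \<in> almost_integral" by (rule \<pi>(2)[OF v _ i]) (use va in simp)
    moreover have "\<pi> ?z i \<in> almost_integral" by (rule \<pi>(2)[OF z za i])
    ultimately show "\<pi>' v i \<in> almost_integral" by (simp only: almost_integral_minus)
  next
    fix v i assume v: "v \<in> carrier ?V" and i: "i < Suc q"
    show "Q.dot (\<pi>' v) (?\<delta> i) p = \<zero>\<^bsub>Q\<^esub>"
    proof (cases "i = q")
      case True
      have "Q.dot (\<pi>' v) (?\<delta> i) p = w v \<oplus>\<^bsub>Q\<^esub> (\<ominus>\<^bsub>Q\<^esub> w v) \<otimes>\<^bsub>Q\<^esub> w y"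
        using dot'[OF v i] True by (simp add: w_def)
      also have "\<dots> = w v \<ominus>\<^bsub>Q\<^esub> w y \<otimes>\<^bsub>Q\<^esub> w v" using c'(1)[OF v] wyc by algebra
      also have "\<dots> = \<zero>\<^bsub>Q\<^esub>" using wyw[OF v] c'(1)[OF v] by (simp add: a_minus_def Q.r_neg)
      finally show ?thesis .
    next
      case False
      then show ?thesis using dot'[OF v i] \<pi>(3)[OF v] \<pi>(3)[OF yV] i c'(1)[OF v] by simp
    qed
  next
    fix v assume v: "v \<in> carrier ?V" and 0: "\<forall>i<Suc q. Q.dot v (?\<delta> i) p = \<zero>\<^bsub>Q\<^esub>"
    then have "\<pi> v = v" by (intro \<pi>(4)) auto
    then have "w v = \<zero>\<^bsub>Q\<^esub>" using 0 by (simp add: w_def)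
    then show "\<pi>' v = v"
      using \<open>\<pi> v = v\<close> V.M.r_zero[OF v] V.smult_l_null[OF \<pi>y] unfolding \<pi>'_def by simp
  qed
qed

text \<open>The map \<rho> is r times the projection onto the kernel of d over Q. The projection
  sends R^p into S^p, and r S lies in R, so \<rho> has values in R^p; linearity and the two
  equations descend because R embeds in Q.\<close>

lemma conductor_splitting:
  assumes r: "r \<in> carrier R" and cond: "\<forall>q\<in>almost_integral. \<iota> r \<otimes>\<^bsub>Q\<^esub> q \<in> A"
    and d: "lin R (free_module R p) (free_module R k) d"
  shows "\<exists>\<rho>. lin R (free_module R p) (free_module R p) \<rho> \<and>
    (\<forall>x\<in>carrier (free_module R p). d (\<rho> x) = \<zero>\<^bsub>free_module R k\<^esub>) \<and>
    (\<forall>x\<in>carrier (free_module R p). d x = \<zero>\<^bsub>free_module R k\<^esub> \<longrightarrow> \<rho> x = r \<odot>\<^bsub>free_module R p\<^esub> x)"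
proof -
  let ?F = "free_module R p" and ?V = "free_module Q p"
  define D where "D i j = d (R.unit_vec p j) i" for i j
  have dF: "d (R.unit_vec p j) \<in> {..<k} \<rightarrow>\<^sub>E carrier R" for j
    using lin_closed[OF d, of "R.unit_vec p j"] by simp
  have D: "D i j \<in> carrier R" if "i < k" for i j using PiE_lessThan_mem[OF dF that] by (simp add: D_def)
  have dx: "d x i = R.dot x (D i) p" if x: "x \<in> carrier ?F" and i: "i < k" for x i
  proof -
    have xi: "x j \<in> carrier R" if "j < p" for j using x that by auto
    have "d x = lc (free_module R k) x (\<lambda>j. d (R.unit_vec p j)) p"
      by (rule R.lin_free_expand[OF R.module_free d]) (use x in simp)
    then show ?thesis
      using R.lc_component[OF i, of p x "\<lambda>j. d (R.unit_vec p j)"] xi dF by (simp add: D_def[abs_def])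
  qed
  have d0: "d x = \<zero>\<^bsub>free_module R k\<^esub> \<longleftrightarrow> (\<forall>i<k. R.dot x (D i) p = \<zero>)" if x: "x \<in> carrier ?F" for x
  proof
    assume "\<forall>i<k. R.dot x (D i) p = \<zero>"
    then show "d x = \<zero>\<^bsub>free_module R k\<^esub>"
      using lin_closed[OF d x] dx[OF x] by (intro PiE_lessThan_eqI[of _ k "carrier R" _ "carrier R"]) auto
  qed (use dx[OF x] in auto)
  have Dq: "\<forall>i<k. \<forall>j<p. D i j \<in> carrier R" using D by simp
  obtain \<pi> where P: "lin Q ?V ?V \<pi>"
     "\<forall>v\<in>carrier ?V. (\<forall>i<p. v i \<in> almost_integral) \<longrightarrow> (\<forall>i<p. \<pi> v i \<in> almost_integral)"
     "\<forall>v\<in>carrier ?V. \<forall>i<k. Q.dot (\<pi> v) (\<lambda>j. \<iota> (D i j)) p = \<zero>\<^bsub>Q\<^esub>"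
     "\<forall>v\<in>carrier ?V. (\<forall>i<k. Q.dot v (\<lambda>j. \<iota> (D i j)) p = \<zero>\<^bsub>Q\<^esub>) \<longrightarrow> \<pi> v = v"
    using exists_kernel_projection[of k p D, OF Dq] by (elim exE conjE) (rule that)
  note \<pi> = P(1) P(2)[rule_format] P(3)[rule_format] P(4)[rule_format]
  define E where "E x = (\<lambda>j\<in>{..<p}. \<iota> (x j))" for x
  have E: "E x \<in> carrier ?V" if "x \<in> carrier ?F" for x using that by (auto simp: E_def)
  have \<pi>E: "\<pi> (E x) \<in> carrier ?V" if "x \<in> carrier ?F" for x using lin_closed[OF \<pi>(1) E[OF that]] .
  have "\<iota> r \<otimes>\<^bsub>Q\<^esub> \<pi> (E x) j \<in> A" if x: "x \<in> carrier ?F" and j: "j < p" for x j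
  proof (rule bspec[OF cond], rule \<pi>(2)[OF E[OF x] _ j])
    fix i assume "i < p"
    then show "E x i \<in> almost_integral" using x almost_integral_A by (auto simp: E_def)
  qed
  then have "\<exists>a\<in>carrier R. \<iota> a = \<iota> r \<otimes>\<^bsub>Q\<^esub> \<pi> (E x) j" if "x \<in> carrier ?F" "j < p" for x j
    using that by (metis (no_types, lifting) image_iff)
  then obtain \<rho>0 where \<rho>0: "\<And>x j. x \<in> carrier ?F \<Longrightarrow> j < p \<Longrightarrow> \<rho>0 x j \<in> carrier R"
     "\<And>x j. x \<in> carrier ?F \<Longrightarrow> j < p \<Longrightarrow> \<iota> (\<rho>0 x j) = \<iota> r \<otimes>\<^bsub>Q\<^esub> \<pi> (E x) j"
    by metis
  define \<rho> where "\<rho> x = (\<lambda>j\<in>{..<p}. \<rho>0 x j)" for x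
  have \<rho>c: "\<rho> x \<in> carrier ?F" if "x \<in> carrier ?F" for x using \<rho>0(1)[OF that] by (auto simp: \<rho>_def)
  have \<rho>j: "\<iota> (\<rho> x j) = \<iota> r \<otimes>\<^bsub>Q\<^esub> \<pi> (E x) j" if "x \<in> carrier ?F" "j < p" for x j
    using \<rho>0(2)[OF that] that by (simp add: \<rho>_def)
  have eqI: "x = y" if "x \<in> carrier ?F" "y \<in> carrier ?F" "\<And>j. j < p \<Longrightarrow> \<iota> (x j) = \<iota> (y j)" for x y
  proof (rule PiE_lessThan_eqI)
    show "x \<in> {..<p} \<rightarrow>\<^sub>E carrier R" "y \<in> {..<p} \<rightarrow>\<^sub>E carrier R" using that by auto
    fix i assume i: "i < p"
    then have "x i \<in> carrier R" "y i \<in> carrier R" using that(1,2) by auto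
    then show "x i = y i" using inj_eq that(3)[OF i] by simp
  qed
  interpret F: module R ?F by (rule R.module_free)
  interpret V: module Q ?V by (rule Q.module_free)
  have xj: "x j \<in> carrier R" if "x \<in> carrier ?F" "j < p" for x j using that by auto
  have vj: "v j \<in> carrier Q" if "v \<in> carrier ?V" "j < p" for v j using that by auto
  have l\<rho>: "lin R ?F ?F \<rho>"
  proof (rule linI)
    fix x y assume x: "x \<in> carrier ?F" and y: "y \<in> carrier ?F"
    have "E (x \<oplus>\<^bsub>?F\<^esub> y) = E x \<oplus>\<^bsub>?V\<^esub> E y"
      using xj[OF x] xj[OF y] by (auto simp: E_def intro!: restrict_ext)
    then have *: "\<pi> (E (x \<oplus>\<^bsub>?F\<^esub> y)) = \<pi> (E x) \<oplus>\<^bsub>?V\<^esub> \<pi> (E y)"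
      using lin_add[OF \<pi>(1) E[OF x] E[OF y]] by simp
    show "\<rho> (x \<oplus>\<^bsub>?F\<^esub> y) = \<rho> x \<oplus>\<^bsub>?F\<^esub> \<rho> y"
    proof (rule eqI)
      show "\<rho> (x \<oplus>\<^bsub>?F\<^esub> y) \<in> carrier ?F" "\<rho> x \<oplus>\<^bsub>?F\<^esub> \<rho> y \<in> carrier ?F"
        using \<rho>c[OF F.M.a_closed[OF x y]] F.M.a_closed[OF \<rho>c[OF x] \<rho>c[OF y]] by blast+
      fix j assume j: "j < p"
      have "\<iota> (\<rho> (x \<oplus>\<^bsub>?F\<^esub> y) j) = \<iota> r \<otimes>\<^bsub>Q\<^esub> (\<pi> (E x) j \<oplus>\<^bsub>Q\<^esub> \<pi> (E y) j)"
        using \<rho>j[OF F.M.a_closed[OF x y] j] * j by simp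
      also have "\<dots> = \<iota> ((\<rho> x \<oplus>\<^bsub>?F\<^esub> \<rho> y) j)"
        using \<rho>j[OF x j] \<rho>j[OF y j] j xj[OF \<rho>c[OF x] j] xj[OF \<rho>c[OF y] j] r
          vj[OF \<pi>E[OF x] j] vj[OF \<pi>E[OF y] j] by (simp add: Q.r_distr)
      finally show "\<iota> (\<rho> (x \<oplus>\<^bsub>?F\<^esub> y) j) = \<iota> ((\<rho> x \<oplus>\<^bsub>?F\<^esub> \<rho> y) j)" .
    qed
  next
    fix c x assume c: "c \<in> carrier R" and x: "x \<in> carrier ?F"
    have ic: "\<iota> c \<in> carrier Q" using c by simp
    have "E (c \<odot>\<^bsub>?F\<^esub> x) = \<iota> c \<odot>\<^bsub>?V\<^esub> E x"
      using xj[OF x] c by (auto simp: E_def intro!: restrict_ext)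
    then have *: "\<pi> (E (c \<odot>\<^bsub>?F\<^esub> x)) = \<iota> c \<odot>\<^bsub>?V\<^esub> \<pi> (E x)"
      using lin_smult[OF \<pi>(1) ic E[OF x]] by simp
    show "\<rho> (c \<odot>\<^bsub>?F\<^esub> x) = c \<odot>\<^bsub>?F\<^esub> \<rho> x"
    proof (rule eqI)
      show "\<rho> (c \<odot>\<^bsub>?F\<^esub> x) \<in> carrier ?F" "c \<odot>\<^bsub>?F\<^esub> \<rho> x \<in> carrier ?F"
        using \<rho>c[OF F.smult_closed[OF c x]] F.smult_closed[OF c \<rho>c[OF x]] by blast+
      fix j assume j: "j < p"
      have "\<iota> (\<rho> (c \<odot>\<^bsub>?F\<^esub> x) j) = \<iota> r \<otimes>\<^bsub>Q\<^esub> (\<iota> c \<otimes>\<^bsub>Q\<^esub> \<pi> (E x) j)"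
        using \<rho>j[OF F.smult_closed[OF c x] j] * j by simp
      also have "\<dots> = \<iota> ((c \<odot>\<^bsub>?F\<^esub> \<rho> x) j)"
        using \<rho>j[OF x j] j xj[OF \<rho>c[OF x] j] r c
          vj[OF \<pi>E[OF x] j] by (simp add: Q.m_lcomm)
      finally show "\<iota> (\<rho> (c \<odot>\<^bsub>?F\<^esub> x) j) = \<iota> ((c \<odot>\<^bsub>?F\<^esub> \<rho> x) j)" .
    qed
  qed (rule \<rho>c)
  have hd: "\<iota> (R.dot (\<rho> x) (D i) p) = \<zero>\<^bsub>Q\<^esub>" if x: "x \<in> carrier ?F" and i: "i < k" for x i
  proof -
    have "\<iota> (R.dot (\<rho> x) (D i) p) = Q.dot (\<lambda>j. \<iota> (\<rho> x j)) (\<lambda>j. \<iota> (D i j)) p"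
      using xj[OF \<rho>c[OF x]] D[OF i] by (intro hom_dot) auto
    also have "\<dots> = Q.dot (\<lambda>j. \<iota> r \<otimes>\<^bsub>Q\<^esub> \<pi> (E x) j) (\<lambda>j. \<iota> (D i j)) p"
      using \<rho>j[OF x] by (intro lc_cong) auto
    also have "\<dots> = \<iota> r \<otimes>\<^bsub>Q\<^esub> Q.dot (\<pi> (E x)) (\<lambda>j. \<iota> (D i j)) p"
      using r vj[OF \<pi>E[OF x]] D[OF i] by (intro Q.dot_scale_left) auto
    also have "\<dots> = \<zero>\<^bsub>Q\<^esub>" using \<pi>(3)[OF E[OF x] i] r by simp
    finally show ?thesis .
  qed
  show ?thesis
  proof (intro exI[of _ \<rho>] conjI ballI impI l\<rho>)
    fix x assume x: "x \<in> carrier ?F"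
    have "R.dot (\<rho> x) (D i) p = \<zero>" if i: "i < k" for i
    proof -
      have "R.dot (\<rho> x) (D i) p \<in> carrier R"
        using xj[OF \<rho>c[OF x]] D[OF i] by (intro R.dot_closed) auto
      then show ?thesis using hd[OF x i] inj_eq[of "R.dot (\<rho> x) (D i) p" \<zero>] by simp
    qed
    then show "d (\<rho> x) = \<zero>\<^bsub>free_module R k\<^esub>" using d0[OF \<rho>c[OF x]] by blast
    assume "d x = \<zero>\<^bsub>free_module R k\<^esub>"
    then have z: "R.dot x (D i) p = \<zero>" if "i < k" for i using d0[OF x] that by blast
    have "Q.dot (E x) (\<lambda>j. \<iota> (D i j)) p = \<zero>\<^bsub>Q\<^esub>" if i: "i < k" for i
    proof -
      have "Q.dot (E x) (\<lambda>j. \<iota> (D i j)) p = Q.dot (\<lambda>j. \<iota> (x j)) (\<lambda>j. \<iota> (D i j)) p"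
        by (intro lc_cong) (auto simp: E_def)
      also have "\<dots> = \<iota> (R.dot x (D i) p)"
        using xj[OF x] D[OF i] by (intro hom_dot[symmetric]) auto
      finally show ?thesis using z[OF i] by simp
    qed
    then have *: "\<pi> (E x) = E x" using \<pi>(4)[OF E[OF x]] by blast
    show "\<rho> x = r \<odot>\<^bsub>?F\<^esub> x"
    proof (rule eqI)
      show "\<rho> x \<in> carrier ?F" by (rule \<rho>c[OF x])
      show "r \<odot>\<^bsub>?F\<^esub> x \<in> carrier ?F" by (rule F.smult_closed[OF r x])
      fix j assume j: "j < p"
      show "\<iota> (\<rho> x j) = \<iota> ((r \<odot>\<^bsub>?F\<^esub> x) j)"
        using \<rho>j[OF x j] * j r xj[OF x j] by (simp add: E_def)
    qed
  qed
qed

end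

section \<open>Modules of homomorphisms and Ext\<close>

lemma mod_hom_eqI:
  "f \<in> mod_hom R M N \<Longrightarrow> g \<in> mod_hom R M N \<Longrightarrow> (\<And>x. x \<in> carrier M \<Longrightarrow> f x = g x) \<Longrightarrow> f = g"
  by (rule extensionalityI[of _ "carrier M"]) (auto simp: mod_hom_iff)

lemma hom_module_simps:
  "carrier (hom_module R M N) = mod_hom R M N"
  "\<zero>\<^bsub>hom_module R M N\<^esub> = (\<lambda>x\<in>carrier M. \<zero>\<^bsub>N\<^esub>)"
  "f \<oplus>\<^bsub>hom_module R M N\<^esub> g = (\<lambda>x\<in>carrier M. f x \<oplus>\<^bsub>N\<^esub> g x)"
  "r \<odot>\<^bsub>hom_module R M N\<^esub> f = (\<lambda>x\<in>carrier M. r \<odot>\<^bsub>N\<^esub> f x)"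
  by (simp_all add: hom_module_def)

lemma module_hom_module:
  assumes M: "module R M" and N: "module R N"
  shows "module R (hom_module R M N)"
proof -
  interpret M: module R M by fact
  interpret N: module R N by fact
  let ?H = "hom_module R M N"
  have cl: "f x \<in> carrier N" if "f \<in> mod_hom R M N" "x \<in> carrier M" for f x
    by (rule lin_closed[OF mod_hom_lin[OF that(1)] that(2)])
  have ad: "f \<oplus>\<^bsub>?H\<^esub> g \<in> mod_hom R M N" if "f \<in> mod_hom R M N" "g \<in> mod_hom R M N" for f g
    unfolding hom_module_simps
    by (rule restrict_mod_hom[OF M lin_plus[OF N]]) (use that in \<open>auto dest: mod_hom_lin\<close>)
  have sc: "r \<odot>\<^bsub>?H\<^esub> f \<in> mod_hom R M N" if "f \<in> mod_hom R M N" "r \<in> carrier R" for f r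
    unfolding hom_module_simps
    by (rule restrict_mod_hom[OF M lin_scale[OF N]]) (use that in \<open>auto dest: mod_hom_lin\<close>)
  have ze: "\<zero>\<^bsub>?H\<^esub> \<in> mod_hom R M N"
    unfolding hom_module_simps by (rule restrict_mod_hom[OF M]) (simp add: lin_def)
  have ab: "abelian_group ?H"
  proof (rule abelian_groupI, unfold hom_module_simps(1))
    fix f g h assume f: "f \<in> mod_hom R M N" and g: "g \<in> mod_hom R M N"
    show "f \<oplus>\<^bsub>?H\<^esub> g \<in> mod_hom R M N" by (rule ad[OF f g])
    show "f \<oplus>\<^bsub>?H\<^esub> g = g \<oplus>\<^bsub>?H\<^esub> f"
      using cl[OF f] cl[OF g] by (auto simp: hom_module_simps N.M.a_comm intro!: restrict_ext)
    assume h: "h \<in> mod_hom R M N"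
    show "f \<oplus>\<^bsub>?H\<^esub> g \<oplus>\<^bsub>?H\<^esub> h = f \<oplus>\<^bsub>?H\<^esub> (g \<oplus>\<^bsub>?H\<^esub> h)"
      using cl[OF f] cl[OF g] cl[OF h] by (auto simp: hom_module_simps N.M.a_assoc intro!: restrict_ext)
  next
    fix f assume f: "f \<in> mod_hom R M N"
    show "\<zero>\<^bsub>?H\<^esub> \<oplus>\<^bsub>?H\<^esub> f = f"
      by (rule mod_hom_eqI[OF ad[OF ze f] f]) (use cl[OF f] in \<open>simp add: hom_module_simps\<close>)
    have "(\<ominus>\<^bsub>R\<^esub> \<one>\<^bsub>R\<^esub>) \<odot>\<^bsub>?H\<^esub> f \<oplus>\<^bsub>?H\<^esub> f = \<zero>\<^bsub>?H\<^esub>"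
      using cl[OF f] by (auto simp: hom_module_simps N.smult_l_minus N.M.l_neg intro!: restrict_ext)
    then show "\<exists>g\<in>mod_hom R M N. g \<oplus>\<^bsub>?H\<^esub> f = \<zero>\<^bsub>?H\<^esub>"
      using sc[OF f, of "\<ominus>\<^bsub>R\<^esub> \<one>\<^bsub>R\<^esub>"] by blast
  qed (rule ze)
  show ?thesis
  proof (rule moduleI[OF M.R.is_cring ab], unfold hom_module_simps(1))
    fix a b f g assume a: "a \<in> carrier R" and f: "f \<in> mod_hom R M N"
    show "a \<odot>\<^bsub>?H\<^esub> f \<in> mod_hom R M N" by (rule sc[OF f a])
    { assume g: "g \<in> mod_hom R M N"
      show "a \<odot>\<^bsub>?H\<^esub> (f \<oplus>\<^bsub>?H\<^esub> g) = a \<odot>\<^bsub>?H\<^esub> f \<oplus>\<^bsub>?H\<^esub> a \<odot>\<^bsub>?H\<^esub> g"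
        using cl[OF f] cl[OF g] a by (auto simp: hom_module_simps N.smult_r_distr intro!: restrict_ext) }
    assume b: "b \<in> carrier R"
    show "(a \<oplus>\<^bsub>R\<^esub> b) \<odot>\<^bsub>?H\<^esub> f = a \<odot>\<^bsub>?H\<^esub> f \<oplus>\<^bsub>?H\<^esub> b \<odot>\<^bsub>?H\<^esub> f"
      using cl[OF f] a b by (auto simp: hom_module_simps N.smult_l_distr intro!: restrict_ext)
    show "(a \<otimes>\<^bsub>R\<^esub> b) \<odot>\<^bsub>?H\<^esub> f = a \<odot>\<^bsub>?H\<^esub> (b \<odot>\<^bsub>?H\<^esub> f)"
      using cl[OF f] a b by (auto simp: hom_module_simps N.smult_assoc1 intro!: restrict_ext)
  next
    fix f assume f: "f \<in> mod_hom R M N"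
    show "\<one>\<^bsub>R\<^esub> \<odot>\<^bsub>?H\<^esub> f = f"
      by (rule mod_hom_eqI[OF sc[OF f] f]) (use cl[OF f] in \<open>simp_all add: hom_module_simps\<close>)
  qed
qed

text \<open>Scalar multiplication takes a union over representatives. Since r K lies in K, all of
  them contribute the coset of r f, which is the zero coset K exactly if r f is in K. K is a
  submodule of H, and Z just supplies the representatives.\<close>

lemma mod_annihilator_quotient_iff:
  assumes H: "module R H" and Z: "Z \<subseteq> carrier H" and K: "submodule K R H"
  shows "r \<in> mod_annihilator R (quotient_module (H\<lparr>carrier := Z\<rparr>) K) \<longleftrightarrow>
     r \<in> carrier R \<and> (\<forall>f\<in>Z. r \<odot>\<^bsub>H\<^esub> f \<in> K)"
proof (cases "r \<in> carrier R")
  case r: True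
  interpret H: module R H by fact
  have Kp: "K \<subseteq> carrier H" "\<zero>\<^bsub>H\<^esub> \<in> K" "\<And>x. x \<in> K \<Longrightarrow> r \<odot>\<^bsub>H\<^esub> x \<in> K"
    using K[unfolded submodule_iff[OF H]] r by auto
  have sg: "subgroup K (add_monoid H)" using K by (rule submodule.axioms)
  have coset: "K +>\<^bsub>H\<lparr>carrier := Z\<rparr>\<^esub> x = K +>\<^bsub>H\<^esub> x" for x by (simp add: a_r_coset_def')
  have smult: "(\<Union>x\<in>K +>\<^bsub>H\<^esub> f. K +>\<^bsub>H\<^esub> (r \<odot>\<^bsub>H\<^esub> x)) = K \<longleftrightarrow> r \<odot>\<^bsub>H\<^esub> f \<in> K" if f: "f \<in> Z" for f
  proof
    have fH: "f \<in> carrier H" using f Z by auto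
    have self: "x \<in> K +>\<^bsub>H\<^esub> x" if "x \<in> carrier H" for x
      using that Kp(2) H.M.l_zero[OF that] unfolding a_r_coset_def' by force
    assume eq: "(\<Union>x\<in>K +>\<^bsub>H\<^esub> f. K +>\<^bsub>H\<^esub> (r \<odot>\<^bsub>H\<^esub> x)) = K"
    have "r \<odot>\<^bsub>H\<^esub> f \<in> (\<Union>x\<in>K +>\<^bsub>H\<^esub> f. K +>\<^bsub>H\<^esub> (r \<odot>\<^bsub>H\<^esub> x))"
      using self[OF fH] self[OF H.smult_closed[OF r fH]] by blast
    then show "r \<odot>\<^bsub>H\<^esub> f \<in> K" by (simp only: eq)
  next
    have fH: "f \<in> carrier H" using f Z by auto
    assume rf: "r \<odot>\<^bsub>H\<^esub> f \<in> K"
    have "K +>\<^bsub>H\<^esub> (r \<odot>\<^bsub>H\<^esub> x) = K" if x: "x \<in> K +>\<^bsub>H\<^esub> f" for x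
    proof -
      obtain k where k: "k \<in> K" "x = k \<oplus>\<^bsub>H\<^esub> f" using x unfolding a_r_coset_def' by blast
      have kH: "k \<in> carrier H" using k Kp by auto
      have "r \<odot>\<^bsub>H\<^esub> x = r \<odot>\<^bsub>H\<^esub> k \<oplus>\<^bsub>H\<^esub> r \<odot>\<^bsub>H\<^esub> f" using k kH fH r by (simp add: H.smult_r_distr)
      also have "\<dots> \<in> K" using Kp(3)[OF k(1)] rf K[unfolded submodule_iff[OF H]] by blast
      finally have rx: "r \<odot>\<^bsub>H\<^esub> x \<in> K" .
      then show ?thesis using H.M.a_coset_join2[OF _ sg rx] Kp by blast
    qed
    moreover have "K +>\<^bsub>H\<^esub> f \<noteq> {}" using Kp(2) by (auto simp: a_r_coset_def')
    ultimately show "(\<Union>x\<in>K +>\<^bsub>H\<^esub> f. K +>\<^bsub>H\<^esub> (r \<odot>\<^bsub>H\<^esub> x)) = K" by auto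
  qed
  show ?thesis
    using smult r by (auto simp: mod_annihilator_def quotient_module_def A_RCOSETS_def' coset
        simp flip: a_r_coset_def')
qed (simp add: mod_annihilator_def)

lemma lin_image_submodule:
  assumes "module R M" "module R N" "lin R M N f" "submodule W R M"
  shows "submodule (f ` W) R N"
proof -
  interpret M: module R M by fact
  interpret N: module R N by fact
  have W: "W \<subseteq> carrier M" "\<zero>\<^bsub>M\<^esub> \<in> W" "\<And>x y. x \<in> W \<Longrightarrow> y \<in> W \<Longrightarrow> x \<oplus>\<^bsub>M\<^esub> y \<in> W"
    "\<And>r x. r \<in> carrier R \<Longrightarrow> x \<in> W \<Longrightarrow> r \<odot>\<^bsub>M\<^esub> x \<in> W"
    using assms(4)[unfolded submodule_iff[OF assms(1)]] by auto
  show ?thesis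
    unfolding submodule_iff[OF assms(2)]
  proof (intro conjI ballI)
    show "f ` W \<subseteq> carrier N" using W(1) lin_closed[OF assms(3)] by auto
    show "\<zero>\<^bsub>N\<^esub> \<in> f ` W" using W(2) lin_zero[OF assms(1-3)] by force
    fix x assume "x \<in> f ` W"
    then obtain a where a: "a \<in> W" "x = f a" by auto
    { fix y assume "y \<in> f ` W"
      then obtain b where b: "b \<in> W" "y = f b" by auto
      then have "x \<oplus>\<^bsub>N\<^esub> y = f (a \<oplus>\<^bsub>M\<^esub> b)" using a subsetD[OF W(1)] lin_add[OF assms(3), of a b] by simp
      then show "x \<oplus>\<^bsub>N\<^esub> y \<in> f ` W" using W(3)[OF a(1) b(1)] by simp }
    fix r assume r: "r \<in> carrier R"
    then have "r \<odot>\<^bsub>N\<^esub> x = f (r \<odot>\<^bsub>M\<^esub> a)" using a r subsetD[OF W(1)] lin_smult[OF assms(3), of r a] by simp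
    then show "r \<odot>\<^bsub>N\<^esub> x \<in> f ` W" using W(4)[OF r a(1)] by simp
  qed
qed

lemma lin_kernel_submodule:
  assumes "module R M" "module R N" "lin R M N f" "submodule W R M"
  shows "submodule {x \<in> W. f x = \<zero>\<^bsub>N\<^esub>} R M"
proof -
  interpret M: module R M by fact
  interpret N: module R N by fact
  have "W \<subseteq> carrier M" "\<zero>\<^bsub>M\<^esub> \<in> W" "\<And>x y. x \<in> W \<Longrightarrow> y \<in> W \<Longrightarrow> x \<oplus>\<^bsub>M\<^esub> y \<in> W"
    "\<And>r x. r \<in> carrier R \<Longrightarrow> x \<in> W \<Longrightarrow> r \<odot>\<^bsub>M\<^esub> x \<in> W"
    using assms(4)[unfolded submodule_iff[OF assms(1)]] by auto
  then show ?thesis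
    unfolding submodule_iff[OF assms(1)]
    by (auto simp: lin_zero[OF assms(1-3)] lin_add[OF assms(3)] lin_smult[OF assms(3)] subset_iff)
qed

lemma submodule_Int:
  assumes "module R M" "submodule W R M" "submodule W' R M"
  shows "submodule (W \<inter> W') R M"
  using assms(2,3) unfolding submodule_iff[OF assms(1)] by auto

lemma lin_hom_diff:
  assumes N: "module R N" and d: "d i \<in> mod_hom R (free_module R (b (Suc i))) (free_module R (b i))"
  shows "lin R (hom_module R (free_module R (b i)) N) (hom_module R (free_module R (b (Suc i))) N) (hom_diff R b d i)"
proof -
  interpret N: module R N by fact
  let ?F = "\<lambda>i. free_module R (b i)"
  have F: "module R (?F i)" for i by (rule N.R.module_free)
  note ld = mod_hom_lin[OF d]
  show ?thesis
  proof (rule linI, unfold hom_module_simps(1))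
    fix f assume f: "f \<in> mod_hom R (?F i) N"
    show "hom_diff R b d i f \<in> mod_hom R (?F (Suc i)) N"
      unfolding hom_diff_def compose_def
      by (rule restrict_mod_hom[OF F lin_comp[OF ld mod_hom_lin[OF f]]])
    { fix g assume g: "g \<in> mod_hom R (?F i) N"
      show "hom_diff R b d i (f \<oplus>\<^bsub>hom_module R (?F i) N\<^esub> g) =
        hom_diff R b d i f \<oplus>\<^bsub>hom_module R (?F (Suc i)) N\<^esub> hom_diff R b d i g"
        unfolding hom_diff_def compose_def hom_module_simps
        using lin_closed[OF ld] by (intro restrict_ext) (simp del: free_module_simps) }
    fix r assume r: "r \<in> carrier R"
    show "hom_diff R b d i (r \<odot>\<^bsub>hom_module R (?F i) N\<^esub> f) =
        r \<odot>\<^bsub>hom_module R (?F (Suc i)) N\<^esub> hom_diff R b d i f"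
      unfolding hom_diff_def compose_def hom_module_simps
      using lin_closed[OF ld] by (intro restrict_ext) (simp del: free_module_simps)
  qed
qed

lemma hom_cocycles_iff:
  assumes "d i \<in> mod_hom R (free_module R (b (Suc i))) (free_module R (b i))"
  shows "f \<in> hom_cocycles R b d N i \<longleftrightarrow> f \<in> mod_hom R (free_module R (b i)) N \<and>
     (\<forall>x\<in>carrier (free_module R (b (Suc i))). f (d i x) = \<zero>\<^bsub>N\<^esub>)"
proof -
  have "hom_diff R b d i f = (\<lambda>x\<in>carrier (free_module R (b (Suc i))). \<zero>\<^bsub>N\<^esub>) \<longleftrightarrow>
    (\<forall>x\<in>carrier (free_module R (b (Suc i))). f (d i x) = \<zero>\<^bsub>N\<^esub>)"
    unfolding hom_diff_def compose_def by (auto simp: fun_eq_iff restrict_def)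
  then show ?thesis by (auto simp: hom_cocycles_def a_kernel_def' hom_module_simps)
qed

lemma mod_annihilator_cohomology_iff:
  assumes N: "module R N"
    and d: "\<And>i. d i \<in> mod_hom R (free_module R (b (Suc i))) (free_module R (b i))"
  shows "r \<in> mod_annihilator R (hom_cohomology R b d N n) \<longleftrightarrow>
     r \<in> carrier R \<and> (\<forall>f\<in>hom_cocycles R b d N n.
       r \<odot>\<^bsub>hom_module R (free_module R (b n)) N\<^esub> f \<in> hom_coboundaries R b d N n)"
  unfolding hom_cohomology_def
proof (rule mod_annihilator_quotient_iff)
  interpret N: module R N by fact
  let ?F = "\<lambda>i. free_module R (b i)"
  have F: "module R (?F i)" for i by (rule N.R.module_free)
  show H: "module R (hom_module R (?F n) N)" by (rule module_hom_module[OF F N])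
  show "hom_cocycles R b d N n \<subseteq> carrier (hom_module R (?F n) N)"
    using hom_cocycles_iff[of d n R b, OF d] by (auto simp: hom_module_simps(1))
  show "submodule (hom_coboundaries R b d N n) R (hom_module R (?F n) N)"
  proof (cases n)
    case 0
    interpret H: module R "hom_module R (?F n) N" by (rule H)
    show ?thesis unfolding submodule_iff[OF H] using 0 H.M.zero_closed H.M.r_zero H.smult_r_null by auto
  next
    case (Suc i)
    interpret H: module R "hom_module R (?F i) N" by (rule module_hom_module[OF F N])
    show ?thesis
      using lin_image_submodule[OF module_hom_module[OF F N] module_hom_module[OF F N]
        lin_hom_diff[where d = d and b = b, OF N d] H.carrier_is_submodule] Suc by simp
  qed
qed

text \<open>In positive degree r annihilates Ext if and only if r times each cocycle factors through
  the preceding differential. The restrictions to carriers that come with \<open>mod_hom\<close> are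
  removed here, so that both inclusions can work with \<open>lin\<close>.\<close>

lemma mod_annihilator_cohomology_Suc:
  assumes N: "module R N"
    and d: "\<And>i. d i \<in> mod_hom R (free_module R (b (Suc i))) (free_module R (b i))"
  shows "r \<in> mod_annihilator R (hom_cohomology R b d N (Suc n)) \<longleftrightarrow>
     r \<in> carrier R \<and> (\<forall>f. lin R (free_module R (b (Suc n))) N f \<longrightarrow>
       (\<forall>x\<in>carrier (free_module R (b (Suc (Suc n)))). f (d (Suc n) x) = \<zero>\<^bsub>N\<^esub>) \<longrightarrow>
       (\<exists>g. lin R (free_module R (b n)) N g \<and>
          (\<forall>x\<in>carrier (free_module R (b (Suc n))). g (d n x) = r \<odot>\<^bsub>N\<^esub> f x)))"
proof -
  interpret N: module R N by fact
  let ?F = "\<lambda>i. free_module R (b i)"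
  have F: "module R (?F i)" for i by (rule N.R.module_free)
  have dc: "d i x \<in> carrier (?F i)" if "x \<in> carrier (?F (Suc i))" for i x
    using lin_closed[OF mod_hom_lin[OF d] that] .
  have cob: "r \<odot>\<^bsub>hom_module R (?F (Suc n)) N\<^esub> f \<in> hom_coboundaries R b d N (Suc n) \<longleftrightarrow>
    (\<exists>g\<in>mod_hom R (?F n) N. \<forall>x\<in>carrier (?F (Suc n)). g (d n x) = r \<odot>\<^bsub>N\<^esub> f x)" for f
    unfolding hom_coboundaries.simps hom_module_simps image_iff hom_diff_def compose_def
    by (auto simp: fun_eq_iff restrict_def simp del: free_module_simps) metis+
  show ?thesis
    unfolding mod_annihilator_cohomology_iff[where d = d and b = b, OF N d] cob
  proof (intro iffI conjI allI impI ballI; (elim conjE)?)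
    fix f
    assume *: "\<forall>f\<in>hom_cocycles R b d N (Suc n). \<exists>g\<in>mod_hom R (?F n) N. \<forall>x\<in>carrier (?F (Suc n)). g (d n x) = r \<odot>\<^bsub>N\<^esub> f x"
      and f: "lin R (?F (Suc n)) N f" "\<forall>x\<in>carrier (?F (Suc (Suc n))). f (d (Suc n) x) = \<zero>\<^bsub>N\<^esub>"
    let ?f = "restrict f (carrier (?F (Suc n)))"
    have "?f \<in> hom_cocycles R b d N (Suc n)"
      unfolding hom_cocycles_iff[of d "Suc n" R b, OF d]
    proof (intro conjI ballI restrict_mod_hom[OF F f(1)])
      fix x assume x: "x \<in> carrier (?F (Suc (Suc n)))"
      show "?f (d (Suc n) x) = \<zero>\<^bsub>N\<^esub>" using f(2) x dc[OF x] by (simp del: free_module_simps)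
    qed
    then obtain g where g: "g \<in> mod_hom R (?F n) N" "\<forall>x\<in>carrier (?F (Suc n)). g (d n x) = r \<odot>\<^bsub>N\<^esub> ?f x"
      using * by blast
    then show "\<exists>g. lin R (?F n) N g \<and> (\<forall>x\<in>carrier (?F (Suc n)). g (d n x) = r \<odot>\<^bsub>N\<^esub> f x)"
      using mod_hom_lin[OF g(1)] by (intro exI[of _ g]) (simp del: free_module_simps)
  next
    fix f
    assume *: "\<forall>f. lin R (?F (Suc n)) N f \<longrightarrow> (\<forall>x\<in>carrier (?F (Suc (Suc n))). f (d (Suc n) x) = \<zero>\<^bsub>N\<^esub>) \<longrightarrow>
       (\<exists>g. lin R (?F n) N g \<and> (\<forall>x\<in>carrier (?F (Suc n)). g (d n x) = r \<odot>\<^bsub>N\<^esub> f x))"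
      and "f \<in> hom_cocycles R b d N (Suc n)"
    then have f: "f \<in> mod_hom R (?F (Suc n)) N" "\<forall>x\<in>carrier (?F (Suc (Suc n))). f (d (Suc n) x) = \<zero>\<^bsub>N\<^esub>"
      using hom_cocycles_iff[of d "Suc n" R b, OF d] by blast+
    obtain g where g: "lin R (?F n) N g" "\<forall>x\<in>carrier (?F (Suc n)). g (d n x) = r \<odot>\<^bsub>N\<^esub> f x"
      using * mod_hom_lin[OF f(1)] f(2) by blast
    show "\<exists>g\<in>mod_hom R (?F n) N. \<forall>x\<in>carrier (?F (Suc n)). g (d n x) = r \<odot>\<^bsub>N\<^esub> f x"
      using restrict_mod_hom[OF F g(1)] g(2) dc by (intro bexI[of _ "restrict g (carrier (?F n))"])
        (simp_all del: free_module_simps)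
  qed
qed

section \<open>Finite generation and free resolutions\<close>

lemma (in abelian_group) minus_add_cancel: "x \<in> carrier G \<Longrightarrow> y \<in> carrier G \<Longrightarrow> x \<ominus> y \<oplus> y = x"
  by (simp add: a_minus_def a_assoc l_neg)

lemma (in abelian_group) eq_if_minus_zero:
  assumes "x \<in> carrier G" "y \<in> carrier G" "x \<ominus> y = \<zero>"
  shows "x = y"
  using minus_add_cancel[OF assms(1,2)] assms by simp

lemma submoduleD:
  assumes "module R M" "submodule H R M"
  shows "H \<subseteq> carrier M" "\<zero>\<^bsub>M\<^esub> \<in> H" "\<And>x y. x \<in> H \<Longrightarrow> y \<in> H \<Longrightarrow> x \<oplus>\<^bsub>M\<^esub> y \<in> H"
    "\<And>r x. r \<in> carrier R \<Longrightarrow> x \<in> H \<Longrightarrow> r \<odot>\<^bsub>M\<^esub> x \<in> H"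
  using assms(2)[unfolded submodule_iff[OF assms(1)]] by auto

text \<open>Generation is expressed through submodules of the ambient M, so that W needs no module
  structure of its own.\<close>

definition finitely_spanned ::
    "('a, 'k) ring_scheme \<Rightarrow> ('a, 'm, 'l) module_scheme \<Rightarrow> 'm set \<Rightarrow> bool" where
  "finitely_spanned R M W \<longleftrightarrow>
     (\<exists>S\<subseteq>W. finite S \<and> (\<forall>H. submodule H R M \<longrightarrow> S \<subseteq> H \<longrightarrow> W \<subseteq> H))"

lemma finitely_spanned_surjection:
  assumes M: "module R M" and W: "submodule W R M" and fs: "finitely_spanned R M W"
  obtains n f where "lin R (free_module R n) M f" "f ` carrier (free_module R n) = W"
proof -
  interpret M: module R M by fact
  obtain S where S: "S \<subseteq> W" "finite S" "\<And>H. submodule H R M \<Longrightarrow> S \<subseteq> H \<Longrightarrow> W \<subseteq> H"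
    using fs unfolding finitely_spanned_def by blast
  obtain n :: nat and y where y: "S = y ` {i. i < n}"
    using S(2) unfolding finite_conv_nat_seg_image by blast
  note Wd = submoduleD[OF M W]
  have yW: "y i \<in> W" "y i \<in> carrier M" if "i < n" for i using y S(1) Wd(1) that by auto
  let ?f = "\<lambda>x. lc M x y n"
  have l: "lin R (free_module R n) M ?f" by (rule lin_lc_free[OF M yW(2)])
  have F: "module R (free_module R n)" by (rule M.R.module_free)
  have "?f ` carrier (free_module R n) \<subseteq> W"
  proof (rule image_subsetI, rule M.lc_mem[OF W])
    fix x i assume "x \<in> carrier (free_module R n)" "i < n"
    then show "x i \<in> carrier R" by auto
  qed (rule yW)
  moreover have "W \<subseteq> ?f ` carrier (free_module R n)"
  proof (rule S(3))
    show "submodule (?f ` carrier (free_module R n)) R M"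
      by (rule lin_image_submodule[OF F M l module.carrier_is_submodule[OF F]])
    show "S \<subseteq> ?f ` carrier (free_module R n)"
    proof
      fix s assume "s \<in> S"
      then obtain j where j: "j < n" "s = y j" using y by auto
      have "?f (M.unit_vec n j) = lc M (\<lambda>i. if i = j then \<one>\<^bsub>R\<^esub> else \<zero>\<^bsub>R\<^esub>) y n"
        by (rule lc_cong) (auto simp: M.R.unit_vec_def)
      also have "\<dots> = s" using M.lc_unit[OF j(1) yW(2)] j(2) by simp
      finally show "s \<in> ?f ` carrier (free_module R n)" by (intro image_eqI[of _ _ "M.unit_vec n j"]) auto
    qed
  qed
  ultimately show ?thesis using that[OF l] by blast
qed

lemma fin_gen_surjection:
  assumes "fin_gen_module R M"
  obtains n f where "lin R (free_module R n) M f" "f ` carrier (free_module R n) = carrier M"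
proof -
  have M: "module R M" using assms by (simp add: fin_gen_module_def)
  obtain S where S: "S \<subseteq> carrier M" "finite S" "carrier M = \<Inter>{H. submodule H R M \<and> S \<subseteq> H}"
    using assms unfolding fin_gen_module_def by blast
  have "finitely_spanned R M (carrier M)"
    unfolding finitely_spanned_def using S(1,2) S(3)[THEN equalityD1] by blast
  then show ?thesis
    using finitely_spanned_surjection[OF M module.carrier_is_submodule[OF M]] that by blast
qed

lemma fin_gen_moduleI:
  assumes M: "module R M" and fs: "finitely_spanned R M (carrier M)"
  shows "fin_gen_module R M"
proof -
  obtain S where S: "S \<subseteq> carrier M" "finite S" "\<And>H. submodule H R M \<Longrightarrow> S \<subseteq> H \<Longrightarrow> carrier M \<subseteq> H"
    using fs unfolding finitely_spanned_def by blast
  have "carrier M = \<Inter>{H. submodule H R M \<and> S \<subseteq> H}"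
    using S(1,3) module.carrier_is_submodule[OF M] by blast
  then show ?thesis unfolding fin_gen_module_def using M S(1,2) by blast
qed

context noetherian_cring begin

lemma ideal_iff_submodule: "ideal I R \<longleftrightarrow> submodule I R (regular_module R)"
  unfolding submodule_iff[OF module_regular] ideal_iff by simp

text \<open>Induction on the rank: the last coordinates of W form a finitely generated ideal, and
  the elements with last coordinate 0 form a submodule of R^k. Lifts of both sets of generators
  generate W.\<close>

lemma free_submodule_finitely_spanned:
  "submodule W R (free_module R k) \<Longrightarrow> finitely_spanned R (free_module R k) W"
proof (induct k arbitrary: W)
  case 0
  note Wd = submoduleD[OF module_free 0]
  have "W \<subseteq> {\<zero>\<^bsub>free_module R 0\<^esub>}" using Wd(1) by (auto simp: restrict_def)
  then show ?case
    unfolding finitely_spanned_def using submoduleD(2)[OF module_free]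
    by (intro exI[of _ "{}"]) blast
next
  case (Suc k)
  let ?F = "free_module R (Suc k)" and ?G = "free_module R k" and ?A = "regular_module R"
  have F: "module R ?F" and G: "module R ?G" and A: "module R ?A"
    by (rule module_free module_regular)+
  interpret F: module R ?F by (rule F)
  interpret A: module R ?A by (rule A)
  note Wd = submoduleD[OF F Suc(2)]
  let ?p = "\<lambda>v. v k" and ?r = "\<lambda>v. restrict v {..<k}"
  have lp: "lin R ?F ?A ?p" by (rule lin_proj) simp
  have lr: "lin R ?F ?G ?r" by (rule linI) (auto intro!: restrict_ext simp: PiE_iff)
  have ip: "ideal (?p ` W) R"
    unfolding ideal_iff_submodule by (rule lin_image_submodule[OF F A lp Suc(2)])
  obtain S1 where S1: "S1 \<subseteq> carrier R" "finite S1" "?p ` W = Idl S1"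
    using finetely_gen[OF ip] by (elim exE conjE) (rule that)
  have "S1 \<subseteq> ?p ` W" using S1 genideal_self by simp
  then obtain A1 where A1: "A1 \<subseteq> W" "finite A1" "S1 = ?p ` A1"
    using finite_subset_image[OF S1(2)] by blast
  define W0 where "W0 = {v \<in> W. v k = \<zero>}"
  have "submodule W0 R ?F"
    using lin_kernel_submodule[OF F A lp Suc(2)] by (simp add: W0_def)
  then have "finitely_spanned R ?G (?r ` W0)"
    by (rule Suc(1)[OF lin_image_submodule[OF F G lr]])
  then obtain S2 where S2: "S2 \<subseteq> ?r ` W0" "finite S2"
      "\<And>H. submodule H R ?G \<Longrightarrow> S2 \<subseteq> H \<Longrightarrow> ?r ` W0 \<subseteq> H"
    unfolding finitely_spanned_def by blast
  obtain A2 where A2: "A2 \<subseteq> W0" "finite A2" "S2 = ?r ` A2"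
    using finite_subset_image[OF S2(2,1)] by blast
  have "W \<subseteq> H" if H: "submodule H R ?F" "A1 \<union> A2 \<subseteq> H" for H
  proof
    fix w assume w: "w \<in> W"
    \<comment> \<open>Intersecting with W ensures that the element h with the same last coordinate
      as w lies in W, so w - h is covered by the induction hypothesis.\<close>
    let ?H = "H \<inter> W"
    have sH: "submodule ?H R ?F" by (rule submodule_Int[OF F H(1) Suc(2)])
    have iH: "ideal (?p ` ?H) R"
      unfolding ideal_iff_submodule by (rule lin_image_submodule[OF F A lp sH])
    have S1H: "S1 \<subseteq> ?p ` ?H" using A1 H(2) by blast
    have "w k \<in> Idl S1" unfolding S1(3)[symmetric] using w by (rule imageI)
    then have "w k \<in> ?p ` ?H" using genideal_minimal[OF iH S1H] by (rule rev_subsetD)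
    then obtain h where h: "h \<in> H" "h \<in> W" "h k = w k" by (elim imageE IntE) (rule that, simp_all)
    let ?u = "w \<ominus>\<^bsub>?F\<^esub> h"
    have c: "w \<in> carrier ?F" "h \<in> carrier ?F" using w h Wd(1) by auto
    have "?u k = w k \<ominus>\<^bsub>?A\<^esub> h k" by (rule lin_diff[OF F A lp c])
    also have "\<dots> = \<zero>"
      using A.M.r_neg[of "w k"] lin_closed[OF lp c(1)] unfolding h(3) a_minus_def by simp
    finally have u0: "?u k = \<zero>" .
    moreover have uW: "?u \<in> W" by (rule submodule_minus[OF F Suc(2) w h(2)])
    ultimately have uW0: "?u \<in> W0" by (simp add: W0_def)
    have "submodule {v \<in> ?H. v k = \<zero>} R ?F"
      using lin_kernel_submodule[OF F A lp sH] by simp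
    then have "submodule (?r ` {v \<in> ?H. v k = \<zero>}) R ?G"
      by (rule lin_image_submodule[OF F G lr])
    moreover have "S2 \<subseteq> ?r ` {v \<in> ?H. v k = \<zero>}"
      unfolding A2(3) using A2(1) H(2) by (intro image_mono) (auto simp: W0_def)
    ultimately have "?r ` W0 \<subseteq> ?r ` {v \<in> ?H. v k = \<zero>}" by (rule S2(3))
    then obtain g where g: "g \<in> H" "g \<in> W" "g k = \<zero>" "?r ?u = ?r g" using uW0 by blast
    have "?u = g"
    proof (rule PiE_lessThan_eqI)
      show "?u \<in> {..<Suc k} \<rightarrow>\<^sub>E carrier R" "g \<in> {..<Suc k} \<rightarrow>\<^sub>E carrier R"
        using uW g(2) Wd(1) by auto
      fix i assume "i < Suc k"
      then show "?u i = g i"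
        using g(3) u0 fun_cong[OF g(4), of i] by (cases "i = k") auto
    qed
    then have "?u \<in> H" using g(1) by simp
    then have "?u \<oplus>\<^bsub>?F\<^esub> h \<in> H" using h(1) submoduleD(3)[OF F H(1)] by blast
    moreover have "?u \<oplus>\<^bsub>?F\<^esub> h = w" using c by (rule F.M.minus_add_cancel)
    ultimately show "w \<in> H" by (simp only:)
  qed
  moreover have "A1 \<union> A2 \<subseteq> W" using A1 A2 by (auto simp: W0_def)
  ultimately show ?case
    unfolding finitely_spanned_def using A1(2) A2(2) by (intro exI[of _ "A1 \<union> A2"]) blast
qed

lemma exists_kernel_surjection:
  assumes "module R N" "lin R (free_module R k) N f"
  obtains n d where "d \<in> mod_hom R (free_module R n) (free_module R k)"
    "d ` carrier (free_module R n) = a_kernel (free_module R k) N f"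
proof -
  have K: "submodule (a_kernel (free_module R k) N f) R (free_module R k)"
    using lin_kernel_submodule[OF module_free assms module.carrier_is_submodule[OF module_free]]
    by (simp add: a_kernel_def')
  obtain n f' where f': "lin R (free_module R n) (free_module R k) f'"
      "f' ` carrier (free_module R n) = a_kernel (free_module R k) N f"
    using finitely_spanned_surjection[OF module_free K free_submodule_finitely_spanned[OF K]] by blast
  let ?d = "restrict f' (carrier (free_module R n))"
  have "?d ` carrier (free_module R n) = a_kernel (free_module R k) N f"
    unfolding f'(2)[symmetric] by (rule image_cong) auto
  then show ?thesis using that[OF restrict_mod_hom[OF module_free f'(1)]] by blast
qed

lemma exists_free_resolution:
  assumes "fin_gen_module R M"
  shows "\<exists>b d e. free_resolution R M b e d"
proof -
  have M: "module R M" using assms by (simp add: fin_gen_module_def)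
  obtain b0 f where f: "lin R (free_module R b0) M f" "f ` carrier (free_module R b0) = carrier M"
    using fin_gen_surjection[OF assms] by blast
  define e where "e = restrict f (carrier (free_module R b0))"
  have e: "e \<in> mod_hom R (free_module R b0) M" "e ` carrier (free_module R b0) = carrier M"
    using restrict_mod_hom[OF module_free f(1)] f(2) by (simp_all add: e_def)
  \<comment> \<open>A triple (b, b', d) is a differential d from R^b' to R^b. \<open>Q\<close> joins
    consecutive triples by exactness, and the clause for n = 0 places the first one over the
    augmentation.\<close>
  define P where "P n x \<longleftrightarrow> (case x of (b, b', d) \<Rightarrow>
      d \<in> mod_hom R (free_module R b') (free_module R b) \<and>
      (n = 0 \<longrightarrow> b = b0 \<and> d ` carrier (free_module R b') = a_kernel (free_module R b0) M e))"
    for n :: nat and x :: "nat \<times> nat \<times> ((nat \<Rightarrow> 'a) \<Rightarrow> nat \<Rightarrow> 'a)"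
  define Q where "Q (n::nat) x y \<longleftrightarrow> (case x of (b, b', d) \<Rightarrow> case y of (c, c', d') \<Rightarrow> c = b' \<and>
      d' ` carrier (free_module R c') = a_kernel (free_module R b') (free_module R b) d)"
    for n and x y :: "nat \<times> nat \<times> ((nat \<Rightarrow> 'a) \<Rightarrow> nat \<Rightarrow> 'a)"
  have "\<exists>F. \<forall>n. P n (F n) \<and> Q n (F n) (F (Suc n))"
  proof (rule dependent_nat_choice)
    obtain b1 d0 where "d0 \<in> mod_hom R (free_module R b1) (free_module R b0)"
      "d0 ` carrier (free_module R b1) = a_kernel (free_module R b0) M e"
      by (rule exists_kernel_surjection[OF M mod_hom_lin[OF e(1)]]) (rule that)
    then show "\<exists>x. P 0 x" unfolding P_def by (intro exI[of _ "(b0, b1, d0)"]) simp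
    fix x n assume "P n x"
    then obtain b b' d where x: "x = (b, b', d)" "d \<in> mod_hom R (free_module R b') (free_module R b)"
      unfolding P_def by (cases x) auto
    obtain c d' where "d' \<in> mod_hom R (free_module R c) (free_module R b')"
      "d' ` carrier (free_module R c) = a_kernel (free_module R b') (free_module R b) d"
      by (rule exists_kernel_surjection[OF module_free mod_hom_lin[OF x(2)]]) (rule that)
    then show "\<exists>y. P (Suc n) y \<and> Q n x y"
      unfolding P_def Q_def x(1) by (intro exI[of _ "(b', c, d')"]) simp
  qed
  then obtain F where F: "\<And>n. P n (F n)" "\<And>n. Q n (F n) (F (Suc n))" by blast
  define b where "b n = fst (F n)" for n
  define d where "d n = snd (snd (F n))" for n
  have Fn: "F n = (b n, b (Suc n), d n)" for n
    using F(2)[of n] unfolding Q_def b_def d_def by (cases "F n"; cases "F (Suc n)") auto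
  have b0: "b 0 = b0" using F(1)[of 0] unfolding Fn P_def by simp
  have "free_resolution R M b e d"
    unfolding free_resolution_def
  proof (intro conjI allI)
    fix i
    show "d i \<in> mod_hom R (free_module R (b (Suc i))) (free_module R (b i))"
      using F(1)[of i] unfolding Fn P_def by simp
    show "d (Suc i) ` carrier (free_module R (b (Suc (Suc i)))) =
        a_kernel (free_module R (b (Suc i))) (free_module R (b i)) (d i)"
      using F(2)[of i] unfolding Fn Q_def by simp
    show "d 0 ` carrier (free_module R (b 1)) = a_kernel (free_module R (b 0)) M e"
      using F(1)[of 0] unfolding Fn P_def by simp
  qed (simp_all only: b0 e)
  then show ?thesis by blast
qed

text \<open>The choice made in \<open>Ext\<close> depends on M but neither on N nor on n, so one
  resolution computes all these modules. The augmentation, bound by the existential quantifier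
  there, is recovered.\<close>

lemma Ext_resolution:
  assumes "fin_gen_module R M"
  obtains b d e where "free_resolution R M b e d" "\<And>N n. Ext R n M N = hom_cohomology R b d N n"
proof -
  let ?x = "SOME (b, d). \<exists>e. free_resolution R M b e d"
  obtain b d where bd: "?x = (b, d)" by (cases ?x) blast
  have "\<exists>x. case x of (b, d) \<Rightarrow> \<exists>e. free_resolution R M b e d"
    using exists_free_resolution[OF assms] by auto
  then have "case ?x of (b, d) \<Rightarrow> \<exists>e. free_resolution R M b e d" by (rule someI_ex)
  then obtain e where "free_resolution R M b e d" unfolding bd by auto
  moreover have "Ext R n M N = hom_cohomology R b d N n" for N n
    unfolding Ext_def bd by simp
  ultimately show ?thesis using that by blast
qed

end

lemma free_resolutionD:
  assumes "free_resolution R M b e d"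
  shows "lin R (free_module R (b 0)) M e" "\<And>i. d i \<in> mod_hom R (free_module R (b (Suc i))) (free_module R (b i))"
    "e ` carrier (free_module R (b 0)) = carrier M"
    "d 0 ` carrier (free_module R (b 1)) = {x \<in> carrier (free_module R (b 0)). e x = \<zero>\<^bsub>M\<^esub>}"
    "\<And>i. d (Suc i) ` carrier (free_module R (b (Suc (Suc i)))) =
        {x \<in> carrier (free_module R (b (Suc i))). d i x = \<zero>\<^bsub>free_module R (b i)\<^esub>}"
proof -
  note * = assms[unfolded free_resolution_def a_kernel_def']
  show "lin R (free_module R (b 0)) M e"
    by (rule mod_hom_lin[OF *[THEN conjunct1]])
  show "d i \<in> mod_hom R (free_module R (b (Suc i))) (free_module R (b i))" for i
    by (rule *[THEN conjunct2, THEN conjunct1, rule_format])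
  show "e ` carrier (free_module R (b 0)) = carrier M"
    by (rule *[THEN conjunct2, THEN conjunct2, THEN conjunct1])
  show "d 0 ` carrier (free_module R (b 1)) = {x \<in> carrier (free_module R (b 0)). e x = \<zero>\<^bsub>M\<^esub>}"
    by (rule *[THEN conjunct2, THEN conjunct2, THEN conjunct2, THEN conjunct1])
  show "d (Suc i) ` carrier (free_module R (b (Suc (Suc i)))) =
        {x \<in> carrier (free_module R (b (Suc i))). d i x = \<zero>\<^bsub>free_module R (b i)\<^esub>}" for i
    by (rule *[THEN conjunct2, THEN conjunct2, THEN conjunct2, THEN conjunct2, rule_format])
qed

section \<open>The conductor annihilates Ext\<close>

text \<open>Let \<rho> on F 1 come from the kernel of d 0. Its values lie in the image of d 1, and
  on this image it is multiplication by r. A cocycle on F 2 descends to the image of d 1, and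
  composing with \<rho> gives the map on F 1 through which r f factors.\<close>

lemma (in normalization_dim1) conductor_annihilates_Ext:
  assumes r: "r \<in> carrier R" and cond: "\<forall>q\<in>almost_integral. \<iota> r \<otimes>\<^bsub>Q\<^esub> q \<in> A"
    and M: "fin_gen_module R M" and N: "fin_gen_module R N"
  shows "r \<in> mod_annihilator R (Ext R 2 M N)"
proof -
  have mN: "module R N" using N by (simp add: fin_gen_module_def)
  interpret N: module R N by (rule mN)
  obtain b d e where res: "free_resolution R M b e d" "\<And>n. Ext R n M N = hom_cohomology R b d N n"
    by (rule Ext_resolution[OF M]) (rule that)
  note D = free_resolutionD[OF res(1)]
  note l = D(2)[THEN mod_hom_lin]
  let ?F = "\<lambda>i. free_module R (b i)"
  interpret F: module R "?F i" for i by (rule R.module_free)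
  have l0: "lin R (?F 1) (?F 0) (d 0)" using l[of 0] by simp
  obtain \<rho> where P: "lin R (?F 1) (?F 1) \<rho>"
    "\<forall>x\<in>carrier (?F 1). d 0 (\<rho> x) = \<zero>\<^bsub>?F 0\<^esub>"
    "\<forall>x\<in>carrier (?F 1). d 0 x = \<zero>\<^bsub>?F 0\<^esub> \<longrightarrow> \<rho> x = r \<odot>\<^bsub>?F 1\<^esub> x"
    using conductor_splitting[OF r cond l0] by (elim exE conjE) (rule that)
  note \<rho> = P(1) P(2)[rule_format] P(3)[rule_format]
  have k1: "d 1 ` carrier (?F 2) = {x \<in> carrier (?F 1). d 0 x = \<zero>\<^bsub>?F 0\<^esub>}"
    using D(5)[of 0] by (simp add: numeral_2_eq_2)
  have k2: "d 2 ` carrier (?F 3) = {x \<in> carrier (?F 2). d 1 x = \<zero>\<^bsub>?F 1\<^esub>}"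
    using D(5)[of 1] by (simp add: numeral_2_eq_2 numeral_3_eq_3)
  have l1: "lin R (?F 2) (?F 1) (d 1)" using l[of 1] by (simp add: numeral_2_eq_2)
  have "r \<in> mod_annihilator R (hom_cohomology R b d N (Suc 1))"
    unfolding mod_annihilator_cohomology_Suc[where b = b and d = d, OF mN D(2)]
  proof (intro conjI allI impI r)
    fix f assume "lin R (?F (Suc 1)) N f" "\<forall>x\<in>carrier (?F (Suc (Suc 1))). f (d (Suc 1) x) = \<zero>\<^bsub>N\<^esub>"
    then have f: "lin R (?F 2) N f" and f0: "\<And>x. x \<in> carrier (?F 3) \<Longrightarrow> f (d 2 x) = \<zero>\<^bsub>N\<^esub>"
      by (simp_all add: numeral_2_eq_2 numeral_3_eq_3 del: free_module_simps)
    \<comment> \<open>f vanishes on the image of d 2, which is the kernel of d 1, so f w depends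
      only on d 1 w. This makes the non-linear choice of preimages h below harmless.\<close>
    have wd: "f w = f w'" if w: "w \<in> carrier (?F 2)" "w' \<in> carrier (?F 2)" "d 1 w = d 1 w'" for w w'
    proof -
      have c: "w \<ominus>\<^bsub>?F 2\<^esub> w' \<in> carrier (?F 2)" by (rule F.M.minus_closed[OF w(1,2)])
      have "d 1 (w \<ominus>\<^bsub>?F 2\<^esub> w') = d 1 w' \<ominus>\<^bsub>?F 1\<^esub> d 1 w'"
        using lin_diff[OF F.module_axioms F.module_axioms l1 w(1,2)] w(3) by (simp only:)
      also have "\<dots> = \<zero>\<^bsub>?F 1\<^esub>"
        using F.M.r_neg[OF lin_closed[OF l1 w(2)]] by (simp only: a_minus_def)
      finally have d0: "d 1 (w \<ominus>\<^bsub>?F 2\<^esub> w') = \<zero>\<^bsub>?F 1\<^esub>" .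
      have "w \<ominus>\<^bsub>?F 2\<^esub> w' \<in> d 2 ` carrier (?F 3)" unfolding k2 mem_Collect_eq by (rule conjI[OF c d0])
      then obtain z where z: "z \<in> carrier (?F 3)" "w \<ominus>\<^bsub>?F 2\<^esub> w' = d 2 z" by (rule imageE) (rule that)
      have "f w \<ominus>\<^bsub>N\<^esub> f w' = f (w \<ominus>\<^bsub>?F 2\<^esub> w')"
        by (rule lin_diff[OF F.module_axioms mN f w(1,2), symmetric])
      also have "\<dots> = \<zero>\<^bsub>N\<^esub>" unfolding z(2) by (rule f0[OF z(1)])
      finally show ?thesis
        by (rule N.M.eq_if_minus_zero[OF lin_closed[OF f w(1)] lin_closed[OF f w(2)]])
    qed
    have "\<exists>w\<in>carrier (?F 2). d 1 w = \<rho> v" if v: "v \<in> carrier (?F 1)" for v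
    proof -
      have "\<rho> v \<in> d 1 ` carrier (?F 2)" unfolding k1 using lin_closed[OF \<rho>(1) v] \<rho>(2)[OF v] by blast
      then show ?thesis by (metis imageE)
    qed
    then obtain h where h: "\<And>v. v \<in> carrier (?F 1) \<Longrightarrow> h v \<in> carrier (?F 2)"
      "\<And>v. v \<in> carrier (?F 1) \<Longrightarrow> d 1 (h v) = \<rho> v"
      by metis
    have "lin R (?F 1) N (\<lambda>v. f (h v))"
    proof (rule linI)
      fix x y assume x: "x \<in> carrier (?F 1)" and y: "y \<in> carrier (?F 1)"
      show "f (h x) \<in> carrier N" by (rule lin_closed[OF f h(1)[OF x]])
      have xy: "x \<oplus>\<^bsub>?F 1\<^esub> y \<in> carrier (?F 1)" by (rule F.M.a_closed[OF x y])
      have "d 1 (h (x \<oplus>\<^bsub>?F 1\<^esub> y)) = d 1 (h x \<oplus>\<^bsub>?F 2\<^esub> h y)"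
        unfolding h(2)[OF xy] lin_add[OF l1 h(1)[OF x] h(1)[OF y]] h(2)[OF x] h(2)[OF y]
        by (rule lin_add[OF \<rho>(1) x y])
      then have "f (h (x \<oplus>\<^bsub>?F 1\<^esub> y)) = f (h x \<oplus>\<^bsub>?F 2\<^esub> h y)"
        by (rule wd[OF h(1)[OF xy] F.M.a_closed[OF h(1)[OF x] h(1)[OF y]]])
      then show "f (h (x \<oplus>\<^bsub>?F 1\<^esub> y)) = f (h x) \<oplus>\<^bsub>N\<^esub> f (h y)"
        using lin_add[OF f h(1)[OF x] h(1)[OF y]] by (simp only:)
    next
      fix c x assume c: "c \<in> carrier R" and x: "x \<in> carrier (?F 1)"
      have cx: "c \<odot>\<^bsub>?F 1\<^esub> x \<in> carrier (?F 1)" by (rule F.smult_closed[OF c x])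
      have "d 1 (h (c \<odot>\<^bsub>?F 1\<^esub> x)) = d 1 (c \<odot>\<^bsub>?F 2\<^esub> h x)"
        unfolding h(2)[OF cx] lin_smult[OF l1 c h(1)[OF x]] h(2)[OF x]
        by (rule lin_smult[OF \<rho>(1) c x])
      then have "f (h (c \<odot>\<^bsub>?F 1\<^esub> x)) = f (c \<odot>\<^bsub>?F 2\<^esub> h x)"
        by (rule wd[OF h(1)[OF cx] F.smult_closed[OF c h(1)[OF x]]])
      then show "f (h (c \<odot>\<^bsub>?F 1\<^esub> x)) = c \<odot>\<^bsub>N\<^esub> f (h x)"
        using lin_smult[OF f c h(1)[OF x]] by (simp only:)
    qed
    moreover have "f (h (d 1 x)) = r \<odot>\<^bsub>N\<^esub> f x" if x: "x \<in> carrier (?F 2)" for x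
    proof -
      have dx: "d 1 x \<in> carrier (?F 1)" by (rule lin_closed[OF l1 x])
      have "d 1 x \<in> d 1 ` carrier (?F 2)" using x by (rule imageI)
      then have "d 0 (d 1 x) = \<zero>\<^bsub>?F 0\<^esub>" unfolding k1 by blast
      then have "d 1 (h (d 1 x)) = r \<odot>\<^bsub>?F 1\<^esub> d 1 x" unfolding h(2)[OF dx] by (rule \<rho>(3)[OF dx])
      also have "\<dots> = d 1 (r \<odot>\<^bsub>?F 2\<^esub> x)" by (rule lin_smult[OF l1 r x, symmetric])
      finally have "f (h (d 1 x)) = f (r \<odot>\<^bsub>?F 2\<^esub> x)"
        by (rule wd[OF h(1)[OF dx] F.smult_closed[OF r x]])
      then show ?thesis using lin_smult[OF f r x] by (simp only:)
    qed
    ultimately show "\<exists>g. lin R (?F 1) N g \<and> (\<forall>x\<in>carrier (?F (Suc 1)). g (d 1 x) = r \<odot>\<^bsub>N\<^esub> f x)"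
      by (intro exI[of _ "\<lambda>v. f (h v)"]) (simp add: numeral_2_eq_2 del: free_module_simps)
  qed
  then show ?thesis unfolding res(2) by (simp add: numeral_2_eq_2)
qed

section \<open>Transport of modules along injections\<close>

text \<open>Injectivity and the cohomology annihilator test modules in one fixed type. Ideals and
  submodules of R^k are moved into that type along an injection, in practice by forming
  singletons.\<close>

definition transport ::
    "('m \<Rightarrow> 'n) \<Rightarrow> ('a, 'm, 'l) module_scheme \<Rightarrow> ('a, 'n) module" where
  "transport j M =
     \<lparr>carrier = j ` carrier M, monoid.mult = undefined, one = undefined, zero = j \<zero>\<^bsub>M\<^esub>,
      add = (\<lambda>x y. j (inv_into (carrier M) j x \<oplus>\<^bsub>M\<^esub> inv_into (carrier M) j y)),
      smult = (\<lambda>r x. j (r \<odot>\<^bsub>M\<^esub> inv_into (carrier M) j x))\<rparr>"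

lemma transport_simps:
  assumes "inj_on j (carrier M)"
  shows "carrier (transport j M) = j ` carrier M" "\<zero>\<^bsub>transport j M\<^esub> = j \<zero>\<^bsub>M\<^esub>"
    "x \<in> carrier M \<Longrightarrow> y \<in> carrier M \<Longrightarrow> j x \<oplus>\<^bsub>transport j M\<^esub> j y = j (x \<oplus>\<^bsub>M\<^esub> y)"
    "x \<in> carrier M \<Longrightarrow> r \<odot>\<^bsub>transport j M\<^esub> j x = j (r \<odot>\<^bsub>M\<^esub> x)"
  using assms by (simp_all add: transport_def inv_into_f_f)

lemma module_transport:
  assumes M: "module R M" and j: "inj_on j (carrier M)"
  shows "module R (transport j M)"
proof -
  interpret module R M by fact
  note t = transport_simps[OF j]
  have ab: "abelian_group (transport j M)"
  proof (rule abelian_groupI, unfold t(1))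
    fix x y z assume "x \<in> j ` carrier M" "y \<in> j ` carrier M"
    then obtain a b where ab: "a \<in> carrier M" "x = j a" "b \<in> carrier M" "y = j b" by auto
    show "x \<oplus>\<^bsub>transport j M\<^esub> y \<in> j ` carrier M" "x \<oplus>\<^bsub>transport j M\<^esub> y = y \<oplus>\<^bsub>transport j M\<^esub> x"
      using ab by (auto simp: t M.a_comm)
    assume "z \<in> j ` carrier M"
    then show "x \<oplus>\<^bsub>transport j M\<^esub> y \<oplus>\<^bsub>transport j M\<^esub> z = x \<oplus>\<^bsub>transport j M\<^esub> (y \<oplus>\<^bsub>transport j M\<^esub> z)"
      using ab by (auto simp: t M.a_assoc)
  next
    fix x assume "x \<in> j ` carrier M"
    then obtain a where a: "a \<in> carrier M" "x = j a" by auto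
    then show "\<zero>\<^bsub>transport j M\<^esub> \<oplus>\<^bsub>transport j M\<^esub> x = x" by (auto simp: t)
    have "j (\<ominus>\<^bsub>M\<^esub> a) \<oplus>\<^bsub>transport j M\<^esub> x = \<zero>\<^bsub>transport j M\<^esub>" using a by (simp add: t M.l_neg)
    then show "\<exists>y\<in>j ` carrier M. y \<oplus>\<^bsub>transport j M\<^esub> x = \<zero>\<^bsub>transport j M\<^esub>" using a by blast
  qed (simp add: t)
  show ?thesis
    by (rule moduleI[OF R.is_cring ab], unfold t(1))
      (auto simp: t smult_l_distr smult_r_distr smult_assoc1)
qed

lemma lin_transport:
  assumes "inj_on j (carrier M)"
  shows "lin R M (transport j M) j"
  using transport_simps[OF assms] by (intro linI) auto

lemma lin_transport_inv:
  assumes "module R M" "inj_on j (carrier M)"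
  shows "lin R (transport j M) M (inv_into (carrier M) j)"
proof -
  interpret module R M by fact
  show ?thesis
    using assms(2) by (intro linI) (auto simp: transport_simps[OF assms(2)])
qed

section \<open>Injective modules over one-dimensional rings\<close>

text \<open>A map from I extends to R and is multiplication by the image of 1. The test modules
  consist of sets of functions, so a ring element is represented by the singleton of a constant
  function.\<close>

lemma baer:
  assumes E: "injective_module R E" and R: "cring R" and I: "ideal I R"
    and \<phi>: "lin R ((regular_module R)\<lparr>carrier := I\<rparr>) E \<phi>"
  shows "\<exists>e\<in>carrier E. \<forall>a\<in>I. \<phi> a = a \<odot>\<^bsub>E\<^esub> e"
proof -
  interpret cring R by fact
  have mE: "module R E" using E by (simp add: injective_module_def)
  interpret E: module R E by fact
  let ?I = "(regular_module R)\<lparr>carrier := I\<rparr>" and ?j = "\<lambda>a::'a. {\<lambda>_::nat. a}"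
  have subI: "submodule I R (regular_module R)"
    using I unfolding submodule_iff[OF module_regular] ideal_iff by simp
  have mI: "module R ?I" by (rule submodule.submodule_is_module[OF subI module_regular])
  have inj: "inj_on ?j V" for V by (rule inj_onI) (metis singleton_inject fun_cong)
  define A where "A = transport ?j ?I"
  define B where "B = transport ?j (regular_module R)"
  have mAB: "module R A" "module R B"
    unfolding A_def B_def by (rule module_transport[OF mI inj] module_transport[OF module_regular inj])+
  have cA: "carrier A = ?j ` I" and cB: "carrier B = ?j ` carrier R"
    by (simp_all add: A_def B_def transport_def)
  have inv: "inv_into I ?j (?j a) = a" if "a \<in> I" for a by (rule inv_into_f_f[OF inj that])
  have Ic: "a \<in> carrier R" if "a \<in> I" for a using that idealD(1)[OF I] by blast
  have h: "restrict (\<lambda>x. x) (carrier A) \<in> mod_hom R A B"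
  proof (rule restrict_mod_hom[OF mAB(1)], rule linI, unfold cA cB)
    fix x y r assume "x \<in> ?j ` I"
    then obtain a where a: "a \<in> I" "x = ?j a" by blast
    show "x \<in> ?j ` carrier R" using a Ic by blast
    { assume r: "r \<in> carrier R"
      show "r \<odot>\<^bsub>A\<^esub> x = r \<odot>\<^bsub>B\<^esub> x"
        using a Ic[OF a(1)] transport_simps(4)[OF inj, of a ?I] transport_simps(4)[OF inj, of a "regular_module R"]
        by (simp add: A_def B_def) }
    assume "y \<in> ?j ` I"
    then obtain b where b: "b \<in> I" "y = ?j b" by blast
    show "x \<oplus>\<^bsub>A\<^esub> y = x \<oplus>\<^bsub>B\<^esub> y"
      using a b Ic[OF a(1)] Ic[OF b(1)] transport_simps(3)[OF inj, of a ?I b] transport_simps(3)[OF inj, of a "regular_module R" b]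
      by (simp add: A_def B_def)
  qed
  have lf: "lin R A E (\<lambda>x. \<phi> (inv_into (carrier ?I) ?j x))"
    unfolding A_def by (rule lin_comp[OF lin_transport_inv[OF mI inj] \<phi>])
  let ?f = "restrict (\<lambda>x. \<phi> (inv_into (carrier ?I) ?j x)) (carrier A)"
  have f: "?f \<in> mod_hom R A E" by (rule restrict_mod_hom[OF mAB(1) lf])
  have "inj_on (restrict (\<lambda>x. x) (carrier A)) (carrier A)" by (rule inj_onI) simp
  then obtain g where g: "g \<in> mod_hom R B E" "\<And>x. x \<in> carrier A \<Longrightarrow> g (restrict (\<lambda>x. x) (carrier A) x) = ?f x"
    using E[unfolded injective_module_def, THEN conjunct2, rule_format, OF mAB h f] by blast
  note lg = mod_hom_lin[OF g(1)]
  have oneB: "?j \<one>\<^bsub>R\<^esub> \<in> carrier B" unfolding cB by (rule imageI) simp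
  show ?thesis
  proof (intro bexI[of _ "g (?j \<one>\<^bsub>R\<^esub>)"] ballI)
    fix a assume a: "a \<in> I"
    have "\<phi> a = ?f (?j a)" using a inv[OF a] by (simp add: cA)
    also have "\<dots> = g (?j a)" using g(2)[of "?j a"] a by (simp add: cA)
    also have "?j a = a \<odot>\<^bsub>B\<^esub> ?j \<one>\<^bsub>R\<^esub>"
      using transport_simps(4)[OF inj, of "\<one>\<^bsub>R\<^esub>" "regular_module R" a] Ic[OF a] by (simp add: B_def)
    also have "g \<dots> = a \<odot>\<^bsub>E\<^esub> g (?j \<one>\<^bsub>R\<^esub>)" by (rule lin_smult[OF lg Ic[OF a] oneB])
    finally show "\<phi> a = a \<odot>\<^bsub>E\<^esub> g (?j \<one>\<^bsub>R\<^esub>)" .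
  qed (rule lin_closed[OF lg oneB])
qed

lemma (in module) smult_minus_left:
  "a \<in> carrier R \<Longrightarrow> b \<in> carrier R \<Longrightarrow> x \<in> carrier M \<Longrightarrow> (a \<ominus> b) \<odot>\<^bsub>M\<^esub> x = a \<odot>\<^bsub>M\<^esub> x \<ominus>\<^bsub>M\<^esub> b \<odot>\<^bsub>M\<^esub> x"
  by (simp add: a_minus_def smult_l_distr smult_l_minus)

lemma (in module) smult_minus_right:
  "a \<in> carrier R \<Longrightarrow> y \<in> carrier M \<Longrightarrow> x \<in> carrier M \<Longrightarrow> a \<odot>\<^bsub>M\<^esub> (x \<ominus>\<^bsub>M\<^esub> y) = a \<odot>\<^bsub>M\<^esub> x \<ominus>\<^bsub>M\<^esub> a \<odot>\<^bsub>M\<^esub> y"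
  by (simp add: a_minus_def smult_r_distr smult_r_minus)

text \<open>\<open>extends_from R I C\<close> says that \<open>Ext\<^sup>1(R/I, C)\<close> vanishes.\<close>

definition extends_from ::
    "('a, 'k) ring_scheme \<Rightarrow> 'a set \<Rightarrow> ('a, 'm, 'l) module_scheme \<Rightarrow> bool" where
  "extends_from R I C \<longleftrightarrow> (\<forall>\<phi>. lin R ((regular_module R)\<lparr>carrier := I\<rparr>) C \<phi> \<longrightarrow>
     (\<exists>c\<in>carrier C. \<forall>a\<in>I. \<phi> a = a \<odot>\<^bsub>C\<^esub> c))"

definition adjoin_vector ::
    "('a, 'k) ring_scheme \<Rightarrow> ('a, 'm, 'l) module_scheme \<Rightarrow> 'm set \<Rightarrow> 'm \<Rightarrow> 'm set" where
  "adjoin_vector R M W v = {x. \<exists>i\<in>W. \<exists>r\<in>carrier R. x = i \<oplus>\<^bsub>M\<^esub> r \<odot>\<^bsub>M\<^esub> v}"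

lemma adjoin_vector_submodule:
  assumes M: "module R M" and W: "submodule W R M" and v: "v \<in> carrier M"
  shows "submodule (adjoin_vector R M W v) R M" "W \<subseteq> adjoin_vector R M W v" "v \<in> adjoin_vector R M W v"
proof -
  interpret module R M by fact
  note Wd = submoduleD[OF M W]
  have Wc: "i \<in> carrier M" if "i \<in> W" for i using that Wd(1) by blast
  show incl: "W \<subseteq> adjoin_vector R M W v"
  proof
    fix i assume i: "i \<in> W"
    have "i = i \<oplus>\<^bsub>M\<^esub> \<zero>\<^bsub>R\<^esub> \<odot>\<^bsub>M\<^esub> v" using Wc[OF i] v by simp
    then show "i \<in> adjoin_vector R M W v" using i R.zero_closed unfolding adjoin_vector_def by blast
  qed
  have "v = \<zero>\<^bsub>M\<^esub> \<oplus>\<^bsub>M\<^esub> \<one>\<^bsub>R\<^esub> \<odot>\<^bsub>M\<^esub> v" using v by simp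
  then show "v \<in> adjoin_vector R M W v" using Wd(2) R.one_closed unfolding adjoin_vector_def by blast
  show "submodule (adjoin_vector R M W v) R M"
    unfolding submodule_iff[OF M]
  proof (intro conjI ballI)
    show "adjoin_vector R M W v \<subseteq> carrier M" using Wc v by (auto simp: adjoin_vector_def)
    show "\<zero>\<^bsub>M\<^esub> \<in> adjoin_vector R M W v" using incl Wd(2) by blast
    fix x assume "x \<in> adjoin_vector R M W v"
    then obtain i r where x: "i \<in> W" "r \<in> carrier R" "x = i \<oplus>\<^bsub>M\<^esub> r \<odot>\<^bsub>M\<^esub> v" unfolding adjoin_vector_def by blast
    { fix y assume "y \<in> adjoin_vector R M W v"
      then obtain k s where y: "k \<in> W" "s \<in> carrier R" "y = k \<oplus>\<^bsub>M\<^esub> s \<odot>\<^bsub>M\<^esub> v" unfolding adjoin_vector_def by blast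
      have "x \<oplus>\<^bsub>M\<^esub> y = (i \<oplus>\<^bsub>M\<^esub> k) \<oplus>\<^bsub>M\<^esub> (r \<oplus>\<^bsub>R\<^esub> s) \<odot>\<^bsub>M\<^esub> v"
        using x y Wc v by (simp add: smult_l_distr M.a_ac)
      then show "x \<oplus>\<^bsub>M\<^esub> y \<in> adjoin_vector R M W v"
        using Wd(3)[OF x(1) y(1)] R.a_closed[OF x(2) y(2)] unfolding adjoin_vector_def by blast }
    fix s assume s: "s \<in> carrier R"
    have "s \<odot>\<^bsub>M\<^esub> x = s \<odot>\<^bsub>M\<^esub> i \<oplus>\<^bsub>M\<^esub> (s \<otimes>\<^bsub>R\<^esub> r) \<odot>\<^bsub>M\<^esub> v"
      using x s Wc v by (simp add: smult_r_distr smult_assoc1)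
    then show "s \<odot>\<^bsub>M\<^esub> x \<in> adjoin_vector R M W v"
      using Wd(4)[OF s x(1)] R.m_closed[OF s x(2)] unfolding adjoin_vector_def by blast
  qed
qed

text \<open>The map i + r v \<mapsto> \<phi> i + r c is well defined as soon as it is consistent on
  the multiples of v that already lie in W.\<close>

lemma lin_adjoin_vector:
  assumes M: "module R M" and C: "module R C" and W: "submodule W R M" and v: "v \<in> carrier M"
    and c: "c \<in> carrier C" and \<phi>: "lin R (M\<lparr>carrier := W\<rparr>) C \<phi>"
    and eq: "\<forall>r\<in>carrier R. r \<odot>\<^bsub>M\<^esub> v \<in> W \<longrightarrow> \<phi> (r \<odot>\<^bsub>M\<^esub> v) = r \<odot>\<^bsub>C\<^esub> c"
  shows "\<exists>\<psi>. lin R (M\<lparr>carrier := adjoin_vector R M W v\<rparr>) C \<psi> \<and> (\<forall>x\<in>W. \<psi> x = \<phi> x) \<and> \<psi> v = c"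
proof -
  interpret module R M by fact
  interpret C: module R C by fact
  note Wd = submoduleD[OF M W]
  have Wc: "i \<in> carrier M" if "i \<in> W" for i using that Wd(1) by blast
  have \<phi>c: "\<phi> i \<in> carrier C" if "i \<in> W" for i using lin_closed[OF \<phi>] that by simp
  have \<phi>a: "\<phi> (i \<oplus>\<^bsub>M\<^esub> k) = \<phi> i \<oplus>\<^bsub>C\<^esub> \<phi> k" if "i \<in> W" "k \<in> W" for i k using lin_add[OF \<phi>, of i k] that by simp
  have \<phi>s: "\<phi> (r \<odot>\<^bsub>M\<^esub> i) = r \<odot>\<^bsub>C\<^esub> \<phi> i" if "i \<in> W" "r \<in> carrier R" for i r using lin_smult[OF \<phi>, of r i] that by simp
  define \<psi> where "\<psi> x = (SOME y. \<exists>i\<in>W. \<exists>r\<in>carrier R. x = i \<oplus>\<^bsub>M\<^esub> r \<odot>\<^bsub>M\<^esub> v \<and> y = \<phi> i \<oplus>\<^bsub>C\<^esub> r \<odot>\<^bsub>C\<^esub> c)" for x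
  \<comment> \<open>Two representations of the same vector give (r - s) v = k - i, a multiple of v
    in W, to which the hypothesis applies.\<close>
  have wd: "\<phi> i \<oplus>\<^bsub>C\<^esub> r \<odot>\<^bsub>C\<^esub> c = \<phi> k \<oplus>\<^bsub>C\<^esub> s \<odot>\<^bsub>C\<^esub> c"
    if "i \<in> W" "k \<in> W" "r \<in> carrier R" "s \<in> carrier R" "i \<oplus>\<^bsub>M\<^esub> r \<odot>\<^bsub>M\<^esub> v = k \<oplus>\<^bsub>M\<^esub> s \<odot>\<^bsub>M\<^esub> v" for i k r s
  proof -
    note cc = Wc[OF that(1)] Wc[OF that(2)]
    have rs: "r \<ominus>\<^bsub>R\<^esub> s \<in> carrier R" and rsv: "r \<odot>\<^bsub>M\<^esub> v \<in> carrier M" "s \<odot>\<^bsub>M\<^esub> v \<in> carrier M"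
      using that(3,4) v by auto
    have "(r \<ominus>\<^bsub>R\<^esub> s) \<odot>\<^bsub>M\<^esub> v = \<ominus>\<^bsub>M\<^esub> i \<oplus>\<^bsub>M\<^esub> (i \<oplus>\<^bsub>M\<^esub> r \<odot>\<^bsub>M\<^esub> v) \<ominus>\<^bsub>M\<^esub> s \<odot>\<^bsub>M\<^esub> v"
      using cc rsv that(3,4) v by (simp add: smult_minus_left M.r_neg1)
    also have "\<dots> = \<ominus>\<^bsub>M\<^esub> i \<oplus>\<^bsub>M\<^esub> k"
      unfolding that(5) using cc rsv by (simp add: a_minus_def M.a_assoc M.r_neg)
    also have "\<dots> = k \<ominus>\<^bsub>M\<^esub> i" using cc by (simp add: a_minus_def M.a_comm)
    finally have e: "(r \<ominus>\<^bsub>R\<^esub> s) \<odot>\<^bsub>M\<^esub> v = k \<ominus>\<^bsub>M\<^esub> i" .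
    have ki: "k \<ominus>\<^bsub>M\<^esub> i \<in> W" by (rule submodule_minus[OF M W that(2,1)])
    have eq': "\<phi> (k \<ominus>\<^bsub>M\<^esub> i) = (r \<ominus>\<^bsub>R\<^esub> s) \<odot>\<^bsub>C\<^esub> c" using eq[rule_format, OF rs] ki unfolding e by simp
    have "\<phi> k = \<phi> ((k \<ominus>\<^bsub>M\<^esub> i) \<oplus>\<^bsub>M\<^esub> i)" using M.minus_add_cancel[OF cc(2,1)] by simp
    also have "\<dots> = (r \<ominus>\<^bsub>R\<^esub> s) \<odot>\<^bsub>C\<^esub> c \<oplus>\<^bsub>C\<^esub> \<phi> i"
      using \<phi>a[OF ki that(1)] eq' by simp
    finally have "\<phi> k \<oplus>\<^bsub>C\<^esub> s \<odot>\<^bsub>C\<^esub> c = \<phi> i \<oplus>\<^bsub>C\<^esub> ((r \<ominus>\<^bsub>R\<^esub> s) \<odot>\<^bsub>C\<^esub> c \<oplus>\<^bsub>C\<^esub> s \<odot>\<^bsub>C\<^esub> c)"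
      using \<phi>c[OF that(1)] rs that(4) c by (simp add: C.M.a_ac)
    also have "(r \<ominus>\<^bsub>R\<^esub> s) \<odot>\<^bsub>C\<^esub> c \<oplus>\<^bsub>C\<^esub> s \<odot>\<^bsub>C\<^esub> c = r \<odot>\<^bsub>C\<^esub> c"
      using that(3,4) c by (simp add: C.smult_minus_left C.M.minus_add_cancel)
    finally show ?thesis by simp
  qed
  have \<psi>: "\<psi> (i \<oplus>\<^bsub>M\<^esub> r \<odot>\<^bsub>M\<^esub> v) = \<phi> i \<oplus>\<^bsub>C\<^esub> r \<odot>\<^bsub>C\<^esub> c" if "i \<in> W" "r \<in> carrier R" for i r
    unfolding \<psi>_def
  proof (rule some_equality)
    show "\<exists>i'\<in>W. \<exists>r'\<in>carrier R. i \<oplus>\<^bsub>M\<^esub> r \<odot>\<^bsub>M\<^esub> v = i' \<oplus>\<^bsub>M\<^esub> r' \<odot>\<^bsub>M\<^esub> v \<and> \<phi> i \<oplus>\<^bsub>C\<^esub> r \<odot>\<^bsub>C\<^esub> c = \<phi> i' \<oplus>\<^bsub>C\<^esub> r' \<odot>\<^bsub>C\<^esub> c"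
      using that by blast
    fix y assume "\<exists>i'\<in>W. \<exists>r'\<in>carrier R. i \<oplus>\<^bsub>M\<^esub> r \<odot>\<^bsub>M\<^esub> v = i' \<oplus>\<^bsub>M\<^esub> r' \<odot>\<^bsub>M\<^esub> v \<and> y = \<phi> i' \<oplus>\<^bsub>C\<^esub> r' \<odot>\<^bsub>C\<^esub> c"
    then show "y = \<phi> i \<oplus>\<^bsub>C\<^esub> r \<odot>\<^bsub>C\<^esub> c" using wd[OF _ that(1) _ that(2)] by metis
  qed
  have "lin R (M\<lparr>carrier := adjoin_vector R M W v\<rparr>) C \<psi>"
  proof (rule linI, simp_all)
    fix x y s assume "x \<in> adjoin_vector R M W v"
    then obtain i r where x: "i \<in> W" "r \<in> carrier R" "x = i \<oplus>\<^bsub>M\<^esub> r \<odot>\<^bsub>M\<^esub> v" unfolding adjoin_vector_def by blast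
    note ic = Wc[OF x(1)]
    show "\<psi> x \<in> carrier C" using x \<phi>c[OF x(1)] c by (simp add: \<psi>)
    { assume s: "s \<in> carrier R"
      have "s \<odot>\<^bsub>M\<^esub> x = s \<odot>\<^bsub>M\<^esub> i \<oplus>\<^bsub>M\<^esub> (s \<otimes>\<^bsub>R\<^esub> r) \<odot>\<^bsub>M\<^esub> v"
        using x s ic v by (simp add: smult_r_distr smult_assoc1)
      then show "\<psi> (s \<odot>\<^bsub>M\<^esub> x) = s \<odot>\<^bsub>C\<^esub> \<psi> x"
        using \<psi>[OF Wd(4)[OF s x(1)], of "s \<otimes>\<^bsub>R\<^esub> r"] x s c \<phi>c[OF x(1)] \<phi>s[OF x(1) s]
        by (simp add: \<psi>[OF x(1,2)] C.smult_r_distr C.smult_assoc1) }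
    assume "y \<in> adjoin_vector R M W v"
    then obtain k q where y: "k \<in> W" "q \<in> carrier R" "y = k \<oplus>\<^bsub>M\<^esub> q \<odot>\<^bsub>M\<^esub> v" unfolding adjoin_vector_def by blast
    have "x \<oplus>\<^bsub>M\<^esub> y = (i \<oplus>\<^bsub>M\<^esub> k) \<oplus>\<^bsub>M\<^esub> (r \<oplus>\<^bsub>R\<^esub> q) \<odot>\<^bsub>M\<^esub> v"
      using x y ic Wc v by (simp add: smult_l_distr M.a_ac)
    then show "\<psi> (x \<oplus>\<^bsub>M\<^esub> y) = \<psi> x \<oplus>\<^bsub>C\<^esub> \<psi> y"
      using \<psi>[OF Wd(3)[OF x(1) y(1)], of "r \<oplus>\<^bsub>R\<^esub> q"] x y c \<phi>c[OF x(1)] \<phi>c[OF y(1)] \<phi>a[OF x(1) y(1)]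
      by (simp add: \<psi>[OF x(1,2)] \<psi>[OF y(1,2)] C.smult_l_distr C.M.a_ac)
  qed
  moreover have "\<psi> x = \<phi> x" if "x \<in> W" for x
    using \<psi>[OF that R.zero_closed] Wc[OF that] v c \<phi>c[OF that] by simp
  moreover have "\<psi> v = c"
  proof -
    have "\<phi> \<zero>\<^bsub>M\<^esub> = \<zero>\<^bsub>R\<^esub> \<odot>\<^bsub>C\<^esub> \<phi> \<zero>\<^bsub>M\<^esub>" using \<phi>s[OF Wd(2) R.zero_closed] by simp
    then have "\<phi> \<zero>\<^bsub>M\<^esub> = \<zero>\<^bsub>C\<^esub>" using C.smult_l_null[OF \<phi>c[OF Wd(2)]] by simp
    then show ?thesis using \<psi>[OF Wd(2) R.one_closed] v c by simp
  qed
  ultimately show ?thesis by blast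
qed

context cring begin

lemma lin_adjoin:
  assumes C: "module R C" and I: "ideal I R" and z: "z \<in> carrier R" and c: "c \<in> carrier C"
    and \<phi>: "lin R ((regular_module R)\<lparr>carrier := I\<rparr>) C \<phi>"
    and eq: "\<forall>r\<in>carrier R. r \<otimes> z \<in> I \<longrightarrow> \<phi> (r \<otimes> z) = r \<odot>\<^bsub>C\<^esub> c"
  shows "\<exists>\<psi>. lin R ((regular_module R)\<lparr>carrier := adjoin I z\<rparr>) C \<psi> \<and> (\<forall>x\<in>I. \<psi> x = \<phi> x) \<and> \<psi> z = c"
proof -
  have I': "submodule I R (regular_module R)"
    using I unfolding submodule_iff[OF module_regular] ideal_iff by simp
  have "adjoin_vector R (regular_module R) I z = adjoin I z"
    by (simp add: adjoin_vector_def adjoin_def)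
  then show ?thesis
    using lin_adjoin_vector[OF module_regular C I' _ c \<phi>, of z] z eq by simp
qed

text \<open>For regular t the assignment of e to t is a well-defined map on tR; by Baer's criterion
  it is multiplication by some e', and then t e' = e.\<close>

lemma injective_divisible:
  assumes E: "injective_module R E" and t: "t \<in> nonzerodivisors R" and e: "e \<in> carrier E"
  shows "\<exists>e'\<in>carrier E. t \<odot>\<^bsub>E\<^esub> e' = e"
proof -
  have mE: "module R E" using E by (simp add: injective_module_def)
  interpret E: module R E by fact
  note tc = nonzerodivisorsD[OF t]
  have z: "lin R ((regular_module R)\<lparr>carrier := {\<zero>}\<rparr>) E (\<lambda>_. \<zero>\<^bsub>E\<^esub>)" by (simp add: lin_def)
  have eq: "\<zero>\<^bsub>E\<^esub> = r \<odot>\<^bsub>E\<^esub> e" if "r \<in> carrier R" "r \<otimes> t \<in> {\<zero>}" for r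
  proof -
    have "r = \<zero>" using tc(3)[OF that(1)] that(2) by simp
    then show ?thesis using e by simp
  qed
  have "\<forall>r\<in>carrier R. r \<otimes> t \<in> {\<zero>} \<longrightarrow> \<zero>\<^bsub>E\<^esub> = r \<odot>\<^bsub>E\<^esub> e" using eq by blast
  from lin_adjoin[OF mE zeroideal tc(1) e z this] obtain \<psi> where
    \<psi>: "lin R ((regular_module R)\<lparr>carrier := adjoin {\<zero>} t\<rparr>) E \<psi>" "\<psi> t = e" by blast
  obtain e' where e': "e' \<in> carrier E" "\<And>a. a \<in> adjoin {\<zero>} t \<Longrightarrow> \<psi> a = a \<odot>\<^bsub>E\<^esub> e'"
    using baer[OF E is_cring adjoin_ideal[OF zeroideal tc(1)] \<psi>(1)] by blast
  show ?thesis
    using e'(1) e'(2)[OF adjoin_self[OF zeroideal tc(1)]] \<psi>(2) by auto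
qed

end

context reduced_local_dim1 begin

text \<open>Vanishing of Ext^1 for the residue field passes to quotients R/I of finite length. In a
  maximal counterexample I, a map on I is extended to I + Rz for a socle element z of R/I, and
  maximality extends it from there.\<close>

lemma extends_from_max_imp:
  assumes C: "module R C" and ext: "extends_from R \<mm> C" and t: "t \<in> nonzerodivisors R"
    and "ideal I R" "t \<in> I"
  shows "extends_from R I C"
proof (rule ccontr)
  assume no: "\<not> ?thesis"
  define S where "S = {I. ideal I R \<and> t \<in> I \<and> \<not> extends_from R I C}"
  have Sne: "S \<noteq> {}" using no assms by (auto simp: S_def)
  have Si: "ideal J R" if "J \<in> S" for J using that by (simp add: S_def)
  obtain I where IS: "I \<in> S" and max: "\<And>J. J \<in> S \<Longrightarrow> I \<subseteq> J \<Longrightarrow> J = I"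
    using ideal_maximal_element[OF Sne Si] by blast
  have I: "ideal I R" "t \<in> I" "\<not> extends_from R I C" using IS by (simp_all add: S_def)
  note Id = idealD[OF I(1)]
  interpret C: module R C by fact
  obtain \<phi> where \<phi>: "lin R ((regular_module R)\<lparr>carrier := I\<rparr>) C \<phi>"
    "\<And>c. c \<in> carrier C \<Longrightarrow> \<exists>a\<in>I. \<phi> a \<noteq> a \<odot>\<^bsub>C\<^esub> c"
    using I(3) unfolding extends_from_def by blast
  have \<phi>c: "\<phi> i \<in> carrier C" if "i \<in> I" for i using lin_closed[OF \<phi>(1)] that by simp
  have \<phi>a: "\<phi> (i \<oplus> k) = \<phi> i \<oplus>\<^bsub>C\<^esub> \<phi> k" if "i \<in> I" "k \<in> I" for i k using lin_add[OF \<phi>(1), of i k] that by simp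
  have \<phi>s: "\<phi> (r \<otimes> i) = r \<odot>\<^bsub>C\<^esub> \<phi> i" if "i \<in> I" "r \<in> carrier R" for i r using lin_smult[OF \<phi>(1), of r i] that by simp
  have "I \<noteq> carrier R"
  proof
    assume eq: "I = carrier R"
    have oneI: "\<one> \<in> I" unfolding eq by (rule one_closed)
    obtain a where a: "a \<in> I" "\<phi> a \<noteq> a \<odot>\<^bsub>C\<^esub> \<phi> \<one>" using \<phi>(2)[OF \<phi>c[OF oneI]] by blast
    have ac: "a \<in> carrier R" by (rule Id(1)[OF a(1)])
    show False using \<phi>s[OF oneI ac] a(2) ac by simp
  qed
  then obtain z where z: "z \<in> carrier R" "z \<notin> I" "\<And>a. a \<in> \<mm> \<Longrightarrow> a \<otimes> z \<in> I"
    using exists_socle_element[OF I(1,2) t] by blast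
  \<comment> \<open>The value for z has to be compatible with \<phi> on \<mm> z. Extending this map
    from \<mm> to R produces it; if r z is in I then r is in \<mm>, as a unit would put z into
    I.\<close>
  have "lin R ((regular_module R)\<lparr>carrier := \<mm>\<rparr>) C (\<lambda>a. \<phi> (a \<otimes> z))"
  proof (rule linI, simp_all)
    fix x y r assume x: "x \<in> \<mm>"
    show "\<phi> (x \<otimes> z) \<in> carrier C" by (rule \<phi>c[OF z(3)[OF x]])
    show "\<phi> (r \<otimes> x \<otimes> z) = r \<odot>\<^bsub>C\<^esub> \<phi> (x \<otimes> z)" if "r \<in> carrier R"
      using \<phi>s[OF z(3)[OF x] that] that max_closed(1)[OF x] z(1) by (simp add: m_assoc)
    show "\<phi> ((x \<oplus> y) \<otimes> z) = \<phi> (x \<otimes> z) \<oplus>\<^bsub>C\<^esub> \<phi> (y \<otimes> z)" if y: "y \<in> \<mm>"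
      using \<phi>a[OF z(3)[OF x] z(3)[OF y]] max_closed(1)[OF x] max_closed(1)[OF y] z(1) by (simp add: l_distr)
  qed
  then obtain c where c: "c \<in> carrier C" "\<And>a. a \<in> \<mm> \<Longrightarrow> \<phi> (a \<otimes> z) = a \<odot>\<^bsub>C\<^esub> c"
    using ext unfolding extends_from_def by blast
  have eq: "\<phi> (r \<otimes> z) = r \<odot>\<^bsub>C\<^esub> c" if r: "r \<in> carrier R" "r \<otimes> z \<in> I" for r
  proof (rule c(2), rule ccontr)
    assume "r \<notin> \<mm>"
    then have u: "r \<in> Units R" using not_max_Unit r(1) by blast
    have "inv r \<otimes> (r \<otimes> z) \<in> I" using Id(4) u r(2) by simp
    moreover have "inv r \<otimes> (r \<otimes> z) = z" using u r(1) z(1) m_assoc[of "inv r" r z] by simp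
    ultimately show False using z(2) by simp
  qed
  have eq': "\<forall>r\<in>carrier R. r \<otimes> z \<in> I \<longrightarrow> \<phi> (r \<otimes> z) = r \<odot>\<^bsub>C\<^esub> c" using eq by blast
  let ?J = "adjoin I z"
  have J: "ideal ?J R" "I \<subseteq> ?J" "z \<in> ?J"
    using adjoin_ideal[OF I(1) z(1)] adjoin_incl[OF I(1) z(1)] adjoin_self[OF I(1) z(1)] by auto
  obtain \<psi> where \<psi>: "lin R ((regular_module R)\<lparr>carrier := ?J\<rparr>) C \<psi>" "\<And>x. x \<in> I \<Longrightarrow> \<psi> x = \<phi> x"
    using lin_adjoin[OF C I(1) z(1) c(1) \<phi>(1) eq'] by blast
  have "extends_from R ?J C"
  proof (rule ccontr)
    assume "\<not> extends_from R ?J C"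
    then have "?J \<in> S" using J I(2) by (auto simp: S_def)
    then show False using max[of ?J] J z(2) by auto
  qed
  then obtain c' where c': "c' \<in> carrier C" "\<And>a. a \<in> ?J \<Longrightarrow> \<psi> a = a \<odot>\<^bsub>C\<^esub> c'"
    using \<psi>(1) unfolding extends_from_def by blast
  have "\<phi> a = a \<odot>\<^bsub>C\<^esub> c'" if "a \<in> I" for a
    using c'(2)[of a] \<psi>(2)[OF that] that J(2) by auto
  then show False using \<phi>(2)[OF c'(1)] by blast
qed

text \<open>The kernel of \<open>d\<close> inherits the extension property from its image: every \<open>k \<rightarrow> im d\<close> extends
  along the socle inclusion \<open>k \<subseteq> R/tR\<close> and lifts to the domain of \<open>d\<close>, by divisibility of the kernel.\<close>

lemma extends_from_max_kernel:
  assumes E: "injective_module R E" and E': "module R E'" and d: "lin R E E' d"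
    and t: "t \<in> \<mm>" "t \<in> nonzerodivisors R"
    and div: "\<And>x. x \<in> carrier E \<Longrightarrow> d x = \<zero>\<^bsub>E'\<^esub> \<Longrightarrow> \<exists>y\<in>carrier E. d y = \<zero>\<^bsub>E'\<^esub> \<and> t \<odot>\<^bsub>E\<^esub> y = x"
    and ext: "extends_from R \<mm> (E'\<lparr>carrier := d ` carrier E\<rparr>)"
  shows "extends_from R \<mm> (E\<lparr>carrier := {x \<in> carrier E. d x = \<zero>\<^bsub>E'\<^esub>}\<rparr>)"
  unfolding extends_from_def
proof (intro allI impI)
  let ?C = "E\<lparr>carrier := {x \<in> carrier E. d x = \<zero>\<^bsub>E'\<^esub>}\<rparr>" and ?D = "E'\<lparr>carrier := d ` carrier E\<rparr>"
  have mE: "module R E" using E by (simp add: injective_module_def)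
  interpret E: module R E by fact
  interpret E': module R E' by fact
  note tc = nonzerodivisorsD[OF t(2)]
  have sD: "submodule (d ` carrier E) R E'"
    by (rule lin_image_submodule[OF mE E' d E.carrier_is_submodule])
  have mD: "module R ?D" by (rule submodule.submodule_is_module[OF sD E'])
  fix \<phi> assume \<phi>: "lin R ((regular_module R)\<lparr>carrier := \<mm>\<rparr>) ?C \<phi>"
  have \<phi>0: "\<phi> a \<in> carrier E" "d (\<phi> a) = \<zero>\<^bsub>E'\<^esub>" if "a \<in> \<mm>" for a
    using lin_closed[OF \<phi>, of a] that by auto
  have "lin R ((regular_module R)\<lparr>carrier := \<mm>\<rparr>) E \<phi>"
    using \<phi> by (auto simp: lin_def)
  then obtain e where e: "e \<in> carrier E" "\<And>a. a \<in> \<mm> \<Longrightarrow> \<phi> a = a \<odot>\<^bsub>E\<^esub> e"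
    using baer[OF E is_cring ideal_max] by blast
  \<comment> \<open>Since a e = \<phi> a lies in the kernel for a in \<mm>, the ideal \<mm> kills c.
    The task is to change e by an element that is killed by \<mm> and maps to c.\<close>
  define c where "c = d e"
  have cc: "c \<in> carrier E'" "c \<in> carrier ?D" using e(1) lin_closed[OF d e(1)] by (auto simp: c_def)
  have ac: "a \<odot>\<^bsub>E'\<^esub> c = \<zero>\<^bsub>E'\<^esub>" if a: "a \<in> \<mm>" for a
  proof -
    have "a \<odot>\<^bsub>E'\<^esub> c = d (a \<odot>\<^bsub>E\<^esub> e)"
      unfolding c_def by (rule lin_smult[OF d max_closed(1)[OF a] e(1), symmetric])
    then show ?thesis using e(2)[OF a] \<phi>0(2)[OF a] by simp
  qed
  have iT: "ideal (PIdl t) R" "t \<in> PIdl t" using cgenideal_ideal[OF tc(1)] cgenideal_self[OF tc(1)] by auto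
  have "PIdl t \<noteq> carrier R"
    using cgenideal_minimal[OF ideal_max t(1)] one_notin_max by auto
  then obtain z where z: "z \<in> carrier R" "z \<notin> PIdl t" "\<And>a. a \<in> \<mm> \<Longrightarrow> a \<otimes> z \<in> PIdl t"
    using exists_socle_element[OF iT t(2)] by blast
  have l0: "lin R ((regular_module R)\<lparr>carrier := PIdl t\<rparr>) ?D (\<lambda>_. \<zero>\<^bsub>E'\<^esub>)"
    using submoduleD(2)[OF E' sD] by (simp add: lin_def)
  have eq: "\<zero>\<^bsub>E'\<^esub> = r \<odot>\<^bsub>?D\<^esub> c" if r: "r \<in> carrier R" "r \<otimes> z \<in> PIdl t" for r
  proof -
    have "r \<in> \<mm>"
    proof (rule ccontr)
      assume "r \<notin> \<mm>"
      then have u: "r \<in> Units R" using not_max_Unit r(1) by blast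
      have "inv r \<otimes> (r \<otimes> z) \<in> PIdl t" using idealD(4)[OF iT(1)] u r(2) by simp
      moreover have "inv r \<otimes> (r \<otimes> z) = z" using u r(1) z(1) m_assoc[of "inv r" r z] by simp
      ultimately show False using z(2) by simp
    qed
    then show ?thesis using ac by simp
  qed
  have eq': "\<forall>r\<in>carrier R. r \<otimes> z \<in> PIdl t \<longrightarrow> \<zero>\<^bsub>E'\<^esub> = r \<odot>\<^bsub>?D\<^esub> c" using eq by blast
  let ?K = "adjoin (PIdl t) z"
  have K: "ideal ?K R" "t \<in> ?K" "z \<in> ?K"
    using adjoin_ideal[OF iT(1) z(1)] adjoin_incl[OF iT(1) z(1)] adjoin_self[OF iT(1) z(1)] iT(2) by auto
  \<comment> \<open>Sending tR to 0 and z to c is the map from the socle line of R/tR. Extended to R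
    it is given by an element c' with t c' = 0 and z c' = c.\<close>
  obtain \<psi> where \<psi>: "lin R ((regular_module R)\<lparr>carrier := ?K\<rparr>) ?D \<psi>" "\<forall>x\<in>PIdl t. \<psi> x = \<zero>\<^bsub>E'\<^esub>" "\<psi> z = c"
    using lin_adjoin[OF mD iT(1) z(1) cc(2) l0 eq'] by blast
  obtain c' where c': "c' \<in> carrier ?D" "\<And>a. a \<in> ?K \<Longrightarrow> \<psi> a = a \<odot>\<^bsub>?D\<^esub> c'"
    using extends_from_max_imp[OF mD ext t(2) K(1,2)] \<psi>(1) unfolding extends_from_def by blast
  have zc': "z \<odot>\<^bsub>E'\<^esub> c' = c" "t \<odot>\<^bsub>E'\<^esub> c' = \<zero>\<^bsub>E'\<^esub>"
    using c'(2)[OF K(3)] c'(2)[OF K(2)] \<psi>(2,3) iT(2) by simp_all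
  obtain e1 where e1: "e1 \<in> carrier E" "c' = d e1" using c'(1) by auto
  have "d (t \<odot>\<^bsub>E\<^esub> e1) = \<zero>\<^bsub>E'\<^esub>" using lin_smult[OF d tc(1) e1(1)] zc'(2) e1(2) by simp
  then obtain e2 where e2: "e2 \<in> carrier E" "d e2 = \<zero>\<^bsub>E'\<^esub>" "t \<odot>\<^bsub>E\<^esub> e2 = t \<odot>\<^bsub>E\<^esub> e1"
    using div[OF E.smult_closed[OF tc(1) e1(1)]] by blast
  \<comment> \<open>The lift e1 of c' is corrected by a kernel element so that t kills it. Then z e3
    is killed by \<mm>, since \<mm> z lies in tR, and it maps to z c' = c.\<close>
  define e3 where "e3 = e1 \<ominus>\<^bsub>E\<^esub> e2"
  have e3: "e3 \<in> carrier E" using e1(1) e2(1) by (simp add: e3_def)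
  have te3: "t \<odot>\<^bsub>E\<^esub> e3 = \<zero>\<^bsub>E\<^esub>"
    using e2(3) E.M.r_neg[OF E.smult_closed[OF tc(1) e1(1)]] E.smult_minus_right[OF tc(1) e2(1) e1(1)]
    by (simp add: e3_def a_minus_def)
  have de3: "d e3 = c'"
    using lin_diff[OF mE E' d e1(1) e2(1)] lin_closed[OF d e1(1)] unfolding e3_def e2(2) e1(2)
    by (simp add: a_minus_def)
  define w where "w = e \<ominus>\<^bsub>E\<^esub> z \<odot>\<^bsub>E\<^esub> e3"
  have ze3: "z \<odot>\<^bsub>E\<^esub> e3 \<in> carrier E" by (rule E.smult_closed[OF z(1) e3])
  have wc: "w \<in> carrier E" using e(1) ze3 by (simp add: w_def)
  have "d w = c \<ominus>\<^bsub>E'\<^esub> z \<odot>\<^bsub>E'\<^esub> c'"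
    unfolding w_def lin_diff[OF mE E' d e(1) ze3] lin_smult[OF d z(1) e3] de3 c_def ..
  then have dw: "d w = \<zero>\<^bsub>E'\<^esub>" using zc'(1) E'.M.r_neg[OF cc(1)] by (simp add: a_minus_def)
  have "\<phi> a = a \<odot>\<^bsub>E\<^esub> w" if a: "a \<in> \<mm>" for a
  proof -
    have a': "a \<in> carrier R" by (rule max_closed(1)[OF a])
    obtain s where s: "s \<in> carrier R" "a \<otimes> z = s \<otimes> t" using z(3)[OF a] by (auto simp: PIdl_mem)
    have "a \<odot>\<^bsub>E\<^esub> (z \<odot>\<^bsub>E\<^esub> e3) = (s \<otimes> t) \<odot>\<^bsub>E\<^esub> e3"
      unfolding s(2)[symmetric] by (rule E.smult_assoc1[OF a' z(1) e3, symmetric])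
    also have "\<dots> = \<zero>\<^bsub>E\<^esub>" using te3 s(1) tc(1) e3 by (simp add: E.smult_assoc1)
    finally have "a \<odot>\<^bsub>E\<^esub> (z \<odot>\<^bsub>E\<^esub> e3) = \<zero>\<^bsub>E\<^esub>" .
    then have "a \<odot>\<^bsub>E\<^esub> w = a \<odot>\<^bsub>E\<^esub> e"
      unfolding w_def using E.smult_minus_right[OF a' ze3 e(1)] E.smult_closed[OF a' e(1)] by (simp add: a_minus_def)
    then show ?thesis using e(2)[OF a] by simp
  qed
  then show "\<exists>c\<in>carrier ?C. \<forall>a\<in>\<mm>. \<phi> a = a \<odot>\<^bsub>?C\<^esub> c"
    using wc dw by auto
qed

end

lemma lc_carrier_update [simp]: "lc (M\<lparr>carrier := W\<rparr>) x y k = lc M x y k"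
  by (induct k) auto

lemma lin_carrier_update:
  "lin R M N f \<Longrightarrow> W \<subseteq> carrier M \<Longrightarrow> lin R (M\<lparr>carrier := W\<rparr>) N f"
  by (auto simp: lin_def subset_iff)

lemma lin_codomain_update:
  "lin R M N f \<Longrightarrow> (\<And>x. x \<in> carrier M \<Longrightarrow> f x \<in> W) \<Longrightarrow> lin R M (N\<lparr>carrier := W\<rparr>) f"
  by (auto simp: lin_def)

lemma lin_codomain_extend:
  "lin R M (N\<lparr>carrier := W\<rparr>) f \<Longrightarrow> W \<subseteq> carrier N \<Longrightarrow> lin R M N f"
  by (auto simp: lin_def)

lemma lin_vimage_submodule:
  assumes "module R M" "module R N" "lin R M N f" "submodule W R N"
  shows "submodule {x \<in> carrier M. f x \<in> W} R M"
proof -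
  interpret M: module R M by fact
  interpret N: module R N by fact
  note Wd = submoduleD[OF assms(2,4)]
  show ?thesis
    unfolding submodule_iff[OF assms(1)]
    using Wd by (auto simp: lin_zero[OF assms(1-3)] lin_add[OF assms(3)] lin_smult[OF assms(3)])
qed

section \<open>Separation by functionals over a Gorenstein ring\<close>

context reduced_local_dim1 begin

text \<open>Beyond the end of a finite injective resolution the kernels are 0, and
  \<open>extends_from_max_kernel\<close> carries the extension property down from each kernel to the
  one before. The descent ends at E 1: divisibility of a kernel is obtained from its being the image
  of the preceding injective. The image of d 0 is the quotient E 0 / R.\<close>

lemma gorenstein_extension:
  fixes T :: "'i itself"
  assumes G: "gorenstein_ring T R" and t: "t \<in> \<mm>" "t \<in> nonzerodivisors R"
  shows "\<exists>(E0 :: ('a, 'i) module) (E1 :: ('a, 'i) module) e d. injective_module R E0 \<and> module R E1 \<and>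
     lin R (regular_module R) E0 e \<and> lin R E0 E1 d \<and> inj_on e (carrier R) \<and>
     e ` carrier R = {x \<in> carrier E0. d x = \<zero>\<^bsub>E1\<^esub>} \<and>
     extends_from R \<mm> (E1\<lparr>carrier := d ` carrier E0\<rparr>)"
proof -
  obtain E :: "nat \<Rightarrow> ('a, 'i) module" and e d n where
    res: "injective_resolution R (regular_module R) E e d" and zero: "\<And>i. n < i \<Longrightarrow> carrier (E i) = {\<zero>\<^bsub>E i\<^esub>}"
    using G unfolding gorenstein_ring_def finite_injective_dim_def by blast
  note res' = res[unfolded injective_resolution_def a_kernel_def']
  have E: "injective_module R (E i)" for i using res' by blast
  then have mE: "module R (E i)" for i by (simp add: injective_module_def)
  have le: "lin R (regular_module R) (E 0) e" by (rule mod_hom_lin) (use res' in blast)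
  have ld: "lin R (E i) (E (Suc i)) (d i)" for i by (rule mod_hom_lin) (use res' in blast)
  have inj: "inj_on e (carrier R)" using res' by simp
  have ke: "e ` carrier R = {x \<in> carrier (E 0). d 0 x = \<zero>\<^bsub>E (Suc 0)\<^esub>}" using res' by simp
  have kd: "d i ` carrier (E i) = {x \<in> carrier (E (Suc i)). d (Suc i) x = \<zero>\<^bsub>E (Suc (Suc i))\<^esub>}" for i
    using res' by blast
  define C where "C j = (E j)\<lparr>carrier := {x \<in> carrier (E j). d j x = \<zero>\<^bsub>E (Suc j)\<^esub>}\<rparr>" for j
  have step: "extends_from R \<mm> (C (Suc i))" if "extends_from R \<mm> (C (Suc (Suc i)))" for i
    unfolding C_def
  proof (rule extends_from_max_kernel[OF E mE ld t])
    show "extends_from R \<mm> ((E (Suc (Suc i)))\<lparr>carrier := d (Suc i) ` carrier (E (Suc i))\<rparr>)"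
      unfolding kd using that unfolding C_def .
    fix x assume x: "x \<in> carrier (E (Suc i))" "d (Suc i) x = \<zero>\<^bsub>E (Suc (Suc i))\<^esub>"
    then have "x \<in> d i ` carrier (E i)" unfolding kd by blast
    then obtain y where y: "y \<in> carrier (E i)" "x = d i y" by blast
    obtain z where z: "z \<in> carrier (E i)" "t \<odot>\<^bsub>E i\<^esub> z = y"
      using injective_divisible[OF E t(2) y(1)] by blast
    have "d i z \<in> d i ` carrier (E i)" using z(1) by (rule imageI)
    then have "d i z \<in> carrier (E (Suc i)) \<and> d (Suc i) (d i z) = \<zero>\<^bsub>E (Suc (Suc i))\<^esub>" unfolding kd by blast
    moreover have "t \<odot>\<^bsub>E (Suc i)\<^esub> d i z = x"
      using lin_smult[OF ld nonzerodivisorsD(1)[OF t(2)] z(1)] z(2) y(2) by simp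
    ultimately show "\<exists>y\<in>carrier (E (Suc i)). d (Suc i) y = \<zero>\<^bsub>E (Suc (Suc i))\<^esub> \<and> t \<odot>\<^bsub>E (Suc i)\<^esub> y = x"
      by blast
  qed
  have top: "extends_from R \<mm> (C (Suc n))"
    unfolding extends_from_def
  proof (intro allI impI)
    fix \<phi> assume \<phi>: "lin R ((regular_module R)\<lparr>carrier := \<mm>\<rparr>) (C (Suc n)) \<phi>"
    interpret En: module R "E (Suc n)" by (rule mE)
    have z: "\<zero>\<^bsub>E (Suc n)\<^esub> \<in> carrier (C (Suc n))"
      using lin_zero[OF mE mE ld[of "Suc n"]] by (simp add: C_def)
    have "\<phi> a = a \<odot>\<^bsub>C (Suc n)\<^esub> \<zero>\<^bsub>E (Suc n)\<^esub>" if "a \<in> \<mm>" for a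
    proof -
      have "\<phi> a \<in> carrier (E (Suc n))" using lin_closed[OF \<phi>, of a] that by (simp add: C_def)
      then show ?thesis using zero[of "Suc n"] max_closed(1)[OF that] by (simp add: C_def)
    qed
    then show "\<exists>c\<in>carrier (C (Suc n)). \<forall>a\<in>\<mm>. \<phi> a = a \<odot>\<^bsub>C (Suc n)\<^esub> c" using z by blast
  qed
  \<comment> \<open>Descending induction written with n - k; the case k = n is index 1.\<close>
  have "extends_from R \<mm> (C (Suc (n - k)))" if "k \<le> n" for k
    using that
  proof (induct k)
    case (Suc k)
    then have "Suc (n - k) = Suc (Suc (n - Suc k))" by simp
    then have "extends_from R \<mm> (C (Suc (Suc (n - Suc k))))" using Suc by (simp only:)
    then show ?case by (rule step)
  qed (use top in simp)
  from this[of n] have "extends_from R \<mm> (C (Suc 0))" by simp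
  then have "extends_from R \<mm> ((E (Suc 0))\<lparr>carrier := d 0 ` carrier (E 0)\<rparr>)"
    unfolding C_def kd .
  then show ?thesis using E[of 0] mE[of "Suc 0"] le ld[of 0] inj ke by blast
qed

text \<open>The extension property of ideals containing t passes to submodules of R^k containing t
  R^k, with the extension given by its values c i at the unit vectors. Vectors with last coordinate
  0 are handled by induction; the rest of the map depends on the last coordinate alone, which runs
  through an ideal containing t.\<close>

lemma extends_from_free:
  assumes C: "module R C" and ext: "\<And>I. ideal I R \<Longrightarrow> t \<in> I \<Longrightarrow> extends_from R I C" and t: "t \<in> carrier R"
  shows "submodule W R (free_module R k) \<Longrightarrow> (\<And>i. i < k \<Longrightarrow> t \<odot>\<^bsub>free_module R k\<^esub> unit_vec k i \<in> W) \<Longrightarrow>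
     lin R ((free_module R k)\<lparr>carrier := W\<rparr>) C \<phi> \<Longrightarrow>
     \<exists>c. (\<forall>i<k. c i \<in> carrier C) \<and> (\<forall>w\<in>W. \<phi> w = lc C w c k)"
proof (induct k arbitrary: W \<phi>)
  case 0
  interpret C: module R C by (rule C)
  have W: "module R ((free_module R 0)\<lparr>carrier := W\<rparr>)"
    by (rule submodule.submodule_is_module[OF 0(1) module_free])
  have "w = \<zero>\<^bsub>(free_module R 0)\<lparr>carrier := W\<rparr>\<^esub>" if "w \<in> W" for w
    using submoduleD(1)[OF module_free 0(1)] that by (auto simp: restrict_def)
  then have "\<phi> w = \<zero>\<^bsub>C\<^esub>" if "w \<in> W" for w
    using lin_zero[OF W C 0(3)] that by metis
  then show ?case by simp
next
  case (Suc k)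
  let ?F = "free_module R (Suc k)" and ?G = "free_module R k" and ?A = "regular_module R"
  have F: "module R ?F" and G: "module R ?G" and A: "module R ?A"
    by (rule module_free module_regular)+
  interpret F: module R ?F by (rule F)
  interpret C: module R C by (rule C)
  let ?W = "?F\<lparr>carrier := W\<rparr>"
  have mW: "module R ?W" by (rule submodule.submodule_is_module[OF Suc(2) F])
  interpret W: module R ?W by (rule mW)
  note Wd = submoduleD[OF F Suc(2)]
  have Wi: "w i \<in> carrier R" if "w \<in> W" "i < Suc k" for w i
  proof -
    have "w \<in> {..<Suc k} \<rightarrow>\<^sub>E carrier R" using Wd(1) that(1) by auto
    then show ?thesis using that(2) by (rule PiE_lessThan_mem)
  qed
  define pad where "pad v = (\<lambda>i\<in>{..<Suc k}. if i < k then v i else \<zero>)" for v :: "nat \<Rightarrow> 'a"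
  have lpad: "lin R ?G ?F pad"
    by (rule linI) (auto intro!: restrict_ext simp: pad_def PiE_iff)
  define W' where "W' = {v \<in> carrier ?G. pad v \<in> W}"
  have sW': "submodule W' R ?G"
    unfolding W'_def by (rule lin_vimage_submodule[OF G F lpad Suc(2)])
  have lpadW: "lin R (?G\<lparr>carrier := W'\<rparr>) ?W pad"
    by (rule lin_codomain_update[OF lin_carrier_update[OF lpad]]) (auto simp: W'_def)
  have units: "t \<odot>\<^bsub>?G\<^esub> unit_vec k i \<in> W'" if i: "i < k" for i
  proof -
    have eq: "pad (t \<odot>\<^bsub>?G\<^esub> unit_vec k i) = t \<odot>\<^bsub>?F\<^esub> unit_vec (Suc k) i"
      using i t by (auto simp: pad_def unit_vec_def intro!: restrict_ext)
    have "t \<odot>\<^bsub>?G\<^esub> unit_vec k i \<in> carrier ?G"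
      by (rule module.smult_closed[OF G t]) simp
    then show ?thesis unfolding W'_def mem_Collect_eq eq using Suc(3)[of i] i by (simp del: free_module_simps)
  qed
  obtain c where c: "\<And>i. i < k \<Longrightarrow> c i \<in> carrier C" "\<And>v. v \<in> W' \<Longrightarrow> \<phi> (pad v) = lc C v c k"
    using Suc(1)[OF sW' units lin_comp[OF lpadW Suc(4)]] by blast
  \<comment> \<open>What remains of \<phi> after subtracting the extension found in rank k. It
    vanishes on vectors with last coordinate 0, hence factors through the last coordinate.\<close>
  define \<theta> where "\<theta> w = \<phi> w \<ominus>\<^bsub>C\<^esub> lc C w c k" for w
  have llc: "lin R ?W C (\<lambda>w. lc C w c k)"
  proof (rule lin_carrier_update[OF _ Wd(1)], rule linI)
    fix x y r assume "x \<in> carrier ?F"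
    then have x: "x i \<in> carrier R" if "i < k" for i using that by (auto simp: PiE_iff)
    show "lc C x c k \<in> carrier C" using x c(1) by simp
    { assume "y \<in> carrier ?F"
      then have y: "y i \<in> carrier R" if "i < k" for i using that by (auto simp: PiE_iff)
      have "lc C (x \<oplus>\<^bsub>?F\<^esub> y) c k = lc C (\<lambda>i. x i \<oplus> y i) c k" by (rule lc_cong) auto
      then show "lc C (x \<oplus>\<^bsub>?F\<^esub> y) c k = lc C x c k \<oplus>\<^bsub>C\<^esub> lc C y c k"
        using C.lc_add_left[of k x y c] x y c(1) by simp }
    assume r: "r \<in> carrier R"
    have "lc C (r \<odot>\<^bsub>?F\<^esub> x) c k = lc C (\<lambda>i. r \<otimes> x i) c k" by (rule lc_cong) auto
    then show "lc C (r \<odot>\<^bsub>?F\<^esub> x) c k = r \<odot>\<^bsub>C\<^esub> lc C x c k"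
      using C.lc_scale_left[of r k x c] x r c(1) by simp
  qed
  have l\<theta>: "lin R ?W C \<theta>" unfolding \<theta>_def by (rule lin_minus[OF C Suc(4) llc])
  have \<theta>0: "\<theta> w = \<zero>\<^bsub>C\<^esub>" if w: "w \<in> W" "w k = \<zero>" for w
  proof -
    have wF: "w \<in> {..<Suc k} \<rightarrow>\<^sub>E carrier R" using w(1) Wd(1) by auto
    have "pad (restrict w {..<k}) = w"
    proof (rule PiE_lessThan_eqI[OF _ wF])
      show "pad (restrict w {..<k}) \<in> {..<Suc k} \<rightarrow>\<^sub>E carrier R"
        using Wi[OF w(1)] by (auto simp: pad_def)
      fix i assume "i < Suc k"
      then show "pad (restrict w {..<k}) i = w i" using w(2) by (cases "i = k") (auto simp: pad_def)
    qed
    moreover have "restrict w {..<k} \<in> carrier ?G" using Wi[OF w(1)] by auto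
    ultimately have "\<phi> w = lc C (restrict w {..<k}) c k"
      using c(2)[of "restrict w {..<k}"] w(1) by (simp add: W'_def)
    also have "\<dots> = lc C w c k" by (rule lc_cong) auto
    finally show ?thesis
      using C.M.r_neg[of "lc C w c k"] lin_closed[OF llc, of w] w(1) by (simp add: \<theta>_def a_minus_def)
  qed
  have \<theta>eq: "\<theta> w = \<theta> w'" if w: "w \<in> W" "w' \<in> W" "w k = w' k" for w w'
  proof (rule C.M.eq_if_minus_zero)
    show "\<theta> w \<in> carrier C" "\<theta> w' \<in> carrier C" using lin_closed[OF l\<theta>] w by auto
    have wF: "w \<in> carrier ?F" "w' \<in> carrier ?F" using w Wd(1) by auto
    have "w \<in> carrier ?W" "w' \<in> carrier ?W" using w by auto
    then have "\<theta> w \<ominus>\<^bsub>C\<^esub> \<theta> w' = \<theta> (w \<ominus>\<^bsub>?W\<^esub> w')" by (rule lin_diff[OF mW C l\<theta>, symmetric])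
    moreover have dW: "w \<ominus>\<^bsub>?W\<^esub> w' \<in> W" using W.M.minus_closed[of w w'] w by simp
    moreover have "(w \<ominus>\<^bsub>?W\<^esub> w') k = \<zero>"
    proof -
      have "lin R ?W ?A (\<lambda>v. v k)" by (rule lin_carrier_update[OF lin_proj Wd(1)]) simp
      from lin_diff[OF mW A this, of w w'] have "(w \<ominus>\<^bsub>?W\<^esub> w') k = w k \<ominus>\<^bsub>?A\<^esub> w' k" using w by simp
      also have "\<dots> = \<zero>"
        using abelian_group.r_neg[OF module.axioms(2)[OF A], of "w' k"] Wi[OF w(2), of k] unfolding w(3) a_minus_def by simp
      finally show ?thesis .
    qed
    ultimately show "\<theta> w \<ominus>\<^bsub>C\<^esub> \<theta> w' = \<zero>\<^bsub>C\<^esub>" using \<theta>0 by simp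
  qed
  let ?I = "(\<lambda>w. w k) ` W"
  have lk: "lin R ?F ?A (\<lambda>w. w k)" by (rule lin_proj) simp
  have I: "ideal ?I R"
    using lin_image_submodule[OF F A lk Suc(2)] unfolding submodule_iff[OF A] ideal_iff by simp
  have tI: "t \<in> ?I"
  proof (rule image_eqI)
    show "t \<odot>\<^bsub>?F\<^esub> unit_vec (Suc k) k \<in> W" by (rule Suc(3)) simp
    show "t = (t \<odot>\<^bsub>?F\<^esub> unit_vec (Suc k) k) k" using t by (simp add: unit_vec_def)
  qed
  define \<psi> where "\<psi> x = \<theta> (SOME w. w \<in> W \<and> w k = x)" for x
  have \<psi>: "\<psi> (w k) = \<theta> w" if "w \<in> W" for w
    unfolding \<psi>_def
  proof (rule someI2[of _ w])
    show "\<theta> v = \<theta> w" if "v \<in> W \<and> v k = w k" for v using \<theta>eq[of v w] that \<open>w \<in> W\<close> by blast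
  qed (use that in simp)
  have "lin R (?A\<lparr>carrier := ?I\<rparr>) C \<psi>"
  proof (rule linI)
    fix x y r assume "x \<in> carrier (?A\<lparr>carrier := ?I\<rparr>)"
    then obtain w where w: "w \<in> W" "x = w k" by auto
    show "\<psi> x \<in> carrier C" using lin_closed[OF l\<theta>, of w] w \<psi> by simp
    { assume "y \<in> carrier (?A\<lparr>carrier := ?I\<rparr>)"
      then obtain v where v: "v \<in> W" "y = v k" by auto
      have "x \<oplus>\<^bsub>?A\<lparr>carrier := ?I\<rparr>\<^esub> y = (w \<oplus>\<^bsub>?F\<^esub> v) k" using w v by simp
      then show "\<psi> (x \<oplus>\<^bsub>?A\<lparr>carrier := ?I\<rparr>\<^esub> y) = \<psi> x \<oplus>\<^bsub>C\<^esub> \<psi> y"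
        using \<psi>[OF Wd(3)[OF w(1) v(1)]] \<psi>[OF w(1)] \<psi>[OF v(1)] w v lin_add[OF l\<theta>, of w v]
        by (simp del: free_module_simps) }
    assume r: "r \<in> carrier R"
    have "r \<odot>\<^bsub>?A\<lparr>carrier := ?I\<rparr>\<^esub> x = (r \<odot>\<^bsub>?F\<^esub> w) k" using w r by simp
    then show "\<psi> (r \<odot>\<^bsub>?A\<lparr>carrier := ?I\<rparr>\<^esub> x) = r \<odot>\<^bsub>C\<^esub> \<psi> x"
      using \<psi>[OF Wd(4)[OF r w(1)]] \<psi>[OF w(1)] w lin_smult[OF l\<theta> r, of w]
      by (simp del: free_module_simps)
  qed
  then obtain ck where ck: "ck \<in> carrier C" "\<And>a. a \<in> ?I \<Longrightarrow> \<psi> a = a \<odot>\<^bsub>C\<^esub> ck"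
    using ext[OF I tI] unfolding extends_from_def by blast
  let ?c = "\<lambda>i. if i < k then c i else ck"
  have "\<phi> w = lc C w ?c (Suc k)" if w: "w \<in> W" for w
  proof -
    have l: "lc C w c k \<in> carrier C" "\<phi> w \<in> carrier C"
      using lin_closed[OF llc, of w] lin_closed[OF Suc(4), of w] w by auto
    have "\<theta> w = w k \<odot>\<^bsub>C\<^esub> ck" using \<psi>[OF w] ck(2)[of "w k"] w by simp
    then have "\<phi> w = w k \<odot>\<^bsub>C\<^esub> ck \<oplus>\<^bsub>C\<^esub> lc C w c k"
      using C.M.minus_add_cancel[OF l(2,1)] by (simp add: \<theta>_def)
    moreover have "lc C w ?c k = lc C w c k" by (rule lc_cong) auto
    ultimately show ?thesis
      using C.M.a_comm[OF C.smult_closed[OF Wi[OF w lessI] ck(1)] l(1)] by simp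
  qed
  then show ?case using c(1) ck(1) by (intro exI[of _ ?c] conjI) auto
qed

text \<open>A lattice containing \<open>t R\<^sup>k\<close> is reflexive: it is cut out by functionals into \<open>R/tR\<close>.\<close>

lemma gorenstein_separation:
  fixes T :: "'i itself"
  assumes G: "gorenstein_ring T R" and t: "t \<in> \<mm>" "t \<in> nonzerodivisors R"
    and S: "submodule S R (free_module R k)" and tS: "\<And>i. i < k \<Longrightarrow> t \<odot>\<^bsub>free_module R k\<^esub> unit_vec k i \<in> S"
    and v: "v \<in> carrier (free_module R k)" "v \<notin> S"
  shows "\<exists>n\<in>carrier (free_module R k). (\<forall>s\<in>S. dot s n k \<in> PIdl t) \<and> dot v n k \<notin> PIdl t"
proof -
  let ?F = "free_module R k"
  have F: "module R ?F" by (rule module_free)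
  interpret F: module R ?F by (rule F)
  note tc = nonzerodivisorsD[OF t(2)]
  obtain E0 E1 :: "('a, 'i) module" and e d where
    E: "injective_module R E0" "module R E1" "lin R (regular_module R) E0 e" "lin R E0 E1 d"
     "inj_on e (carrier R)" "e ` carrier R = {x \<in> carrier E0. d x = \<zero>\<^bsub>E1\<^esub>}"
     "extends_from R \<mm> (E1\<lparr>carrier := d ` carrier E0\<rparr>)"
    using gorenstein_extension[OF G t] by (elim exE conjE) (rule that)
  have mE0: "module R E0" using E(1) by (simp add: injective_module_def)
  interpret E0: module R E0 by (rule mE0)
  interpret E1: module R E1 by (rule E(2))
  let ?C = "E1\<lparr>carrier := d ` carrier E0\<rparr>"
  have sC: "submodule (d ` carrier E0) R E1"
    by (rule lin_image_submodule[OF mE0 E(2,4) E0.carrier_is_submodule])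
  have mC: "module R ?C" by (rule submodule.submodule_is_module[OF sC E(2)])
  have ker: "d (e r) = \<zero>\<^bsub>E1\<^esub>" "e r \<in> carrier E0" if "r \<in> carrier R" for r
    using E(6)[THEN equalityD1, THEN subsetD, OF imageI[OF that]] by simp_all
  have iT: "ideal (PIdl t) R" "t \<in> PIdl t" using cgenideal_ideal[OF tc(1)] cgenideal_self[OF tc(1)] by auto
  have "PIdl t \<noteq> carrier R"
    using cgenideal_minimal[OF ideal_max t(1)] one_notin_max by auto
  then obtain z where z: "z \<in> carrier R" "z \<notin> PIdl t" "\<And>a. a \<in> \<mm> \<Longrightarrow> a \<otimes> z \<in> PIdl t"
    using exists_socle_element[OF iT t(2)] by blast
  \<comment> \<open>In the injective module E0 the element u stands for 1/t, and c below is the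
    class of z/t in E0 / R.\<close>
  obtain u where u: "u \<in> carrier E0" "t \<odot>\<^bsub>E0\<^esub> u = e \<one>"
    using injective_divisible[OF E(1) t(2) ker(2)[OF one_closed]] by blast
  have es: "e (r \<otimes> s) = r \<odot>\<^bsub>E0\<^esub> e s" if "r \<in> carrier R" "s \<in> carrier R" for r s
    using lin_smult[OF E(3), of r s] that by simp
  have zu: "z \<odot>\<^bsub>E0\<^esub> u \<in> carrier E0" by (rule E0.smult_closed[OF z(1) u(1)])
  define c where "c = d (z \<odot>\<^bsub>E0\<^esub> u)"
  have cC: "c \<in> carrier ?C" "c \<in> carrier E1" using zu lin_closed[OF E(4) zu] by (auto simp: c_def)
  note Sd = submoduleD[OF F S]
  have l0: "lin R (?F\<lparr>carrier := S\<rparr>) ?C (\<lambda>_. \<zero>\<^bsub>E1\<^esub>)"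
    using submoduleD(2)[OF E(2) sC] by (simp add: lin_def)
  \<comment> \<open>The map that is 0 on S and c at v is consistent: r v in S forces r into \<mm>,
    and then r z is in tR, so r z/t lies in R and has class 0.\<close>
  have "\<forall>r\<in>carrier R. r \<odot>\<^bsub>?F\<^esub> v \<in> S \<longrightarrow> \<zero>\<^bsub>E1\<^esub> = r \<odot>\<^bsub>?C\<^esub> c"
  proof (intro ballI impI)
    fix r assume r: "r \<in> carrier R" "r \<odot>\<^bsub>?F\<^esub> v \<in> S"
    have "r \<in> \<mm>"
    proof (rule ccontr)
      assume "r \<notin> \<mm>"
      then have un: "r \<in> Units R" using not_max_Unit r(1) by blast
      have "inv r \<odot>\<^bsub>?F\<^esub> (r \<odot>\<^bsub>?F\<^esub> v) = v"
        using F.smult_assoc1[OF Units_inv_closed[OF un] r(1) v(1), symmetric] F.smult_one[OF v(1)] un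
        by (simp del: free_module_simps)
      then show False using Sd(4)[OF Units_inv_closed[OF un] r(2)] v(2) by (simp del: free_module_simps)
    qed
    then obtain s where s: "s \<in> carrier R" "r \<otimes> z = s \<otimes> t" using z(3) by (auto simp: PIdl_mem)
    have "r \<odot>\<^bsub>E1\<^esub> c = d (r \<odot>\<^bsub>E0\<^esub> (z \<odot>\<^bsub>E0\<^esub> u))"
      unfolding c_def by (rule lin_smult[OF E(4) r(1) zu, symmetric])
    also have "r \<odot>\<^bsub>E0\<^esub> (z \<odot>\<^bsub>E0\<^esub> u) = (s \<otimes> t) \<odot>\<^bsub>E0\<^esub> u"
      unfolding s(2)[symmetric] by (rule E0.smult_assoc1[OF r(1) z(1) u(1), symmetric])
    also have "\<dots> = e s"
      using E0.smult_assoc1[OF s(1) tc(1) u(1)] u(2) es[OF s(1) one_closed] s(1) by simp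
    also have "d (e s) = \<zero>\<^bsub>E1\<^esub>" by (rule ker(1)[OF s(1)])
    finally show "\<zero>\<^bsub>E1\<^esub> = r \<odot>\<^bsub>?C\<^esub> c" by simp
  qed
  from lin_adjoin_vector[OF F mC S v(1) cC(1) l0 this] obtain \<psi> where
    \<psi>: "lin R (?F\<lparr>carrier := adjoin_vector R ?F S v\<rparr>) ?C \<psi>" "\<And>x. x \<in> S \<Longrightarrow> \<psi> x = \<zero>\<^bsub>E1\<^esub>" "\<psi> v = c"
    by blast
  note W = adjoin_vector_submodule[OF F S v(1)]
  have ext: "extends_from R I ?C" if "ideal I R" "t \<in> I" for I
    by (rule extends_from_max_imp[OF mC E(7) t(2) that])
  have tW: "t \<odot>\<^bsub>?F\<^esub> unit_vec k i \<in> adjoin_vector R ?F S v" if "i < k" for i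
    using tS[OF that] W(2) by blast
  obtain a where a: "\<And>i. i < k \<Longrightarrow> a i \<in> d ` carrier E0"
      "\<And>w. w \<in> adjoin_vector R ?F S v \<Longrightarrow> \<psi> w = lc E1 w a k"
    using extends_from_free[OF mC ext tc(1) W(1) tW \<psi>(1)] by auto
  have "\<forall>i. \<exists>\<epsilon>. i < k \<longrightarrow> \<epsilon> \<in> carrier E0 \<and> a i = d \<epsilon>" using a(1) by blast
  then obtain \<epsilon> where \<epsilon>: "\<And>i. i < k \<Longrightarrow> \<epsilon> i \<in> carrier E0" "\<And>i. i < k \<Longrightarrow> a i = d (\<epsilon> i)" by metis
  have ac: "a i \<in> carrier E1" if "i < k" for i using \<epsilon>[OF that] lin_closed[OF E(4)] by simp
  have Fi: "w i \<in> carrier R" if "w \<in> carrier ?F" "i < k" for w i using that by (auto simp: PiE_iff)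
  \<comment> \<open>S contains t times the i-th unit vector, so t kills a i. For a lift \<epsilon> i
    in E0 this says t \<epsilon> i = e (m i), so a i is the class of m i / t, and the m i form the
    functional sought.\<close>
  have ta: "t \<odot>\<^bsub>E1\<^esub> a i = \<zero>\<^bsub>E1\<^esub>" if i: "i < k" for i
  proof -
    have "\<zero>\<^bsub>E1\<^esub> = lc E1 (t \<odot>\<^bsub>?F\<^esub> unit_vec k i) a k"
      using a(2)[OF tW[OF i]] \<psi>(2)[OF tS[OF i]] by (simp only:)
    also have "\<dots> = lc E1 (\<lambda>j. t \<otimes> (if j = i then \<one> else \<zero>)) a k"
      by (rule lc_cong) (auto simp: unit_vec_def)
    also have "\<dots> = t \<odot>\<^bsub>E1\<^esub> lc E1 (\<lambda>j. if j = i then \<one> else \<zero>) a k"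
      using ac tc(1) by (intro E1.lc_scale_left) auto
    also have "\<dots> = t \<odot>\<^bsub>E1\<^esub> a i" using E1.lc_unit[OF i] ac by simp
    finally show ?thesis by simp
  qed
  have "t \<odot>\<^bsub>E0\<^esub> \<epsilon> i \<in> e ` carrier R" if "i < k" for i
    unfolding E(6) using ta[OF that, unfolded \<epsilon>(2)[OF that]] \<epsilon>(1)[OF that]
      lin_smult[OF E(4) tc(1) \<epsilon>(1)[OF that]] tc(1) by simp
  then have "\<forall>i. \<exists>m. i < k \<longrightarrow> m \<in> carrier R \<and> t \<odot>\<^bsub>E0\<^esub> \<epsilon> i = e m" by blast
  then obtain m where m: "\<And>i. i < k \<Longrightarrow> m i \<in> carrier R" "\<And>i. i < k \<Longrightarrow> t \<odot>\<^bsub>E0\<^esub> \<epsilon> i = e (m i)" by metis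
  define n where "n = restrict m {..<k}"
  have nF: "n \<in> carrier ?F" using m(1) by (auto simp: n_def)
  have edot: "e (dot w n k) = t \<odot>\<^bsub>E0\<^esub> lc E0 w \<epsilon> k" if w: "w \<in> carrier ?F" for w
  proof -
    have "dot w n k = dot w m k" by (rule lc_cong) (auto simp: n_def)
    then have "e (dot w n k) = lc E0 w (\<lambda>i. e (m i)) k"
      using lin_lc[OF module_regular mE0 E(3), of k w m] Fi[OF w] m(1) by simp
    also have "\<dots> = lc E0 w (\<lambda>i. t \<odot>\<^bsub>E0\<^esub> \<epsilon> i) k" using m(2) by (intro lc_cong) auto
    also have "\<dots> = t \<odot>\<^bsub>E0\<^esub> lc E0 w \<epsilon> k" using Fi[OF w] \<epsilon>(1) tc(1) by (intro E0.lc_scale_right) auto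
    finally show ?thesis .
  qed
  have dlc: "d (lc E0 w \<epsilon> k) = lc E1 w a k" if w: "w \<in> carrier ?F" for w
  proof -
    have "d (lc E0 w \<epsilon> k) = lc E1 w (\<lambda>i. d (\<epsilon> i)) k"
      using Fi[OF w] \<epsilon>(1) by (intro lin_lc[OF mE0 E(2,4)]) auto
    also have "\<dots> = lc E1 w a k" using \<epsilon>(2) by (intro lc_cong) auto
    finally show ?thesis .
  qed
  have lcc: "lc E0 w \<epsilon> k \<in> carrier E0" if "w \<in> carrier ?F" for w
    using Fi[OF that] \<epsilon>(1) by simp
  have dotc: "dot w n k \<in> carrier R" if "w \<in> carrier ?F" for w
    using Fi[OF that] Fi[OF nF] by simp
  have inj: "x = y" if "x \<in> carrier R" "y \<in> carrier R" "e x = e y" for x y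
    using E(5) that by (auto dest: inj_onD)
  show ?thesis
  proof (intro bexI[of _ n] conjI ballI nF)
    fix s assume s: "s \<in> S"
    then have sF: "s \<in> carrier ?F" using Sd(1) by blast
    have "d (lc E0 s \<epsilon> k) = \<zero>\<^bsub>E1\<^esub>"
      unfolding dlc[OF sF] using a(2)[of s] \<psi>(2)[OF s] W(2) s by auto
    then have "lc E0 s \<epsilon> k \<in> e ` carrier R" unfolding E(6) using lcc[OF sF] by blast
    then obtain \<rho> where \<rho>: "\<rho> \<in> carrier R" "lc E0 s \<epsilon> k = e \<rho>" by blast
    have "e (dot s n k) = e (t \<otimes> \<rho>)" using edot[OF sF] \<rho> es[OF tc(1) \<rho>(1)] by simp
    then have "dot s n k = \<rho> \<otimes> t" using inj[OF dotc[OF sF]] \<rho>(1) tc(1) by (simp add: m_comm)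
    then show "dot s n k \<in> PIdl t" using \<rho>(1) by (auto simp: PIdl_mem)
  next
    \<comment> \<open>The lift of the value at v is z/t plus an element of R. Multiplied by t it is
      z modulo tR, and z is not in tR.\<close>
    let ?s = "lc E0 v \<epsilon> k"
    note vs = lcc[OF v(1)]
    have "d ?s = c" unfolding dlc[OF v(1)] using a(2)[OF W(3)] \<psi>(3) by simp
    then have "d (?s \<ominus>\<^bsub>E0\<^esub> z \<odot>\<^bsub>E0\<^esub> u) = c \<ominus>\<^bsub>E1\<^esub> c"
      using lin_diff[OF mE0 E(2,4) vs zu] by (simp add: c_def)
    also have "\<dots> = \<zero>\<^bsub>E1\<^esub>" using E1.M.r_neg[OF cC(2)] by (simp add: a_minus_def)
    finally have "?s \<ominus>\<^bsub>E0\<^esub> z \<odot>\<^bsub>E0\<^esub> u \<in> e ` carrier R" unfolding E(6) using vs zu by simp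
    then obtain \<rho> where \<rho>: "\<rho> \<in> carrier R" "?s \<ominus>\<^bsub>E0\<^esub> z \<odot>\<^bsub>E0\<^esub> u = e \<rho>" by blast
    have "?s = e \<rho> \<oplus>\<^bsub>E0\<^esub> z \<odot>\<^bsub>E0\<^esub> u" using E0.M.minus_add_cancel[OF vs zu] \<rho>(2) by simp
    then have "e (dot v n k) = t \<odot>\<^bsub>E0\<^esub> e \<rho> \<oplus>\<^bsub>E0\<^esub> t \<odot>\<^bsub>E0\<^esub> (z \<odot>\<^bsub>E0\<^esub> u)"
      using edot[OF v(1)] tc(1) ker(2)[OF \<rho>(1)] zu by (simp add: E0.smult_r_distr)
    also have "t \<odot>\<^bsub>E0\<^esub> (z \<odot>\<^bsub>E0\<^esub> u) = z \<odot>\<^bsub>E0\<^esub> (t \<odot>\<^bsub>E0\<^esub> u)"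
      using E0.smult_assoc1[OF tc(1) z(1) u(1)] E0.smult_assoc1[OF z(1) tc(1) u(1)] m_comm[OF tc(1) z(1)] by simp
    also have "\<dots> = e z" using u(2) es[OF z(1) one_closed] z(1) by simp
    also have "t \<odot>\<^bsub>E0\<^esub> e \<rho> \<oplus>\<^bsub>E0\<^esub> e z = e (t \<otimes> \<rho> \<oplus> z)"
      using lin_add[OF E(3), of "t \<otimes> \<rho>" z] es[OF tc(1) \<rho>(1)] tc(1) \<rho>(1) z(1) by simp
    finally have eq: "dot v n k = t \<otimes> \<rho> \<oplus> z" using inj[OF dotc[OF v(1)]] tc(1) \<rho>(1) z(1) by simp
    show "dot v n k \<notin> PIdl t"
    proof
      assume "dot v n k \<in> PIdl t"
      then have "dot v n k \<ominus> t \<otimes> \<rho> \<in> PIdl t"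
        using idealD(5,7)[OF iT(1)] iT(2) \<rho>(1) by blast
      moreover have "dot v n k \<ominus> t \<otimes> \<rho> = z" unfolding eq using tc(1) \<rho>(1) z(1) by algebra
      ultimately show False using z(2) by simp
    qed
  qed
qed

end

section \<open>Cosyzygies of lattices\<close>

lemma lin_inv_into:
  assumes "module R M" "lin R M N f" "inj_on f (carrier M)"
  shows "lin R (N\<lparr>carrier := f ` carrier M\<rparr>) M (inv_into (carrier M) f)"
proof -
  interpret M: module R M by fact
  note inv = inv_into_f_f[OF assms(3)]
  have "inv_into (carrier M) f (f x \<oplus>\<^bsub>N\<^esub> f y) = x \<oplus>\<^bsub>M\<^esub> y" if "x \<in> carrier M" "y \<in> carrier M" for x y
    using inv[of "x \<oplus>\<^bsub>M\<^esub> y"] lin_add[OF assms(2) that] that by simp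
  moreover have "inv_into (carrier M) f (r \<odot>\<^bsub>N\<^esub> f x) = r \<odot>\<^bsub>M\<^esub> x" if "r \<in> carrier R" "x \<in> carrier M" for r x
    using inv[of "r \<odot>\<^bsub>M\<^esub> x"] lin_smult[OF assms(2) that] that by simp
  ultimately show ?thesis by (intro linI) (auto simp: inv)
qed

lemma lin_into_free:
  assumes "\<And>j. j < c \<Longrightarrow> lin R M (regular_module R) (\<lambda>x. f x j)"
  shows "lin R M (free_module R c) (\<lambda>x. restrict (f x) {..<c})"
  using linD[OF assms] by (intro linI) (auto intro!: restrict_ext)

context reduced_local_dim1 begin

text \<open>Let n_1, ..., n_c generate the functionals that map S into tR. By
  \<open>gorenstein_separation\<close>, v is in S if and only if every v n_j lies in tR, that is, if
  (v, y) is in the kernel of (v, y) \<mapsto> (v n_j + t y_j) for some y, which is unique as t is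
  regular. So S is the kernel of \<pi> on R^(k+c). The image of \<pi> contains t R^c, so the
  construction can be repeated.\<close>

lemma exists_cosyzygy:
  fixes T :: "'i itself"
  assumes G: "gorenstein_ring T R" and t: "t \<in> \<mm>" "t \<in> nonzerodivisors R"
    and S: "submodule S R (free_module R k)" and tS: "\<forall>i<k. t \<odot>\<^bsub>free_module R k\<^esub> unit_vec k i \<in> S"
  shows "\<exists>c k' \<pi> \<sigma> \<iota>. lin R (free_module R k') (free_module R c) \<pi> \<and>
     (\<forall>i<c. t \<odot>\<^bsub>free_module R c\<^esub> unit_vec c i \<in> \<pi> ` carrier (free_module R k')) \<and>
     lin R (free_module R k'\<lparr>carrier := {w \<in> carrier (free_module R k'). \<pi> w = \<zero>\<^bsub>free_module R c\<^esub>}\<rparr>)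
       (free_module R k\<lparr>carrier := S\<rparr>) \<sigma> \<and>
     lin R (free_module R k\<lparr>carrier := S\<rparr>)
       (free_module R k'\<lparr>carrier := {w \<in> carrier (free_module R k'). \<pi> w = \<zero>\<^bsub>free_module R c\<^esub>}\<rparr>) \<iota> \<and>
     (\<forall>s\<in>S. \<sigma> (\<iota> s) = s)"
proof -
  let ?F = "free_module R k" and ?A = "regular_module R"
  have F: "module R ?F" and A: "module R ?A" by (rule module_free module_regular)+
  note tc = nonzerodivisorsD[OF t(2)]
  note Sd = submoduleD[OF F S]
  have Fi: "w i \<in> carrier R" if "w \<in> carrier (free_module R l)" "i < l" for w i l using that by (auto simp: PiE_iff)
  have iT: "ideal (PIdl t) R" by (rule cgenideal_ideal[OF tc(1)])
  note Td = idealD[OF iT]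
  have ldr: "lin R ?F ?A (\<lambda>n. dot v n k)" if v: "v \<in> carrier ?F" for v
  proof -
    have "lin R ?F ?A (\<lambda>n. dot n v k)" by (rule lin_dot[OF Fi[OF v]])
    moreover have "dot n v k = dot v n k" if "n \<in> carrier ?F" for n
      using Fi[OF v] Fi[OF that] by (intro lc_regular_commute)
    ultimately show ?thesis using lin_cong[OF F, of "\<lambda>n. dot n v k" "\<lambda>n. dot v n k" ?A] by simp
  qed
  have sv: "submodule {n \<in> carrier ?F. dot v n k \<in> PIdl t} R ?F" if v: "v \<in> carrier ?F" for v
    by (rule lin_vimage_submodule[OF F A ldr[OF v] iT[unfolded ideal_iff_submodule]])
  define D where "D = {n \<in> carrier ?F. \<forall>s\<in>S. dot s n k \<in> PIdl t}"
  have sD: "submodule D R ?F"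
    unfolding submodule_iff[OF F]
  proof (intro conjI ballI)
    show "D \<subseteq> carrier ?F" by (auto simp: D_def)
    have SF: "s \<in> carrier ?F" if "s \<in> S" for s using that Sd(1) by blast
    note sub = submoduleD[OF F sv[OF SF]]
    have Dm: "n \<in> D" if "n \<in> carrier ?F" "\<And>s. s \<in> S \<Longrightarrow> n \<in> {n \<in> carrier ?F. dot s n k \<in> PIdl t}" for n
      using that by (simp add: D_def)
    have Ds: "n \<in> {n \<in> carrier ?F. dot s n k \<in> PIdl t}" "n \<in> carrier ?F" if "n \<in> D" "s \<in> S" for n s
      using that by (simp_all add: D_def)
    have ne: "\<zero>\<^bsub>?F\<^esub> \<in> S" by (rule Sd(2))
    show "\<zero>\<^bsub>?F\<^esub> \<in> D" using sub(1,2) ne by (intro Dm) blast+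
    fix x assume x: "x \<in> D"
    show "x \<oplus>\<^bsub>?F\<^esub> y \<in> D" if y: "y \<in> D" for y
      using sub(3)[OF _ Ds(1)[OF x] Ds(1)[OF y]] sub(1) ne by (intro Dm) blast+
    show "r \<odot>\<^bsub>?F\<^esub> x \<in> D" if "r \<in> carrier R" for r
      using sub(4)[OF _ that Ds(1)[OF x]] sub(1) ne by (intro Dm) blast+
  qed
  obtain c N where N: "lin R (free_module R c) ?F N" "N ` carrier (free_module R c) = D"
    by (rule finitely_spanned_surjection[OF F sD free_submodule_finitely_spanned[OF sD]])
  define n where "n j = N (unit_vec c j)" for j
  have nD: "n j \<in> D" "n j \<in> carrier ?F" for j
    using N(2) lin_closed[OF N(1), of "unit_vec c j"] by (auto simp: n_def simp del: free_module_simps) (simp_all)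
  have memS: "v \<in> S" if v: "v \<in> carrier ?F" "\<And>j. j < c \<Longrightarrow> dot v (n j) k \<in> PIdl t" for v
  proof (rule ccontr)
    assume "v \<notin> S"
    then obtain m where m: "m \<in> carrier ?F" "\<forall>s\<in>S. dot s m k \<in> PIdl t" "dot v m k \<notin> PIdl t"
      using gorenstein_separation[OF G t S tS[rule_format] v(1)] by blast
    have "m \<in> D" using m by (simp add: D_def)
    then obtain y where y: "y \<in> carrier (free_module R c)" "m = N y" using N(2) by blast
    have "m = lc ?F y n c"
      unfolding y(2) n_def by (rule lin_free_expand[OF F N(1)]) (use y(1) in simp)
    moreover have "lc ?F y n c \<in> {n \<in> carrier ?F. dot v n k \<in> PIdl t}"
      using Fi[OF y(1)] v nD(2) by (intro module.lc_mem[OF F sv[OF v(1)]]) blast+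
    ultimately show False using m(3) by blast
  qed
  let ?k = "k + c" and ?C = "free_module R c"
  let ?G = "free_module R ?k"
  have Gm: "module R ?G" and C: "module R ?C" by (rule module_free)+
  \<comment> \<open>The first k entries of w are the vector v, the remaining c entries are
    y.\<close>
  define h where "h w j = dot (restrict w {..<k}) (n j) k \<oplus> t \<otimes> w (k + j)" for w j
  define \<pi> where "\<pi> w = restrict (h w) {..<c}" for w
  have lr: "lin R ?G ?F (\<lambda>w. restrict w {..<k})"
    by (rule linI) (auto intro!: restrict_ext simp: PiE_iff)
  have l2: "lin R ?G ?A (\<lambda>w. t \<otimes> w (k + j))" if "j < c" for j
    using lin_scale[OF A lin_proj[of "k + j" ?k] tc(1)] that by simp
  have lh: "lin R ?G ?A (\<lambda>w. h w j)" if "j < c" for j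
    unfolding h_def using lin_plus[OF A lin_comp[OF lr lin_dot[OF Fi[OF nD(2)]]] l2[OF that]] by simp
  have l\<pi>: "lin R ?G ?C \<pi>" unfolding \<pi>_def by (rule lin_into_free[OF lh])
  let ?K = "{w \<in> carrier ?G. \<pi> w = \<zero>\<^bsub>?C\<^esub>}"
  have \<pi>0: "\<pi> w = \<zero>\<^bsub>?C\<^esub> \<longleftrightarrow> (\<forall>j<c. h w j = \<zero>)" for w
    by (auto simp: \<pi>_def fun_eq_iff restrict_def)
  have wk: "w (k + j) \<in> carrier R" if "w \<in> carrier ?G" "j < c" for w j using Fi[OF that(1)] that(2) by simp
  have wr: "restrict w {..<k} \<in> carrier ?F" if "w \<in> carrier ?G" for w by (rule lin_closed[OF lr that])
  have dc: "dot v (n j) k \<in> carrier R" if "v \<in> carrier ?F" for v j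
    using Fi[OF that] Fi[OF nD(2)] by (intro dot_closed)
  have hz: "h w j = \<zero> \<longleftrightarrow> dot (restrict w {..<k}) (n j) k = (\<ominus> w (k + j)) \<otimes> t" if w: "w \<in> carrier ?G" "j < c" for w j
  proof -
    have "x \<oplus> t \<otimes> y = \<zero> \<longleftrightarrow> x = (\<ominus> y) \<otimes> t" if "x \<in> carrier R" "y \<in> carrier R" for x y
    proof
      assume "x \<oplus> t \<otimes> y = \<zero>"
      moreover have "x = (x \<oplus> t \<otimes> y) \<ominus> t \<otimes> y" using that tc(1) by algebra
      ultimately have "x = \<zero> \<ominus> t \<otimes> y" by simp
      also have "\<dots> = (\<ominus> y) \<otimes> t" using that tc(1) by algebra
      finally show "x = (\<ominus> y) \<otimes> t" .
    next
      assume "x = (\<ominus> y) \<otimes> t"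
      then show "x \<oplus> t \<otimes> y = \<zero>" using that tc(1) by algebra
    qed
    then show ?thesis unfolding h_def using dc[OF wr[OF w(1)]] wk[OF w] by blast
  qed
  have Kr: "restrict w {..<k} \<in> S" if "w \<in> ?K" for w
  proof (rule memS)
    show "restrict w {..<k} \<in> carrier ?F" using wr that by blast
    fix j assume j: "j < c"
    then have "dot (restrict w {..<k}) (n j) k = (\<ominus> w (k + j)) \<otimes> t" using hz[of w j] that \<pi>0[of w] by blast
    then show "dot (restrict w {..<k}) (n j) k \<in> PIdl t"
      using wk[of w j] j that by (auto simp: PIdl_mem)
  qed
  let ?\<sigma> = "\<lambda>w. restrict w {..<k}"
  have inj: "inj_on ?\<sigma> ?K"
  proof (rule inj_onI)
    fix w w' assume w: "w \<in> ?K" "w' \<in> ?K" and eq: "?\<sigma> w = ?\<sigma> w'"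
    have wG: "w \<in> carrier ?G" "w' \<in> carrier ?G" using w by blast+
    have "w i = w' i" if i: "i < ?k" for i
    proof (cases "i < k")
      case True
      then show ?thesis using fun_cong[OF eq, of i] by simp
    next
      case False
      then obtain j where j: "i = k + j" "j < c" using i by (metis add_less_cancel_left le_Suc_ex not_less)
      have "(\<ominus> w (k + j)) \<otimes> t = (\<ominus> w' (k + j)) \<otimes> t"
        using hz[OF wG(1) j(2)] hz[OF wG(2) j(2)] w \<pi>0[of w] \<pi>0[of w'] j(2) eq by simp
      then have "t \<otimes> (\<ominus> w (k + j)) = t \<otimes> (\<ominus> w' (k + j))"
        using wk[OF wG(1) j(2)] wk[OF wG(2) j(2)] tc(1) by (simp only: m_comm[of t] a_inv_closed)
      then have "\<ominus> w (k + j) = \<ominus> w' (k + j)"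
        by (rule nonzerodivisor_cancel[OF t(2) a_inv_closed[OF wk[OF wG(1) j(2)]] a_inv_closed[OF wk[OF wG(2) j(2)]]])
      then show ?thesis unfolding j(1)
        using wk[OF wG(1) j(2)] wk[OF wG(2) j(2)] minus_minus by metis
    qed
    then show "w = w'" using wG by (intro PiE_lessThan_eqI[of w ?k _ w']) simp_all
  qed
  have im: "?\<sigma> ` ?K = S"
  proof (intro equalityI image_subsetI Kr subsetI)
    fix s assume s: "s \<in> S"
    then have sF: "s \<in> carrier ?F" using Sd(1) by blast
    have "dot s (n j) k \<in> PIdl t" for j using nD(1)[of j] s by (simp add: D_def)
    then have "\<forall>j. \<exists>y. y \<in> carrier R \<and> dot s (n j) k = y \<otimes> t" by (simp add: PIdl_mem) blast
    then obtain y where y: "\<And>j. y j \<in> carrier R" "\<And>j. dot s (n j) k = y j \<otimes> t" by metis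
    define w where "w = (\<lambda>i\<in>{..<?k}. if i < k then s i else \<ominus> y (i - k))"
    have wG: "w \<in> carrier ?G"
      unfolding w_def free_module_simps restrict_PiE_iff using y(1) Fi[OF sF] by simp
    have sw: "?\<sigma> w = s"
    proof (rule PiE_lessThan_eqI)
      show "?\<sigma> w \<in> {..<k} \<rightarrow>\<^sub>E carrier R" using wr[OF wG] by simp
      show "s \<in> {..<k} \<rightarrow>\<^sub>E carrier R" using sF by simp
    qed (simp add: w_def)
    have "h w j = \<zero>" if "j < c" for j
      unfolding hz[OF wG that] sw y(2) using that y(1)[of j] by (simp add: w_def)
    then have "w \<in> ?K" using wG \<pi>0[of w] by blast
    then show "s \<in> ?\<sigma> ` ?K" using sw by (intro image_eqI[of _ _ w]) auto
  qed
  have sK: "submodule ?K R ?G"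
    by (rule lin_kernel_submodule[OF Gm C l\<pi> module.carrier_is_submodule[OF Gm]])
  have mK: "module R (?G\<lparr>carrier := ?K\<rparr>)" by (rule submodule.submodule_is_module[OF sK Gm])
  have l\<sigma>: "lin R (?G\<lparr>carrier := ?K\<rparr>) ?F ?\<sigma>" by (rule lin_carrier_update[OF lr]) blast
  have l\<sigma>': "lin R (?G\<lparr>carrier := ?K\<rparr>) (?F\<lparr>carrier := S\<rparr>) ?\<sigma>"
    by (rule lin_codomain_update[OF l\<sigma>]) (use Kr in simp)
  let ?\<iota> = "inv_into ?K ?\<sigma>"
  have l\<iota>: "lin R (?F\<lparr>carrier := S\<rparr>) (?G\<lparr>carrier := ?K\<rparr>) ?\<iota>"
    using lin_inv_into[OF mK l\<sigma>] inj im by simp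
  have \<sigma>\<iota>: "?\<sigma> (?\<iota> s) = s" if "s \<in> S" for s using f_inv_into_f[of s ?\<sigma> ?K] that im by simp
  have tC: "t \<odot>\<^bsub>?C\<^esub> unit_vec c i \<in> \<pi> ` carrier ?G" if i: "i < c" for i
  proof (rule image_eqI)
    show uG: "unit_vec ?k (k + i) \<in> carrier ?G" by simp
    show "t \<odot>\<^bsub>?C\<^esub> unit_vec c i = \<pi> (unit_vec ?k (k + i))"
    proof (rule PiE_lessThan_eqI)
      show "t \<odot>\<^bsub>?C\<^esub> unit_vec c i \<in> {..<c} \<rightarrow>\<^sub>E carrier R"
        using module.smult_closed[OF C tc(1), of "unit_vec c i"] by simp
      show "\<pi> (unit_vec ?k (k + i)) \<in> {..<c} \<rightarrow>\<^sub>E carrier R" using lin_closed[OF l\<pi> uG] by simp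
      fix j assume j: "j < c"
      have "dot (restrict (unit_vec ?k (k + i)) {..<k}) (n j) k = \<zero>"
        using module.lc_zero_left[OF A, of k "restrict (unit_vec ?k (k + i)) {..<k}" "n j"] Fi[OF nD(2)]
        by (simp add: unit_vec_def)
      then show "(t \<odot>\<^bsub>?C\<^esub> unit_vec c i) j = \<pi> (unit_vec ?k (k + i)) j"
        using i j tc(1) by (simp add: \<pi>_def h_def unit_vec_def)
    qed
  qed
  show ?thesis using l\<pi> tC l\<sigma>' l\<iota> \<sigma>\<iota> by blast
qed

end

section \<open>Retracts up to maps factoring through free modules\<close>

text \<open>U is a retract of V modulo maps that factor through finitely generated free modules:
  \<alpha> \<beta> is the identity plus such a map.\<close>

definition stable_retract ::
    "('a, 'k) ring_scheme \<Rightarrow> ('a, 'm, 'l) module_scheme \<Rightarrow> ('a, 'n, 'j) module_scheme \<Rightarrow> bool" where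
  "stable_retract R U V \<longleftrightarrow> (\<exists>\<alpha> \<beta> g p q. lin R V U \<alpha> \<and> lin R U V \<beta> \<and>
     lin R U (free_module R g) p \<and> lin R (free_module R g) U q \<and>
     (\<forall>x\<in>carrier U. \<alpha> (\<beta> x) = x \<oplus>\<^bsub>U\<^esub> q (p x)))"

lemma stable_retractI:
  assumes "lin R V U \<alpha>" "lin R U V \<beta>" "lin R U (free_module R g) p" "lin R (free_module R g) U q"
    "\<And>x. x \<in> carrier U \<Longrightarrow> \<alpha> (\<beta> x) = x \<oplus>\<^bsub>U\<^esub> q (p x)"
  shows "stable_retract R U V"
  unfolding stable_retract_def using assms by blast

lemma stable_retractE:
  assumes "stable_retract R U V"
  obtains \<alpha> \<beta> g p q where "lin R V U \<alpha>" "lin R U V \<beta>" "lin R U (free_module R g) p"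
    "lin R (free_module R g) U q" "\<forall>x\<in>carrier U. \<alpha> (\<beta> x) = x \<oplus>\<^bsub>U\<^esub> q (p x)"
  using assms unfolding stable_retract_def by (elim exE conjE) (rule that)

lemma stable_retract_transfer:
  assumes U: "stable_retract R U V" and \<sigma>: "lin R U Z \<sigma>" and \<iota>: "lin R Z U \<iota>"
    and \<sigma>\<iota>: "\<forall>z\<in>carrier Z. \<sigma> (\<iota> z) = z"
  shows "stable_retract R Z V"
proof (rule stable_retractE[OF U])
  fix \<alpha> \<beta> g p q
  assume l: "lin R V U \<alpha>" "lin R U V \<beta>" "lin R U (free_module R g) p" "lin R (free_module R g) U q"
    and eq: "\<forall>x\<in>carrier U. \<alpha> (\<beta> x) = x \<oplus>\<^bsub>U\<^esub> q (p x)"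
  show ?thesis
  proof (rule stable_retractI)
    show "lin R V Z (\<lambda>y. \<sigma> (\<alpha> y))" by (rule lin_comp[OF l(1) \<sigma>])
    show "lin R Z V (\<lambda>z. \<beta> (\<iota> z))" by (rule lin_comp[OF \<iota> l(2)])
    show "lin R Z (free_module R g) (\<lambda>z. p (\<iota> z))" by (rule lin_comp[OF \<iota> l(3)])
    show "lin R (free_module R g) Z (\<lambda>v. \<sigma> (q v))" by (rule lin_comp[OF l(4) \<sigma>])
    fix z assume z: "z \<in> carrier Z"
    note iz = lin_closed[OF \<iota> z]
    show "\<sigma> (\<alpha> (\<beta> (\<iota> z))) = z \<oplus>\<^bsub>Z\<^esub> \<sigma> (q (p (\<iota> z)))"
      unfolding eq[rule_format, OF iz] lin_add[OF \<sigma> iz lin_closed[OF l(4) lin_closed[OF l(3) iz]]] \<sigma>\<iota>[rule_format, OF z] ..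
  qed
qed

text \<open>The maps \<alpha>, \<beta>, q lift to the free covers as A, B, Q. The error A B - 1 - Q
  p \<pi> takes values in the kernel K of \<pi>. On K the term Q p \<pi> vanishes, so A B is the
  identity plus a map that passes through the free cover.\<close>

lemma stable_retract_syzygy:
  assumes U: "module R U" and V: "module R V" and UV: "stable_retract R U V"
    and \<pi>: "lin R (free_module R a) U \<pi>" "\<pi> ` carrier (free_module R a) = carrier U"
    and \<rho>: "lin R (free_module R b) V \<rho>" "\<rho> ` carrier (free_module R b) = carrier V"
  shows "stable_retract R
     (free_module R a\<lparr>carrier := {v \<in> carrier (free_module R a). \<pi> v = \<zero>\<^bsub>U\<^esub>}\<rparr>)
     (free_module R b\<lparr>carrier := {w \<in> carrier (free_module R b). \<rho> w = \<zero>\<^bsub>V\<^esub>}\<rparr>)"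
    (is "stable_retract R (?F\<lparr>carrier := ?K\<rparr>) (?G\<lparr>carrier := ?L\<rparr>)")
proof (rule stable_retractE[OF UV])
  fix \<alpha> \<beta> g p q
  assume l: "lin R V U \<alpha>" "lin R U V \<beta>" "lin R U (free_module R g) p" "lin R (free_module R g) U q"
    and eq: "\<forall>x\<in>carrier U. \<alpha> (\<beta> x) = x \<oplus>\<^bsub>U\<^esub> q (p x)"
  interpret U: module R U by (rule U)
  interpret V: module R V by (rule V)
  let ?H = "free_module R g"
  have F: "module R ?F" and G: "module R ?G" and H: "module R ?H" by (rule U.R.module_free)+
  interpret F: module R ?F by (rule F)
  have cF: "carrier (free_module R k) = {..<k} \<rightarrow>\<^sub>E carrier R" for k by simp
  obtain A where A: "lin R ?G ?F A" "\<And>w. w \<in> carrier ?G \<Longrightarrow> \<pi> (A w) = \<alpha> (\<rho> w)"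
  proof (rule lin_free_lift[OF F U \<pi>(1) lin_comp[OF \<rho>(1) l(1)]])
    show "\<alpha> (\<rho> w) \<in> \<pi> ` carrier ?F" if "w \<in> {..<b} \<rightarrow>\<^sub>E carrier R" for w
      unfolding \<pi>(2) by (rule lin_closed[OF l(1) lin_closed[OF \<rho>(1)]]) (use that in simp)
  qed (use that in simp)
  obtain B where B: "lin R ?F ?G B" "\<And>v. v \<in> carrier ?F \<Longrightarrow> \<rho> (B v) = \<beta> (\<pi> v)"
  proof (rule lin_free_lift[OF G V \<rho>(1) lin_comp[OF \<pi>(1) l(2)]])
    show "\<beta> (\<pi> w) \<in> \<rho> ` carrier ?G" if "w \<in> {..<a} \<rightarrow>\<^sub>E carrier R" for w
      unfolding \<rho>(2) by (rule lin_closed[OF l(2) lin_closed[OF \<pi>(1)]]) (use that in simp)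
  qed (use that in simp)
  obtain Q where Q: "lin R ?H ?F Q" "\<And>u. u \<in> carrier ?H \<Longrightarrow> \<pi> (Q u) = q u"
  proof (rule lin_free_lift[OF F U \<pi>(1) l(4)])
    show "q u \<in> \<pi> ` carrier ?F" if "u \<in> {..<g} \<rightarrow>\<^sub>E carrier R" for u
      unfolding \<pi>(2) by (rule lin_closed[OF l(4)]) (use that in simp)
  qed (use that in simp)
  define \<delta> where "\<delta> v = (A (B v) \<ominus>\<^bsub>?F\<^esub> v) \<ominus>\<^bsub>?F\<^esub> Q (p (\<pi> v))" for v
  have lQ: "lin R ?F ?F (\<lambda>v. Q (p (\<pi> v)))" by (rule lin_comp[OF lin_comp[OF \<pi>(1) l(3)] Q(1)])
  have lAB: "lin R ?F ?F (\<lambda>v. A (B v))" by (rule lin_comp[OF B(1) A(1)])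
  have l\<delta>: "lin R ?F ?F \<delta>"
    unfolding \<delta>_def by (rule lin_minus[OF F lin_minus[OF F lAB lin_id] lQ])
  have \<pi>\<delta>: "\<delta> v \<in> ?K" if v: "v \<in> carrier ?F" for v
  proof -
    note x = lin_closed[OF \<pi>(1) v]
    note y = lin_closed[OF l(4) lin_closed[OF l(3) x]]
    have ABv: "A (B v) \<in> carrier ?F" and Qv: "Q (p (\<pi> v)) \<in> carrier ?F"
      using lin_closed[OF lAB v] lin_closed[OF lQ v] by blast+
    have "\<pi> (\<delta> v) = (\<pi> (A (B v)) \<ominus>\<^bsub>U\<^esub> \<pi> v) \<ominus>\<^bsub>U\<^esub> \<pi> (Q (p (\<pi> v)))"
      unfolding \<delta>_def lin_diff[OF F U \<pi>(1) F.M.minus_closed[OF ABv v] Qv] lin_diff[OF F U \<pi>(1) ABv v] ..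
    also have "\<pi> (A (B v)) = \<pi> v \<oplus>\<^bsub>U\<^esub> q (p (\<pi> v))"
      unfolding A(2)[OF lin_closed[OF B(1) v]] B(2)[OF v] by (rule eq[rule_format, OF x])
    also have "\<pi> (Q (p (\<pi> v))) = q (p (\<pi> v))" by (rule Q(2)[OF lin_closed[OF l(3) x]])
    also have "(\<pi> v \<oplus>\<^bsub>U\<^esub> q (p (\<pi> v))) \<ominus>\<^bsub>U\<^esub> \<pi> v \<ominus>\<^bsub>U\<^esub> q (p (\<pi> v)) = \<zero>\<^bsub>U\<^esub>"
      using x y by (simp add: a_minus_def U.M.a_ac U.M.r_neg1 U.M.r_neg U.M.r_neg2)
    finally show ?thesis using lin_closed[OF l\<delta> v] by blast
  qed
  have KF: "?K \<subseteq> carrier ?F" and LG: "?L \<subseteq> carrier ?G" by blast+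
  show ?thesis
  proof (rule stable_retractI)
    show "lin R (?G\<lparr>carrier := ?L\<rparr>) (?F\<lparr>carrier := ?K\<rparr>) A"
    proof (rule lin_codomain_update[OF lin_carrier_update[OF A(1) LG]])
      fix w assume "w \<in> carrier (?G\<lparr>carrier := ?L\<rparr>)"
      then have w: "w \<in> carrier ?G" "\<rho> w = \<zero>\<^bsub>V\<^esub>" by simp_all
      show "A w \<in> ?K"
        using A(2)[OF w(1)] lin_closed[OF A(1) w(1)] lin_zero[OF V U l(1)] unfolding w(2) by simp
    qed
    show "lin R (?F\<lparr>carrier := ?K\<rparr>) (?G\<lparr>carrier := ?L\<rparr>) B"
    proof (rule lin_codomain_update[OF lin_carrier_update[OF B(1) KF]])
      fix w assume "w \<in> carrier (?F\<lparr>carrier := ?K\<rparr>)"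
      then have w: "w \<in> carrier ?F" "\<pi> w = \<zero>\<^bsub>U\<^esub>" by simp_all
      show "B w \<in> ?L"
        using B(2)[OF w(1)] lin_closed[OF B(1) w(1)] lin_zero[OF U V l(2)] unfolding w(2) by simp
    qed
    show "lin R (?F\<lparr>carrier := ?K\<rparr>) ?F (\<lambda>v. v)" by (rule lin_carrier_update[OF lin_id KF])
    show "lin R ?F (?F\<lparr>carrier := ?K\<rparr>) \<delta>" by (rule lin_codomain_update[OF l\<delta> \<pi>\<delta>])
    fix v assume "v \<in> carrier (?F\<lparr>carrier := ?K\<rparr>)"
    then have v: "v \<in> carrier ?F" "\<pi> v = \<zero>\<^bsub>U\<^esub>" by simp_all
    have ABv: "A (B v) \<in> carrier ?F" by (rule lin_closed[OF lAB v(1)])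
    have "Q (p (\<pi> v)) = \<zero>\<^bsub>?F\<^esub>"
      unfolding v(2) lin_zero[OF U H l(3)] by (rule lin_zero[OF H F Q(1)])
    then have "\<delta> v = A (B v) \<ominus>\<^bsub>?F\<^esub> v"
      using ABv v(1) unfolding \<delta>_def by (simp add: a_minus_def del: free_module_simps)
    then show "A (B v) = v \<oplus>\<^bsub>?F\<lparr>carrier := ?K\<rparr>\<^esub> \<delta> v"
      using F.M.minus_add_cancel[OF ABv v(1)] F.M.a_comm[OF v(1) F.M.minus_closed[OF ABv v(1)]]
      by (simp del: free_module_simps)
  qed
qed

text \<open>One step of the comparison: S is a copy of the kernel of \<pi>, so a stable retraction
  of the image of \<pi> onto V induces one between S and the kernel of any free cover \<rho> of
  V.\<close>

lemma (in cring) stable_retract_cosyzygy: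
  assumes \<pi>: "lin R (free_module R a) (free_module R c) \<pi>"
    and \<sigma>: "lin R (free_module R a\<lparr>carrier := {w \<in> carrier (free_module R a). \<pi> w = \<zero>\<^bsub>free_module R c\<^esub>}\<rparr>) (N\<lparr>carrier := S\<rparr>) \<sigma>"
    and \<iota>: "lin R (N\<lparr>carrier := S\<rparr>) (free_module R a\<lparr>carrier := {w \<in> carrier (free_module R a). \<pi> w = \<zero>\<^bsub>free_module R c\<^esub>}\<rparr>) \<iota>"
    and \<sigma>\<iota>: "\<forall>z\<in>S. \<sigma> (\<iota> z) = z"
    and V: "module R V" and \<rho>: "lin R (free_module R b) V \<rho>" "\<rho> ` carrier (free_module R b) = carrier V"
    and st: "stable_retract R (free_module R c\<lparr>carrier := \<pi> ` carrier (free_module R a)\<rparr>) V"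
  shows "stable_retract R (N\<lparr>carrier := S\<rparr>)
     (free_module R b\<lparr>carrier := {w \<in> carrier (free_module R b). \<rho> w = \<zero>\<^bsub>V\<^esub>}\<rparr>)"
proof (rule stable_retract_transfer[OF _ \<sigma> \<iota>])
  let ?C = "free_module R c" and ?F = "free_module R a"
  let ?T = "\<pi> ` carrier ?F"
  have F: "module R ?F" and C: "module R ?C" by (rule module_free)+
  have S: "submodule ?T R ?C" by (rule lin_image_submodule[OF F C \<pi> module.carrier_is_submodule[OF F]])
  have mS: "module R (?C\<lparr>carrier := ?T\<rparr>)" by (rule submodule.submodule_is_module[OF S C])
  have l\<pi>: "lin R ?F (?C\<lparr>carrier := ?T\<rparr>) \<pi>" by (rule lin_codomain_update[OF \<pi>]) (rule imageI)
  show "stable_retract R (?F\<lparr>carrier := {w \<in> carrier ?F. \<pi> w = \<zero>\<^bsub>?C\<^esub>}\<rparr>)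
     (free_module R b\<lparr>carrier := {w \<in> carrier (free_module R b). \<rho> w = \<zero>\<^bsub>V\<^esub>}\<rparr>)"
    using stable_retract_syzygy[OF mS V st l\<pi> _ \<rho>] by (simp del: free_module_simps)
qed (use \<sigma>\<iota> in simp)

context reduced_local_dim1 begin

text \<open>The lattice S' is fixed before M and the resolution, so the comparison holds for
  whichever resolution \<open>Ext\<close> selects. The image of d n is the syzygy of order n + 1, so
  n = 0 already takes one cosyzygy.\<close>

lemma iterated_cosyzygy:
  fixes T :: "'i itself"
  assumes G: "gorenstein_ring T R" and t: "t \<in> \<mm>" "t \<in> nonzerodivisors R"
  shows "submodule S R (free_module R k) \<Longrightarrow> \<forall>i<k. t \<odot>\<^bsub>free_module R k\<^esub> unit_vec k i \<in> S \<Longrightarrow>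
    \<exists>c S'. submodule S' R (free_module R c) \<and>
      (\<forall>(M :: ('a, 'm, 'l) module_scheme) b e d. free_resolution R M b e d \<longrightarrow> module R M \<longrightarrow>
         stable_retract R (free_module R c\<lparr>carrier := S'\<rparr>) M \<longrightarrow>
         stable_retract R (free_module R k\<lparr>carrier := S\<rparr>)
           (free_module R (b n)\<lparr>carrier := d n ` carrier (free_module R (b (Suc n)))\<rparr>))"
proof (induct n arbitrary: S k)
  case (0 S k)
  obtain c a \<pi> \<sigma> \<iota> where \<pi>: "lin R (free_module R a) (free_module R c) \<pi>"
     "\<forall>i<c. t \<odot>\<^bsub>free_module R c\<^esub> unit_vec c i \<in> \<pi> ` carrier (free_module R a)"
    and \<sigma>\<iota>: "lin R (free_module R a\<lparr>carrier := {w \<in> carrier (free_module R a). \<pi> w = \<zero>\<^bsub>free_module R c\<^esub>}\<rparr>)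
       (free_module R k\<lparr>carrier := S\<rparr>) \<sigma>"
     "lin R (free_module R k\<lparr>carrier := S\<rparr>)
       (free_module R a\<lparr>carrier := {w \<in> carrier (free_module R a). \<pi> w = \<zero>\<^bsub>free_module R c\<^esub>}\<rparr>) \<iota>"
     "\<forall>s\<in>S. \<sigma> (\<iota> s) = s"
    using exists_cosyzygy[OF G t 0(1) 0(2)] by (elim exE conjE) (rule that)
  have F: "module R (free_module R a)" and C: "module R (free_module R c)" by (rule module_free)+
  show ?case
  proof (intro exI[of _ c] exI[of _ "\<pi> ` carrier (free_module R a)"] conjI allI impI)
    show "submodule (\<pi> ` carrier (free_module R a)) R (free_module R c)"
      by (rule lin_image_submodule[OF F C \<pi>(1) module.carrier_is_submodule[OF F]])
    fix M :: "('a, 'm, 'l) module_scheme" and b e d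
    assume r: "free_resolution R M b e d" and M: "module R M"
      and st: "stable_retract R (free_module R c\<lparr>carrier := \<pi> ` carrier (free_module R a)\<rparr>) M"
    note rD = free_resolutionD[OF r]
    show "stable_retract R (free_module R k\<lparr>carrier := S\<rparr>)
       (free_module R (b 0)\<lparr>carrier := d 0 ` carrier (free_module R (b (Suc 0)))\<rparr>)"
      using stable_retract_cosyzygy[OF \<pi>(1) \<sigma>\<iota> M rD(1,3) st] rD(4) by (simp del: free_module_simps)
  qed
next
  case (Suc n S k)
  obtain c a \<pi> \<sigma> \<iota> where \<pi>: "lin R (free_module R a) (free_module R c) \<pi>"
     "\<forall>i<c. t \<odot>\<^bsub>free_module R c\<^esub> unit_vec c i \<in> \<pi> ` carrier (free_module R a)"
    and \<sigma>\<iota>: "lin R (free_module R a\<lparr>carrier := {w \<in> carrier (free_module R a). \<pi> w = \<zero>\<^bsub>free_module R c\<^esub>}\<rparr>)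
       (free_module R k\<lparr>carrier := S\<rparr>) \<sigma>"
     "lin R (free_module R k\<lparr>carrier := S\<rparr>)
       (free_module R a\<lparr>carrier := {w \<in> carrier (free_module R a). \<pi> w = \<zero>\<^bsub>free_module R c\<^esub>}\<rparr>) \<iota>"
     "\<forall>s\<in>S. \<sigma> (\<iota> s) = s"
    using exists_cosyzygy[OF G t Suc(2) Suc(3)] by (elim exE conjE) (rule that)
  have F: "module R (free_module R a)" and C: "module R (free_module R c)" by (rule module_free)+
  have S: "submodule (\<pi> ` carrier (free_module R a)) R (free_module R c)"
    by (rule lin_image_submodule[OF F C \<pi>(1) module.carrier_is_submodule[OF F]])
  from Suc(1)[OF S \<pi>(2)] obtain c' S' where S': "submodule S' R (free_module R c')"
    "\<forall>(M :: ('a, 'm, 'l) module_scheme) b e d. free_resolution R M b e d \<longrightarrow> module R M \<longrightarrow>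
         stable_retract R (free_module R c'\<lparr>carrier := S'\<rparr>) M \<longrightarrow>
         stable_retract R (free_module R c\<lparr>carrier := \<pi> ` carrier (free_module R a)\<rparr>)
           (free_module R (b n)\<lparr>carrier := d n ` carrier (free_module R (b (Suc n)))\<rparr>)"
    by blast
  show ?case
  proof (intro exI[of _ c'] exI[of _ S'] conjI S'(1) allI impI)
    fix M :: "('a, 'm, 'l) module_scheme" and b e d
    assume r: "free_resolution R M b e d" and M: "module R M"
      and st: "stable_retract R (free_module R c'\<lparr>carrier := S'\<rparr>) M"
    note rD = free_resolutionD[OF r]
    let ?B = "free_module R (b n)" and ?B' = "free_module R (b (Suc n))"
    have B: "module R ?B" "module R ?B'" by (rule module_free)+
    have ld: "lin R ?B' ?B (d n)" by (rule mod_hom_lin[OF rD(2)])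
    let ?V = "?B\<lparr>carrier := d n ` carrier ?B'\<rparr>"
    have mV: "module R ?V"
      by (rule submodule.submodule_is_module[OF lin_image_submodule[OF B(2,1) ld module.carrier_is_submodule[OF B(2)]] B(1)])
    have ld': "lin R ?B' ?V (d n)" by (rule lin_codomain_update[OF ld]) (rule imageI)
    have "stable_retract R (free_module R c\<lparr>carrier := \<pi> ` carrier (free_module R a)\<rparr>) ?V"
      using S'(2) r M st by blast
    from stable_retract_cosyzygy[OF \<pi>(1) \<sigma>\<iota> mV ld' _ this]
    show "stable_retract R (free_module R k\<lparr>carrier := S\<rparr>)
       (?B'\<lparr>carrier := d (Suc n) ` carrier (free_module R (b (Suc (Suc n))))\<rparr>)"
      unfolding rD(5) by (simp del: free_module_simps)
  qed
qed

end

section \<open>The cohomology annihilator lies in the conductor\<close>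

lemma stable_retract_of_retract:
  assumes "module R Z" "lin R V Z \<sigma>" "lin R Z V \<iota>" "\<forall>z\<in>carrier Z. \<sigma> (\<iota> z) = z"
  shows "stable_retract R Z V"
proof -
  interpret Z: module R Z by fact
  have F: "module R (free_module R 0)" by (rule Z.R.module_free)
  interpret F: module R "free_module R 0" by (rule F)
  show ?thesis
  proof (rule stable_retractI[OF assms(2,3)])
    show "lin R Z (free_module R 0) (\<lambda>_. \<zero>\<^bsub>free_module R 0\<^esub>)"
      using F.M.zero_closed F.M.l_zero F.smult_r_null by (simp add: lin_def del: free_module_simps)
    show "lin R (free_module R 0) Z (\<lambda>_. \<zero>\<^bsub>Z\<^esub>)" by (simp add: lin_def)
  qed (use assms(4) in simp)
qed

section \<open>Finitely generated test modules in the prescribed type\<close>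

lemma finitely_spanned_image:
  assumes M: "module R M" and N: "module R N" and f: "lin R M N f"
    and W: "W \<subseteq> carrier M" "finitely_spanned R M W"
  shows "finitely_spanned R N (f ` W)"
proof -
  obtain S where S: "S \<subseteq> W" "finite S" "\<And>H. submodule H R M \<Longrightarrow> S \<subseteq> H \<Longrightarrow> W \<subseteq> H"
    using W(2) unfolding finitely_spanned_def by blast
  have "f ` W \<subseteq> H" if H: "submodule H R N" "f ` S \<subseteq> H" for H
    using S(3)[OF lin_vimage_submodule[OF M N f H(1)]] H(2) S(1) W(1) by blast
  then show ?thesis unfolding finitely_spanned_def using S(1,2) by (intro exI[of _ "f ` S"]) auto
qed

lemma submodule_carrier_update:
  assumes M: "module R M" and W: "submodule W R M" and H: "submodule H R (M\<lparr>carrier := W\<rparr>)"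
  shows "submodule H R M"
  using H submoduleD[OF M W]
  unfolding submodule_iff[OF M] submodule_iff[OF submodule.submodule_is_module[OF W M]] by auto

abbreviation singletons :: "('a, 'm, 'l) module_scheme \<Rightarrow> ('a, 'm set) module" where
  "singletons \<equiv> transport (\<lambda>x. {x})"

lemma inj_singleton: "inj_on (\<lambda>x. {x}) W"
  by (rule inj_onI) simp

text \<open>This makes submodules of free modules, in particular cosyzygies and syzygies, admissible
  as M and N in the cohomology annihilator.\<close>

lemma (in noetherian_cring) fin_gen_singletons:
  assumes W: "submodule W R (free_module R k)"
  shows "fin_gen_module R (singletons (free_module R k\<lparr>carrier := W\<rparr>))"
proof -
  let ?F = "free_module R k"
  let ?M = "?F\<lparr>carrier := W\<rparr>"
  have F: "module R ?F" by (rule module_free)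
  have M: "module R ?M" by (rule submodule.submodule_is_module[OF W F])
  have N: "module R (singletons ?M)" by (rule module_transport[OF M inj_singleton])
  have "finitely_spanned R ?M W"
    using free_submodule_finitely_spanned[OF W] submodule_carrier_update[OF F W]
    unfolding finitely_spanned_def by meson
  then have "finitely_spanned R (singletons ?M) ((\<lambda>x. {x}) ` W)"
    by (intro finitely_spanned_image[OF M N lin_transport[OF inj_singleton]]) simp_all
  then show ?thesis using transport_simps(1)[OF inj_singleton, of ?M] by (intro fin_gen_moduleI[OF N]) simp
qed

context cring begin

lemma dot_cong_mult:
  "(\<And>i. i < k \<Longrightarrow> x i \<otimes> y i = x' i \<otimes> y' i) \<Longrightarrow> dot x y k = dot x' y' k"
  by (induct k) auto

text \<open>If \<open>(a/s) I \<subseteq> I\<close> then a composite \<open>I \<rightarrow> R\<^sup>g \<rightarrow> I\<close> acts as multiplication by some \<open>w\<close> with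
  \<open>(a/s) w \<in> R\<close>; here \<open>w\<close> is the value at \<open>d\<close>, divided by \<open>d\<close>.\<close>

lemma ideal_through_free:
  assumes I: "ideal I R" and d: "d \<in> I" and as: "a \<in> carrier R" "s \<in> carrier R"
    and stable: "\<And>x. x \<in> I \<Longrightarrow> \<exists>x'\<in>I. a \<otimes> x = s \<otimes> x'"
    and p: "lin R (regular_module R\<lparr>carrier := I\<rparr>) (free_module R g) p"
    and q: "lin R (free_module R g) (regular_module R\<lparr>carrier := I\<rparr>) q"
  shows "\<exists>w\<in>carrier R. a \<otimes> q (p d) = s \<otimes> (d \<otimes> w)"
proof -
  let ?A = "regular_module R" and ?F = "free_module R g"
  note Ic = idealD(1)[OF I]
  have pI: "p x i \<in> carrier R" if "x \<in> I" "i < g" for x i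
    using lin_closed[OF p, of x] that by (auto simp: PiE_iff)
  have "lin R ?F ?A q" using q Ic by (auto simp: lin_def)
  then have qpd: "q (p d) = dot (p d) (\<lambda>i. q (unit_vec g i)) g"
    using lin_closed[OF p, of d] d by (intro lin_free_expand[OF module_regular]) simp_all
  have qI: "q (unit_vec g i) \<in> I" for i using lin_closed[OF q, of "unit_vec g i"] by simp
  then have "\<forall>i. \<exists>x'. x' \<in> I \<and> a \<otimes> q (unit_vec g i) = s \<otimes> x'" using stable by blast
  then obtain u where u: "\<And>i. u i \<in> I" "\<And>i. a \<otimes> q (unit_vec g i) = s \<otimes> u i" by metis
  \<comment> \<open>Both sides are the i-th component of p at d * u i, computed by linearity of p on
    I in two ways. It moves the multiplication by a/s from q to p.\<close>
  have swap: "p d i \<otimes> u i = (d \<otimes> p (u i) i) \<otimes> \<one>" if i: "i < g" for i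
  proof -
    have "u i \<otimes> p d i = p (u i \<otimes> d) i" using lin_smult[OF p, of "u i" d] Ic[OF u(1)] d i by simp
    also have "u i \<otimes> d = d \<otimes> u i" using Ic[OF u(1)] Ic[OF d] by (rule m_comm)
    also have "p (d \<otimes> u i) i = d \<otimes> p (u i) i" using lin_smult[OF p, of d "u i"] Ic[OF d] u(1) i by simp
    finally show ?thesis using m_comm[OF pI[OF d i] Ic[OF u(1)]] pI[OF u(1) i] Ic[OF d] by simp
  qed
  let ?w = "dot (\<lambda>i. p (u i) i) (\<lambda>_. \<one>) g"
  have "a \<otimes> q (p d) = dot (p d) (\<lambda>i. a \<otimes> q (unit_vec g i)) g"
    unfolding qpd using pI[OF d] Ic[OF qI] as(1) by (intro dot_scale_right[symmetric])
  also have "\<dots> = s \<otimes> dot (p d) u g"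
    unfolding u(2) using pI[OF d] Ic[OF u(1)] as(2) by (intro dot_scale_right)
  also have "dot (p d) u g = dot (\<lambda>i. d \<otimes> p (u i) i) (\<lambda>_. \<one>) g" by (rule dot_cong_mult[OF swap])
  also have "\<dots> = d \<otimes> ?w" using pI[OF u(1)] Ic[OF d] by (intro dot_scale_left) auto
  finally show ?thesis using pI[OF u(1)] by (intro bexI[of _ ?w]) auto
qed

end

context reduced_local_dim1 begin

text \<open>In degree 0 the coboundaries are just 0, and for N = M the augmentation is a cocycle. So
  r kills M, a copy of R.\<close>

lemma cohomology_annihilator_at_0:
  assumes r: "r \<in> cohomology_annihilator_at R 0"
  shows "r = \<zero>"
proof -
  let ?F = "free_module R 1"
  have F: "module R ?F" by (rule module_free)
  have sF: "submodule (carrier ?F) R ?F" by (rule module.carrier_is_submodule[OF F])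
  define M where "M = singletons (?F\<lparr>carrier := carrier ?F\<rparr>)"
  have M: "fin_gen_module R M" unfolding M_def by (rule fin_gen_singletons[OF sF])
  have mM: "module R M" using M by (simp add: fin_gen_module_def)
  obtain b d e where res: "free_resolution R M b e d" "\<And>n. Ext R n M M = hom_cohomology R b d M n"
    by (rule Ext_resolution[OF M]) (rule that)
  note D = free_resolutionD[OF res(1)]
  have "r \<in> mod_annihilator R (hom_cohomology R b d M 0)"
    using r M unfolding cohomology_annihilator_at_def res(2)[symmetric] by blast
  then have ann: "r \<in> carrier R" "\<And>f. f \<in> hom_cocycles R b d M 0 \<Longrightarrow>
      r \<odot>\<^bsub>hom_module R (free_module R (b 0)) M\<^esub> f \<in> hom_coboundaries R b d M 0"
    unfolding mod_annihilator_cohomology_iff[where b = b and d = d, OF mM D(2)] by blast+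
  have "e \<in> mod_hom R (free_module R (b 0)) M" using res(1) by (simp add: free_resolution_def)
  moreover have "e (d 0 x) = \<zero>\<^bsub>M\<^esub>" if "x \<in> carrier (free_module R (b (Suc 0)))" for x
    using D(4)[THEN equalityD1, THEN subsetD, OF imageI[of x]] that by simp
  ultimately have "e \<in> hom_cocycles R b d M 0" using hom_cocycles_iff[where b = b and d = d, OF D(2)] by blast
  from ann(2)[OF this] have re: "(\<lambda>x\<in>carrier (free_module R (b 0)). r \<odot>\<^bsub>M\<^esub> e x) = (\<lambda>x\<in>carrier (free_module R (b 0)). \<zero>\<^bsub>M\<^esub>)"
    by (simp add: hom_module_simps)
  note ts = transport_simps[OF inj_singleton]
  have "{unit_vec 1 0} \<in> carrier M" by (simp add: M_def ts)
  then obtain v where v: "v \<in> carrier (free_module R (b 0))" "e v = {unit_vec 1 0}" using D(3) by (metis imageE)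
  have "r \<odot>\<^bsub>M\<^esub> {unit_vec 1 0} = \<zero>\<^bsub>M\<^esub>" using fun_cong[OF re, of v] v by simp
  then have "{r \<odot>\<^bsub>?F\<^esub> unit_vec 1 0} = {\<zero>\<^bsub>?F\<^esub>}"
    unfolding M_def using ts(4)[of "unit_vec 1 0" "?F\<lparr>carrier := carrier ?F\<rparr>" r] by (simp add: ts(2))
  then have "(r \<odot>\<^bsub>?F\<^esub> unit_vec 1 0) 0 = \<zero>\<^bsub>?F\<^esub> 0" by simp
  then show ?thesis using ann(1) by (simp add: unit_vec_def)
qed

text \<open>I, viewed inside R^1, is a stable retract of the syzygy K of order n + 1 of some M.
  Since r annihilates Ext^(n+1)(M, K), multiplication by r on K factors through a free module.
  Transported to I it acquires the error term of the stable retraction, which factors through a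
  second free module.\<close>

lemma cohomology_annihilator_factors:
  fixes T :: "'i itself"
  assumes G: "gorenstein_ring T R" and t: "t \<in> \<mm>" "t \<in> nonzerodivisors R"
    and I: "ideal I R" "t \<in> I" and r: "r \<in> cohomology_annihilator_at R (Suc n)"
  shows "\<exists>g p q g' p' q'.
    lin R (regular_module R\<lparr>carrier := I\<rparr>) (free_module R g) p \<and>
    lin R (free_module R g) (regular_module R\<lparr>carrier := I\<rparr>) q \<and>
    lin R (regular_module R\<lparr>carrier := I\<rparr>) (free_module R g') p' \<and>
    lin R (free_module R g') (regular_module R\<lparr>carrier := I\<rparr>) q' \<and>
    (\<forall>x\<in>I. r \<otimes> x = q (p x) \<oplus> q' (p' x))"
proof -
  let ?A = "regular_module R" and ?F = "free_module R 1"
  let ?I = "?A\<lparr>carrier := I\<rparr>"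
  have A: "module R ?A" and F: "module R ?F" by (rule module_regular module_free)+
  have rc: "r \<in> carrier R" using r by (simp add: cohomology_annihilator_at_def)
  note Ic = idealD(1)[OF I(1)]
  have sI: "submodule I R ?A" using I(1) by (simp add: ideal_iff_submodule)
  have mI: "module R ?I" by (rule submodule.submodule_is_module[OF sI A])
  have lp: "lin R ?F ?A (\<lambda>v. v 0)" by (rule lin_proj) simp
  define S where "S = {v \<in> carrier ?F. v 0 \<in> I}"
  have S: "submodule S R ?F" unfolding S_def by (rule lin_vimage_submodule[OF F A lp sI])
  have tS: "\<forall>i<1. t \<odot>\<^bsub>?F\<^esub> unit_vec 1 i \<in> S"
    using module.smult_closed[OF F nonzerodivisorsD(1)[OF t(2)], of "unit_vec 1 0"] I(2) Ic[OF I(2)]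
    by (simp add: S_def unit_vec_def)
  obtain c S' where S': "submodule S' R (free_module R c)"
    and st: "\<forall>(M :: ('a, (nat \<Rightarrow> 'a) set) module) b e d. free_resolution R M b e d \<longrightarrow> module R M \<longrightarrow>
         stable_retract R (free_module R c\<lparr>carrier := S'\<rparr>) M \<longrightarrow>
         stable_retract R (?F\<lparr>carrier := S\<rparr>)
           (free_module R (b n)\<lparr>carrier := d n ` carrier (free_module R (b (Suc n)))\<rparr>)"
    using iterated_cosyzygy[OF G t S tS, where n = n] by (elim exE conjE) (rule that)
  let ?S' = "free_module R c\<lparr>carrier := S'\<rparr>"
  have mS': "module R ?S'" by (rule submodule.submodule_is_module[OF S' module_free])
  define M where "M = singletons ?S'"
  have M: "fin_gen_module R M" unfolding M_def by (rule fin_gen_singletons[OF S'])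
  have mM: "module R M" using M by (simp add: fin_gen_module_def)
  have stM: "stable_retract R ?S' M" unfolding M_def
    by (rule stable_retract_of_retract[OF mS' lin_transport_inv[OF mS' inj_singleton] lin_transport[OF inj_singleton]])
      (simp add: inv_into_f_f[OF inj_singleton])
  obtain b d e where res: "free_resolution R M b e d"
    "\<And>N :: ('a, (nat \<Rightarrow> 'a) set) module. \<And>n. Ext R n M N = hom_cohomology R b d N n"
    by (rule Ext_resolution[OF M]) (rule that)
  note D = free_resolutionD[OF res(1)]
  let ?B = "free_module R (b n)" and ?B' = "free_module R (b (Suc n))"
  have B: "module R ?B" "module R ?B'" by (rule module_free)+
  have ld: "lin R ?B' ?B (d n)" by (rule mod_hom_lin[OF D(2)])
  let ?K = "?B\<lparr>carrier := d n ` carrier ?B'\<rparr>"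
  have sK: "submodule (d n ` carrier ?B') R ?B"
    by (rule lin_image_submodule[OF B(2,1) ld module.carrier_is_submodule[OF B(2)]])
  have mK: "module R ?K" by (rule submodule.submodule_is_module[OF sK B(1)])
  have ld': "lin R ?B' ?K (d n)" by (rule lin_codomain_update[OF ld]) (rule imageI)
  define N where "N = singletons ?K"
  have N: "fin_gen_module R N" unfolding N_def by (rule fin_gen_singletons[OF sK])
  have mN: "module R N" using N by (simp add: fin_gen_module_def)
  have lN: "lin R ?K N (\<lambda>x. {x})" unfolding N_def by (rule lin_transport[OF inj_singleton])
  have lN': "lin R N ?K (inv_into (carrier ?K) (\<lambda>x. {x}))"
    unfolding N_def by (rule lin_transport_inv[OF mK inj_singleton])
  have "r \<in> mod_annihilator R (hom_cohomology R b d N (Suc n))"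
    using r M N unfolding cohomology_annihilator_at_def res(2)[symmetric] by blast
  then have ex: "\<exists>g. lin R ?B N g \<and> (\<forall>x\<in>carrier ?B'. g (d n x) = r \<odot>\<^bsub>N\<^esub> f x)"
    if "lin R ?B' N f" "\<forall>x\<in>carrier (free_module R (b (Suc (Suc n)))). f (d (Suc n) x) = \<zero>\<^bsub>N\<^esub>" for f
    using that unfolding mod_annihilator_cohomology_Suc[where b = b and d = d, OF mN D(2)] by blast
  \<comment> \<open>The cocycle is d n itself, taken as a map to its image K; its class is the
    obstruction to extending the identity of K to the free module above it.\<close>
  have dd: "\<forall>x\<in>carrier (free_module R (b (Suc (Suc n)))). {d n (d (Suc n) x)} = \<zero>\<^bsub>N\<^esub>"
  proof
    fix x assume x: "x \<in> carrier (free_module R (b (Suc (Suc n))))"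
    show "{d n (d (Suc n) x)} = \<zero>\<^bsub>N\<^esub>"
      using D(5)[of n, THEN equalityD1, THEN subsetD, OF imageI[OF x]] lin_zero[OF mK mN lN]
      by (simp del: free_module_simps)
  qed
  obtain g where g: "lin R ?B N g" "\<forall>x\<in>carrier ?B'. g (d n x) = r \<odot>\<^bsub>N\<^esub> {d n x}"
    using ex[OF lin_comp[OF ld' lN] dd] by (elim exE conjE) (rule that)
  \<comment> \<open>The factorization through d n, moved back from singletons to K. On K the map h
    is multiplication by r.\<close>
  define h where "h y = inv_into (carrier ?K) (\<lambda>x. {x}) (g y)" for y
  have lh: "lin R ?B ?K h" unfolding h_def by (rule lin_comp[OF g(1) lN'])
  have h: "h y = r \<odot>\<^bsub>?K\<^esub> y" if y: "y \<in> carrier ?K" for y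
  proof -
    have "g y = r \<odot>\<^bsub>N\<^esub> {y}" using g(2) y by auto
    also have "\<dots> = {r \<odot>\<^bsub>?K\<^esub> y}" by (rule lin_smult[OF lN rc y, symmetric])
    finally show ?thesis
      unfolding h_def using inv_into_f_f[OF inj_singleton module.smult_closed[OF mK rc y]] by simp
  qed
  have "stable_retract R (?F\<lparr>carrier := S\<rparr>) ?K" using st res(1) mM stM by blast
  moreover have "lin R (?F\<lparr>carrier := S\<rparr>) ?I (\<lambda>v. v 0)"
    by (rule lin_codomain_update[OF lin_carrier_update[OF lp]]) (auto simp: S_def)
  moreover have "lin R ?I (?F\<lparr>carrier := S\<rparr>) (\<lambda>x. \<lambda>i\<in>{..<1}. x)"

    using Ic by (intro linI) (simp_all add: S_def restrict_PiE_iff cong: restrict_cong)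
  ultimately have "stable_retract R ?I ?K" by (rule stable_retract_transfer) simp
  then obtain \<alpha> \<beta> g' p' q' where l: "lin R ?K ?I \<alpha>" "lin R ?I ?K \<beta>" "lin R ?I (free_module R g') p'"
    "lin R (free_module R g') ?I q'" and eq: "\<forall>x\<in>carrier ?I. \<alpha> (\<beta> x) = x \<oplus>\<^bsub>?I\<^esub> q' (p' x)"
    by (rule stable_retractE) (rule that)
  have l\<beta>: "lin R ?I ?B \<beta>" by (rule lin_codomain_extend[OF l(2)]) (use submoduleD(1)[OF B(1) sK] in simp)
  \<comment> \<open>Since \<alpha> h \<beta> x = r (x + q' p' x), multiplication by r is a map
    through R^(b n) minus r times a map through R^g'.\<close>
  have "r \<otimes> x = \<alpha> (h (\<beta> x)) \<oplus> (\<ominus> r) \<otimes> q' (p' x)" if x: "x \<in> I" for x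
  proof -
    have q': "q' (p' x) \<in> carrier R" using lin_closed[OF l(4) lin_closed[OF l(3)], of x] x Ic by simp
    have \<beta>x: "\<beta> x \<in> carrier ?K" using lin_closed[OF l(2), of x] x by simp
    have "\<alpha> (h (\<beta> x)) = r \<otimes> (x \<oplus> q' (p' x))"
      unfolding h[OF \<beta>x] lin_smult[OF l(1) rc \<beta>x] using eq x by simp
    then show ?thesis using rc Ic[OF x] q' by algebra
  qed
  moreover have "lin R (free_module R g') ?I (\<lambda>v. (\<ominus> r) \<otimes> q' v)"
    using lin_scale[OF mI l(4), of "\<ominus> r"] rc by simp
  ultimately show ?thesis
    using l\<beta> lin_comp[OF lh l(1)] l(3) by blast
qed

end

text \<open>Multiplication by r on an ideal stable under q is a sum of two maps through free
  modules. Evaluated at the regular element d of the ideal, \<open>ideal_through_free\<close> bounds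
  the denominator of q times each of them.\<close>

lemma (in normalization_dim1) cohomology_annihilator_conductor:
  fixes T :: "'i itself"
  assumes G: "gorenstein_ring T R" and r: "r \<in> cohomology_annihilator R" and q: "q \<in> almost_integral"
  shows "\<iota> r \<otimes>\<^bsub>Q\<^esub> q \<in> A"
proof -
  have qc: "q \<in> carrier Q" using q by (rule almost_integral_carrier)
  obtain n where n: "r \<in> cohomology_annihilator_at R n" using r by (auto simp: cohomology_annihilator_def)
  show ?thesis
  proof (cases n)
    case 0
    then have "r = \<zero>" using n cohomology_annihilator_at_0 by simp
    then show ?thesis using A_zero qc by simp
  next
    case (Suc n')
    have rc: "r \<in> carrier R" using n by (simp add: cohomology_annihilator_at_def)
    obtain a s where as: "a \<in> carrier R" "s \<in> nonzerodivisors R" "q \<otimes>\<^bsub>Q\<^esub> \<iota> s = \<iota> a"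
      using fractions[OF qc] by blast
    note sc = R.nonzerodivisorsD(1)[OF as(2)]
    have sq: "\<iota> s \<otimes>\<^bsub>Q\<^esub> q = \<iota> a" using as(3) Q.m_comm[OF qc nzd_closed[OF as(2)]] by simp
    obtain I d where I: "ideal I R" "d \<in> I" "d \<in> nonzerodivisors R"
      and stable: "\<And>x. x \<in> I \<Longrightarrow> \<exists>x'\<in>I. a \<otimes> x = s \<otimes> x'"
      by (rule almost_integral_ideal[OF q as(1) sc sq]) (rule that)
    note dc = R.nonzerodivisorsD(1)[OF I(3)]
    obtain t where t: "t \<in> \<mm>" "t \<in> nonzerodivisors R" using exists_nonzerodivisor_in_max by blast
    note tc = R.nonzerodivisorsD(1)[OF t(2)]
    \<comment> \<open>The cosyzygies require a regular element of the ideal that also lies in \<mm>;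
      d itself might be a unit.\<close>
    have "d \<otimes> t \<in> \<mm>" "d \<otimes> t \<in> nonzerodivisors R" "d \<otimes> t \<in> I"
      using R.idealD(4)[OF ideal_max dc t(1)] R.mult_nonzerodivisor[OF I(3) t(2)] R.idealD(5)[OF I(1) tc I(2)] by blast+
    from cohomology_annihilator_factors[OF G this(1,2) I(1) this(3) n[unfolded Suc]]
    obtain g p f g' p' f' where
      l: "lin R (regular_module R\<lparr>carrier := I\<rparr>) (free_module R g) p"
       "lin R (free_module R g) (regular_module R\<lparr>carrier := I\<rparr>) f"
       "lin R (regular_module R\<lparr>carrier := I\<rparr>) (free_module R g') p'"
       "lin R (free_module R g') (regular_module R\<lparr>carrier := I\<rparr>) f'"
      and eq: "\<forall>x\<in>I. r \<otimes> x = f (p x) \<oplus> f' (p' x)" by (elim exE conjE) (rule that)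
    obtain w where w: "w \<in> carrier R" "a \<otimes> f (p d) = s \<otimes> (d \<otimes> w)"
      using R.ideal_through_free[OF I(1,2) as(1) sc stable l(1,2)] by blast
    obtain w' where w': "w' \<in> carrier R" "a \<otimes> f' (p' d) = s \<otimes> (d \<otimes> w')"
      using R.ideal_through_free[OF I(1,2) as(1) sc stable l(3,4)] by blast
    have fc: "f (p d) \<in> carrier R" "f' (p' d) \<in> carrier R"
      using lin_closed[OF l(2) lin_closed[OF l(1)], of d] lin_closed[OF l(4) lin_closed[OF l(3)], of d]
        I(2) R.idealD(1)[OF I(1)] by simp_all
    have "d \<otimes> (r \<otimes> a) = a \<otimes> (r \<otimes> d)" using dc rc as(1) by (simp add: R.m_ac)
    also have "\<dots> = a \<otimes> f (p d) \<oplus> a \<otimes> f' (p' d)" using eq I(2) fc as(1) by (simp add: R.r_distr)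
    also have "\<dots> = d \<otimes> (s \<otimes> (w \<oplus> w'))" unfolding w(2) w'(2) using w w' dc sc by (simp add: R.r_distr R.m_ac)
    \<comment> \<open>After cancelling d this reads r q = w + w' in Q, because q = a/s.\<close>
    finally have "r \<otimes> a = s \<otimes> (w \<oplus> w')"
      using R.nonzerodivisor_cancel[OF I(3)] rc as(1) sc w w' by simp
    then have "\<iota> r \<otimes>\<^bsub>Q\<^esub> \<iota> a = \<iota> s \<otimes>\<^bsub>Q\<^esub> \<iota> (w \<oplus> w')"
      using rc as(1) sc w w' by (simp only: hom_mult[symmetric] R.a_closed)
    moreover have "\<iota> r \<otimes>\<^bsub>Q\<^esub> \<iota> a = \<iota> s \<otimes>\<^bsub>Q\<^esub> (\<iota> r \<otimes>\<^bsub>Q\<^esub> q)"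
      unfolding sq[symmetric] using rc sc qc by (simp add: Q.m_ac)
    ultimately have "\<iota> s \<otimes>\<^bsub>Q\<^esub> (\<iota> r \<otimes>\<^bsub>Q\<^esub> q) = \<iota> s \<otimes>\<^bsub>Q\<^esub> \<iota> (w \<oplus> w')" by simp
    then have "\<iota> r \<otimes>\<^bsub>Q\<^esub> q = \<iota> (w \<oplus> w')"
      using unit_cancel[OF as(2)] rc qc w w' by simp
    then show ?thesis using R.a_closed[OF w(1) w'(1)] by (rule image_eqI)
  qed
qed

theorem theorem5p10:
  fixes R :: "('a, 'k) ring_scheme"
  assumes "cring R"
    and "noetherian_ring R"
    and "local_ring R"
    and "krull_dim R = 1"
    and "gorenstein_ring TYPE('i) R"
    and "reduced_ring (adic_completion R (max_ideal R))"
  shows "cohomology_annihilator R = conductor R"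
proof -
  have ex1: "\<exists>!\<mm>. maximalideal \<mm> R" using assms(3) by (simp add: local_ring_def)
  have "local_noetherian R (max_ideal R)"
    unfolding local_noetherian_def noetherian_cring_def local_noetherian_axioms_def max_ideal_def
    using assms(1,2) theI'[OF ex1] the1_equality[OF ex1] by blast
  then have red: "reduced_local_dim1 R (max_ideal R)"
    unfolding reduced_local_dim1_def reduced_local_dim1_axioms_def
    using assms(4) local_noetherian.reduced_of_completion[OF _ assms(6)] by blast
  interpret cring R by fact
  interpret normalization_dim1 R "total_quotient_ring R" "to_frac R" "max_ideal R"
    unfolding normalization_dim1_def using fraction_ring_total_quotient red by blast
  have "\<one>\<^bsub>R\<^esub> \<noteq> \<zero>\<^bsub>R\<^esub>" using one_notin_max idealD(2)[OF ideal_max] by metis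
  \<comment> \<open>R is Noetherian and nonzero, so integral and almost integral elements agree and
    the conductor is tested on the latter.\<close>
  then have "normalization R = almost_integral"
    unfolding normalization_def
    using integral_imp_almost_integral almost_integral_imp_integral[OF assms(2)] by blast
  then have cond: "r \<in> conductor R \<longleftrightarrow> r \<in> carrier R \<and>
      (\<forall>q\<in>almost_integral. to_frac R r \<otimes>\<^bsub>total_quotient_ring R\<^esub> q \<in> A)" for r
    by (simp add: conductor_def)
  show ?thesis
  proof (intro equalityI subsetI)
    fix r assume r: "r \<in> cohomology_annihilator R"
    then have "r \<in> carrier R" by (auto simp: cohomology_annihilator_def cohomology_annihilator_at_def)
    then show "r \<in> conductor R"
      unfolding cond using cohomology_annihilator_conductor[OF assms(5) r] by blast
  next
    fix r assume "r \<in> conductor R"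
    then have "r \<in> cohomology_annihilator_at R 2"
      unfolding cohomology_annihilator_at_def cond using conductor_annihilates_Ext by blast
    then show "r \<in> cohomology_annihilator R" by (auto simp: cohomology_annihilator_def)
  qed
qed

end
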